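(* Let $k$ be an algebraically closed field of characteristic zero and let $W=(a_1,a_2,a_3;h)$ be a regular system of weights of dual type, with signature $A_W=(\alpha_1,\alpha_2,\alpha_3)$, associated abelian group $L(A_W)$, $L(A_W)$-graded ring $R_{A_W}$, principal lattice $L_W=\mathbb{Z}\vec{\omega}_W\subset L(A_W)$ (identified with $\mathbb{Z}$ via $d\mapsto d\cdot\vec\omega_W$) and $L_W$-graded subring $R_W\subset R_{A_W}$, all as defined in the context. Then: (i) There exist homogeneous elements $x,y,z\in R_W$ of degrees $a_1,a_2,a_3$ respectively with respect to $L_W$ such that $R_W\simeq k[x,y,z]/(f_W)$ for some weighted homogeneous polynomial $f_W\in k[x,y,z]$ of degree $h$ (where $x,y,z$ have degrees $a_1,a_2,a_3$) such that the hypersurface $\{f_W=0\}\subset k^3$ has at most an isolated singularity, only at the origin. (ii) There exists an equivalence of abelian categories $$\mathrm{mod}_{L(A_W)}\text{-}R_{A_W}\big/\mathrm{tor}_{L(A_W)}\text{-}R_{A_W}\;\simeq\;\mathrm{gr}\text{-}R_W\big/\mathrm{tor}\text{-}R_W .$$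
   Context: **Regular systems of weights.** A tuple of positive integers $W=(a_1,a_2,a_3;h)$ is a regular system of weights if $\gcd(a_1,a_2,a_3,h)=1$ and $\chi_W(T)=\prod_{i=1}^3\frac{1-T^{h-a_i}}{1-T^{a_i}}$ is a polynomial in $T$. Put $\epsilon_W:=a_1+a_2+a_3-h$ and $\omega_i:=a_i/h$, $\hat c_W:=1-2\epsilon_W/h$, $\mathbf e[t]:=\exp(2\pi\sqrt{-1}\,t)$. **Dual type.** Let $G$ be $\{1\}$ or the cyclic group $G_W^0$ generated by $\mathrm{diag}(\mathbf e[\omega_1],\mathbf e[\omega_2],\mathbf e[\omega_3])$; write elements of $G$ as $\mathrm{diag}(\mathbf e[\omega_i\alpha_i])_{i=1,2,3}$ with $\alpha_i\in\mathbb Z$. Set $\chi(W,G)(y,\bar y):=\frac{(-1)^3}{|G|}\sum_{\alpha,\beta\in G}\ \prod_{\omega_i\alpha_i\notin\mathbb Z}(y\bar y)^{\frac{1-2\omega_i}{2}}\left(\frac{y}{\bar y}\right)^{-\omega_i\alpha_i+[\omega_i\alpha_i]+\frac12}\prod_{\omega_i\alpha_i\in\mathbb Z}\mathbf e[\omega_i\beta_i+\tfrac12]\frac{1-\mathbf e[1-\omega_i\beta_i](y\bar y)^{1-\omega_i}}{1-\mathbf e[\omega_i\beta_i](y\bar y)^{\omega_i}}$, with $[\cdot]$ the integer part. A regular system of weights $W^*$ is dual to $W$ if $\chi(W^*,\{1\})(y,\bar y)=(-1)^3\bar y^{\hat c_W}\chi(W,G_W^0)(y,\bar y^{-1})$;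 $W$ is of dual type if it has a dual $W^*$. **Classification (known, due to K. Saito; to be used as the working description of "dual type").** Up to permutation of the weights, a regular system of weights of dual type is one of the following five types, where all parameters and all listed weights are positive integers and $(a,b)$ means gcd. For each type we list $W$, its signature $A_W=(\alpha_1,\alpha_2,\alpha_3)$ with this ordering, and a triple $\vec l_W=(\vec l_1,\vec l_2,\vec l_3)$ of elements of the group $L(A_W)$ defined below, called the principal generators. - Type I: $W=(p_2p_3,p_3p_1,p_1p_2;p_1p_2p_3)$, $(p_i,p_j)=1$ for $i\ne j$; $A_W=(p_1,p_2,p_3)$; $\vec l_W=(\vec X_1,\vec X_2,\vec X_3)$. - Type II: $W=(p_3,\frac{p_1p_3}{p_2},(p_2-1)p_1;p_1p_3)$, $p_2\neq p_3$, $p_2|p_3$, $(p_1,p_3)=1$, $(p_2-1,p_3)=1$, $(p_3/p_2-1,p_3)=1$; $A_W=(p_1,\frac{p_3}{p_2},(p_2-1)p_1)$; $\vec l_W=(\vec X_1+\vec X_3,\ p_1\vec X_3,\ \vec X_2)$. - Type III: $W=(p_2,p_1q_2,p_1q_3;p_1p_2)$, $(p_1,p_2)=1$, $p_2+1=(q_2+1)(q_3+1)$, $(q_2,q_3)=1$; $A_W=(p_1,p_1q_2,p_1q_3)$; $\vec l_W=(\vec X_1+\vec X_2+\vec X_3,\ p_1\vec X_3,\ p_1\vec X_2)$. - Type IV: $W=(\frac{p_3}{p_1},(p_1-1)\frac{p_3}{p_2},p_2-p_1+1;p_3)$, $p_1\ne p_2\ne p_3$, $p_1|p_2$, $p_2|p_3$,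 $(p_1-1,p_2)=1$, $(p_2-p_1+1,p_3)=1$, $(p_3/p_2-1,p_3/p_1)=1$, $(p_3/p_1-p_3/p_2+1,p_3)=1$; $A_W=(\frac{p_3}{p_2},(p_1-1)\frac{p_3}{p_2},p_2-p_1+1)$; $\vec l_W=(\frac{p_3}{p_2}\vec X_2+\vec X_3,\ p_1\vec X_3,\ \vec X_1+\vec X_2)$. - Type V: $W=(lm-m+1,\ kl-l+1,\ mk-k+1;\ klm+1)$ with positive integers $k,l,m$ (here $k$ is an integer, not the field) and each of the three weights coprime to $klm+1$; $A_W=(lm-m+1,\ mk-k+1,\ kl-l+1)$; $\vec l_W=(\vec X_2+l\vec X_3,\ \vec X_1+k\vec X_2,\ \vec X_3+m\vec X_1)$. **The group and ring of $A_W$.** $L(A_W)$ is the abelian group generated by $\vec X_1,\vec X_2,\vec X_3$ with relations $\alpha_i\vec X_i=\alpha_j\vec X_j$ for all $i<j$. Put $\vec c:=\alpha_1\vec X_1=\alpha_2\vec X_2=\alpha_3\vec X_3$ and $\vec\omega_{A_W}:=\vec c-\vec X_1-\vec X_2-\vec X_3$. The $L(A_W)$-graded $k$-algebra $R_{A_W}:=k[X_1,X_2,X_3]/(X_1^{\alpha_1}+X_2^{\alpha_2}+X_3^{\alpha_3})$ has $X_i$ in degree $\vec X_i$. **Principal lattice and $R_W$.** There is a unique element $\vec\omega_W\in L(A_W)$ with $-\epsilon_W\cdot\vec\omega_W=\vec\omega_{A_W}$ and $a_i\cdot\vec\omega_W=\vec l_i$ for $i=1,2,3$. Put $L_W:=\mathbb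 Z\vec\omega_W$ and $R_W:=\bigoplus_{d\in\mathbb Z_{\ge0}}R_{W,d}$ with $R_{W,d}:=(R_{A_W})_{d\cdot\vec\omega_W}$, the homogeneous part of $R_{A_W}$ of degree $d\cdot\vec\omega_W$. **Categories.** $\mathrm{mod}_{L(A_W)}\text{-}R_{A_W}$ is the abelian category of finitely generated $L(A_W)$-graded $R_{A_W}$-modules, $\mathrm{tor}_{L(A_W)}\text{-}R_{A_W}$ its full subcategory of modules finite dimensional over $k$; $\mathrm{gr}\text{-}R_W$ is the abelian category of finitely generated $L_W$-graded $R_W$-modules, $\mathrm{tor}\text{-}R_W$ its full subcategory of modules finite dimensional over $k$. The quotients are Serre quotients. (They are the categories of coherent sheaves on the stacks $[\mathrm{Spec}(R_{A_W})\setminus\{0\}/\mathrm{Spec}(kL(A_W))]$ and $[\mathrm{Spec}(R_W)\setminus\{0\}/\mathrm{Spec}(kL_W)]$.) *)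

theory Defs
  imports
    "HOL-Algebra.Algebraic_Closure_Type"
    "HOL-Algebra.Free_Abelian_Groups"
    "HOL-Algebra.QuotRing"
    "HOL-Algebra.Module"
    "HOL-Computational_Algebra.Formal_Laurent_Series"
    "HOL-Library.Numeral_Type"
    "HOL-Library.Poly_Mapping"
begin

section \<open>Regular systems of weights of dual type\<close>

text \<open>
  Triples are functions on the three-element type \<^typ>\<open>3\<close>, whose elements are written
  \<open>1, 2, 3\<close> (here \<open>3 = 0\<close>).
\<close>

definition tri :: "'a \<Rightarrow> 'a \<Rightarrow> 'a \<Rightarrow> 3 \<Rightarrow> 'a" where
  "tri x y z = (\<lambda>i. if i = 1 then x else if i = 2 then y else z)"

text \<open>
  The rational function \<open>\<chi>\<^sub>W\<close> is formed in the field of Laurent series, where its denominator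
  is invertible; there \<open>T\<close> may also be raised to a negative exponent \<open>h - a\<^sub>i\<close>.
\<close>

definition char_fun :: "(3 \<Rightarrow> nat) \<Rightarrow> nat \<Rightarrow> rat fls" where
  "char_fun a h = (\<Prod>i\<in>UNIV. (1 - fls_X_intpow (int h - int (a i))) / (1 - fls_X_intpow (int (a i))))"

definition regular_weights :: "(3 \<Rightarrow> nat) \<Rightarrow> nat \<Rightarrow> bool" where
  "regular_weights a h \<longleftrightarrow>
     (\<forall>i. 0 < a i) \<and> 0 < h \<and> gcd (a 1) (gcd (a 2) (gcd (a 3) h)) = 1 \<and>
     (\<exists>P :: rat poly. char_fun a h = fps_to_fls (fps_of_poly P))"

definition eps :: "(3 \<Rightarrow> nat) \<Rightarrow> nat \<Rightarrow> int" where
  "eps a h = (\<Sum>i\<in>UNIV. int (a i)) - int h"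

text \<open>The element \<open>n X\<^sub>i\<close> of the free abelian group on \<open>X\<^sub>1, X\<^sub>2, X\<^sub>3\<close>.\<close>

abbreviation gX :: "nat \<Rightarrow> 3 \<Rightarrow> (3 \<Rightarrow>\<^sub>0 int)" where
  "gX n i \<equiv> Poly_Mapping.single i (int n)"

text \<open>
  Saito's classification. \<open>dual_type a h A l\<close> says that \<open>W = (a\<^sub>1,a\<^sub>2,a\<^sub>3;h)\<close> is, up to
  permutation of the weights, one of the five types, with signature \<open>A\<close> and principal generators
  the classes in \<open>L(A)\<close> of the \<open>l i\<close>. A permutation of the weights permutes the principal
  generators along with them (they satisfy \<open>a\<^sub>i \<omega>\<^sub>W = l\<^sub>i\<close>) and keeps the signature. All
  divisions are exact and no subtraction truncates.
\<close>

inductive dual_type ::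
  "(3 \<Rightarrow> nat) \<Rightarrow> nat \<Rightarrow> (3 \<Rightarrow> nat) \<Rightarrow> (3 \<Rightarrow> (3 \<Rightarrow>\<^sub>0 int)) \<Rightarrow> bool" where
  type_I:
    "\<lbrakk>0 < p1; 0 < p2; 0 < p3; coprime p1 p2; coprime p2 p3; coprime p1 p3\<rbrakk> \<Longrightarrow>
     dual_type (tri (p2 * p3) (p3 * p1) (p1 * p2)) (p1 * p2 * p3)
       (tri p1 p2 p3)
       (tri (gX 1 1) (gX 1 2) (gX 1 3))"
| type_II:
    "\<lbrakk>0 < p1; 0 < p2; 0 < p3; 0 < p2 - 1; p2 \<noteq> p3; p2 dvd p3; coprime p1 p3; coprime (p2 - 1) p3;
      coprime (p3 div p2 - 1) p3\<rbrakk> \<Longrightarrow>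
     dual_type (tri p3 (p1 * p3 div p2) ((p2 - 1) * p1)) (p1 * p3)
       (tri p1 (p3 div p2) ((p2 - 1) * p1))
       (tri (gX 1 1 + gX 1 3) (gX p1 3) (gX 1 2))"
| type_III:
    "\<lbrakk>0 < p1; 0 < p2; 0 < q2; 0 < q3; coprime p1 p2; p2 + 1 = (q2 + 1) * (q3 + 1); coprime q2 q3\<rbrakk> \<Longrightarrow>
     dual_type (tri p2 (p1 * q2) (p1 * q3)) (p1 * p2)
       (tri p1 (p1 * q2) (p1 * q3))
       (tri (gX 1 1 + gX 1 2 + gX 1 3) (gX p1 3) (gX p1 2))"
| type_IV:
    "\<lbrakk>0 < p1; 0 < p2; 0 < p3; 0 < p1 - 1; p1 \<noteq> p2; p2 \<noteq> p3; p1 dvd p2; p2 dvd p3;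
      coprime (p1 - 1) p2; coprime (p2 - p1 + 1) p3; coprime (p3 div p2 - 1) (p3 div p1);
      coprime (p3 div p1 - p3 div p2 + 1) p3\<rbrakk> \<Longrightarrow>
     dual_type (tri (p3 div p1) ((p1 - 1) * (p3 div p2)) (p2 - p1 + 1)) p3
       (tri (p3 div p2) ((p1 - 1) * (p3 div p2)) (p2 - p1 + 1))
       (tri (gX (p3 div p2) 2 + gX 1 3) (gX p1 3) (gX 1 1 + gX 1 2))"
| type_V:
    "\<lbrakk>0 < k; 0 < l; 0 < m; coprime (l * m - m + 1) (k * l * m + 1);
      coprime (k * l - l + 1) (k * l * m + 1); coprime (m * k - k + 1) (k * l * m + 1)\<rbrakk> \<Longrightarrow>
     dual_type (tri (l * m - m + 1) (k * l - l + 1) (m * k - k + 1)) (k * l * m + 1)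
       (tri (l * m - m + 1) (m * k - k + 1) (k * l - l + 1))
       (tri (gX 1 2 + gX l 3) (gX 1 1 + gX k 2) (gX 1 3 + gX m 1))"
| permute:
    "\<lbrakk>dual_type a h A l; bij \<sigma>\<rbrakk> \<Longrightarrow> dual_type (a \<circ> \<sigma>) h A (l \<circ> \<sigma>)"


section \<open>Graded algebras and graded modules\<close>

text \<open>A \<open>k\<close>-algebra with structure map \<open>ga_emb\<close>, graded by the commutative group \<open>ga_grp\<close>.\<close>

record ('k, 'g, 'r) graded_algebra =
  ga_grp :: "'g monoid"
  ga_ring :: "'r ring"
  ga_emb :: "'k \<Rightarrow> 'r"
  ga_comp :: "'g \<Rightarrow> 'r set"

text \<open>
  The fields \<open>mult\<close> and \<open>one\<close> that the module record inherits from rings carry no meaning.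
\<close>

record ('g, 'r, 'u) gmodule = "('r, 'u) module" +
  gm_comp :: "'g \<Rightarrow> 'u set"

definition graded_module :: "('k, 'g, 'r) graded_algebra \<Rightarrow> ('g, 'r, 'u) gmodule \<Rightarrow> bool" where
  "graded_module S M \<longleftrightarrow>
     Module.module (ga_ring S) M \<and>
     (\<forall>g\<in>carrier (ga_grp S). subgroup (gm_comp M g) (add_monoid M)) \<and>
     (\<forall>x\<in>carrier M. \<exists>!c. finite {g. c g \<noteq> \<zero>\<^bsub>M\<^esub>} \<and>
        (\<forall>g\<in>carrier (ga_grp S). c g \<in> gm_comp M g) \<and>
        (\<forall>g. g \<notin> carrier (ga_grp S) \<longrightarrow> c g = \<zero>\<^bsub>M\<^esub>) \<and>
        x = finsum M c {g. c g \<noteq> \<zero>\<^bsub>M\<^esub>}) \<and>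
     (\<forall>g\<in>carrier (ga_grp S). \<forall>h\<in>carrier (ga_grp S). \<forall>r\<in>ga_comp S g. \<forall>x\<in>gm_comp M h.
        r \<odot>\<^bsub>M\<^esub> x \<in> gm_comp M (g \<otimes>\<^bsub>ga_grp S\<^esub> h))"

definition mod_objects :: "('k, 'g, 'r) graded_algebra \<Rightarrow> ('g, 'r, 'u) gmodule set" where
  "mod_objects S = {M. graded_module S M \<and>
     (\<exists>B. finite B \<and> B \<subseteq> carrier M \<and>
        (\<forall>x\<in>carrier M. \<exists>c. c \<in> B \<rightarrow> carrier (ga_ring S) \<and> x = (\<Oplus>\<^bsub>M\<^esub>b\<in>B. c b \<odot>\<^bsub>M\<^esub> b)))}"

definition tor_objects :: "('k, 'g, 'r) graded_algebra \<Rightarrow> ('g, 'r, 'u) gmodule set" where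
  "tor_objects S = {M \<in> mod_objects S.
     \<exists>B. finite B \<and> B \<subseteq> carrier M \<and>
        (\<forall>x\<in>carrier M. \<exists>c. x = (\<Oplus>\<^bsub>M\<^esub>b\<in>B. ga_emb S (c b) \<odot>\<^bsub>M\<^esub> b))}"

definition gr_hom ::
  "('k, 'g, 'r) graded_algebra \<Rightarrow> ('g, 'r, 'u) gmodule \<Rightarrow> ('g, 'r, 'v) gmodule \<Rightarrow> ('u \<Rightarrow> 'v) set" where
  "gr_hom S M N = {f \<in> carrier M \<rightarrow> carrier N.
     (\<forall>x\<in>carrier M. \<forall>y\<in>carrier M. f (x \<oplus>\<^bsub>M\<^esub> y) = f x \<oplus>\<^bsub>N\<^esub> f y) \<and>
     (\<forall>r\<in>carrier (ga_ring S). \<forall>x\<in>carrier M. f (r \<odot>\<^bsub>M\<^esub> x) = r \<odot>\<^bsub>N\<^esub> f x) \<and>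
     (\<forall>g\<in>carrier (ga_grp S). \<forall>x\<in>gm_comp M g. f x \<in> gm_comp N g)}"

definition sub_gmod :: "('g, 'r, 'u) gmodule \<Rightarrow> 'u set \<Rightarrow> ('g, 'r, 'u) gmodule" where
  "sub_gmod M N = M\<lparr>carrier := N, gm_comp := (\<lambda>g. gm_comp M g \<inter> N)\<rparr>"

definition quot_gmod :: "('g, 'r, 'u) gmodule \<Rightarrow> 'u set \<Rightarrow> ('g, 'r, 'u set) gmodule" where
  "quot_gmod M N =
     \<lparr>carrier = a_rcosets\<^bsub>M\<^esub> N, monoid.mult = undefined, one = undefined, ring.zero = N, ring.add = set_add M,
      module.smult = (\<lambda>r C. \<Union>x\<in>C. N +>\<^bsub>M\<^esub> (r \<odot>\<^bsub>M\<^esub> x)),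
      gm_comp = (\<lambda>g. (\<lambda>x. N +>\<^bsub>M\<^esub> x) ` gm_comp M g)\<rparr>"

definition graded_submodule ::
  "('k, 'g, 'r) graded_algebra \<Rightarrow> 'u set \<Rightarrow> ('g, 'r, 'u) gmodule \<Rightarrow> bool" where
  "graded_submodule S N M \<longleftrightarrow> submodule N (ga_ring S) M \<and> graded_module S (sub_gmod M N)"


section \<open>Categories with addition of morphisms, and their equivalence\<close>

text \<open>
  Hom-sets of different pairs of objects need not be disjoint, so composition and addition take
  the objects as arguments: \<open>Comp C A B Z g f\<close> is \<open>g \<circ> f\<close> for \<open>f : A \<rightarrow> B\<close>, \<open>g : B \<rightarrow> Z\<close>.
\<close>

record ('o, 'm) cat =
  Obj :: "'o set"
  Hom :: "'o \<Rightarrow> 'o \<Rightarrow> 'm set"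
  Idm :: "'o \<Rightarrow> 'm"
  Comp :: "'o \<Rightarrow> 'o \<Rightarrow> 'o \<Rightarrow> 'm \<Rightarrow> 'm \<Rightarrow> 'm"
  Add :: "'o \<Rightarrow> 'o \<Rightarrow> 'm \<Rightarrow> 'm \<Rightarrow> 'm"

definition category :: "('o, 'm) cat \<Rightarrow> bool" where
  "category C \<longleftrightarrow>
     (\<forall>A\<in>Obj C. Idm C A \<in> Hom C A A) \<and>
     (\<forall>A\<in>Obj C. \<forall>B\<in>Obj C. \<forall>Z\<in>Obj C. \<forall>f\<in>Hom C A B. \<forall>g\<in>Hom C B Z. Comp C A B Z g f \<in> Hom C A Z) \<and>
     (\<forall>A\<in>Obj C. \<forall>B\<in>Obj C. \<forall>f\<in>Hom C A B.
        Comp C A A B f (Idm C A) = f \<and> Comp C A B B (Idm C B) f = f) \<and>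
     (\<forall>A\<in>Obj C. \<forall>B\<in>Obj C. \<forall>Z\<in>Obj C. \<forall>V\<in>Obj C.
        \<forall>f\<in>Hom C A B. \<forall>g\<in>Hom C B Z. \<forall>h\<in>Hom C Z V.
        Comp C A Z V h (Comp C A B Z g f) = Comp C A B V (Comp C B Z V h g) f)"

definition additive_functor ::
  "('o, 'm) cat \<Rightarrow> ('p, 'n) cat \<Rightarrow> ('o \<Rightarrow> 'p) \<Rightarrow> ('o \<Rightarrow> 'o \<Rightarrow> 'm \<Rightarrow> 'n) \<Rightarrow> bool" where
  "additive_functor C D F\<^sub>o F\<^sub>m \<longleftrightarrow>
     category C \<and> category D \<and>
     (\<forall>A\<in>Obj C. F\<^sub>o A \<in> Obj D) \<and>
     (\<forall>A\<in>Obj C. \<forall>B\<in>Obj C. \<forall>f\<in>Hom C A B. F\<^sub>m A B f \<in> Hom D (F\<^sub>o A) (F\<^sub>o B)) \<and>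
     (\<forall>A\<in>Obj C. F\<^sub>m A A (Idm C A) = Idm D (F\<^sub>o A)) \<and>
     (\<forall>A\<in>Obj C. \<forall>B\<in>Obj C. \<forall>Z\<in>Obj C. \<forall>f\<in>Hom C A B. \<forall>g\<in>Hom C B Z.
        F\<^sub>m A Z (Comp C A B Z g f) = Comp D (F\<^sub>o A) (F\<^sub>o B) (F\<^sub>o Z) (F\<^sub>m B Z g) (F\<^sub>m A B f)) \<and>
     (\<forall>A\<in>Obj C. \<forall>B\<in>Obj C. \<forall>f\<in>Hom C A B. \<forall>g\<in>Hom C A B.
        F\<^sub>m A B (Add C A B f g) = Add D (F\<^sub>o A) (F\<^sub>o B) (F\<^sub>m A B f) (F\<^sub>m A B g))"

definition iso_mor :: "('o, 'm) cat \<Rightarrow> 'o \<Rightarrow> 'o \<Rightarrow> 'm \<Rightarrow> bool" where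
  "iso_mor C A B f \<longleftrightarrow> f \<in> Hom C A B \<and>
     (\<exists>g\<in>Hom C B A. Comp C A B A g f = Idm C A \<and> Comp C B A B f g = Idm C B)"

text \<open>\<open>\<eta>\<close> is a natural isomorphism from the identity functor to the endofunctor \<open>(T\<^sub>o, T\<^sub>m)\<close>.\<close>

definition nat_iso_from_id ::
  "('o, 'm) cat \<Rightarrow> ('o \<Rightarrow> 'o) \<Rightarrow> ('o \<Rightarrow> 'o \<Rightarrow> 'm \<Rightarrow> 'm) \<Rightarrow> ('o \<Rightarrow> 'm) \<Rightarrow> bool" where
  "nat_iso_from_id C T\<^sub>o T\<^sub>m \<eta> \<longleftrightarrow>
     (\<forall>A\<in>Obj C. iso_mor C A (T\<^sub>o A) (\<eta> A)) \<and>
     (\<forall>A\<in>Obj C. \<forall>B\<in>Obj C. \<forall>f\<in>Hom C A B.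
        Comp C A B (T\<^sub>o B) (\<eta> B) f = Comp C A (T\<^sub>o A) (T\<^sub>o B) (T\<^sub>m A B f) (\<eta> A))"

definition equivalent_cats :: "('o, 'm) cat \<Rightarrow> ('p, 'n) cat \<Rightarrow> bool" where
  "equivalent_cats C D \<longleftrightarrow>
     (\<exists>F\<^sub>o F\<^sub>m G\<^sub>o G\<^sub>m \<eta> \<theta>.
        additive_functor C D F\<^sub>o F\<^sub>m \<and> additive_functor D C G\<^sub>o G\<^sub>m \<and>
        nat_iso_from_id C (G\<^sub>o \<circ> F\<^sub>o) (\<lambda>A B f. G\<^sub>m (F\<^sub>o A) (F\<^sub>o B) (F\<^sub>m A B f)) \<eta> \<and>
        nat_iso_from_id D (F\<^sub>o \<circ> G\<^sub>o) (\<lambda>A B f. F\<^sub>m (G\<^sub>o A) (G\<^sub>o B) (G\<^sub>m A B f)) \<theta>)"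


section \<open>The Serre quotient of finitely generated by finite-dimensional graded modules\<close>

text \<open>
  Gabriel's construction: a morphism \<open>M \<rightarrow> N\<close> of the quotient is an element of the colimit of
  \<open>Hom (M', N/N')\<close> over the subobjects \<open>M' \<subseteq> M\<close>, \<open>N' \<subseteq> N\<close> with \<open>M/M'\<close> and \<open>N'\<close> torsion.
\<close>

type_synonym 'u qrep = "'u set \<times> 'u set \<times> ('u \<Rightarrow> 'u set)"

definition q_index ::
  "('k, 'g, 'r) graded_algebra \<Rightarrow> ('g, 'r, 'u) gmodule \<Rightarrow> ('g, 'r, 'u) gmodule \<Rightarrow> ('u set \<times> 'u set) set"
where
  "q_index S M N = {(M', N'). graded_submodule S M' M \<and> quot_gmod M M' \<in> tor_objects S \<and>
     graded_submodule S N' N \<and> sub_gmod N N' \<in> tor_objects S}"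

definition q_reps ::
  "('k, 'g, 'r) graded_algebra \<Rightarrow> ('g, 'r, 'u) gmodule \<Rightarrow> ('g, 'r, 'u) gmodule \<Rightarrow> 'u qrep set" where
  "q_reps S M N = {(M', N', f). (M', N') \<in> q_index S M N \<and>
     f \<in> gr_hom S (sub_gmod M M') (quot_gmod N N')}"

text \<open>
  Two representatives are identified if they induce the same map \<open>M\<^sub>3 \<rightarrow> N/N\<^sub>3\<close> at some later
  index; \<open>N\<^sub>3 <+> C\<close> is the image in \<open>N/N\<^sub>3\<close> of a coset \<open>C\<close> of a smaller submodule.
\<close>

definition q_rel ::
  "('k, 'g, 'r) graded_algebra \<Rightarrow> ('g, 'r, 'u) gmodule \<Rightarrow> ('g, 'r, 'u) gmodule \<Rightarrow> 'u qrep rel" where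
  "q_rel S M N = {((M\<^sub>1, N\<^sub>1, f\<^sub>1), (M\<^sub>2, N\<^sub>2, f\<^sub>2)).
     (M\<^sub>1, N\<^sub>1, f\<^sub>1) \<in> q_reps S M N \<and> (M\<^sub>2, N\<^sub>2, f\<^sub>2) \<in> q_reps S M N \<and>
     (\<exists>M\<^sub>3 N\<^sub>3. (M\<^sub>3, N\<^sub>3) \<in> q_index S M N \<and> M\<^sub>3 \<subseteq> M\<^sub>1 \<inter> M\<^sub>2 \<and> N\<^sub>1 \<union> N\<^sub>2 \<subseteq> N\<^sub>3 \<and>
        (\<forall>x\<in>M\<^sub>3. N\<^sub>3 <+>\<^bsub>N\<^esub> f\<^sub>1 x = N\<^sub>3 <+>\<^bsub>N\<^esub> f\<^sub>2 x))}"

definition q_id :: "('g, 'r, 'u) gmodule \<Rightarrow> 'u qrep" where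
  "q_id M = (carrier M, {\<zero>\<^bsub>M\<^esub>}, \<lambda>x. {\<zero>\<^bsub>M\<^esub>} +>\<^bsub>M\<^esub> x)"

text \<open>
  For \<open>f : M' \<rightarrow> N/N'\<close> and \<open>g : N'' \<rightarrow> P/P'\<close>, Gabriel's composite is the map
  \<open>f\<inverse>((N' + N'')/N') \<rightarrow> (N' + N'')/N' \<cong> N''/(N' \<inter> N'') \<rightarrow> P/(P' + g(N' \<inter> N''))\<close>.
  As \<open>g\<close> takes values in cosets of \<open>P'\<close>, the unions below are \<open>P' + g(N' \<inter> N'')\<close> and a coset of it.
\<close>

definition q_comp :: "'u qrep \<Rightarrow> 'u qrep \<Rightarrow> 'u qrep" where
  "q_comp = (\<lambda>(N'', P', g) (M', N', f).
     ({x \<in> M'. f x \<inter> N'' \<noteq> {}}, \<Union>y\<in>N' \<inter> N''. g y, \<lambda>x. \<Union>y\<in>f x \<inter> N''. g y))"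

definition q_add :: "('g, 'r, 'u) gmodule \<Rightarrow> 'u qrep \<Rightarrow> 'u qrep \<Rightarrow> 'u qrep" where
  "q_add N = (\<lambda>(M\<^sub>1, N\<^sub>1, f\<^sub>1) (M\<^sub>2, N\<^sub>2, f\<^sub>2).
     (M\<^sub>1 \<inter> M\<^sub>2, N\<^sub>1 <+>\<^bsub>N\<^esub> N\<^sub>2, \<lambda>x. f\<^sub>1 x <+>\<^bsub>N\<^esub> f\<^sub>2 x))"

text \<open>
  The quotient category of the graded \<open>S\<close>-modules with underlying set in the type \<open>'u\<close>, which
  plays the role of the universe. For the algebras below every finitely generated module has at most
  as many elements as the infinite field \<open>k\<close>, so every isomorphism class is represented as soon as
  \<open>k\<close> injects into \<open>'u\<close>.
\<close>

definition serre_quotient ::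
  "'u itself \<Rightarrow> ('k, 'g, 'r) graded_algebra \<Rightarrow> (('g, 'r, 'u) gmodule, 'u qrep set) cat" where
  "serre_quotient U S =
     \<lparr>Obj = mod_objects S,
      Hom = (\<lambda>M N. q_reps S M N // q_rel S M N),
      Idm = (\<lambda>M. q_rel S M M `` {q_id M}),
      Comp = (\<lambda>M N P \<beta> \<alpha>. \<Union>g\<in>\<beta>. \<Union>f\<in>\<alpha>. q_rel S M P `` {q_comp g f}),
      Add = (\<lambda>M N \<alpha> \<beta>. \<Union>f\<in>\<alpha>. \<Union>g\<in>\<beta>. q_rel S M N `` {q_add N f g})\<rparr>"


section \<open>Polynomials in three variables\<close>

type_synonym 'k poly3 = "(3 \<Rightarrow>\<^sub>0 nat) \<Rightarrow>\<^sub>0 'k"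

abbreviation poly3_ring :: "'k::comm_ring_1 poly3 ring" where
  "poly3_ring \<equiv> ring_of_type_algebra"

definition const3 :: "'k::comm_ring_1 \<Rightarrow> 'k poly3" where
  "const3 c = Poly_Mapping.single 0 c"

definition var3 :: "3 \<Rightarrow> 'k::comm_ring_1 poly3" where
  "var3 i = Poly_Mapping.single (Poly_Mapping.single i 1) 1"

definition eval3 :: "'k::comm_ring_1 poly3 \<Rightarrow> (3 \<Rightarrow> 'k) \<Rightarrow> 'k" where
  "eval3 f p = (\<Sum>m\<in>Poly_Mapping.keys f.
     Poly_Mapping.lookup f m * (\<Prod>i\<in>UNIV. p i ^ Poly_Mapping.lookup m i))"

definition pderiv3 :: "3 \<Rightarrow> 'k::comm_ring_1 poly3 \<Rightarrow> 'k poly3" where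
  "pderiv3 i f = (\<Sum>m\<in>Poly_Mapping.keys f.
     Poly_Mapping.single (m - Poly_Mapping.single i 1)
       (of_nat (Poly_Mapping.lookup m i) * Poly_Mapping.lookup f m))"

definition weighted_homogeneous :: "(3 \<Rightarrow> nat) \<Rightarrow> nat \<Rightarrow> 'k::comm_ring_1 poly3 \<Rightarrow> bool" where
  "weighted_homogeneous a h f \<longleftrightarrow>
     (\<forall>m\<in>Poly_Mapping.keys f. (\<Sum>i\<in>UNIV. a i * Poly_Mapping.lookup m i) = h)"

definition singular_points :: "'k::comm_ring_1 poly3 \<Rightarrow> (3 \<Rightarrow> 'k) set" where
  "singular_points f = {p. eval3 f p = 0 \<and> (\<forall>i. eval3 (pderiv3 i f) p = 0)}"


section \<open>The group \<open>L(A)\<close>, the algebra \<open>R\<^sub>A\<close> and the subalgebra \<open>R\<^sub>W\<close>\<close>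

definition L_relations :: "(3 \<Rightarrow> nat) \<Rightarrow> (3 \<Rightarrow>\<^sub>0 int) set" where
  "L_relations A = generate (free_Abelian_group UNIV) {gX (A i) i - gX (A j) j | i j. True}"

definition L_group :: "(3 \<Rightarrow> nat) \<Rightarrow> (3 \<Rightarrow>\<^sub>0 int) set monoid" where
  "L_group A = free_Abelian_group UNIV Mod L_relations A"

definition L_class :: "(3 \<Rightarrow> nat) \<Rightarrow> (3 \<Rightarrow>\<^sub>0 int) \<Rightarrow> (3 \<Rightarrow>\<^sub>0 int) set" where
  "L_class A v = L_relations A #>\<^bsub>free_Abelian_group UNIV\<^esub> v"

definition omega_A :: "(3 \<Rightarrow> nat) \<Rightarrow> (3 \<Rightarrow>\<^sub>0 int) set" where
  "omega_A A = L_class A (gX (A 1) 1 - gX 1 1 - gX 1 2 - gX 1 3)"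

definition RA_ideal :: "(3 \<Rightarrow> nat) \<Rightarrow> 'k::comm_ring_1 poly3 set" where
  "RA_ideal A = PIdl\<^bsub>poly3_ring\<^esub> (\<Sum>i\<in>UNIV. var3 i ^ A i)"

definition RA :: "(3 \<Rightarrow> nat) \<Rightarrow> ('k::comm_ring_1, (3 \<Rightarrow>\<^sub>0 int) set, 'k poly3 set) graded_algebra" where
  "RA A =
     \<lparr>ga_grp = L_group A,
      ga_ring = poly3_ring Quot RA_ideal A,
      ga_emb = (\<lambda>c. RA_ideal A +>\<^bsub>poly3_ring\<^esub> const3 c),
      ga_comp = (\<lambda>g. (\<lambda>f. RA_ideal A +>\<^bsub>poly3_ring\<^esub> f) `
        {f. \<forall>m\<in>Poly_Mapping.keys f. L_class A (Poly_Mapping.map int m) = g})\<rparr>"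

definition omega_W ::
  "(3 \<Rightarrow> nat) \<Rightarrow> nat \<Rightarrow> (3 \<Rightarrow> nat) \<Rightarrow> (3 \<Rightarrow> (3 \<Rightarrow>\<^sub>0 int)) \<Rightarrow> (3 \<Rightarrow>\<^sub>0 int) set" where
  "omega_W a h A l = (THE w. w \<in> carrier (L_group A) \<and>
     w [^]\<^bsub>L_group A\<^esub> (- eps a h) = omega_A A \<and>
     (\<forall>i. w [^]\<^bsub>L_group A\<^esub> a i = L_class A (l i)))"

text \<open>
  For \<open>w\<close> in \<open>L(A)\<close>, the subalgebra of \<open>R\<^sub>A\<close> that is the sum of the homogeneous parts of degrees
  \<open>d w\<close>, \<open>d \<ge> 0\<close>, graded by the subgroup generated by \<open>w\<close>. With \<open>w = \<omega>\<^sub>W\<close> these are \<open>R\<^sub>W\<close>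
  and \<open>L\<^sub>W\<close>.
\<close>

definition RW ::
  "(3 \<Rightarrow> nat) \<Rightarrow> (3 \<Rightarrow>\<^sub>0 int) set \<Rightarrow> ('k::comm_ring_1, (3 \<Rightarrow>\<^sub>0 int) set, 'k poly3 set) graded_algebra" where
  "RW A w =
     \<lparr>ga_grp = (L_group A)\<lparr>carrier := range (\<lambda>d::int. w [^]\<^bsub>L_group A\<^esub> d)\<rparr>,
      ga_ring = (ga_ring (RA A))\<lparr>carrier :=
        {finsum (ga_ring (RA A)) c D | c D. finite D \<and>
           (\<forall>d::nat\<in>D. c d \<in> ga_comp (RA A) (w [^]\<^bsub>L_group A\<^esub> d))}\<rparr>,
      ga_emb = ga_emb (RA A),
      ga_comp = (\<lambda>g. if \<exists>d::nat. g = w [^]\<^bsub>L_group A\<^esub> d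
        then ga_comp (RA A) g else {\<zero>\<^bsub>ga_ring (RA A)\<^esub>})\<rparr>"

end

theory Submission
  imports Defs "HOL-Library.Product_Lexorder"
begin

text \<open>
  \<open>R\<^sub>W\<close> consists of the combinations of monomials whose exponent vectors lie in the lattice spanned by
  the three principal generators. Reduction modulo \<open>F = X\<^sub>1 ^ \<alpha>\<^sub>1 + X\<^sub>2 ^ \<alpha>\<^sub>2 + X\<^sub>3 ^ \<alpha>\<^sub>3\<close> makes the
  coordinates of such an exponent non-negative, so the principal generators, read as monomials,
  generate \<open>R\<^sub>W\<close>. The product of \<open>F\<close> with the monomial of exponent \<open>l\<^sub>1 + l\<^sub>2 + l\<^sub>3 - (1, 1, 1)\<close> is a
  polynomial \<open>f\<^sub>W\<close> in them, and comparing the smallest coordinates in a multiple of \<open>F\<close> shows that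
  \<open>f\<^sub>W\<close> generates their relations.

  For the equivalence, any coset of \<open>L\<^sub>W\<close> in \<open>L(A)\<close> is reached by monomials in two of the three
  variables. So the elements of \<open>R\<^sub>A\<close> with degree in a given coset generate an ideal of finite
  codimension, and a graded \<open>R\<^sub>A\<close>-module is determined up to torsion by its part with degrees
  in \<open>L\<^sub>W\<close>; conversely every \<open>R\<^sub>W\<close>-module arises from an extension of scalars. Morphisms of the Serre
  quotients are handled as graded relations, that is, graded submodules of \<open>M \<times> N\<close>.
\<close>

text \<open>Two features of the statement shape the proof. Morphisms of the quotient are classes of
  triples with values in cosets, and the underlying sets lie in prescribed types. So finite
  codimension is a predicate \<open>fd\<close> stable under linear relations, operations on
  morphisms are monotone operations on relations, and modules move between types along injections,
  which exist because a finitely generated module has no more elements than the infinite field.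
  Restriction to the principal lattice is inverted by \<open>star\<close>. That \<open>star\<close>
  yields a morphism again rests on \<open>saturation_fd\<close>: in a finitely generated module, the
  elements that fixed powers of the variables multiply into a submodule form a space of finite
  dimension modulo it. For the presentation, the types are reduced to two integer matrices
  \<open>lam\<close> and \<open>E\<close> subject to \<open>wcore\<close>, and the principal element
  is a Bezout combination \<open>wv\<close> of the principal generators. What is left to each type
  is how negative coordinates are removed and why the origin is the only critical zero; the latter
  uses characteristic zero.\<close>

abbreviation (input) add_in :: "'a => ('a, 'b) ring_scheme => 'a => 'a" ("(_ \<oplus>[_] _)" [65, 0, 66] 65)
  where "x \<oplus>[M] y \<equiv> x \<oplus>\<^bsub>M\<^esub> y"

abbreviation (input) minus_in :: "'a => ('a, 'b) ring_scheme => 'a => 'a" ("(_ \<ominus>[_] _)" [65, 0, 66] 65)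
  where "x \<ominus>[M] y \<equiv> x \<ominus>\<^bsub>M\<^esub> y"

abbreviation (input) uminus_in :: "('a, 'b) ring_scheme => 'a => 'a" ("\<ominus>[_] _" [0, 81] 80)
  where "\<ominus>[M] x \<equiv> \<ominus>\<^bsub>M\<^esub> x"

abbreviation (input) zero_in :: "('a, 'b) ring_scheme => 'a" ("\<zero>[_]")
  where "\<zero>[M] \<equiv> \<zero>\<^bsub>M\<^esub>"

abbreviation (input) mult_in :: "'a => ('a, 'b) monoid_scheme => 'a => 'a" ("(_ \<otimes>[_] _)" [70, 0, 71] 70)
  where "x \<otimes>[M] y \<equiv> x \<otimes>\<^bsub>M\<^esub> y"

abbreviation (input) smult_in :: "'r => ('r, 'u, 'b) module_scheme => 'u => 'u" ("(_ \<odot>[_] _)" [70, 0, 71] 70)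
  where "r \<odot>[M] x \<equiv> r \<odot>\<^bsub>M\<^esub> x"

abbreviation (input) pow_in :: "'a => ('a, 'b) monoid_scheme => 'n::semiring_1 => 'a" ("(_ [^][_] _)" [76, 0, 75] 75)
  where "x [^][M] n \<equiv> x [^]\<^bsub>M\<^esub> n"

abbreviation (input) one_in :: "('a, 'b) monoid_scheme => 'a" ("\<one>[_]")
  where "\<one>[M] \<equiv> \<one>\<^bsub>M\<^esub>"

abbreviation (input) inv_in :: "('a, 'b) monoid_scheme => 'a => 'a" ("(inv[_] _)" [0, 81] 80)
  where "inv[M] x \<equiv> inv\<^bsub>M\<^esub> x"

abbreviation (input) coset_in :: "'a set => ('a, 'b) ring_scheme => 'a => 'a set" ("(_ +>[_] _)" [60, 0, 61] 60)
  where "V +>[M] x \<equiv> V +>\<^bsub>M\<^esub> x"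

abbreviation (input) set_add_in :: "'a set => ('a, 'b) ring_scheme => 'a set => 'a set" ("(_ <+>[_] _)" [60, 0, 61] 60)
  where "V <+>[M] W \<equiv> V <+>\<^bsub>M\<^esub> W"

abbreviation (input) Rc :: "('k, 'g, 'r) graded_algebra => 'r set" where "Rc S \<equiv> carrier (ga_ring S)"
abbreviation (input) Gc :: "('k, 'g, 'r) graded_algebra => 'g set" where "Gc S \<equiv> carrier (ga_grp S)"

section \<open>Finite codimension of subspaces\<close>

text \<open>The scalars act through a function and not through a field of the record: a graded
  module carries only the action of its ring, and becomes a vector space through
  \<open>ga_emb\<close>.\<close>

locale kspace = abelian_group M for M :: "('u, 'b) ring_scheme" (structure) +
 fixes sc :: "'k::field => 'u => 'u"
 assumes sc_closed [simp]: "x \<in> carrier M ==> sc c x \<in> carrier M"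
  and sc_add: "x \<in> carrier M ==> y \<in> carrier M ==> sc c (x \<oplus> y) = sc c x \<oplus> sc c y"
  and add_sc: "x \<in> carrier M ==> sc (c + d) x = sc c x \<oplus> sc d x"
  and mult_sc: "x \<in> carrier M ==> sc (c * d) x = sc c (sc d x)"
  and one_sc [simp]: "x \<in> carrier M ==> sc 1 x = x"
begin

lemma zero_sc [simp]: "x \<in> carrier M ==> sc 0 x = \<zero>"
 using add_sc[of x 0 0] by (simp add: add.r_cancel_one')

lemma sc_zero [simp]: "sc c \<zero> = \<zero>"
 using sc_add[of \<zero> \<zero> c] by (simp add: add.r_cancel_one')

end

definition ksub :: "('u, 'b) ring_scheme => ('k::field => 'u => 'u) => 'u set => bool" where
 "ksub M sc V \<longleftrightarrow> V <= carrier M \<and> \<zero>[M] \<in> V \<and> (\<forall>x\<in>V. \<forall>y\<in>V. x \<oplus>[M] y \<in> V) \<and> (\<forall>c. \<forall>x\<in>V. sc c x \<in> V)"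

text \<open>\<open>fd M sc V Y\<close> says that \<open>V\<close> is finite dimensional modulo \<open>Y\<close>: each step of the induction
 adds one dimension.\<close>

inductive fd :: "('u, 'b) ring_scheme => ('k::field => 'u => 'u) => 'u set => 'u set => bool"
 for M sc where
 fd_base: "V <= Y ==> fd M sc V Y"
| fd_step: "fd M sc V\<^sub>0 Y ==> ksub M sc V\<^sub>0 ==> v \<in> carrier M ==>
  (\<forall>x\<in>V. \<exists>c. \<exists>x\<^sub>0\<in>V\<^sub>0. x = sc c v \<oplus>[M] x\<^sub>0) ==> fd M sc V Y"

text \<open>Linear relations instead of linear maps: they are closed under converse, so images are
  preimages, and inclusions, projections, intersections and sums of subspaces all become instances
  of one closure property.\<close>

definition klin where
 "klin M sc N sc' Ga \<longleftrightarrow> Ga <= carrier M \<times> carrier N \<and> (\<zero>[M], \<zero>[N]) \<in> Ga \<and>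
   (\<forall>x y x' y'. (x, y) \<in> Ga --> (x', y') \<in> Ga --> (x \<oplus>[M] x', y \<oplus>[N] y') \<in> Ga) \<and>
   (\<forall>c x y. (x, y) \<in> Ga --> (sc c x, sc' c y) \<in> Ga)"

lemma klin_converse: "klin M sc N sc' Ga ==> klin N sc' M sc (Ga\<inverse>)"
 unfolding klin_def by blast

lemma fd_mono: "fd M sc V Y ==> V' <= V ==> Y <= Y' ==> fd M sc V' Y'"
proof (induction arbitrary: V' Y' rule: fd.induct)
 case (fd_base V Y)
 then show ?case by (blast intro: fd.fd_base)
next
 case (fd_step V\<^sub>0 Y v V)
 have "fd M sc V\<^sub>0 Y'" using fd_step.IH fd_step.prems(2) by simp
 then show ?case
  using fd_step.hyps(2,3) by (rule fd.fd_step) (use fd_step.hyps(4) fd_step.prems(1) in blast)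
qed

lemma fd_trans: "fd M sc V Y ==> fd M sc Y Z ==> fd M sc V Z"
proof (induction rule: fd.induct)
 case (fd_base V Y)
 then show ?case using fd_mono[of M sc Y Z V Z] by blast
next
 case (fd_step V\<^sub>0 Y v V)
 show ?case
  using fd_step.IH[OF fd_step.prems] fd_step.hyps(2,3,4) by (rule fd.fd_step)
qed

lemma klin_ksub_vimage:
 assumes "klin M sc N sc' Ga" "ksub N sc' Z"
 shows "ksub M sc (Ga\<inverse> `` Z)"
 unfolding ksub_def
proof (intro conjI ballI allI)
 show "Ga\<inverse> `` Z <= carrier M" using assms(1) by (auto simp: klin_def)
 show "\<zero>[M] \<in> Ga\<inverse> `` Z" using assms by (auto simp: klin_def ksub_def)
next
 fix x x' assume "x \<in> Ga\<inverse> `` Z" "x' \<in> Ga\<inverse> `` Z"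
 then obtain z z' where *: "(x, z) \<in> Ga" "z \<in> Z" "(x', z') \<in> Ga" "z' \<in> Z" by blast
 then have "(x \<oplus>[M] x', z \<oplus>[N] z') \<in> Ga" using assms(1) by (simp add: klin_def)
 moreover have "z \<oplus>[N] z' \<in> Z" using assms(2) * by (simp add: ksub_def)
 ultimately show "x \<oplus>[M] x' \<in> Ga\<inverse> `` Z" by blast
next
 fix c x assume "x \<in> Ga\<inverse> `` Z"
 then obtain z where *: "(x, z) \<in> Ga" "z \<in> Z" by blast
 then have "(sc c x, sc' c z) \<in> Ga" using assms(1) by (simp add: klin_def)
 moreover have "sc' c z \<in> Z" using assms(2) * by (simp add: ksub_def)
 ultimately show "sc c x \<in> Ga\<inverse> `` Z" by blast
qed

text \<open>Applied to suitable linear relations, this yields all closure properties of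
 finite codimension: for subspaces, images, preimages and sums.\<close>

lemma fd_vimage:
 assumes M: "kspace M sc" and N: "kspace N sc'" and Ga: "klin M sc N sc' Ga"
  and "fd N sc' Z W"
 shows "fd M sc (Ga\<inverse> `` Z) (Ga\<inverse> `` W)"
 using assms(4)
proof (induction rule: fd.induct)
 case (fd_base V Y)
 then show ?case by (blast intro: fd.fd_base)
next
 case (fd_step V\<^sub>0 Y v V)
 interpret M: kspace M sc by fact
 interpret N: kspace N sc' by fact
 have kX0: "ksub M sc (Ga\<inverse> `` V\<^sub>0)" using klin_ksub_vimage[OF Ga fd_step.hyps(2)] .
 have X0: "V\<^sub>0 <= carrier N" using fd_step.hyps(2) by (simp add: ksub_def)
 show ?case
 proof (cases "Ga\<inverse> `` V <= Ga\<inverse> `` V\<^sub>0")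
  case True
  then show ?thesis using fd_step.IH fd_mono by blast
 next
  case False
  \<comment> \<open>An \<open>x\<close> related to a point of \<open>V\<close> but to none of
    \<open>V\<^sub>0\<close> takes over the role of \<open>v\<close> upstairs: the coefficient
    \<open>c\<close> of \<open>v\<close> in its image cannot vanish.\<close>
  then obtain x z where xz: "(x, z) \<in> Ga" "z \<in> V" and nx: "x \<notin> Ga\<inverse> `` V\<^sub>0" by blast
  obtain c z\<^sub>0 where z: "z = sc' c v \<oplus>[N] z\<^sub>0" "z\<^sub>0 \<in> V\<^sub>0" using fd_step.hyps(4) xz by blast
  have z0: "z\<^sub>0 \<in> carrier N" using z X0 by blast
  have c: "c \<noteq> 0"
  proof
   assume "c = 0"
   then have "z = z\<^sub>0" using z z0 fd_step.hyps(3) by simp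
   then show False using z xz nx by blast
  qed
  have xM: "x \<in> carrier M" using xz Ga by (auto simp: klin_def)
  show ?thesis
  proof (rule fd.fd_step[OF fd_step.IH kX0 xM], safe)
   fix x' z' assume xz': "(x', z') \<in> Ga" "z' \<in> V"
   obtain c' z\<^sub>0' where z': "z' = sc' c' v \<oplus>[N] z\<^sub>0'" "z\<^sub>0' \<in> V\<^sub>0" using fd_step.hyps(4) xz' by blast
   have z0': "z\<^sub>0' \<in> carrier N" using z' X0 by blast
   have xM': "x' \<in> carrier M" using xz' Ga by (auto simp: klin_def)
   \<comment> \<open>The multiple of \<open>x\<close> that cancels the \<open>v\<close>-component of
     the image of \<open>x'\<close>.\<close>
   let ?d = "- (c' / c)"
   have "(sc ?d x \<oplus>[M] x', sc' ?d z \<oplus>[N] z') \<in> Ga"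
    using Ga xz xz' unfolding klin_def by blast
   moreover have "sc' ?d z \<oplus>[N] z' = sc' ?d z\<^sub>0 \<oplus>[N] z\<^sub>0'"
   proof -
    have "sc' ?d z = sc' (- c') v \<oplus>[N] sc' ?d z\<^sub>0"
     unfolding z(1) using z0 fd_step.hyps(3) c
     by (simp add: N.sc_add N.mult_sc[symmetric])
    also have "\<dots> \<oplus>[N] z' = sc' (- c') v \<oplus>[N] sc' c' v \<oplus>[N] (sc' ?d z\<^sub>0 \<oplus>[N] z\<^sub>0')"
     unfolding z'(1) using z0 z0' fd_step.hyps(3) by (simp add: N.a_ac)
    also have "sc' (- c') v \<oplus>[N] sc' c' v = \<zero>[N]"
     using fd_step.hyps(3) N.add_sc[of v "-c'" c'] by simp
    finally show ?thesis using z0 z0' by simp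
   qed
   moreover have "sc' ?d z\<^sub>0 \<oplus>[N] z\<^sub>0' \<in> V\<^sub>0"
    using fd_step.hyps(2) z z' by (simp add: ksub_def)
   ultimately have "sc ?d x \<oplus>[M] x' \<in> Ga\<inverse> `` V\<^sub>0" by auto
   moreover have "x' = sc (c' / c) x \<oplus>[M] (sc ?d x \<oplus>[M] x')"
   proof -
    have "sc (c' / c) x \<oplus>[M] (sc ?d x \<oplus>[M] x') = (sc (c' / c) x \<oplus>[M] sc ?d x) \<oplus>[M] x'"
     using xM xM' by (simp add: M.a_assoc)
    also have "sc (c' / c) x \<oplus>[M] sc ?d x = \<zero>[M]"
     using xM M.add_sc[of x "c' / c" ?d] by simp
    finally show ?thesis using xM' by simp
   qed
   ultimately show "\<exists>c. \<exists>x\<^sub>0\<in>Ga\<inverse> `` V\<^sub>0. x' = sc c x \<oplus>[M] x\<^sub>0" by blast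
  qed
 qed
qed

lemma fd_image:
 assumes "kspace M sc" "kspace N sc'" "klin M sc N sc' Ga" "fd M sc V Y"
 shows "fd N sc' (Ga `` V) (Ga `` Y)"
 using fd_vimage[OF assms(2,1) klin_converse[OF assms(3)] assms(4)] by simp

context kspace
begin

lemma klin_Id_on: "ksub M sc V ==> klin M sc M sc (Id_on V)"
 unfolding klin_def ksub_def by auto

text \<open>Preimages under the identity relation on \<open>Z\<close> are intersections with
  \<open>Z\<close>.\<close>

lemma fd_Int: "fd M sc V Y ==> ksub M sc Z ==> fd M sc (Z \<inter> V) (Z \<inter> Y)"
 using fd_vimage[OF kspace_axioms kspace_axioms klin_Id_on, of Z V Y]
 by (simp add: Image_def Id_on_def Int_def conj_commute)

lemma ksub_carrier: "ksub M sc (carrier M)"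
 by (simp add: ksub_def)

lemma ksub_zero: "ksub M sc {\<zero>}"
 by (simp add: ksub_def)

lemma ksub_Int: "ksub M sc V ==> ksub M sc Y ==> ksub M sc (V \<inter> Y)"
 by (auto simp: ksub_def)

lemma fd_carrier_Int:
 assumes "fd M sc (carrier M) V" "fd M sc (carrier M) Y" "ksub M sc V"
 shows "fd M sc (carrier M) (V \<inter> Y)"
proof -
 have "fd M sc (V \<inter> carrier M) (V \<inter> Y)" by (rule fd_Int[OF assms(2,3)])
 moreover have "V \<inter> carrier M = V" using assms(3) by (auto simp: ksub_def)
 ultimately show ?thesis using fd_trans[OF assms(1)] by simp
qed

lemma set_add_iff: "z \<in> V <+>[M] Y \<longleftrightarrow> (\<exists>x\<in>V. \<exists>y\<in>Y. z = x \<oplus> y)"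
 by (auto simp: set_add_def set_mult_def)

lemma ksub_set_add:
 assumes "ksub M sc V" "ksub M sc Y"
 shows "ksub M sc (V <+>[M] Y)"
proof -
 have V: "V <= carrier M" "\<zero> \<in> V" "\<And>x y. x \<in> V ==> y \<in> V ==> x \<oplus> y \<in> V" "\<And>c x. x \<in> V ==> sc c x \<in> V"
  and Y: "Y <= carrier M" "\<zero> \<in> Y" "\<And>x y. x \<in> Y ==> y \<in> Y ==> x \<oplus> y \<in> Y" "\<And>c x. x \<in> Y ==> sc c x \<in> Y"
  using assms by (auto simp: ksub_def)
 show ?thesis unfolding ksub_def set_add_iff Ball_def
 proof (intro conjI allI impI subsetI)
  fix z assume "z \<in> V <+>[M] Y" then show "z \<in> carrier M" using V Y by (auto simp: set_add_iff)
 next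
  show "\<exists>x\<in>V. \<exists>y\<in>Y. \<zero> = x \<oplus> y" using V(2) Y(2) l_zero[OF zero_closed] by metis
 next
  fix u v assume "\<exists>x\<in>V. \<exists>y\<in>Y. u = x \<oplus> y" "\<exists>x\<in>V. \<exists>y\<in>Y. v = x \<oplus> y"
  then obtain x y x' y' where *: "x \<in> V" "y \<in> Y" "u = x \<oplus> y" "x' \<in> V" "y' \<in> Y" "v = x' \<oplus> y'" by blast
  then have "u \<oplus> v = (x \<oplus> x') \<oplus> (y \<oplus> y')" using V(1) Y(1) by (simp add: subset_iff a_ac)
  then show "\<exists>x\<in>V. \<exists>y\<in>Y. u \<oplus> v = x \<oplus> y" using * V(3) Y(3) by blast
 next
  fix c u assume "\<exists>x\<in>V. \<exists>y\<in>Y. u = x \<oplus> y"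
  then obtain x y where *: "x \<in> V" "y \<in> Y" "u = x \<oplus> y" by blast
  then have "sc c u = sc c x \<oplus> sc c y" using V(1) Y(1) by (simp add: subset_iff sc_add)
  then show "\<exists>x\<in>V. \<exists>y\<in>Y. sc c u = x \<oplus> y" using * V(4) Y(4) by blast
 qed
qed

lemma subset_set_add:
 assumes "ksub M sc V" "ksub M sc Y"
 shows "V <= V <+>[M] Y" "Y <= V <+>[M] Y"
proof -
 have "\<zero> \<in> V" "\<zero> \<in> Y" "V <= carrier M" "Y <= carrier M" using assms by (auto simp: ksub_def)
 moreover have "x = x \<oplus> \<zero>" if "x \<in> V" for x using that calculation by auto
 moreover have "y = \<zero> \<oplus> y" if "y \<in> Y" for y using that calculation by auto
 ultimately show "V <= V <+>[M] Y" "Y <= V <+>[M] Y" unfolding subset_iff set_add_iff by blast+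
qed

text \<open>Forgetting the summand in \<open>W\<close> is a linear relation between
  \<open>x \<oplus> y\<close> and \<open>y\<close>; the preimage of \<open>V\<close> under it is the
  sum of \<open>W\<close> and \<open>V\<close>.\<close>

lemma fd_set_add_left:
 assumes W: "ksub M sc W" and "fd M sc V Y" "V <= carrier M"
 shows "fd M sc (W <+>[M] V) (W <+>[M] Y)"
proof -
 let ?Ga = "{(x \<oplus> y, y) |x y. x \<in> W \<and> y \<in> carrier M}"
 have Wc: "\<And>x. x \<in> W ==> x \<in> carrier M" "\<zero> \<in> W" "\<And>x y. x \<in> W ==> y \<in> W ==> x \<oplus> y \<in> W" "\<And>c x. x \<in> W ==> sc c x \<in> W"
  using W by (auto simp: ksub_def)
 have mem: "(z, y) \<in> ?Ga \<longleftrightarrow> (\<exists>x\<in>W. y \<in> carrier M \<and> z = x \<oplus> y)" for z y by auto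
 have "klin M sc M sc ?Ga"
  unfolding klin_def mem
 proof (intro conjI allI impI)
  show "?Ga <= carrier M \<times> carrier M" using Wc by auto
  show "\<exists>x\<in>W. \<zero> \<in> carrier M \<and> \<zero> = x \<oplus> \<zero>" using Wc(2) by (intro bexI[of _ \<zero>]) auto
 next
  fix x y x' y' assume "\<exists>xa\<in>W. y \<in> carrier M \<and> x = xa \<oplus> y" "\<exists>x\<in>W. y' \<in> carrier M \<and> x' = x \<oplus> y'"
  then obtain u u' where *: "u \<in> W" "y \<in> carrier M" "x = u \<oplus> y" "u' \<in> W" "y' \<in> carrier M" "x' = u' \<oplus> y'" by blast
  then have "x \<oplus> x' = (u \<oplus> u') \<oplus> (y \<oplus> y')" using Wc(1) by (simp add: a_ac)
  then show "\<exists>xa\<in>W. y \<oplus> y' \<in> carrier M \<and> x \<oplus> x' = xa \<oplus> (y \<oplus> y')" using * Wc(3) by blast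
 next
  fix c x y assume "\<exists>xa\<in>W. y \<in> carrier M \<and> x = xa \<oplus> y"
  then show "\<exists>xa\<in>W. sc c y \<in> carrier M \<and> sc c x = xa \<oplus> sc c y"
   using Wc by (metis sc_add sc_closed)
 qed
 from fd_vimage[OF kspace_axioms kspace_axioms this assms(2)]
 have "fd M sc (?Ga\<inverse> `` V) (?Ga\<inverse> `` Y)" .
 moreover have "W <+>[M] V <= ?Ga\<inverse> `` V"
 proof
  fix z assume "z \<in> W <+>[M] V"
  then obtain x y where "x \<in> W" "y \<in> V" "z = x \<oplus> y" by (auto simp: set_add_iff)
  then have "(z, y) \<in> ?Ga" "y \<in> V" using assms(3) by auto
  then show "z \<in> ?Ga\<inverse> `` V" by blast
 qed
 moreover have "?Ga\<inverse> `` Y <= W <+>[M] Y" by (auto simp: set_add_iff) blast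
 ultimately show ?thesis using fd_mono by blast
qed

lemma fd_set_add:
 assumes "ksub M sc V" "ksub M sc Y" "fd M sc V {\<zero>}" "fd M sc Y {\<zero>}"
 shows "fd M sc (V <+>[M] Y) {\<zero>}"
proof -
 have "fd M sc (V <+>[M] Y) (V <+>[M] {\<zero>})"
  using fd_set_add_left[OF assms(1,4)] assms(2) by (simp add: ksub_def)
 moreover have "V <+>[M] {\<zero>} <= V" using assms(1) by (auto simp: set_add_iff ksub_def)
 ultimately show ?thesis using fd_trans[OF _ assms(3)] fd_mono by blast
qed

text \<open>The finite set can be chosen inside \<open>Z\<close>, because each step of
  \<open>fd\<close> enlarges \<open>Z \<inter> V\<^sub>0\<close> by at most one direction, and any
  element of \<open>Z\<close> outside \<open>V\<^sub>0\<close> spans it.\<close>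

lemma fd_imp_basis:
 assumes "fd M sc V Y" "ksub M sc Z" "Z <= V" "ksub M sc Y"
 shows "\<exists>B\<subseteq>Z. finite B \<and> (\<forall>z\<in>Z. \<exists>c. \<exists>y\<in>Y. z = (\<Oplus>b\<in>B. sc (c b) b) \<oplus> y)"
 using assms
proof (induction arbitrary: Z rule: fd.induct)
 case (fd_base V Y)
 have "\<exists>y\<in>Y. z = (\<Oplus>b\<in>{}. sc (c b) b) \<oplus> y" if "z \<in> Z" for z and c :: "'u => 'k"
  using that fd_base by (auto simp: ksub_def intro!: bexI[of _ z])
 then show ?case by (intro exI[of _ "{}"]) auto
next
 case (fd_step V\<^sub>0 Y v V)
 let ?Z0 = "Z \<inter> V\<^sub>0"
 have Zc: "\<And>x. x \<in> Z ==> x \<in> carrier M" and Yc: "\<And>x. x \<in> Y ==> x \<in> carrier M"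
  and X0c: "\<And>x. x \<in> V\<^sub>0 ==> x \<in> carrier M"
  using fd_step.prems fd_step.hyps(2) by (auto simp: ksub_def)
 have "ksub M sc ?Z0" using ksub_Int fd_step by blast
 from fd_step.IH[OF this _ fd_step.prems(3)] obtain B where
  B: "B <= ?Z0" "finite B" "\<forall>z\<in>?Z0. \<exists>c. \<exists>y\<in>Y. z = (\<Oplus>b\<in>B. sc (c b) b) \<oplus> y" by auto
 show ?case
 proof (cases "Z <= V\<^sub>0")
  case True
  then show ?thesis using B by (intro exI[of _ B]) blast
 next
  case False
  then obtain z where z: "z \<in> Z" "z \<notin> V\<^sub>0" by blast
  obtain c z\<^sub>0 where zc: "z = sc c v \<oplus> z\<^sub>0" "z\<^sub>0 \<in> V\<^sub>0"
   using fd_step.hyps(4) fd_step.prems z(1) by blast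
  have "z\<^sub>0 \<in> carrier M" using zc(2) X0c by blast
  with zc z fd_step.hyps(3) have c: "c \<noteq> 0" by auto
  have zB: "z \<notin> B" using z B by blast
  have "\<exists>c. \<exists>y\<in>Y. u = (\<Oplus>b\<in>insert z B. sc (c b) b) \<oplus> y" if u: "u \<in> Z" for u
  proof -
   obtain c' u\<^sub>0 where uc: "u = sc c' v \<oplus> u\<^sub>0" "u\<^sub>0 \<in> V\<^sub>0"
    using fd_step.hyps(4) fd_step.prems u by blast
   let ?d = "- (c' / c)"
   have "sc ?d z \<oplus> u = sc ?d z\<^sub>0 \<oplus> u\<^sub>0"
   proof -
    have "sc ?d z = sc (- c') v \<oplus> sc ?d z\<^sub>0"
     unfolding zc(1) using X0c[OF zc(2)] fd_step.hyps(3) c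
     by (simp add: sc_add mult_sc[symmetric])
    also have "\<dots> \<oplus> u = sc (- c') v \<oplus> sc c' v \<oplus> (sc ?d z\<^sub>0 \<oplus> u\<^sub>0)"
     unfolding uc(1) using X0c[OF zc(2)] X0c[OF uc(2)] fd_step.hyps(3) by (simp add: a_ac)
    also have "sc (- c') v \<oplus> sc c' v = \<zero>"
     using fd_step.hyps(3) add_sc[of v "-c'" c'] by simp
    finally show ?thesis using X0c[OF zc(2)] X0c[OF uc(2)] by simp
   qed
   moreover have "\<dots> \<in> V\<^sub>0" using fd_step.hyps(2) zc(2) uc(2) by (simp add: ksub_def)
   moreover have "sc ?d z \<oplus> u \<in> Z" using fd_step.prems(1) z(1) u by (simp add: ksub_def)
   ultimately have "sc ?d z \<oplus> u \<in> ?Z0" by simp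
   then obtain c'' y where y: "y \<in> Y" "sc ?d z \<oplus> u = (\<Oplus>b\<in>B. sc (c'' b) b) \<oplus> y" using B(3) by blast
   let ?c = "c''(z := c' / c)"
   have "(\<Oplus>b\<in>insert z B. sc (?c b) b) = sc (c' / c) z \<oplus> (\<Oplus>b\<in>B. sc (c'' b) b)"
   proof -
    have "(\<Oplus>b\<in>insert z B. sc (?c b) b) = sc (?c z) z \<oplus> (\<Oplus>b\<in>B. sc (?c b) b)"
     by (rule finsum_insert) (use B zB z Zc in auto)
    moreover have "(\<Oplus>b\<in>B. sc (?c b) b) = (\<Oplus>b\<in>B. sc (c'' b) b)"
     by (rule finsum_cong') (use B zB Zc in auto)
    ultimately show ?thesis by simp
   qed
   moreover have cl: "(\<Oplus>b\<in>B. sc (c'' b) b) \<in> carrier M"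
    by (rule finsum_closed) (use B Zc in auto)
   moreover have "u = sc (c' / c) z \<oplus> (sc ?d z \<oplus> u)"
   proof -
    have "sc (c' / c) z \<oplus> (sc ?d z \<oplus> u) = (sc (c' / c) z \<oplus> sc ?d z) \<oplus> u"
     using Zc z u by (simp add: a_assoc)
    also have "sc (c' / c) z \<oplus> sc ?d z = \<zero>" using Zc[OF z(1)] add_sc[of z "c' / c" ?d] by simp
    finally show ?thesis using Zc u by simp
   qed
   ultimately have "u = (\<Oplus>b\<in>insert z B. sc (?c b) b) \<oplus> y"
    using y Yc Zc z by (simp add: a_assoc)
   then show ?thesis using y(1) by blast
  qed
  then show ?thesis using B z by (intro exI[of _ "insert z B"]) blast
 qed
qed

lemma basis_imp_fd:
 assumes "finite B" "B <= carrier M" "\<forall>x\<in>V. \<exists>c. \<exists>y\<in>Y. x = (\<Oplus>b\<in>B. sc (c b) b) \<oplus> y" "ksub M sc Y"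
 shows "fd M sc V Y"
 using assms(1,2,3)
proof (induction B arbitrary: V rule: finite_induct)
 case empty
 then show ?case using assms(4) by (intro fd.fd_base) (auto simp: ksub_def)
next
 case (insert v B)
 let ?s = "%c. \<Oplus>b\<in>B. sc (c b) b"
 have Yc: "\<And>x. x \<in> Y ==> x \<in> carrier M" using assms(4) by (auto simp: ksub_def)
 have sc_in: "(%b. sc (c b) b) \<in> B \<rightarrow> carrier M" for c using insert.prems by auto
 have cl: "?s c \<in> carrier M" for c by (rule finsum_closed[OF sc_in])
 \<comment> \<open>A step of \<open>fd\<close> starts from a subspace, so \<open>V\<close> without
   its \<open>v\<close>-components is enlarged to all combinations of the other generators modulo
   \<open>Y\<close>.\<close>
 let ?X0 = "{?s c \<oplus> y |c y. y \<in> Y}"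
 have s_add: "?s c \<oplus> ?s d = ?s (%b. c b + d b)" for c d
 proof -
  have "?s (%b. c b + d b) = (\<Oplus>b\<in>B. sc (c b) b \<oplus> sc (d b) b)"
   by (rule finsum_cong') (use insert.prems in \<open>auto simp: add_sc\<close>)
  then show ?thesis using finsum_addf[OF sc_in sc_in] by simp
 qed
 have s_sc: "sc a (?s c) = ?s (%b. a * c b)" for a c
  using insert.hyps(1) insert.prems(1)
 proof (induction B rule: finite_induct)
  case (insert x F)
  have F: "(%b. sc (c b) b) \<in> F \<rightarrow> carrier M" "(%b. sc (a * c b) b) \<in> F \<rightarrow> carrier M" using insert.prems by auto
  then show ?case using insert by (simp add: sc_add mult_sc)
 qed simp
 have X0I: "?s c \<oplus> y \<in> ?X0" if "y \<in> Y" for c y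
  using that by (intro CollectI exI conjI) (rule refl)
 have kX0: "ksub M sc ?X0"
  unfolding ksub_def
 proof (intro conjI ballI allI)
  show "?X0 <= carrier M" using cl Yc by auto
  have "?s (%_. 0) = \<zero>" by (rule add.finprod_one_eqI) (use insert.prems in auto)
  then have "\<zero> = ?s (%_. 0) \<oplus> \<zero>" by simp
  moreover have "\<zero> \<in> Y" using assms(4) by (simp add: ksub_def)
  ultimately show "\<zero> \<in> ?X0" using X0I[of \<zero> "%_. 0"] by simp
 next
  fix x y assume "x \<in> ?X0" "y \<in> ?X0"
  then obtain c u d v where *: "x = ?s c \<oplus> u" "u \<in> Y" "y = ?s d \<oplus> v" "v \<in> Y" by blast
  have "u \<oplus> v \<in> Y" using assms(4) * by (simp add: ksub_def)
  from X0I[OF this] have "?s (%b. c b + d b) \<oplus> (u \<oplus> v) \<in> ?X0" .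
  moreover have "x \<oplus> y = (?s c \<oplus> ?s d) \<oplus> (u \<oplus> v)" using * Yc cl by (simp add: a_ac)
  ultimately show "x \<oplus> y \<in> ?X0" by (simp only: s_add)
 next
  fix a x assume "x \<in> ?X0"
  then obtain c u where *: "x = ?s c \<oplus> u" "u \<in> Y" by blast
  have "sc a u \<in> Y" using assms(4) * by (simp add: ksub_def)
  from X0I[OF this] have "?s (%b. a * c b) \<oplus> sc a u \<in> ?X0" .
  moreover have "sc a x = ?s (%b. a * c b) \<oplus> sc a u" using * Yc cl by (simp add: sc_add s_sc)
  ultimately show "sc a x \<in> ?X0" by (simp only:)
 qed
 have fX0: "fd M sc ?X0 Y" by (rule insert.IH) (use insert.prems in auto)
 have dec: "\<forall>x\<in>V. \<exists>c. \<exists>x\<^sub>0\<in>?X0. x = sc c v \<oplus> x\<^sub>0"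
 proof
  fix x assume "x \<in> V"
  then obtain c y where y: "y \<in> Y" "x = (\<Oplus>b\<in>insert v B. sc (c b) b) \<oplus> y" using insert.prems by blast
  have "x = sc (c v) v \<oplus> ?s c \<oplus> y"
   using y(2) finsum_insert[OF insert.hyps sc_in, of c] insert.prems by simp
  then have "x = sc (c v) v \<oplus> (?s c \<oplus> y)" using y(1) Yc cl insert.prems by (simp add: a_assoc)
  then show "\<exists>c. \<exists>x\<^sub>0\<in>?X0. x = sc c v \<oplus> x\<^sub>0"
   using X0I[OF y(1), of c] by (intro exI[of _ "c v"] bexI[of _ "?s c \<oplus> y"])
 qed
 have "v \<in> carrier M" using insert.prems by simp
 from fX0 kX0 this dec show ?case by (rule fd.fd_step)
qed

end

section \<open>Graded modules\<close>

text \<open>With the identity as \<open>\<phi>\<close>, this also transports finite sums between two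
  records with the same addition, such as a module and a submodule.\<close>

lemma finsum_additive:
 assumes N: "abelian_group N" and M: "abelian_group M"
  and cl: "\<And>x. x \<in> carrier N ==> \<phi> x \<in> carrier M"
  and add: "\<And>x y. x \<in> carrier N ==> y \<in> carrier N ==> \<phi> (x \<oplus>[N] y) = \<phi> x \<oplus>[M] \<phi> y"
  and c: "c \<in> A \<rightarrow> carrier N"
 shows "\<phi> (finsum N c A) = finsum M (%a. \<phi> (c a)) A"
proof -
 interpret N: abelian_group N by fact
 interpret M: abelian_group M by fact
 have z: "\<phi> \<zero>[N] = \<zero>[M]"
  using add[of "\<zero>[N]" "\<zero>[N]"] cl[of "\<zero>[N]"] by (simp add: M.add.r_cancel_one')
 show ?thesis
 proof (cases "finite A")
  case True
  then show ?thesis using c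
  proof (induction A rule: finite_induct)
   case (insert a A)
   then have cA: "c \<in> A \<rightarrow> carrier N" "c a \<in> carrier N" by auto
   moreover have "(%a. \<phi> (c a)) \<in> A \<rightarrow> carrier M" using cA cl by auto
   ultimately show ?case using insert by (simp add: add cl)
  qed (simp add: z)
 next
  \<comment> \<open>Over an infinite index set \<open>finsum\<close> is zero by convention, on both
    sides.\<close>
  case False
  then show ?thesis by (simp add: z finsum_def finprod_def)
 qed
qed

lemma (in abelian_group) finsum_mem:
 assumes "V <= carrier G" "\<zero> \<in> V" "\<And>x y. x \<in> V ==> y \<in> V ==> x \<oplus> y \<in> V" "c \<in> A \<rightarrow> V"
 shows "finsum G c A \<in> V"
proof (cases "finite A")
 case True
 then show ?thesis using assms(4)
 proof (induction A rule: finite_induct)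
  case (insert a A)
  then have "c a \<in> V" "c \<in> A \<rightarrow> V" by auto
  moreover have "c \<in> A \<rightarrow> carrier G" "c a \<in> carrier G" using calculation assms(1) by auto
  ultimately show ?case using insert assms(3) by simp
 qed (simp add: assms)
next
 case False
 then show ?thesis using assms by (simp add: finsum_def finprod_def)
qed

lemma (in abelian_group) add_subgroupI:
 assumes "V <= carrier G" "\<zero> \<in> V" "\<And>x y. x \<in> V ==> y \<in> V ==> x \<oplus> y \<in> V" "\<And>x. x \<in> V ==> \<ominus> x \<in> V"
 shows "subgroup V (add_monoid G)"
 using assms by (intro subgroup.intro) (auto simp: a_inv_def)

definition is_dec :: "('k, 'g, 'r) graded_algebra => ('g, 'r, 'u) gmodule => 'u => ('g => 'u) => bool" where
 "is_dec S M x c \<longleftrightarrow> finite {g. c g \<noteq> \<zero>[M]} \<and>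
    (\<forall>g\<in>Gc S. c g \<in> gm_comp M g) \<and>
    (\<forall>g. g \<notin> Gc S --> c g = \<zero>[M]) \<and>
    x = finsum M c {g. c g \<noteq> \<zero>[M]}"

text \<open>The family of homogeneous components of \<open>x\<close>. It is indexed by the whole
  type of degrees and vanishes off the grading group.\<close>

definition hc :: "('k, 'g, 'r) graded_algebra => ('g, 'r, 'u) gmodule => 'u => 'g => 'u" where
 "hc S M x = (THE c. is_dec S M x c)"

definition esc :: "('k, 'g, 'r) graded_algebra => ('g, 'r, 'u) gmodule => 'k => 'u => 'u" where
 "esc S M c x = ga_emb S c \<odot>[M] x"

text \<open>An elementwise form of \<open>graded_submodule\<close>: closure under homogeneous
  components replaces a grading of the submodule as a module in its own right.\<close>

definition gsub :: "('k, 'g, 'r) graded_algebra => ('g, 'r, 'u) gmodule => 'u set => bool" where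
 "gsub S M V \<longleftrightarrow> V <= carrier M \<and> \<zero>[M] \<in> V \<and> (\<forall>x\<in>V. \<forall>y\<in>V. x \<oplus>[M] y \<in> V) \<and>
   (\<forall>r\<in>Rc S. \<forall>x\<in>V. r \<odot>[M] x \<in> V) \<and> (\<forall>x\<in>V. \<forall>g\<in>Gc S. hc S M x g \<in> V)"

lemma is_dec_finsum:
 assumes "abelian_group M" "is_dec S M x c" "finite A" "{g. c g \<noteq> \<zero>[M]} <= A" "\<And>g. c g \<in> carrier M"
 shows "x = finsum M c A"
proof -
 interpret abelian_group M by fact
 have "finsum M c {g. c g \<noteq> \<zero>[M]} = finsum M c A"
  by (rule add.finprod_mono_neutral_cong_left) (use assms in auto)
 then show ?thesis using assms(2) by (simp add: is_dec_def)
qed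

lemma is_decI:
 assumes "abelian_group M" "finite A" "\<And>g. g \<in> Gc S ==> c g \<in> gm_comp M g"
  "\<And>g. g \<notin> Gc S ==> c g = \<zero>[M]" "\<And>g. g \<notin> A ==> c g = \<zero>[M]"
  "\<And>g. c g \<in> carrier M" "x = finsum M c A"
 shows "is_dec S M x c"
proof -
 interpret abelian_group M by fact
 have sub: "{g. c g \<noteq> \<zero>[M]} <= A" using assms(5) by blast
 have "finsum M c {g. c g \<noteq> \<zero>[M]} = finsum M c A"
  by (rule add.finprod_mono_neutral_cong_left) (use assms sub in auto)
 then show ?thesis using assms finite_subset[OF sub] by (simp add: is_dec_def)
qed

text \<open>Unique decomposition follows from additive projections that are correct on homogeneous
  elements: applying \<open>pr\<close> to any decomposition returns its terms.\<close>

lemma graded_moduleI: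
 assumes m: "Module.module (ga_ring S) M"
  and sg: "\<And>g. g \<in> Gc S ==> subgroup (gm_comp M g) (add_monoid M)"
  and dec: "\<And>x. x \<in> carrier M ==> is_dec S M x (pr x)"
  and add: "\<And>x y g. x \<in> carrier M ==> y \<in> carrier M ==> pr (x \<oplus>[M] y) g = pr x g \<oplus>[M] pr y g"
  and hom: "\<And>g g' x. g \<in> Gc S ==> x \<in> gm_comp M g ==> pr x g' = (if g' = g then x else \<zero>[M])"
  and mult: "\<And>g h r x. g \<in> Gc S ==> h \<in> Gc S ==> r \<in> ga_comp S g ==>
   x \<in> gm_comp M h ==> r \<odot>[M] x \<in> gm_comp M (g \<otimes>[ga_grp S] h)"
 shows "graded_module S M"
proof -
 interpret Module.module "ga_ring S" M by fact
 have cc: "x \<in> carrier M" if "g \<in> Gc S" "x \<in> gm_comp M g" for g x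
  using subgroup.subset[OF sg[OF that(1)]] that(2) by auto
 have "c = pr x" if x: "x \<in> carrier M" and c: "is_dec S M x c" for x c
 proof
  fix g
  let ?A = "{g. c g \<noteq> \<zero>[M]}"
  have cM: "c h \<in> carrier M" for h using c cc[of h "c h"] unfolding is_dec_def by (cases "h \<in> Gc S") auto
  have AG: "?A <= Gc S" using c by (auto simp: is_dec_def)
  have prM: "pr y g \<in> carrier M" if "y \<in> carrier M" for y
   using dec[OF that] cc[of g "pr y g"] unfolding is_dec_def by (cases "g \<in> Gc S") auto
  have "pr x g = pr (finsum M c ?A) g" using c by (simp add: is_dec_def)
  also have "\<dots> = finsum M (%a. pr (c a) g) ?A"
   by (rule finsum_additive) (use prM add cM in \<open>auto intro: abelian_group_axioms\<close>)
  also have "\<dots> = finsum M (%a. if g = a then c a else \<zero>[M]) ?A"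
  proof (rule M.finsum_cong')
   show "pr (c i) g = (if g = i then c i else \<zero>[M])" if "i \<in> ?A" for i
    using that AG c by (intro hom) (auto simp: is_dec_def)
  qed (use cM in auto)
  also have "\<dots> = c g"
  proof (cases "g \<in> ?A")
   case True
   then show ?thesis using M.finsum_singleton[OF True, of c] cM c by (auto simp: is_dec_def)
  next
   case False
   then have "finsum M (%a. if g = a then c a else \<zero>[M]) ?A = \<zero>[M]"
    by (intro M.add.finprod_one_eqI) auto
   then show ?thesis using False by auto
  qed
  finally show "c g = pr x g" by simp
 qed
 then have "\<forall>x\<in>carrier M. \<exists>!c. is_dec S M x c" using dec by blast
 then show ?thesis unfolding graded_module_def is_dec_def[symmetric]
  using m sg mult by simp
qed

locale galg =
 fixes S :: "('k::field, 'g, 'r) graded_algebra"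
 assumes grp: "comm_group (ga_grp S)" and rng: "cring (ga_ring S)"
  and emb_closed [simp]: "ga_emb S c \<in> Rc S"
  and emb_add: "ga_emb S (c + d) = ga_emb S c \<oplus>[ga_ring S] ga_emb S d"
  and emb_mult: "ga_emb S (c * d) = ga_emb S c \<otimes>[ga_ring S] ga_emb S d"
  and emb_one: "ga_emb S 1 = \<one>[ga_ring S]"
  and ga_comp_closed: "g \<in> Gc S ==> r \<in> ga_comp S g ==> r \<in> Rc S"
begin

sublocale G: comm_group "ga_grp S" by (rule grp)

end

locale gmod = galg S for S :: "('k::field, 'g, 'r) graded_algebra" +
 fixes M :: "('g, 'r, 'u) gmodule"
 assumes gm: "graded_module S M"
begin

sublocale Module.module "ga_ring S" M
 using gm by (simp add: graded_module_def)

sublocale kspace M "esc S M"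
 by unfold_locales
  (auto simp: esc_def emb_add emb_mult emb_one smult_l_distr smult_r_distr smult_assoc1)

lemma comp_subgroup: "g \<in> Gc S ==> subgroup (gm_comp M g) (add_monoid M)"
 using gm by (simp add: graded_module_def)

lemma comp_carrier: "g \<in> Gc S ==> x \<in> gm_comp M g ==> x \<in> carrier M"
 using subgroup.subset[OF comp_subgroup] by auto

lemma comp_zero: "g \<in> Gc S ==> \<zero>[M] \<in> gm_comp M g"
 using subgroup.one_closed[OF comp_subgroup] by auto

lemma comp_add: "g \<in> Gc S ==> x \<in> gm_comp M g ==> y \<in> gm_comp M g ==> x \<oplus>[M] y \<in> gm_comp M g"
 using subgroup.m_closed[OF comp_subgroup] by auto

lemma comp_minus: "g \<in> Gc S ==> x \<in> gm_comp M g ==> \<ominus>[M] x \<in> gm_comp M g"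
 using subgroup.m_inv_closed[OF comp_subgroup] by (simp add: a_inv_def)

lemma comp_smult:
 "g \<in> Gc S ==> h \<in> Gc S ==> r \<in> ga_comp S g ==> x \<in> gm_comp M h ==>
  r \<odot>[M] x \<in> gm_comp M (g \<otimes>[ga_grp S] h)"
 using gm by (simp add: graded_module_def)

lemma ex1_dec: "x \<in> carrier M ==> \<exists>!c. is_dec S M x c"
 using gm by (simp add: graded_module_def is_dec_def)

lemma hc_dec: "x \<in> carrier M ==> is_dec S M x (hc S M x)"
 unfolding hc_def by (rule theI'[OF ex1_dec])

lemma hc_unique: "x \<in> carrier M ==> is_dec S M x c ==> hc S M x = c"
 using ex1_dec hc_dec by blast

lemma hc_comp: "x \<in> carrier M ==> g \<in> Gc S ==> hc S M x g \<in> gm_comp M g"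
 using hc_dec by (auto simp: is_dec_def)

lemma hc_out: "x \<in> carrier M ==> g \<notin> Gc S ==> hc S M x g = \<zero>[M]"
 using hc_dec by (auto simp: is_dec_def)

lemma hc_closed [simp]: "x \<in> carrier M ==> hc S M x g \<in> carrier M"
 by (cases "g \<in> Gc S") (auto simp: hc_out intro: comp_carrier hc_comp)

lemma hc_finite: "x \<in> carrier M ==> finite {g. hc S M x g \<noteq> \<zero>[M]}"
 using hc_dec by (auto simp: is_dec_def)

lemma hc_supp: "x \<in> carrier M ==> {g. hc S M x g \<noteq> \<zero>[M]} <= Gc S"
 using hc_out by auto

lemma hc_sum:
 assumes "x \<in> carrier M" "finite A" "{g. hc S M x g \<noteq> \<zero>[M]} <= A"
 shows "x = finsum M (hc S M x) A"
 by (rule is_dec_finsum) (use assms hc_dec in \<open>auto intro: M.abelian_group_axioms\<close>)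

lemma hc_add:
 assumes "x \<in> carrier M" "y \<in> carrier M"
 shows "hc S M (x \<oplus>[M] y) g = hc S M x g \<oplus>[M] hc S M y g"
proof -
 let ?A = "{g. hc S M x g \<noteq> \<zero>[M]} \<union> {g. hc S M y g \<noteq> \<zero>[M]}"
 have fin: "finite ?A" using hc_finite assms by auto
 have "is_dec S M (x \<oplus>[M] y) (%g. hc S M x g \<oplus>[M] hc S M y g)"
 proof (rule is_decI[where A = ?A])
  have "finsum M (%g. hc S M x g \<oplus>[M] hc S M y g) ?A = finsum M (hc S M x) ?A \<oplus>[M] finsum M (hc S M y) ?A"
   by (rule M.finsum_addf) (use assms in auto)
  then show "x \<oplus>[M] y = finsum M (%g. hc S M x g \<oplus>[M] hc S M y g) ?A"
   using hc_sum[OF assms(1) fin] hc_sum[OF assms(2) fin] by auto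
 qed (use assms fin in \<open>auto intro: M.abelian_group_axioms comp_add hc_comp simp: hc_out\<close>)
 then show ?thesis using hc_unique[of "x \<oplus>[M] y"] assms by simp
qed

lemma hc_of_comp:
 assumes "g \<in> Gc S" "x \<in> gm_comp M g"
 shows "hc S M x g' = (if g' = g then x else \<zero>[M])"
proof -
 have x: "x \<in> carrier M" using comp_carrier assms by blast
 have "is_dec S M x (%g'. if g' = g then x else \<zero>[M])"
  by (rule is_decI[where A = "{g}"]) (use assms x comp_zero in \<open>auto intro: M.abelian_group_axioms\<close>)
 then show ?thesis using hc_unique[OF x] by auto
qed

lemma hc_zero [simp]: "hc S M \<zero>[M] g = \<zero>[M]"
 using hc_of_comp[of "\<one>[ga_grp S]" "\<zero>[M]" g] comp_zero by auto

lemma hc_hc: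
 assumes "x \<in> carrier M"
 shows "hc S M (hc S M x g) g' = (if g' = g then hc S M x g else \<zero>[M])"
 using hc_of_comp[OF _ hc_comp[OF assms]] hc_out[OF assms] by (cases "g \<in> Gc S") auto

lemma hc_finsum:
 assumes "f \<in> A \<rightarrow> carrier M"
 shows "hc S M (finsum M f A) g = finsum M (%a. hc S M (f a) g) A"
 by (rule finsum_additive) (use assms in \<open>auto intro: M.abelian_group_axioms simp: hc_add\<close>)

lemma hc_minus:
 assumes "x \<in> carrier M"
 shows "hc S M (\<ominus>[M] x) g = \<ominus>[M] hc S M x g"
 using hc_add[of "\<ominus>[M] x" x g] assms M.minus_equality[of "hc S M (\<ominus>[M] x) g" "hc S M x g"]
 by (simp add: M.l_neg)

text \<open>Multiplication by a homogeneous \<open>r\<close> translates the degrees by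
  \<open>g'\<close>; the translated family is a decomposition of the product, and decompositions are
  unique.\<close>

lemma hc_smult:
 assumes g': "g' \<in> Gc S" and r: "r \<in> ga_comp S g'" and x: "x \<in> carrier M"
  and g: "g \<in> Gc S"
 shows "hc S M (r \<odot>[M] x) (g' \<otimes>[ga_grp S] g) = r \<odot>[M] hc S M x g"
proof -
 let ?G = "Gc S"
 let ?c = "%h. if h \<in> ?G then r \<odot>[M] hc S M x (inv[ga_grp S] g' \<otimes>[ga_grp S] h) else \<zero>[M]"
 let ?s = "{g. hc S M x g \<noteq> \<zero>[M]}"
 have rR: "r \<in> Rc S" using ga_comp_closed g' r by blast
 have bck: "g' \<otimes>[ga_grp S] (inv[ga_grp S] g' \<otimes>[ga_grp S] h) = h" if "h \<in> ?G" for h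
  using that g' by (simp add: G.m_assoc[symmetric])
 have fth: "inv[ga_grp S] g' \<otimes>[ga_grp S] (g' \<otimes>[ga_grp S] h) = h" if "h \<in> ?G" for h
  using that g' by (simp add: G.m_assoc[symmetric])
 have sG: "?s <= ?G" using hc_supp[OF x] .
 let ?A = "(%h. g' \<otimes>[ga_grp S] h) ` ?s"
 have inj: "inj_on (%h. g' \<otimes>[ga_grp S] h) ?s"
  by (rule inj_onI) (use sG g' in \<open>auto simp: subset_iff\<close>)
 have "is_dec S M (r \<odot>[M] x) ?c"
 proof (rule is_decI[where A = ?A])
  show "abelian_group M" by (rule M.abelian_group_axioms)
  show "finite ?A" using hc_finite[OF x] by simp
  show "?c g \<in> gm_comp M g" if "g \<in> ?G" for g
   using comp_smult[OF g' _ r hc_comp[OF x], of "inv[ga_grp S] g' \<otimes>[ga_grp S] g"] that bck[OF that] g' by simp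
  show "?c g = \<zero>[M]" if "g \<notin> ?G" for g using that by simp
  show "?c h = \<zero>[M]" if "h \<notin> ?A" for h
  proof (cases "h \<in> ?G")
   case True
   then have "inv[ga_grp S] g' \<otimes>[ga_grp S] h \<notin> ?s" using that bck[OF True] by (metis image_eqI)
   then show ?thesis using rR by simp
  qed simp
  show "?c h \<in> carrier M" for h using rR x by simp
  have "r \<odot>[M] x = r \<odot>[M] finsum M (hc S M x) ?s"
   using hc_sum[OF x hc_finite[OF x]] by simp
  also have "\<dots> = finsum M (%h. r \<odot>[M] hc S M x h) ?s"
   by (rule finsum_additive) (use rR x in \<open>auto intro: M.abelian_group_axioms simp: smult_r_distr\<close>)
  also have "\<dots> = finsum M (%h. ?c (g' \<otimes>[ga_grp S] h)) ?s"
   by (rule M.finsum_cong') (use sG g' rR x fth in \<open>auto simp: subset_iff\<close>)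
  also have "\<dots> = finsum M ?c ?A"
   using M.finsum_reindex[of ?c "%h. g' \<otimes>[ga_grp S] h" ?s] inj rR x by auto
  finally show "r \<odot>[M] x = finsum M ?c ?A" .
 qed
 from hc_unique[OF _ this] rR x have "hc S M (r \<odot>[M] x) = ?c" by simp
 then show ?thesis using g g' fth[OF g] by simp
qed

lemma gsubD:
 assumes "gsub S M V"
 shows "\<And>x. x \<in> V ==> x \<in> carrier M" "\<zero>[M] \<in> V" "\<And>x y. x \<in> V ==> y \<in> V ==> x \<oplus>[M] y \<in> V"
  "\<And>r x. r \<in> Rc S ==> x \<in> V ==> r \<odot>[M] x \<in> V" "\<And>x g. x \<in> V ==> hc S M x g \<in> V"
  "\<And>x. x \<in> V ==> \<ominus>[M] x \<in> V"
proof -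
 note * = assms[unfolded gsub_def]
 show "\<And>x. x \<in> V ==> x \<in> carrier M" "\<zero>[M] \<in> V" "\<And>x y. x \<in> V ==> y \<in> V ==> x \<oplus>[M] y \<in> V"
  "\<And>r x. r \<in> Rc S ==> x \<in> V ==> r \<odot>[M] x \<in> V"
  using * by auto
 show "hc S M x g \<in> V" if "x \<in> V" for x g
  using * that hc_out[of x g] by (cases "g \<in> Gc S") auto
 show "\<ominus>[M] x \<in> V" if "x \<in> V" for x
 proof -
  have "(\<ominus>[ga_ring S] \<one>\<^bsub>ga_ring S\<^esub>) \<odot>[M] x \<in> V" using * that by auto
  moreover have "x \<in> carrier M" using * that by blast
  ultimately show ?thesis by (simp add: smult_l_minus)
 qed
qed

lemma gsub_finsum: "gsub S M V ==> c \<in> A \<rightarrow> V ==> finsum M c A \<in> V"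
 by (rule M.finsum_mem) (auto simp: gsubD)

lemma gsub_ksub: "gsub S M V ==> ksub M (esc S M) V"
 by (auto simp: ksub_def esc_def gsubD)

lemma gsub_hcI: "gsub S M V ==> x \<in> carrier M ==> (\<And>g. g \<in> Gc S ==> hc S M x g \<in> V) ==> x \<in> V"
proof -
 assume V: "gsub S M V" and x: "x \<in> carrier M" and h: "\<And>g. g \<in> Gc S ==> hc S M x g \<in> V"
 have "finsum M (hc S M x) {g. hc S M x g \<noteq> \<zero>[M]} \<in> V"
  by (rule gsub_finsum[OF V]) (use hc_supp[OF x] h in auto)
 then show "x \<in> V" using hc_sum[OF x hc_finite[OF x]] by simp
qed

lemma gsub_carrier: "gsub S M (carrier M)"
 by (simp add: gsub_def)

lemma gsub_zero: "gsub S M {\<zero>[M]}"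
 by (simp add: gsub_def)

lemma gsub_Int: "gsub S M V ==> gsub S M W ==> gsub S M (V \<inter> W)"
 by (auto simp: gsub_def)

lemma gsub_set_add:
 assumes "gsub S M V" "gsub S M W"
 shows "gsub S M (V <+>[M] W)"
proof -
 note V = gsubD[OF assms(1)] and W = gsubD[OF assms(2)]
 have k: "ksub M (esc S M) (V <+>[M] W)" using ksub_set_add gsub_ksub assms by blast
 show ?thesis unfolding gsub_def
 proof (intro conjI ballI)
  fix r x assume r: "r \<in> Rc S" and "x \<in> V <+>[M] W"
  then obtain v w where *: "v \<in> V" "w \<in> W" "x = v \<oplus>[M] w" by (auto simp: set_add_iff)
  have "r \<odot>[M] x = r \<odot>[M] v \<oplus>[M] r \<odot>[M] w" using * r V(1) W(1) by (simp add: smult_r_distr)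
  then show "r \<odot>[M] x \<in> V <+>[M] W" unfolding set_add_iff using V(4)[OF r *(1)] W(4)[OF r *(2)] by blast
 next
  fix x g assume "x \<in> V <+>[M] W"
  then obtain v w where *: "v \<in> V" "w \<in> W" "x = v \<oplus>[M] w" by (auto simp: set_add_iff)
  have "hc S M x g = hc S M v g \<oplus>[M] hc S M w g" using * V(1) W(1) by (simp add: hc_add)
  then show "hc S M x g \<in> V <+>[M] W" unfolding set_add_iff using V(5)[OF *(1)] W(5)[OF *(2)] by blast
 qed (use k in \<open>auto simp: ksub_def\<close>)
qed

subsection \<open>Graded submodules\<close>

lemma sub_gmod_simps [simp]:
 "carrier (sub_gmod M V) = V" "ring.add (sub_gmod M V) = ring.add M" "ring.zero (sub_gmod M V) = ring.zero M"
 "module.smult (sub_gmod M V) = module.smult M" "gm_comp (sub_gmod M V) g = gm_comp M g \<inter> V"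
 by (auto simp: sub_gmod_def)

lemma sub_module:
 assumes "V <= carrier M" "\<zero>[M] \<in> V" "\<And>x y. x \<in> V ==> y \<in> V ==> x \<oplus>[M] y \<in> V"
  "\<And>r x. r \<in> Rc S ==> x \<in> V ==> r \<odot>[M] x \<in> V"
 shows "Module.module (ga_ring S) (sub_gmod M V)"
proof (rule moduleI[OF rng])
 have c: "\<And>x. x \<in> V ==> x \<in> carrier M" using assms by blast
 show "abelian_group (sub_gmod M V)"
 proof (rule abelian_groupI)
  fix x assume "x \<in> carrier (sub_gmod M V)"
  then have x: "x \<in> V" by simp
  have "(\<ominus>[ga_ring S] \<one>\<^bsub>ga_ring S\<^esub>) \<odot>[M] x \<in> V" using assms(4) x by simp
  moreover have "(\<ominus>[ga_ring S] \<one>\<^bsub>ga_ring S\<^esub>) \<odot>[M] x \<oplus>[M] x = \<zero>[M]"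
   using c[OF x] by (simp add: smult_l_minus M.l_neg)
  ultimately show "\<exists>y\<in>carrier (sub_gmod M V). y \<oplus>[sub_gmod M V] x = \<zero>[sub_gmod M V]" by auto
 qed (use assms c in \<open>auto simp: M.a_ac\<close>)
qed (use assms in \<open>auto simp: smult_l_distr smult_r_distr smult_assoc1 subset_iff\<close>)

lemma sub_graded:
 assumes V: "gsub S M V"
 shows "graded_module S (sub_gmod M V)" "x \<in> V ==> hc S (sub_gmod M V) x = hc S M x"
proof -
 note V' = gsubD[OF V]
 have m: "Module.module (ga_ring S) (sub_gmod M V)"
  by (rule sub_module) (use V' in auto)
 interpret N: Module.module "ga_ring S" "sub_gmod M V" by (rule m)
 have dec: "is_dec S (sub_gmod M V) x (hc S M x)" if "x \<in> V" for x
 proof (rule is_decI[where A = "{g. hc S M x g \<noteq> \<zero>[M]}"])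
  have x: "x \<in> carrier M" using that V' by blast
  show "finite {g. hc S M x g \<noteq> \<zero>[M]}" using hc_finite x .
  have "finsum (sub_gmod M V) (hc S M x) {g. hc S M x g \<noteq> \<zero>[M]} = finsum M (hc S M x) {g. hc S M x g \<noteq> \<zero>[M]}"
   by (rule finsum_additive[where \<phi> = "%x. x"]) (use V' that in \<open>auto intro: N.abelian_group_axioms M.abelian_group_axioms\<close>)
  then show "x = finsum (sub_gmod M V) (hc S M x) {g. hc S M x g \<noteq> \<zero>[M]}"
   using hc_sum[OF x hc_finite[OF x]] by simp
 qed (use that V' hc_comp hc_out in \<open>auto intro: N.abelian_group_axioms\<close>)
 show gr: "graded_module S (sub_gmod M V)"
 proof (rule graded_moduleI[where pr = "hc S M"])
  show "subgroup (gm_comp (sub_gmod M V) g) (add_monoid (sub_gmod M V))" if "g \<in> Gc S" for g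
  proof (rule N.M.add_subgroupI)
   fix x assume x: "x \<in> gm_comp (sub_gmod M V) g"
   then have "\<ominus>[M] x \<in> gm_comp M g \<inter> V" using comp_minus[OF that] V' by auto
   moreover have "\<ominus>[sub_gmod M V] x = \<ominus>[M] x"
    using x V' N.M.minus_equality[of "\<ominus>[M] x" x] by (auto simp: M.l_neg)
   ultimately show "\<ominus>[sub_gmod M V] x \<in> gm_comp (sub_gmod M V) g" by simp
  qed (use that V' comp_zero comp_add in auto)
 qed (use m dec V' hc_add hc_of_comp comp_smult ga_comp_closed in auto)
 interpret N': gmod S "sub_gmod M V" using gr by unfold_locales
 show "x \<in> V ==> hc S (sub_gmod M V) x = hc S M x"
  using N'.hc_unique[OF _ dec] by simp
qed

text \<open>A decomposition inside \<open>V\<close> is also one in \<open>M\<close>, so by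
  uniqueness the components taken in \<open>M\<close> stay in \<open>V\<close>.\<close>

lemma graded_submodule_iff: "graded_submodule S V M \<longleftrightarrow> gsub S M V"
proof
 assume "gsub S M V"
 note V' = gsubD[OF this]
 have "submodule V (ga_ring S) M"
  by (intro submodule.intro submodule_axioms.intro M.add_subgroupI) (use V' in auto)
 then show "graded_submodule S V M" using sub_graded(1)[OF \<open>gsub S M V\<close>] by (simp add: graded_submodule_def)
next
 assume a: "graded_submodule S V M"
 interpret N: gmod S "sub_gmod M V" using a by unfold_locales (simp add: graded_submodule_def)
 have s: "submodule V (ga_ring S) M" using a by (simp add: graded_submodule_def)
 have VM: "V <= carrier M" using submodule.axioms(1)[OF s] subgroup.subset by fastforce
 have "hc S M x g \<in> V" if x: "x \<in> V" for x g
 proof -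
  let ?c = "hc S (sub_gmod M V) x"
  have cV: "?c g \<in> V" for g using N.hc_closed[of x g] x by simp
  have "is_dec S M x ?c"
  proof (rule is_decI[where A = "{g. ?c g \<noteq> \<zero>[M]}"])
   show "finite {g. ?c g \<noteq> \<zero>[M]}" using N.hc_finite[of x] x by simp
   show "?c g \<in> gm_comp M g" if "g \<in> Gc S" for g using N.hc_comp[of x g] x that by simp
   show "?c g = \<zero>[M]" if "g \<notin> Gc S" for g using N.hc_out[of x g] x that by simp
   have "finsum (sub_gmod M V) ?c {g. ?c g \<noteq> \<zero>[M]} = finsum M ?c {g. ?c g \<noteq> \<zero>[M]}"
    by (rule finsum_additive[where \<phi> = "%x. x"])
     (use VM cV in \<open>auto intro: N.abelian_group_axioms M.abelian_group_axioms\<close>)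
   then show "x = finsum M ?c {g. ?c g \<noteq> \<zero>[M]}"
    using N.hc_sum[of x "{g. ?c g \<noteq> \<zero>[M]}"] N.hc_finite[of x] x by simp
  qed (use cV VM in \<open>auto intro: M.abelian_group_axioms\<close>)
  then show ?thesis using hc_unique[of x] VM x cV by auto
 qed
 then show "gsub S M V" unfolding gsub_def
  using VM N.M.zero_closed N.M.add.m_closed N.smult_closed by auto
qed

end

section \<open>Cosets and quotients by graded submodules\<close>

context gmod
begin

lemma coset_mem: "z \<in> V +>[M] x \<longleftrightarrow> (\<exists>v\<in>V. z = v \<oplus>[M] x)"
 by (auto simp: a_r_coset_def')

lemma coset_self: "gsub S M V ==> x \<in> carrier M ==> x \<in> V +>[M] x"
 unfolding coset_mem using gsubD(2) by (intro bexI[of _ "\<zero>[M]"]) auto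

lemma coset_mem_iff:
 assumes V: "gsub S M V" and x: "x \<in> carrier M"
 shows "z \<in> V +>[M] x \<longleftrightarrow> z \<in> carrier M \<and> z \<ominus>[M] x \<in> V"
proof
 assume "z \<in> V +>[M] x"
 then obtain v where v: "v \<in> V" "z = v \<oplus>[M] x" by (auto simp: coset_mem)
 have "v \<in> carrier M" using V v gsubD by blast
 then have "z \<ominus>[M] x = v" using x v by (simp add: M.minus_eq M.a_assoc M.r_neg)
 then show "z \<in> carrier M \<and> z \<ominus>[M] x \<in> V" using v x \<open>v \<in> carrier M\<close> by simp
next
 assume z: "z \<in> carrier M \<and> z \<ominus>[M] x \<in> V"
 then have "z = (z \<ominus>[M] x) \<oplus>[M] x" using x by (simp add: M.minus_eq M.a_assoc M.l_neg)
 then show "z \<in> V +>[M] x" using z unfolding coset_mem by blast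
qed

lemma coset_eq:
 assumes V: "gsub S M V" and x: "x \<in> carrier M" and y: "y \<in> carrier M"
 shows "V +>[M] x = V +>[M] y \<longleftrightarrow> x \<ominus>[M] y \<in> V"
proof
 assume "V +>[M] x = V +>[M] y"
 then show "x \<ominus>[M] y \<in> V" using coset_self[OF V x] coset_mem_iff[OF V y] by simp
next
 assume d: "x \<ominus>[M] y \<in> V"
 have e: "z \<ominus>[M] x \<in> V \<longleftrightarrow> z \<ominus>[M] y \<in> V" if z: "z \<in> carrier M" for z
 proof
  assume "z \<ominus>[M] x \<in> V"
  then have "(z \<ominus>[M] x) \<oplus>[M] (x \<ominus>[M] y) \<in> V" using d gsubD(3)[OF V] by blast
  moreover have "(z \<ominus>[M] x) \<oplus>[M] (x \<ominus>[M] y) = z \<ominus>[M] y"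
   using x y z by (simp add: M.minus_eq M.a_assoc M.r_neg1)
  ultimately show "z \<ominus>[M] y \<in> V" by simp
 next
  assume "z \<ominus>[M] y \<in> V"
  then have "(z \<ominus>[M] y) \<oplus>[M] (\<ominus>[M] (x \<ominus>[M] y)) \<in> V" using d gsubD(3,6)[OF V] by blast
  moreover have "(z \<ominus>[M] y) \<oplus>[M] (\<ominus>[M] (x \<ominus>[M] y)) = z \<ominus>[M] x"
  proof -
   have "\<ominus>[M] (x \<ominus>[M] y) = y \<ominus>[M] x" using x y by (simp add: M.minus_eq M.minus_add M.a_comm)
   then show ?thesis using x y z by (simp add: M.minus_eq M.a_assoc M.r_neg1)
  qed
  ultimately show "z \<ominus>[M] x \<in> V" by simp
 qed
 show "V +>[M] x = V +>[M] y" using e coset_mem_iff[OF V x] coset_mem_iff[OF V y] by blast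
qed

lemma coset_eqI: "gsub S M V ==> x \<in> carrier M ==> z \<in> V +>[M] x ==> V +>[M] z = V +>[M] x"
 using coset_mem_iff coset_eq by blast

lemma coset_zero: "gsub S M V ==> V +>[M] \<zero>[M] = V"
 by (auto simp: coset_mem gsubD intro: bexI[of _ "x" for x])

text \<open>Stated for two submodules so that it covers both the addition in a quotient
  (\<open>V = W\<close>) and the projection of a coset of \<open>V\<close> to one of the larger
  \<open>W\<close>, the form that occurs in \<open>q_rel\<close>.\<close>

lemma coset_sum:
 assumes V: "gsub S M V" and W: "gsub S M W" and "V <= W" and x: "x \<in> carrier M" and y: "y \<in> carrier M"
 shows "(W +>[M] x) <+>[M] (V +>[M] y) = W +>[M] (x \<oplus>[M] y)"
proof (intro Set.set_eqI iffI)
 fix z assume "z \<in> (W +>[M] x) <+>[M] (V +>[M] y)"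
 then obtain w v where *: "w \<in> W" "v \<in> V" "z = (w \<oplus>[M] x) \<oplus>[M] (v \<oplus>[M] y)"
  by (auto simp: set_add_iff coset_mem)
 have c: "w \<in> carrier M" "v \<in> carrier M" using * gsubD(1)[OF V] gsubD(1)[OF W] by auto
 have "z = (w \<oplus>[M] v) \<oplus>[M] (x \<oplus>[M] y)" using * c x y by (simp add: M.a_ac)
 moreover have "w \<oplus>[M] v \<in> W" using * assms(3) gsubD(3)[OF W] by blast
 ultimately show "z \<in> W +>[M] (x \<oplus>[M] y)" unfolding coset_mem by blast
next
 fix z assume "z \<in> W +>[M] (x \<oplus>[M] y)"
 then obtain w where *: "w \<in> W" "z = w \<oplus>[M] (x \<oplus>[M] y)" by (auto simp: coset_mem)
 have "w \<in> carrier M" using * gsubD(1)[OF W] by auto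
 then have "z = (w \<oplus>[M] x) \<oplus>[M] y" using * x y by (simp add: M.a_ac)
 moreover have "w \<oplus>[M] x \<in> W +>[M] x" using * unfolding coset_mem by blast
 ultimately show "z \<in> (W +>[M] x) <+>[M] (V +>[M] y)"
  unfolding set_add_iff using coset_self[OF V y] by blast
qed

lemma coset_smult:
 assumes V: "gsub S M V" and r: "r \<in> Rc S" and x: "x \<in> carrier M"
 shows "(\<Union>z\<in>V +>[M] x. V +>[M] (r \<odot>[M] z)) = V +>[M] (r \<odot>[M] x)"
proof -
 have "V +>[M] (r \<odot>[M] z) = V +>[M] (r \<odot>[M] x)" if "z \<in> V +>[M] x" for z
 proof -
  have z: "z \<in> carrier M" "z \<ominus>[M] x \<in> V" using that coset_mem_iff[OF V x] by auto
  have "r \<odot>[M] z \<ominus>[M] r \<odot>[M] x = r \<odot>[M] (z \<ominus>[M] x)"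
   using z r x by (simp add: M.minus_eq smult_r_distr smult_r_minus)
  then show ?thesis using z r x gsubD(4)[OF V] by (simp add: coset_eq[OF V])
 qed
 then show ?thesis using coset_self[OF V x] by blast
qed

lemma quot_gmod_simps [simp]:
 "carrier (quot_gmod M V) = (%x. V +>[M] x) ` carrier M" "ring.add (quot_gmod M V) = set_add M"
 "ring.zero (quot_gmod M V) = V" "module.smult (quot_gmod M V) r C = (\<Union>x\<in>C. V +>[M] (r \<odot>[M] x))"
 "gm_comp (quot_gmod M V) g = (%x. V +>[M] x) ` gm_comp M g"
 by (auto simp: quot_gmod_def A_RCOSETS_def')

lemma quot_module:
 assumes V: "gsub S M V"
 shows "Module.module (ga_ring S) (quot_gmod M V)"
proof (rule moduleI[OF rng])
 note s = coset_sum[OF V V subset_refl] and sm = coset_smult[OF V]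
 show "abelian_group (quot_gmod M V)"
 proof (rule abelian_groupI)
  fix C assume "C \<in> carrier (quot_gmod M V)"
  then obtain x where x: "x \<in> carrier M" "C = V +>[M] x" by auto
  then have "V +>[M] (\<ominus>[M] x) \<in> carrier (quot_gmod M V)"
   "(V +>[M] (\<ominus>[M] x)) \<oplus>[quot_gmod M V] C = \<zero>[quot_gmod M V]"
   by (auto simp: s M.l_neg coset_zero[OF V])
  then show "\<exists>y\<in>carrier (quot_gmod M V). y \<oplus>[quot_gmod M V] C = \<zero>[quot_gmod M V]" by blast
 next
  show "\<zero>[quot_gmod M V] \<in> carrier (quot_gmod M V)"
   using coset_zero[OF V] by (auto intro!: image_eqI[of _ _ "\<zero>[M]"])
 next
  fix C assume "C \<in> carrier (quot_gmod M V)"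
  then obtain x where x: "x \<in> carrier M" "C = V +>[M] x" by auto
  then show "\<zero>[quot_gmod M V] \<oplus>[quot_gmod M V] C = C"
   using s[of "\<zero>[M]" x] by (simp add: coset_zero[OF V])
 qed (auto simp: s M.a_ac)
qed (clarsimp simp: coset_sum[OF V V subset_refl] coset_smult[OF V] smult_l_distr smult_r_distr smult_assoc1
  simp del: UN_simps UN_UN_flatten)+

lemma quot_graded:
 assumes V: "gsub S M V"
 shows "graded_module S (quot_gmod M V)"
  "x \<in> carrier M ==> hc S (quot_gmod M V) (V +>[M] x) g = V +>[M] hc S M x g"
proof -
 let ?Q = "quot_gmod M V"
 note s = coset_sum[OF V V subset_refl] and sm = coset_smult[OF V]
 interpret Q: Module.module "ga_ring S" ?Q by (rule quot_module[OF V])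
 \<comment> \<open>The components of a coset are read off an arbitrary representative; two
   representatives differ by an element of \<open>V\<close>, whose components lie in
   \<open>V\<close>.\<close>
 define pr where "pr C g = V +>[M] hc S M (SOME x. x \<in> C) g" for C g
 have pr: "pr (V +>[M] x) g = V +>[M] hc S M x g" if x: "x \<in> carrier M" for x g
 proof -
  let ?z = "SOME z. z \<in> V +>[M] x"
  have "?z \<in> V +>[M] x" using coset_self[OF V x] by (rule someI)
  then have z: "?z \<in> carrier M" "?z \<ominus>[M] x \<in> V" using coset_mem_iff[OF V x] by auto
  have "hc S M ?z g \<ominus>[M] hc S M x g = hc S M (?z \<ominus>[M] x) g"
   using z x by (simp add: M.minus_eq hc_add hc_minus)
  then show ?thesis using gsubD(5)[OF V z(2)] z x by (simp add: pr_def coset_eq[OF V])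
 qed
 have dec: "is_dec S ?Q (V +>[M] x) (pr (V +>[M] x))" if x: "x \<in> carrier M" for x
 proof (rule is_decI[where A = "{g. hc S M x g \<noteq> \<zero>[M]}"])
  show "finite {g. hc S M x g \<noteq> \<zero>[M]}" by (rule hc_finite[OF x])
  show "V +>[M] x = finsum ?Q (pr (V +>[M] x)) {g. hc S M x g \<noteq> \<zero>[M]}"
  proof -
   have "V +>[M] finsum M (hc S M x) {g. hc S M x g \<noteq> \<zero>[M]} =
     finsum ?Q (%g. V +>[M] hc S M x g) {g. hc S M x g \<noteq> \<zero>[M]}"
    by (rule finsum_additive) (use x s in \<open>auto intro: M.abelian_group_axioms Q.abelian_group_axioms\<close>)
   moreover have "V +>[M] x = V +>[M] finsum M (hc S M x) {g. hc S M x g \<noteq> \<zero>[M]}"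
    using hc_sum[OF x hc_finite[OF x]] by simp
   moreover have "pr (V +>[M] x) = (%g. V +>[M] hc S M x g)" using pr[OF x] by blast
   ultimately show ?thesis by metis
  qed
 qed (use x hc_comp[OF x] hc_out[OF x] in \<open>auto simp: pr coset_zero[OF V] intro: Q.abelian_group_axioms\<close>)
 show gr: "graded_module S ?Q"
 proof (rule graded_moduleI[where pr = pr])
  show "subgroup (gm_comp ?Q g) (add_monoid ?Q)" if g: "g \<in> Gc S" for g
  proof (rule Q.M.add_subgroupI)
   show "gm_comp ?Q g <= carrier ?Q" using comp_carrier[OF g] by auto
   show "\<zero>[?Q] \<in> gm_comp ?Q g" using coset_zero[OF V] comp_zero[OF g] by (auto intro!: image_eqI[of _ _ "\<zero>[M]"])
   show "C \<oplus>[?Q] D \<in> gm_comp ?Q g" if "C \<in> gm_comp ?Q g" "D \<in> gm_comp ?Q g" for C D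
    using that comp_carrier[OF g] comp_add[OF g] by (auto simp: s)
   fix C assume "C \<in> gm_comp ?Q g"
   then obtain x where x: "x \<in> gm_comp M g" "C = V +>[M] x" by auto
   have xc: "x \<in> carrier M" using x comp_carrier[OF g] by blast
   have "(V +>[M] (\<ominus>[M] x)) \<oplus>[?Q] C = \<zero>[?Q]" using xc x by (simp add: s M.l_neg coset_zero[OF V])
   then have "\<ominus>[?Q] C = V +>[M] (\<ominus>[M] x)" using Q.M.minus_equality xc x by auto
   then show "\<ominus>[?Q] C \<in> gm_comp ?Q g" using comp_minus[OF g x(1)] by simp
  qed
  show "is_dec S ?Q C (pr C)" if "C \<in> carrier ?Q" for C using that dec by auto
  show "pr (C \<oplus>[?Q] D) g = pr C g \<oplus>[?Q] pr D g" if "C \<in> carrier ?Q" "D \<in> carrier ?Q" for C D g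
   using that by (auto simp: s pr hc_add)
  show "pr C g' = (if g' = g then C else \<zero>[?Q])" if "g \<in> Gc S" "C \<in> gm_comp ?Q g" for C g g'
   using that comp_carrier[OF that(1)] by (auto simp: pr hc_of_comp coset_zero[OF V])
  show "r \<odot>[?Q] C \<in> gm_comp ?Q (g \<otimes>[ga_grp S] h)"
   if "g \<in> Gc S" "h \<in> Gc S" "r \<in> ga_comp S g" "C \<in> gm_comp ?Q h" for g h r C
   using that comp_smult[OF that(1,2,3)] comp_carrier[OF that(2)] ga_comp_closed[OF that(1,3)] by (auto simp: sm)
 qed (rule Q.module_axioms)
 interpret Q': gmod S ?Q using gr by unfold_locales
 show "hc S ?Q (V +>[M] x) g = V +>[M] hc S M x g" if x: "x \<in> carrier M"
  using Q'.hc_unique[OF _ dec[OF x]] x by (simp add: pr)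
qed

text \<open>Generators over the field generate over the ring, so finite generation is automatic for
  a finite dimensional module and torsion means exactly finite dimension.\<close>

lemma tor_iff: "M \<in> tor_objects S \<longleftrightarrow> fd M (esc S M) (carrier M) {\<zero>[M]}"
proof
 assume "M \<in> tor_objects S"
 then obtain B where B: "finite B" "B <= carrier M"
  "\<forall>x\<in>carrier M. \<exists>c. x = (\<Oplus>\<^bsub>M\<^esub>b\<in>B. ga_emb S (c b) \<odot>[M] b)" by (auto simp: tor_objects_def)
 have "\<forall>x\<in>carrier M. \<exists>c. \<exists>y\<in>{\<zero>[M]}. x = (\<Oplus>\<^bsub>M\<^esub>b\<in>B. esc S M (c b) b) \<oplus>[M] y"
 proof
  fix x assume x: "x \<in> carrier M"
  then obtain c where "x = (\<Oplus>\<^bsub>M\<^esub>b\<in>B. esc S M (c b) b)" using B(3) unfolding esc_def by blast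
  then show "\<exists>c. \<exists>y\<in>{\<zero>[M]}. x = (\<Oplus>\<^bsub>M\<^esub>b\<in>B. esc S M (c b) b) \<oplus>[M] y" using x by (intro exI[of _ c]) auto
 qed
 then show "fd M (esc S M) (carrier M) {\<zero>[M]}" using basis_imp_fd[OF B(1,2)] ksub_zero by blast
next
 assume "fd M (esc S M) (carrier M) {\<zero>[M]}"
 from fd_imp_basis[OF this ksub_carrier subset_refl ksub_zero] obtain B where
  B: "B <= carrier M" "finite B" "\<forall>z\<in>carrier M. \<exists>c. \<exists>y\<in>{\<zero>[M]}. z = (\<Oplus>\<^bsub>M\<^esub>b\<in>B. esc S M (c b) b) \<oplus>[M] y" by blast
 have *: "\<exists>c. z = (\<Oplus>\<^bsub>M\<^esub>b\<in>B. ga_emb S (c b) \<odot>[M] b)" if z: "z \<in> carrier M" for z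
 proof -
  obtain c where c: "z = (\<Oplus>\<^bsub>M\<^esub>b\<in>B. esc S M (c b) b) \<oplus>[M] \<zero>[M]" using B(3) z by blast
  moreover have "(\<Oplus>\<^bsub>M\<^esub>b\<in>B. esc S M (c b) b) \<in> carrier M" by (rule M.finsum_closed) (use B in auto)
  ultimately show ?thesis unfolding esc_def by auto
 qed
 moreover have "\<exists>c. c \<in> B \<rightarrow> Rc S \<and> z = (\<Oplus>\<^bsub>M\<^esub>b\<in>B. c b \<odot>[M] b)" if z: "z \<in> carrier M" for z
 proof -
  obtain c where "z = (\<Oplus>\<^bsub>M\<^esub>b\<in>B. ga_emb S (c b) \<odot>[M] b)" using *[OF z] by blast
  then show ?thesis by (intro exI[of _ "%b. ga_emb S (c b)"]) auto
 qed
 ultimately show "M \<in> tor_objects S" unfolding tor_objects_def mod_objects_def using gm B by blast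
qed

lemma sub_tor_iff:
 assumes V: "gsub S M V"
 shows "sub_gmod M V \<in> tor_objects S \<longleftrightarrow> fd M (esc S M) V {\<zero>[M]}"
proof -
 interpret N: gmod S "sub_gmod M V" using sub_graded(1)[OF V] by unfold_locales
 have k: "klin M (esc S M) (sub_gmod M V) (esc S (sub_gmod M V)) (Id_on V)"
  using gsubD[OF V] by (auto simp: klin_def esc_def)
 have i: "(Id_on V)\<inverse> `` V = V" "(Id_on V)\<inverse> `` {\<zero>[M]} = {\<zero>[M]}" "Id_on V `` V = V" "Id_on V `` {\<zero>[M]} = {\<zero>[M]}"
  using gsubD(2)[OF V] by auto
 show ?thesis unfolding N.tor_iff
  using fd_vimage[OF kspace_axioms N.kspace_axioms k, of V "{\<zero>[M]}"]
   fd_image[OF kspace_axioms N.kspace_axioms k, of V "{\<zero>[M]}"] unfolding i by auto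
qed

text \<open>The graph of the projection is a linear relation whose preimage of the zero coset is
  \<open>V\<close>; \<open>fd\<close> passes through it in both directions.\<close>

lemma quot_tor_iff:
 assumes V: "gsub S M V"
 shows "quot_gmod M V \<in> tor_objects S \<longleftrightarrow> fd M (esc S M) (carrier M) V"
proof -
 let ?Q = "quot_gmod M V"
 interpret Q: gmod S ?Q using quot_graded(1)[OF V] by unfold_locales
 let ?Ga = "(%x. (x, V +>[M] x)) ` carrier M"
 have k: "klin M (esc S M) ?Q (esc S ?Q) ?Ga"
  using coset_zero[OF V] coset_sum[OF V V subset_refl] coset_smult[OF V]
  by (auto simp: klin_def esc_def image_iff)
 have z: "V +>[M] x = V \<longleftrightarrow> x \<in> V" if "x \<in> carrier M" for x
  using coset_eq[OF V that, of "\<zero>[M]"] coset_zero[OF V] that M.minus_equality[of "\<zero>[M]" "\<zero>[M]"]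
  by (simp add: M.minus_eq)
 have i: "?Ga\<inverse> `` carrier ?Q = carrier M" "?Ga\<inverse> `` {V} = V" "?Ga `` carrier M = carrier ?Q" "?Ga `` V = {V}"
  using z gsubD(1,2)[OF V] by (auto simp: image_iff Image_iff)
 show ?thesis unfolding Q.tor_iff
  using fd_vimage[OF kspace_axioms Q.kspace_axioms k, of "carrier ?Q" "{V}"]
   fd_image[OF kspace_axioms Q.kspace_axioms k, of "carrier M" V] unfolding i by auto
qed

end

lemma graded_map_hc:
 assumes "gmod S M" "gmod S N" "\<And>x. x \<in> carrier M ==> \<phi> x \<in> carrier N"
  "\<And>x y. x \<in> carrier M ==> y \<in> carrier M ==> \<phi> (x \<oplus>[M] y) = \<phi> x \<oplus>[N] \<phi> y"
  "\<And>g x. g \<in> Gc S ==> x \<in> gm_comp M g ==> \<phi> x \<in> gm_comp N g" "x \<in> carrier M"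
 shows "hc S N (\<phi> x) g = \<phi> (hc S M x g)"
proof -
 interpret M: gmod S M by fact
 interpret N: gmod S N by fact
 have z: "\<phi> \<zero>[M] = \<zero>[N]"
  using assms(4)[of "\<zero>[M]" "\<zero>[M]"] assms(3)[of "\<zero>[M]"] by (simp add: N.M.add.r_cancel_one')
 let ?A = "{g. hc S M x g \<noteq> \<zero>[M]}"
 have "is_dec S N (\<phi> x) (%g. \<phi> (hc S M x g))"
 proof (rule is_decI[where A = ?A])
  show "\<phi> x = finsum N (%g. \<phi> (hc S M x g)) ?A"
   using finsum_additive[OF M.M.abelian_group_axioms N.M.abelian_group_axioms assms(3,4), of "hc S M x" ?A]
    M.hc_sum[OF assms(6) M.hc_finite[OF assms(6)]] assms(6) by auto
 qed (use assms z M.hc_comp M.hc_out M.hc_finite in \<open>auto intro: N.M.abelian_group_axioms\<close>)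
 then show ?thesis using N.hc_unique assms by simp
qed

section \<open>Morphisms of the Serre quotient as relations\<close>

text \<open>
 A representative \<open>(M', N', f)\<close> is encoded by the graded submodule \<open>{(x, y). x \<in> M' \<and> y \<in> f x}\<close> of
 \<open>M \<times> N\<close>. Gabriel's composition becomes composition of relations, and equality of morphisms becomes
 the equivalence relation generated by inclusion, so that every monotone operation respects it.
\<close>

definition glin :: "('k, 'g, 'r) graded_algebra => ('g, 'r, 'u) gmodule => ('g, 'r, 'v) gmodule => ('u \<times> 'v) set => bool" where
 "glin S M N Ga \<longleftrightarrow> Ga <= carrier M \<times> carrier N \<and> (\<zero>[M], \<zero>[N]) \<in> Ga \<and>
   (\<forall>x y x' y'. (x, y) \<in> Ga --> (x', y') \<in> Ga --> (x \<oplus>[M] x', y \<oplus>[N] y') \<in> Ga) \<and>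
   (\<forall>r\<in>Rc S. \<forall>x y. (x, y) \<in> Ga --> (r \<odot>[M] x, r \<odot>[N] y) \<in> Ga) \<and>
   (\<forall>g\<in>Gc S. \<forall>x y. (x, y) \<in> Ga --> (hc S M x g, hc S N y g) \<in> Ga)"

text \<open>The domain plays the role of \<open>M'\<close> and the fibre over zero that of
  \<open>N'\<close>. The two conditions say that \<open>M/M'\<close> and \<open>N'\<close> are
  torsion.\<close>

definition grel :: "('k::field, 'g, 'r) graded_algebra => ('g, 'r, 'u) gmodule => ('g, 'r, 'v) gmodule => ('u \<times> 'v) set => bool" where
 "grel S M N Ga \<longleftrightarrow> glin S M N Ga \<and> fd M (esc S M) (carrier M) (Domain Ga) \<and> fd N (esc S N) (Ga `` {\<zero>[M]}) {\<zero>[N]}"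

text \<open>The counterpart of \<open>q_rel\<close>: on some \<open>M\<^sub>3\<close> with torsion
  quotient, all values of the two relations agree up to a torsion submodule
  \<open>N\<^sub>3\<close>.\<close>

definition geq :: "('k::field, 'g, 'r) graded_algebra => ('g, 'r, 'u) gmodule => ('g, 'r, 'v) gmodule =>
  ('u \<times> 'v) set => ('u \<times> 'v) set => bool" where
 "geq S M N Ga Da \<longleftrightarrow> (\<exists>M\<^sub>3 N\<^sub>3. gsub S M M\<^sub>3 \<and> fd M (esc S M) (carrier M) M\<^sub>3 \<and>
   gsub S N N\<^sub>3 \<and> fd N (esc S N) N\<^sub>3 {\<zero>[N]} \<and> M\<^sub>3 <= Domain Ga \<inter> Domain Da \<and>
   (\<forall>x\<in>M\<^sub>3. \<forall>y z. (x, y) \<in> Ga --> (x, z) \<in> Da --> y \<ominus>[N] z \<in> N\<^sub>3))"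

definition rsum :: "('g, 'r, 'v) gmodule => ('u \<times> 'v) set => ('u \<times> 'v) set => ('u \<times> 'v) set" where
 "rsum N Ga Da = {(x, y \<oplus>[N] z) |x y z. (x, y) \<in> Ga \<and> (x, z) \<in> Da}"

lemma glin_converse: "glin S M N Ga ==> glin S N M (Ga\<inverse>)"
 unfolding glin_def by blast

lemma glin_comp:
 assumes "glin S M N Ga" "glin S N P Da"
 shows "glin S M P (Ga O Da)"
proof -
 note Ga = assms(1)[unfolded glin_def] and Da = assms(2)[unfolded glin_def]
 show ?thesis unfolding glin_def
 proof (intro conjI ballI allI impI)
  show "Ga O Da <= carrier M \<times> carrier P" using Ga Da by auto
  show "(\<zero>[M], \<zero>[P]) \<in> Ga O Da" using Ga Da by (intro relcompI[of _ "\<zero>[N]"]) auto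
 next
  fix x z x' z' assume "(x, z) \<in> Ga O Da" "(x', z') \<in> Ga O Da"
  then obtain y y' where *: "(x, y) \<in> Ga" "(y, z) \<in> Da" "(x', y') \<in> Ga" "(y', z') \<in> Da" by blast
  show "(x \<oplus>[M] x', z \<oplus>[P] z') \<in> Ga O Da" using Ga Da * by (intro relcompI[of _ "y \<oplus>[N] y'"]) auto
 next
  fix r x z assume r: "r \<in> Rc S" and "(x, z) \<in> Ga O Da"
  then obtain y where *: "(x, y) \<in> Ga" "(y, z) \<in> Da" by blast
  show "(r \<odot>[M] x, r \<odot>[P] z) \<in> Ga O Da" using Ga Da * r by (intro relcompI[of _ "r \<odot>[N] y"]) auto
 next
  fix g x z assume g: "g \<in> Gc S" and "(x, z) \<in> Ga O Da"
  then obtain y where *: "(x, y) \<in> Ga" "(y, z) \<in> Da" by blast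
  show "(hc S M x g, hc S P z g) \<in> Ga O Da" using Ga Da * g by (intro relcompI[of _ "hc S N y g"]) auto
 qed
qed

lemma glin_Image:
 assumes "glin S M N Ga" "gsub S M V"
 shows "gsub S N (Ga `` V)"
 unfolding gsub_def
proof (intro conjI ballI)
 show "Ga `` V <= carrier N" using assms by (auto simp: glin_def)
 show "\<zero>[N] \<in> Ga `` V" using assms by (auto simp: glin_def gsub_def)
next
 fix y y' assume "y \<in> Ga `` V" "y' \<in> Ga `` V"
 then obtain x x' where *: "(x, y) \<in> Ga" "x \<in> V" "(x', y') \<in> Ga" "x' \<in> V" by blast
 then have "(x \<oplus>[M] x', y \<oplus>[N] y') \<in> Ga" "x \<oplus>[M] x' \<in> V" using assms by (auto simp: glin_def gsub_def)
 then show "y \<oplus>[N] y' \<in> Ga `` V" by blast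
next
 fix r y assume r: "r \<in> Rc S" "y \<in> Ga `` V"
 then obtain x where *: "(x, y) \<in> Ga" "x \<in> V" by blast
 then have "(r \<odot>[M] x, r \<odot>[N] y) \<in> Ga" "r \<odot>[M] x \<in> V" using assms r by (auto simp: glin_def gsub_def)
 then show "r \<odot>[N] y \<in> Ga `` V" by blast
next
 fix y g assume g: "y \<in> Ga `` V" "g \<in> Gc S"
 then obtain x where *: "(x, y) \<in> Ga" "x \<in> V" by blast
 then have "(hc S M x g, hc S N y g) \<in> Ga" "hc S M x g \<in> V" using assms g by (auto simp: glin_def gsub_def)
 then show "hc S N y g \<in> Ga `` V" by blast
qed

locale gmod2 = M: gmod S M + N: gmod S N
 for S :: "('k::field, 'g, 'r) graded_algebra" and M :: "('g, 'r, 'u) gmodule" and N :: "('g, 'r, 'v) gmodule"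
begin

lemma glin_klin: "glin S M N Ga ==> klin M (esc S M) N (esc S N) Ga"
 unfolding glin_def klin_def esc_def by simp

lemma gsub_Domain:
 assumes "glin S M N Ga" shows "gsub S M (Domain Ga)"
proof -
 have "Domain Ga = Ga\<inverse> `` carrier N" using assms by (auto simp: glin_def)
 then show ?thesis using glin_Image[OF glin_converse[OF assms] N.gsub_carrier] by simp
qed

lemma gsub_fibre: "glin S M N Ga ==> gsub S N (Ga `` {\<zero>[M]})"
 using glin_Image M.gsub_zero by blast

lemma glinD:
 assumes "glin S M N Ga"
 shows "\<And>x y. (x, y) \<in> Ga ==> x \<in> carrier M" "\<And>x y. (x, y) \<in> Ga ==> y \<in> carrier N" "(\<zero>[M], \<zero>[N]) \<in> Ga"
  "\<And>x y x' y'. (x, y) \<in> Ga ==> (x', y') \<in> Ga ==> (x \<oplus>[M] x', y \<oplus>[N] y') \<in> Ga"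
  "\<And>r x y. r \<in> Rc S ==> (x, y) \<in> Ga ==> (r \<odot>[M] x, r \<odot>[N] y) \<in> Ga"
  "\<And>g x y. (x, y) \<in> Ga ==> (hc S M x g, hc S N y g) \<in> Ga"
  "\<And>x y x' y'. (x, y) \<in> Ga ==> (x', y') \<in> Ga ==> (x \<ominus>[M] x', y \<ominus>[N] y') \<in> Ga"
proof -
 note * = assms[unfolded glin_def]
 show c: "\<And>x y. (x, y) \<in> Ga ==> x \<in> carrier M" "\<And>x y. (x, y) \<in> Ga ==> y \<in> carrier N" "(\<zero>[M], \<zero>[N]) \<in> Ga"
  and a: "\<And>x y x' y'. (x, y) \<in> Ga ==> (x', y') \<in> Ga ==> (x \<oplus>[M] x', y \<oplus>[N] y') \<in> Ga"
  and s: "\<And>r x y. r \<in> Rc S ==> (x, y) \<in> Ga ==> (r \<odot>[M] x, r \<odot>[N] y) \<in> Ga"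
  using * by auto
 show "(hc S M x g, hc S N y g) \<in> Ga" if "(x, y) \<in> Ga" for x y g
  using * that c M.hc_out[of x g] N.hc_out[of y g] by (cases "g \<in> Gc S") auto
 show "(x \<ominus>[M] x', y \<ominus>[N] y') \<in> Ga" if "(x, y) \<in> Ga" "(x', y') \<in> Ga" for x y x' y'
 proof -
  have "((\<ominus>[ga_ring S] \<one>\<^bsub>ga_ring S\<^esub>) \<odot>[M] x', (\<ominus>[ga_ring S] \<one>\<^bsub>ga_ring S\<^esub>) \<odot>[N] y') \<in> Ga"
   using s that by simp
  then have "(\<ominus>[M] x', \<ominus>[N] y') \<in> Ga" using c that by (simp add: M.smult_l_minus N.smult_l_minus)
  then show ?thesis using a that unfolding a_minus_def by blast
 qed
qed

lemma glin_finsum: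
 assumes "glin S M N Ga" "\<And>i. i \<in> I ==> (x i, y i) \<in> Ga"
 shows "(finsum M x I, finsum N y I) \<in> Ga"
proof (cases "finite I")
 case True
 then show ?thesis using assms(2)
 proof (induction I rule: finite_induct)
  case (insert i I)
  then have "x \<in> I \<rightarrow> carrier M" "y \<in> I \<rightarrow> carrier N" "x i \<in> carrier M" "y i \<in> carrier N"
   using glinD(1,2)[OF assms(1)] by blast+
  then show ?case using insert glinD(4)[OF assms(1)] by simp
 qed (simp add: glinD(3)[OF assms(1)])
next
 case False
 then show ?thesis using glinD(3)[OF assms(1)] by (simp add: finsum_def finprod_def)
qed

lemma grel_glin: "grel S M N Ga ==> glin S M N Ga" by (simp add: grel_def)

text \<open>Two values of \<open>Da\<close> at the same point differ by an element of its fibre over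
  zero, and this fibre is finite dimensional.\<close>

lemma geq_sub:
 assumes "grel S M N Ga" "grel S M N Da" "Ga <= Da"
 shows "geq S M N Ga Da"
proof -
 have "y \<ominus>[N] z \<in> Da `` {\<zero>[M]}" if "(x, y) \<in> Ga" "(x, z) \<in> Da" for x y z
 proof -
  have "(x \<ominus>[M] x, y \<ominus>[N] z) \<in> Da" using glinD(7)[OF grel_glin[OF assms(2)]] that assms(3) by blast
  moreover have "x \<in> carrier M" using glinD(1)[OF grel_glin[OF assms(2)] that(2)] .
  ultimately show ?thesis by (simp add: M.M.minus_eq M.M.r_neg)
 qed
 then show ?thesis unfolding geq_def using assms gsub_Domain[OF grel_glin] gsub_fibre[OF grel_glin]
  by (intro exI[of _ "Domain Ga"] exI[of _ "Da `` {\<zero>[M]}"]) (auto simp: grel_def)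
qed

lemma geq_sym:
 assumes "glin S M N Ga" "glin S M N Da" "geq S M N Ga Da"
 shows "geq S M N Da Ga"
proof -
 obtain M3 N3 where *: "gsub S M M3" "fd M (esc S M) (carrier M) M3"
   "gsub S N N3" "fd N (esc S N) N3 {\<zero>[N]}" "M3 <= Domain Ga \<inter> Domain Da"
   "\<forall>x\<in>M3. \<forall>y z. (x, y) \<in> Ga --> (x, z) \<in> Da --> y \<ominus>[N] z \<in> N3" using assms(3) unfolding geq_def by blast
 have "z \<ominus>[N] y \<in> N3" if "x \<in> M3" "(x, y) \<in> Ga" "(x, z) \<in> Da" for x y z
 proof -
  have "\<ominus>[N] (y \<ominus>[N] z) \<in> N3" using *(6) that N.gsubD(6)[OF *(3)] by blast
  moreover have "\<ominus>[N] (y \<ominus>[N] z) = z \<ominus>[N] y"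
   using glinD(2)[OF assms(1) that(2)] glinD(2)[OF assms(2) that(3)]
   by (simp add: N.M.minus_eq N.M.minus_add N.M.a_comm)
  ultimately show ?thesis by simp
 qed
 then show ?thesis unfolding geq_def using * by (intro exI[of _ M3] exI[of _ N3]) auto
qed

lemma geq_trans:
 assumes Ga: "glin S M N Ga" "glin S M N Da" "glin S M N \<Theta>" and "geq S M N Ga Da" "geq S M N Da \<Theta>"
 shows "geq S M N Ga \<Theta>"
proof -
 obtain M3 N3 where *: "gsub S M M3" "fd M (esc S M) (carrier M) M3"
   "gsub S N N3" "fd N (esc S N) N3 {\<zero>[N]}" "M3 <= Domain Ga \<inter> Domain Da"
   "\<forall>x\<in>M3. \<forall>y z. (x, y) \<in> Ga --> (x, z) \<in> Da --> y \<ominus>[N] z \<in> N3" using assms(4) unfolding geq_def by blast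
 obtain M4 N4 where **: "gsub S M M4" "fd M (esc S M) (carrier M) M4"
   "gsub S N N4" "fd N (esc S N) N4 {\<zero>[N]}" "M4 <= Domain Da \<inter> Domain \<Theta>"
   "\<forall>x\<in>M4. \<forall>y z. (x, y) \<in> Da --> (x, z) \<in> \<Theta> --> y \<ominus>[N] z \<in> N4" using assms(5) unfolding geq_def by blast
 have "y \<ominus>[N] z \<in> N3 <+>[N] N4" if x: "x \<in> M3 \<inter> M4" and y: "(x, y) \<in> Ga" and z: "(x, z) \<in> \<Theta>" for x y z
 proof -
  obtain w where w: "(x, w) \<in> Da" using x *(5) by blast
  have c: "y \<in> carrier N" "z \<in> carrier N" "w \<in> carrier N"
   using glinD(2)[OF Ga(1) y] glinD(2)[OF Ga(3) z] glinD(2)[OF Ga(2) w] .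
  have "y \<ominus>[N] w \<in> N3" "w \<ominus>[N] z \<in> N4" using x y z w *(6) **(6) by blast+
  moreover have "y \<ominus>[N] z = (y \<ominus>[N] w) \<oplus>[N] (w \<ominus>[N] z)"
   using c by (simp add: N.M.minus_eq N.M.a_assoc N.M.r_neg1)
  ultimately show ?thesis unfolding N.set_add_iff by blast
 qed
 moreover have "fd M (esc S M) (carrier M) (M3 \<inter> M4)"
  using M.fd_carrier_Int[OF *(2) **(2) M.gsub_ksub[OF *(1)]] .
 moreover have "fd N (esc S N) (N3 <+>[N] N4) {\<zero>[N]}"
  using N.fd_set_add[OF N.gsub_ksub[OF *(3)] N.gsub_ksub[OF **(3)] *(4) **(4)] .
 ultimately show ?thesis unfolding geq_def
  using M.gsub_Int[OF *(1) **(1)] N.gsub_set_add[OF *(3) **(3)] *(5) **(5)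
  by (intro exI[of _ "M3 \<inter> M4"] exI[of _ "N3 <+>[N] N4"]) auto
qed

lemma rsum_mem: "(x, w) \<in> rsum N Ga Da \<longleftrightarrow> (\<exists>y z. (x, y) \<in> Ga \<and> (x, z) \<in> Da \<and> w = y \<oplus>[N] z)"
 by (auto simp: rsum_def)

lemma rsum_fibre: "rsum N Ga Da `` {w} = Ga `` {w} <+>[N] Da `` {w}"
 by (rule Set.set_eqI) (simp only: Image_singleton_iff rsum_mem N.set_add_iff, blast)

lemma glin_rsum:
 assumes Ga: "glin S M N Ga" and Da: "glin S M N Da"
 shows "glin S M N (rsum N Ga Da)"
 unfolding glin_def rsum_mem
proof (intro conjI ballI allI impI)
 show "rsum N Ga Da <= carrier M \<times> carrier N"
  using glinD(1,2)[OF Ga] glinD(1,2)[OF Da] by (auto simp: rsum_def)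
 show "\<exists>y z. (\<zero>[M], y) \<in> Ga \<and> (\<zero>[M], z) \<in> Da \<and> \<zero>[N] = y \<oplus>[N] z"
  using glinD(3)[OF Ga] glinD(3)[OF Da] by (intro exI[of _ "\<zero>[N]"]) simp
next
 fix x w x' w' assume "\<exists>y z. (x, y) \<in> Ga \<and> (x, z) \<in> Da \<and> w = y \<oplus>[N] z"
  "\<exists>y z. (x', y) \<in> Ga \<and> (x', z) \<in> Da \<and> w' = y \<oplus>[N] z"
 then obtain y z y' z' where *: "(x, y) \<in> Ga" "(x, z) \<in> Da" "w = y \<oplus>[N] z"
  "(x', y') \<in> Ga" "(x', z') \<in> Da" "w' = y' \<oplus>[N] z'" by blast
 have "w \<oplus>[N] w' = (y \<oplus>[N] y') \<oplus>[N] (z \<oplus>[N] z')"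
  using * glinD(2)[OF Ga *(1)] glinD(2)[OF Ga *(4)] glinD(2)[OF Da *(2)] glinD(2)[OF Da *(5)]
  by (simp add: N.M.a_ac)
 then show "\<exists>y z. (x \<oplus>[M] x', y) \<in> Ga \<and> (x \<oplus>[M] x', z) \<in> Da \<and> w \<oplus>[N] w' = y \<oplus>[N] z"
  using glinD(4)[OF Ga *(1,4)] glinD(4)[OF Da *(2,5)] by blast
next
 fix r x w assume r: "r \<in> Rc S" and "\<exists>y z. (x, y) \<in> Ga \<and> (x, z) \<in> Da \<and> w = y \<oplus>[N] z"
 then obtain y z where *: "(x, y) \<in> Ga" "(x, z) \<in> Da" "w = y \<oplus>[N] z" by blast
 have "r \<odot>[N] w = r \<odot>[N] y \<oplus>[N] r \<odot>[N] z"
  using * r glinD(2)[OF Ga *(1)] glinD(2)[OF Da *(2)] by (simp add: N.smult_r_distr)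
 then show "\<exists>y z. (r \<odot>[M] x, y) \<in> Ga \<and> (r \<odot>[M] x, z) \<in> Da \<and> r \<odot>[N] w = y \<oplus>[N] z"
  using glinD(5)[OF Ga r *(1)] glinD(5)[OF Da r *(2)] by blast
next
 fix g x w assume "\<exists>y z. (x, y) \<in> Ga \<and> (x, z) \<in> Da \<and> w = y \<oplus>[N] z"
 then obtain y z where *: "(x, y) \<in> Ga" "(x, z) \<in> Da" "w = y \<oplus>[N] z" by blast
 have "hc S N w g = hc S N y g \<oplus>[N] hc S N z g"
  using * glinD(2)[OF Ga *(1)] glinD(2)[OF Da *(2)] by (simp add: N.hc_add)
 then show "\<exists>y z. (hc S M x g, y) \<in> Ga \<and> (hc S M x g, z) \<in> Da \<and> hc S N w g = y \<oplus>[N] z"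
  using glinD(6)[OF Ga *(1)] glinD(6)[OF Da *(2)] by blast
qed

lemma grel_rsum:
 assumes Ga: "grel S M N Ga" and Da: "grel S M N Da"
 shows "grel S M N (rsum N Ga Da)"
proof -
 note g = grel_glin[OF Ga] grel_glin[OF Da]
 have "Domain (rsum N Ga Da) = Domain Ga \<inter> Domain Da" by (auto simp: rsum_def)
 moreover have "rsum N Ga Da `` {\<zero>[M]} = Ga `` {\<zero>[M]} <+>[N] Da `` {\<zero>[M]}" by (rule rsum_fibre)
 moreover have "fd N (esc S N) (Ga `` {\<zero>[M]} <+>[N] Da `` {\<zero>[M]}) {\<zero>[N]}"
  using N.fd_set_add[OF N.gsub_ksub[OF gsub_fibre[OF g(1)]] N.gsub_ksub[OF gsub_fibre[OF g(2)]]] assms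
  by (simp add: grel_def)
 moreover have "fd M (esc S M) (carrier M) (Domain Ga \<inter> Domain Da)"
  using M.fd_carrier_Int[OF _ _ M.gsub_ksub[OF gsub_Domain[OF g(1)]]] assms by (simp add: grel_def)
 ultimately show ?thesis using glin_rsum[OF g] by (simp add: grel_def)
qed

lemma grel_restrict:
 assumes Ga: "grel S M N Ga" and V: "gsub S M V" "fd M (esc S M) (carrier M) V" "V <= Domain Ga"
 shows "grel S M N (Ga \<inter> V \<times> UNIV)"
proof -
 note g = grel_glin[OF Ga]
 have "glin S M N (Ga \<inter> V \<times> UNIV)"
  unfolding glin_def using glinD[OF g] M.gsubD[OF V(1)] by auto
 moreover have "Domain (Ga \<inter> V \<times> UNIV) = V" using V(3) by auto
 moreover have "(Ga \<inter> V \<times> UNIV) `` {\<zero>[M]} <= Ga `` {\<zero>[M]}" by auto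
 ultimately show ?thesis using Ga V fd_mono unfolding grel_def by (metis subset_refl)
qed

text \<open>After restriction to \<open>M\<^sub>3\<close>, both relations are contained in the one
  obtained from \<open>Ga\<close> by blurring its values by \<open>N\<^sub>3\<close>.\<close>

lemma geq_zigzag:
 assumes Ga: "grel S M N Ga" and Da: "grel S M N Da" and "geq S M N Ga Da"
 obtains Ga' Da' \<Theta> where "grel S M N Ga'" "grel S M N Da'" "grel S M N \<Theta>" "Ga' <= Ga" "Da' <= Da" "Ga' <= \<Theta>" "Da' <= \<Theta>"
proof -
 obtain M3 N3 where *: "gsub S M M3" "fd M (esc S M) (carrier M) M3"
   "gsub S N N3" "fd N (esc S N) N3 {\<zero>[N]}" "M3 <= Domain Ga \<inter> Domain Da"
   "\<forall>x\<in>M3. \<forall>y z. (x, y) \<in> Ga --> (x, z) \<in> Da --> y \<ominus>[N] z \<in> N3" using assms(3) unfolding geq_def by blast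
 let ?Ga = "Ga \<inter> M3 \<times> UNIV" and ?Da = "Da \<inter> M3 \<times> UNIV"
 let ?\<Theta> = "rsum N ?Ga (M3 \<times> N3)"
 have 1: "grel S M N ?Ga" "grel S M N ?Da" using grel_restrict[OF Ga] grel_restrict[OF Da] * by auto
 have "glin S M N (M3 \<times> N3)"
  unfolding glin_def using M.gsubD[OF *(1)] N.gsubD[OF *(3)] by auto
 moreover have "Domain (M3 \<times> N3) = M3" "(M3 \<times> N3) `` {\<zero>[M]} = N3"
  using M.gsubD(2)[OF *(1)] N.gsubD(2)[OF *(3)] by auto
 ultimately have "grel S M N (M3 \<times> N3)" using * by (simp add: grel_def)
 then have 2: "grel S M N ?\<Theta>" using grel_rsum 1 by blast
 have 3: "?Ga <= ?\<Theta>"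
 proof clarify
  fix x y assume a: "(x, y) \<in> Ga" "x \<in> M3"
  moreover have "y \<in> carrier N" using glinD(2)[OF grel_glin[OF Ga] a(1)] .
  ultimately show "(x, y) \<in> ?\<Theta>" unfolding rsum_mem using N.gsubD(2)[OF *(3)]
   by (intro exI[of _ y] exI[of _ "\<zero>[N]"]) auto
 qed
 have 4: "?Da <= ?\<Theta>"
 proof clarify
  fix x z assume a: "(x, z) \<in> Da" "x \<in> M3"
  obtain y where y: "(x, y) \<in> Ga" using a *(5) by blast
  have c: "y \<in> carrier N" "z \<in> carrier N" using glinD(2)[OF grel_glin[OF Ga] y] glinD(2)[OF grel_glin[OF Da] a(1)] .
  have "\<ominus>[N] (y \<ominus>[N] z) \<in> N3" using *(6) a y N.gsubD(6)[OF *(3)] by blast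
  moreover have "z = y \<oplus>[N] (\<ominus>[N] (y \<ominus>[N] z))"
   using c by (simp add: N.M.minus_eq N.M.minus_add N.M.r_neg2)
  ultimately show "(x, z) \<in> ?\<Theta>" unfolding rsum_mem using a y by blast
 qed
 show thesis by (rule that[OF 1 2 _ _ 3 4]) auto
qed

text \<open>Along the zigzag of inclusions a monotone \<open>F\<close> yields inclusions again.
  Well-definedness of composition, addition, restriction, extension and transport of morphisms all
  comes from here.\<close>

lemma geq_cong:
 assumes Ga: "grel S M N Ga" and Da: "grel S M N Da" and "geq S M N Ga Da"
  and F: "\<And>Ga. grel S M N Ga ==> grel S' M' N' (F Ga)" and mono: "\<And>Ga Da. Ga <= Da ==> F Ga <= F Da"
  and M': "gmod2 S' M' N'"
 shows "geq S' M' N' (F Ga) (F Da)"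
proof -
 interpret M': gmod2 S' M' N' by (rule M')
 obtain Ga' Da' \<Theta> where *: "grel S M N Ga'" "grel S M N Da'" "grel S M N \<Theta>" "Ga' <= Ga" "Da' <= Da" "Ga' <= \<Theta>" "Da' <= \<Theta>"
  using geq_zigzag[OF assms(1-3)] .
 note f = F[OF Ga] F[OF Da] F[OF *(1)] F[OF *(2)] F[OF *(3)]
 note l = f[THEN M'.grel_glin]
 have "geq S' M' N' (F Ga') (F Ga)" "geq S' M' N' (F Ga') (F \<Theta>)" "geq S' M' N' (F Da') (F \<Theta>)" "geq S' M' N' (F Da') (F Da)"
  using M'.geq_sub f mono * by simp_all
 then show ?thesis using M'.geq_sym M'.geq_trans l by meson
qed

end

text \<open>The domain of the composite is the preimage of \<open>Domain Da\<close>, and its fibre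
  over zero is the image under \<open>Da\<close> of the fibre of \<open>Ga\<close>; both are handled
  by transporting \<open>fd\<close> along a linear relation and transitivity.\<close>

lemma grel_comp:
 assumes "gmod S M" "gmod S N" "gmod S P" "grel S M N Ga" "grel S N P Da"
 shows "grel S M P (Ga O Da)"
proof -
 interpret M: gmod S M by fact
 interpret N: gmod S N by fact
 interpret P: gmod S P by fact
 interpret MN: gmod2 S M N by unfold_locales
 interpret NP: gmod2 S N P by unfold_locales
 have g: "glin S M N Ga" "glin S N P Da" using assms by (auto simp: grel_def)
 have d: "Domain (Ga O Da) = Ga\<inverse> `` Domain Da" by auto
 have "fd M (esc S M) (Ga\<inverse> `` carrier N) (Ga\<inverse> `` Domain Da)"
  using fd_vimage[OF M.kspace_axioms N.kspace_axioms MN.glin_klin[OF g(1)]] assms(5) by (simp add: grel_def)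
 moreover have "Ga\<inverse> `` carrier N = Domain Ga" using g(1) by (auto simp: glin_def)
 ultimately have 1: "fd M (esc S M) (carrier M) (Domain (Ga O Da))"
  using fd_trans assms(4) unfolding d grel_def by metis
 have f: "(Ga O Da) `` {\<zero>[M]} = Da `` (Ga `` {\<zero>[M]})" by auto
 have "fd P (esc S P) (Da `` (Ga `` {\<zero>[M]})) (Da `` {\<zero>[N]})"
  using fd_image[OF N.kspace_axioms P.kspace_axioms NP.glin_klin[OF g(2)]] assms(4) by (simp add: grel_def)
 then have "fd P (esc S P) ((Ga O Da) `` {\<zero>[M]}) {\<zero>[P]}"
  using fd_trans assms(5) unfolding f grel_def by metis
 then show ?thesis using 1 glin_comp[OF g] by (simp add: grel_def)
qed

lemma (in gmod) grel_Id: "grel S M M (Id_on (carrier M))"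
proof -
 have "Id_on (carrier M) `` {\<zero>[M]} = {\<zero>[M]}" by auto
 then show ?thesis by (auto simp: grel_def glin_def intro!: fd_base)
qed

section \<open>The Serre quotient is a category\<close>

definition rel_of :: "'u qrep => ('u \<times> 'u) set" where
 "rel_of r = {(x, y). x \<in> fst r \<and> y \<in> snd (snd r) x}"

definition rep_of :: "('g, 'r, 'u) gmodule => ('u \<times> 'u) set => 'u qrep" where
 "rep_of M Ga = (Domain Ga, Ga `` {\<zero>[M]}, %x. Ga `` {x})"

definition qcl :: "('k, 'g, 'r) graded_algebra => ('g, 'r, 'u) gmodule => ('g, 'r, 'u) gmodule => ('u \<times> 'u) set => 'u qrep set" where
 "qcl S M N Ga = q_rel S M N `` {rep_of M Ga}"

lemma rel_of_rep_of [simp]: "rel_of (rep_of M Ga) = Ga"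
 by (auto simp: rel_of_def rep_of_def)

text \<open>Gabriel's composite is composition of relations on the nose, not merely up to
  equivalence; associativity is inherited from relations.\<close>

lemma rel_of_comp: "rel_of (q_comp g f) = rel_of f O rel_of g"
 by (auto simp: rel_of_def q_comp_def split: prod.splits)

locale gmod2u = gmod2 S M N
 for S :: "('k::field, 'g, 'r) graded_algebra" and M N :: "('g, 'r, 'u) gmodule"
begin

text \<open>Differences of values at one point lie in the fibre over zero. Hence a graded relation
  is the same as a map from its domain to cosets of that fibre.\<close>

lemma fibre_coset:
 assumes "glin S M N Ga" "(x, y) \<in> Ga"
 shows "Ga `` {x} = Ga `` {\<zero>[M]} +>[N] y"
proof (intro Set.set_eqI iffI)
 fix z assume "z \<in> Ga `` {x}"
 then have z: "(x, z) \<in> Ga" by simp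
 have "(x \<ominus>[M] x, z \<ominus>[N] y) \<in> Ga" using glinD(7)[OF assms(1) z assms(2)] .
 then have "z \<ominus>[N] y \<in> Ga `` {\<zero>[M]}" using glinD(1)[OF assms] by (simp add: M.M.minus_eq M.M.r_neg)
 then show "z \<in> Ga `` {\<zero>[M]} +>[N] y"
  using N.coset_mem_iff[OF gsub_fibre[OF assms(1)] glinD(2)[OF assms]] glinD(2)[OF assms(1) z] by simp
next
 fix z assume "z \<in> Ga `` {\<zero>[M]} +>[N] y"
 then obtain v where v: "(\<zero>[M], v) \<in> Ga" "z = v \<oplus>[N] y" unfolding N.coset_mem by blast
 have "(\<zero>[M] \<oplus>[M] x, v \<oplus>[N] y) \<in> Ga" using glinD(4)[OF assms(1) v(1) assms(2)] .
 then show "z \<in> Ga `` {x}" using v glinD(1)[OF assms] by simp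
qed

lemma q_index_iff: "(V, W) \<in> q_index S M N \<longleftrightarrow> gsub S M V \<and> fd M (esc S M) (carrier M) V \<and>
  gsub S N W \<and> fd N (esc S N) W {\<zero>[N]}"
 unfolding q_index_def using M.graded_submodule_iff N.graded_submodule_iff M.quot_tor_iff N.sub_tor_iff by auto

text \<open>The two submodules of a representative can be recovered from its relation. The function
  \<open>f\<close> is recovered on \<open>V\<close> only; its values elsewhere are arbitrary, and
  \<open>q_rel\<close> ignores them.\<close>

lemma q_reps_iff: "(V, W, f) \<in> q_reps S M N \<longleftrightarrow> grel S M N (rel_of (V, W, f)) \<and>
  V = Domain (rel_of (V, W, f)) \<and> W = rel_of (V, W, f) `` {\<zero>[M]}"
proof
 assume "(V, W, f) \<in> q_reps S M N"
 then have V: "gsub S M V" "fd M (esc S M) (carrier M) V" and W: "gsub S N W" "fd N (esc S N) W {\<zero>[N]}"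
  and f: "f \<in> gr_hom S (sub_gmod M V) (quot_gmod N W)"
  using q_index_iff by (auto simp: q_reps_def)
 let ?Q = "quot_gmod N W"
 note V' = M.gsubD[OF V(1)] and W' = N.gsubD[OF W(1)]
 interpret SM: gmod S "sub_gmod M V" using M.sub_graded(1)[OF V(1)] by unfold_locales
 interpret Q: gmod S ?Q using N.quot_graded(1)[OF W(1)] by unfold_locales
 have fQ: "f x \<in> carrier ?Q" if "x \<in> V" for x using f that unfolding gr_hom_def by auto
 have fc: "\<exists>y\<in>carrier N. f x = W +>[N] y" if "x \<in> V" for x
  using fQ[OF that] unfolding N.quot_gmod_simps by blast
 have fadd: "f (x \<oplus>[M] y) = f x <+>[N] f y" if "x \<in> V" "y \<in> V" for x y
  using f that unfolding gr_hom_def by auto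
 have fsm: "f (r \<odot>[M] x) = (\<Union>z\<in>f x. W +>[N] (r \<odot>[N] z))" if "r \<in> Rc S" "x \<in> V" for r x
  using f that unfolding gr_hom_def by auto
 have fhom: "f x \<in> gm_comp ?Q g" if "g \<in> Gc S" "x \<in> gm_comp (sub_gmod M V) g" for g x
  using f that unfolding gr_hom_def by auto
 have memf: "y \<in> carrier N \<and> f x = W +>[N] y" if "x \<in> V" "y \<in> f x" for x y
  using fc[OF that(1)] that(2) N.coset_eqI[OF W(1)] N.coset_mem_iff[OF W(1)] by blast
 have f0: "f \<zero>[M] = W"
 proof -
  have "f \<zero>[M] \<oplus>[?Q] f \<zero>[M] = f \<zero>[M]" using fadd[OF V'(2) V'(2)] by simp
  then show ?thesis using Q.M.add.r_cancel_one'[OF fQ[OF V'(2)] fQ[OF V'(2)]] by simp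
 qed
 let ?Ga = "rel_of (V, W, f)"
 have mem: "(x, y) \<in> ?Ga \<longleftrightarrow> x \<in> V \<and> y \<in> f x" for x y by (simp add: rel_of_def)
 have "glin S M N ?Ga"
  unfolding glin_def mem
 proof (intro conjI ballI allI impI)
  show "?Ga <= carrier M \<times> carrier N" using V' memf by (auto simp: rel_of_def)
  show "\<zero>[M] \<in> V" "\<zero>[N] \<in> f \<zero>[M]" using V'(2) W'(2) f0 by auto
 next
  fix x y x' y' assume "x \<in> V \<and> y \<in> f x" "x' \<in> V \<and> y' \<in> f x'"
  then show "x \<oplus>[M] x' \<in> V" "y \<oplus>[N] y' \<in> f (x \<oplus>[M] x')" using V'(3) fadd by (auto simp: N.set_add_iff)
 next
  fix r x y assume a: "r \<in> Rc S" "x \<in> V \<and> y \<in> f x"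
  then show "r \<odot>[M] x \<in> V" using V'(4) by blast
  have "r \<odot>[N] y \<in> W +>[N] (r \<odot>[N] y)" using memf a N.coset_self[OF W(1)] by auto
  then show "r \<odot>[N] y \<in> f (r \<odot>[M] x)" using fsm a by auto
 next
  fix g x y assume a: "g \<in> Gc S" "x \<in> V \<and> y \<in> f x"
  then have x: "x \<in> V" and y: "y \<in> f x" by auto
  show "hc S M x g \<in> V" using V'(5) x by blast
  have yN: "y \<in> carrier N" "f x = W +>[N] y" using memf x y by auto
  have "hc S ?Q (f x) g = f (hc S (sub_gmod M V) x g)"
   by (rule graded_map_hc[OF SM.gmod_axioms Q.gmod_axioms]) (use x fQ fadd fhom in auto)
  then have "f (hc S M x g) = W +>[N] hc S N y g"
   using M.sub_graded(2)[OF V(1) x] N.quot_graded(2)[OF W(1) yN(1)] yN(2) by simp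
  then show "hc S N y g \<in> f (hc S M x g)" using N.coset_self[OF W(1)] yN by simp
 qed
 moreover have "Domain ?Ga = V"
  using fc N.coset_self[OF W(1)] by (fastforce simp: rel_of_def)
 moreover have "?Ga `` {\<zero>[M]} = W" using f0 V'(2) by (auto simp: rel_of_def)
 ultimately show "grel S M N ?Ga \<and> V = Domain ?Ga \<and> W = ?Ga `` {\<zero>[M]}" using V W by (simp add: grel_def)
next
 let ?Ga = "rel_of (V, W, f)"
 assume a: "grel S M N ?Ga \<and> V = Domain ?Ga \<and> W = ?Ga `` {\<zero>[M]}"
 then have g: "glin S M N ?Ga" and VD: "Domain ?Ga = V" and WD: "?Ga `` {\<zero>[M]} = W" by (auto simp: grel_def)
 have V: "gsub S M V" using gsub_Domain[OF g] VD by simp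
 have W: "gsub S N W" using gsub_fibre[OF g] WD by simp
 let ?Q = "quot_gmod N W"
 have fx: "y \<in> carrier N \<and> f x = W +>[N] y" if "(x, y) \<in> ?Ga" for x y
 proof -
  have "f x = ?Ga `` {x}" using that by (auto simp: rel_of_def)
  then show ?thesis using fibre_coset[OF g that] WD glinD(2)[OF g that] by simp
 qed
 have "f \<in> gr_hom S (sub_gmod M V) ?Q"
  unfolding gr_hom_def
 proof (intro CollectI conjI ballI)
  show "f \<in> carrier (sub_gmod M V) \<rightarrow> carrier ?Q"
  proof
   fix x assume "x \<in> carrier (sub_gmod M V)"
   then obtain y where "(x, y) \<in> ?Ga" using VD by auto
   then show "f x \<in> carrier ?Q" using fx by auto
  qed
 next
  fix x x' assume "x \<in> carrier (sub_gmod M V)" "x' \<in> carrier (sub_gmod M V)"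
  then have "x \<in> Domain ?Ga" "x' \<in> Domain ?Ga" using VD by auto
  then obtain y y' where y: "(x, y) \<in> ?Ga" "(x', y') \<in> ?Ga" by (elim DomainE)
  show "f (x \<oplus>[sub_gmod M V] x') = f x \<oplus>[?Q] f x'"
   using fx[OF y(1)] fx[OF y(2)] fx[OF glinD(4)[OF g y]] N.coset_sum[OF W W subset_refl] by simp
 next
  fix r x assume r: "r \<in> Rc S" and "x \<in> carrier (sub_gmod M V)"
  then obtain y where y: "(x, y) \<in> ?Ga" using VD by auto
  show "f (r \<odot>[sub_gmod M V] x) = r \<odot>[?Q] f x"
   using fx[OF y] fx[OF glinD(5)[OF g r y]] N.coset_smult[OF W r] by simp
 next
  fix h x assume h: "h \<in> Gc S" and "x \<in> gm_comp (sub_gmod M V) h"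
  then have x: "x \<in> gm_comp M h" "x \<in> V" by auto
  then obtain y where y: "(x, y) \<in> ?Ga" using VD by auto
  \<comment> \<open>A homogeneous \<open>x\<close> has a homogeneous value of the same degree, since
    the relation is closed under components.\<close>
  have "(x, hc S N y h) \<in> ?Ga" using glinD(6)[OF g y, of h] M.hc_of_comp[OF h x(1)] by simp
  then show "f x \<in> gm_comp ?Q h" using fx[of x "hc S N y h"] N.hc_comp[of y h] fx[OF y] h by auto
 qed
 moreover have "(V, W) \<in> q_index S M N"
  unfolding q_index_iff using V W a VD WD by (simp add: grel_def)
 ultimately show "(V, W, f) \<in> q_reps S M N" by (simp add: q_reps_def)
qed

lemma q_reps_grel: "r \<in> q_reps S M N ==> grel S M N (rel_of r)"
 using q_reps_iff by (cases r) auto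

lemma rep_of_in: "grel S M N Ga ==> rep_of M Ga \<in> q_reps S M N"
 using rel_of_rep_of[of M Ga] unfolding rep_of_def q_reps_iff by simp

lemma q_rel_iff:
 assumes r: "r \<in> q_reps S M N" and s: "s \<in> q_reps S M N"
 shows "(r, s) \<in> q_rel S M N \<longleftrightarrow> geq S M N (rel_of r) (rel_of s)"
proof -
 obtain V1 W1 f1 V2 W2 f2 where rs: "r = (V1, W1, f1)" "s = (V2, W2, f2)" by (cases r, cases s) blast
 note r' = r[unfolded rs q_reps_iff] and s' = s[unfolded rs q_reps_iff]
 let ?Ga = "rel_of r" and ?Da = "rel_of s"
 have g: "glin S M N ?Ga" "glin S M N ?Da" using r' s' rs by (auto simp: grel_def)
 have D: "Domain ?Ga = V1" "Domain ?Da = V2" "?Ga `` {\<zero>[M]} = W1" "?Da `` {\<zero>[M]} = W2" using r' s' rs by auto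
 have W: "gsub S N W1" "gsub S N W2" "fd N (esc S N) W1 {\<zero>[N]}" "fd N (esc S N) W2 {\<zero>[N]}"
  using gsub_fibre[OF g(1)] gsub_fibre[OF g(2)] r' s' D rs by (auto simp: grel_def)
 have mem: "(x, y) \<in> ?Ga \<longleftrightarrow> x \<in> V1 \<and> y \<in> f1 x" "(x, y) \<in> ?Da \<longleftrightarrow> x \<in> V2 \<and> y \<in> f2 x" for x y
  by (auto simp: rs rel_of_def)
 have f1: "y \<in> carrier N \<and> f1 x = W1 +>[N] y" if "(x, y) \<in> ?Ga" for x y
  using fibre_coset[OF g(1) that] glinD(2)[OF g(1) that] that mem D by auto
 have f2: "y \<in> carrier N \<and> f2 x = W2 +>[N] y" if "(x, y) \<in> ?Da" for x y
  using fibre_coset[OF g(2) that] glinD(2)[OF g(2) that] that mem D by auto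
 show ?thesis
 proof
  assume "(r, s) \<in> q_rel S M N"
  then obtain M3 N3 where 3: "(M3, N3) \<in> q_index S M N" "M3 <= V1 \<inter> V2" "W1 \<union> W2 <= N3"
   "\<forall>x\<in>M3. N3 <+>[N] f1 x = N3 <+>[N] f2 x" unfolding q_rel_def rs by blast
  have N3: "gsub S N N3" using 3(1) q_index_iff by blast
  have "y \<ominus>[N] z \<in> N3" if x: "x \<in> M3" and y: "(x, y) \<in> ?Ga" and z: "(x, z) \<in> ?Da" for x y z
  proof -
   have "N3 <+>[N] f1 x = N3 +>[N] y" "N3 <+>[N] f2 x = N3 +>[N] z"
    using f1[OF y] f2[OF z] N.coset_sum[OF W(1) N3 _ _, of "\<zero>[N]" y] N.coset_sum[OF W(2) N3 _ _, of "\<zero>[N]" z]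
     N.coset_zero[OF N3] 3(3) by auto
   then show ?thesis using 3(4) x N.coset_eq[OF N3] f1[OF y] f2[OF z] by metis
  qed
  then show "geq S M N ?Ga ?Da" unfolding geq_def
   using 3 D unfolding q_index_iff by (intro exI[of _ M3] exI[of _ N3]) auto
 next
  assume "geq S M N ?Ga ?Da"
  then obtain M3 N3 where *: "gsub S M M3" "fd M (esc S M) (carrier M) M3"
   "gsub S N N3" "fd N (esc S N) N3 {\<zero>[N]}" "M3 <= V1 \<inter> V2"
   "\<forall>x\<in>M3. \<forall>y z. (x, y) \<in> ?Ga --> (x, z) \<in> ?Da --> y \<ominus>[N] z \<in> N3" unfolding geq_def D by blast
  \<comment> \<open>\<open>q_rel\<close> asks for a submodule that contains \<open>W1\<close> and
    \<open>W2\<close>, whereas the one provided by \<open>geq\<close> need not; enlarging it keeps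
    it torsion.\<close>
  let ?N = "N3 <+>[N] (W1 <+>[N] W2)"
  note k = N.gsub_ksub
  have W12: "gsub S N (W1 <+>[N] W2)" using N.gsub_set_add W by blast
  have N4: "gsub S N ?N" using N.gsub_set_add *(3) W12 by blast
  have "fd N (esc S N) ?N {\<zero>[N]}"
   using N.fd_set_add[OF k[OF *(3)] k[OF W12] *(4) N.fd_set_add[OF k[OF W(1)] k[OF W(2)] W(3,4)]] .
  then have i: "(M3, ?N) \<in> q_index S M N" unfolding q_index_iff using * N4 by blast
  have sub: "N3 <= ?N" "W1 <= ?N" "W2 <= ?N"
   using N.subset_set_add[OF k[OF *(3)] k[OF W12]] N.subset_set_add[OF k[OF W(1)] k[OF W(2)]] by auto
  have "?N <+>[N] f1 x = ?N <+>[N] f2 x" if x: "x \<in> M3" for x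
  proof -
   obtain y z where yz: "(x, y) \<in> ?Ga" "(x, z) \<in> ?Da" using x *(5) D by blast
   have "y \<ominus>[N] z \<in> ?N" using *(6) x yz sub by blast
   then have "?N +>[N] y = ?N +>[N] z" using N.coset_eq[OF N4] f1[OF yz(1)] f2[OF yz(2)] by blast
   moreover have "?N <+>[N] f1 x = ?N +>[N] y" "?N <+>[N] f2 x = ?N +>[N] z"
    using f1[OF yz(1)] f2[OF yz(2)] N.coset_sum[OF W(1) N4 sub(2), of "\<zero>[N]" y]
     N.coset_sum[OF W(2) N4 sub(3), of "\<zero>[N]" z] N.coset_zero[OF N4] by auto
   ultimately show ?thesis by simp
  qed
  then show "(r, s) \<in> q_rel S M N" unfolding q_rel_def using i *(5) sub r s rs by blast
 qed
qed

lemma qcl_mem: "grel S M N Ga ==> r \<in> qcl S M N Ga \<longleftrightarrow> r \<in> q_reps S M N \<and> geq S M N Ga (rel_of r)"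
proof -
 assume Ga: "grel S M N Ga"
 have "(rep_of M Ga, r) \<in> q_rel S M N ==> r \<in> q_reps S M N" by (auto simp: q_rel_def)
 then show ?thesis using q_rel_iff[OF rep_of_in[OF Ga], of r] by (auto simp: qcl_def)
qed

lemma geq_refl: "grel S M N Ga ==> geq S M N Ga Ga"
 using geq_sub by blast

lemma qcl_eq_iff:
 assumes Ga: "grel S M N Ga" and Da: "grel S M N Da"
 shows "qcl S M N Ga = qcl S M N Da \<longleftrightarrow> geq S M N Ga Da"
proof
 assume "qcl S M N Ga = qcl S M N Da"
 moreover have "rep_of M Da \<in> qcl S M N Da" using qcl_mem[OF Da] rep_of_in[OF Da] geq_refl[OF Da] by simp
 ultimately show "geq S M N Ga Da" using qcl_mem[OF Ga, of "rep_of M Da"] by simp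
next
 note g = grel_glin[OF Ga] grel_glin[OF Da]
 assume *: "geq S M N Ga Da"
 have "geq S M N Ga (rel_of r) \<longleftrightarrow> geq S M N Da (rel_of r)" if "r \<in> q_reps S M N" for r
  using geq_trans geq_sym g * grel_glin[OF q_reps_grel[OF that]] by blast
 then show "qcl S M N Ga = qcl S M N Da" using qcl_mem[OF Ga] qcl_mem[OF Da] by blast
qed

lemma q_rel_class: "r \<in> q_reps S M N ==> q_rel S M N `` {r} = qcl S M N (rel_of r)"
proof (intro Set.set_eqI)
 fix s assume r: "r \<in> q_reps S M N"
 have "s \<in> q_rel S M N `` {r} \<longleftrightarrow> s \<in> q_reps S M N \<and> (r, s) \<in> q_rel S M N" by (auto simp: q_rel_def)
 then show "s \<in> q_rel S M N `` {r} \<longleftrightarrow> s \<in> qcl S M N (rel_of r)"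
  using q_rel_iff[OF r] qcl_mem[OF q_reps_grel[OF r]] by blast
qed

lemma Hom_serre: "Hom (serre_quotient U S) M N = {qcl S M N Ga |Ga. grel S M N Ga}"
proof -
 have "q_reps S M N // q_rel S M N = (%r. q_rel S M N `` {r}) ` q_reps S M N" by (auto simp: quotient_def)
 also have "\<dots> = {qcl S M N Ga |Ga. grel S M N Ga}"
 proof (intro Set.set_eqI iffI)
  fix C assume "C \<in> (%r. q_rel S M N `` {r}) ` q_reps S M N"
  then obtain r where r: "r \<in> q_reps S M N" "C = q_rel S M N `` {r}" by blast
  then show "C \<in> {qcl S M N Ga |Ga. grel S M N Ga}" using q_rel_class[OF r(1)] q_reps_grel[OF r(1)] by blast
 next
  fix C assume "C \<in> {qcl S M N Ga |Ga. grel S M N Ga}"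
  then obtain Ga where "grel S M N Ga" "C = qcl S M N Ga" by blast
  then show "C \<in> (%r. q_rel S M N `` {r}) ` q_reps S M N" using rep_of_in unfolding qcl_def by blast
 qed
 finally show ?thesis by (simp add: serre_quotient_def)
qed

lemma rel_of_add: "rel_of (q_add N r s) = rsum N (rel_of r) (rel_of s)"
 by (auto simp: rel_of_def q_add_def rsum_def N.set_add_iff split: prod.splits)

lemma q_add_in:
 assumes r: "r \<in> q_reps S M N" and s: "s \<in> q_reps S M N"
 shows "q_add N r s \<in> q_reps S M N"
proof -
 obtain V1 W1 f1 V2 W2 f2 where rs: "r = (V1, W1, f1)" "s = (V2, W2, f2)" by (cases r, cases s) blast
 note r' = r[unfolded rs q_reps_iff] and s' = s[unfolded rs q_reps_iff]
 have q: "q_add N r s = (V1 \<inter> V2, W1 <+>[N] W2, %x. f1 x <+>[N] f2 x)" by (simp add: q_add_def rs)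
 have rel: "rel_of (V1 \<inter> V2, W1 <+>[N] W2, %x. f1 x <+>[N] f2 x) = rsum N (rel_of r) (rel_of s)"
  using rel_of_add[of r s] q by simp
 have "Domain (rsum N (rel_of r) (rel_of s)) = Domain (rel_of r) \<inter> Domain (rel_of s)" by (auto simp: rsum_def)
 moreover have "rsum N (rel_of r) (rel_of s) `` {\<zero>[M]} = rel_of r `` {\<zero>[M]} <+>[N] rel_of s `` {\<zero>[M]}"
  by (rule rsum_fibre)
 ultimately show ?thesis unfolding q q_reps_iff rel
  using r' s' grel_rsum[OF q_reps_grel[OF r] q_reps_grel[OF s]] unfolding rs by simp
qed

text \<open>The sum is a union over all pairs of representatives. All of them give one class, by
  \<open>geq_cong\<close> in one argument at a time, and there is at least one pair.\<close>

lemma Add_serre: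
 assumes Ga: "grel S M N Ga" and Da: "grel S M N Da"
 shows "Add (serre_quotient U S) M N (qcl S M N Ga) (qcl S M N Da) = qcl S M N (rsum N Ga Da)"
proof -
 have "q_rel S M N `` {q_add N f g} = qcl S M N (rsum N Ga Da)" if f: "f \<in> qcl S M N Ga" and g: "g \<in> qcl S M N Da" for f g
 proof -
  have f': "f \<in> q_reps S M N" "geq S M N Ga (rel_of f)" using f qcl_mem[OF Ga] by auto
  have g': "g \<in> q_reps S M N" "geq S M N Da (rel_of g)" using g qcl_mem[OF Da] by auto
  note rf = q_reps_grel[OF f'(1)] and rg = q_reps_grel[OF g'(1)]
  have "geq S M N (rsum N Ga Da) (rsum N (rel_of f) Da)"
   by (rule geq_cong[OF Ga rf f'(2)]) (use grel_rsum Da gmod2_axioms in \<open>auto simp: rsum_def\<close>)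
  moreover have "geq S M N (rsum N (rel_of f) Da) (rsum N (rel_of f) (rel_of g))"
   by (rule geq_cong[OF Da rg g'(2)]) (use grel_rsum rf gmod2_axioms in \<open>auto simp: rsum_def\<close>)
  ultimately have "geq S M N (rsum N Ga Da) (rsum N (rel_of f) (rel_of g))"
   using geq_trans grel_rsum grel_glin Ga Da rf rg by meson
  then have "qcl S M N (rsum N Ga Da) = qcl S M N (rsum N (rel_of f) (rel_of g))"
   using qcl_eq_iff grel_rsum Ga Da rf rg by blast
  then show ?thesis using q_rel_class[OF q_add_in[OF f'(1) g'(1)]] rel_of_add by simp
 qed
 moreover have "qcl S M N Ga \<noteq> {}" "qcl S M N Da \<noteq> {}"
  using qcl_mem[OF Ga, of "rep_of M Ga"] qcl_mem[OF Da, of "rep_of M Da"] rep_of_in Ga Da geq_refl by auto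
 ultimately show ?thesis by (simp add: serre_quotient_def)
qed

end

lemma Comp_serre:
 assumes "gmod S M" "gmod S N" "gmod S P" and Ga: "grel S M N Ga" and Da: "grel S N P Da"
 shows "Comp (serre_quotient U S) M N P (qcl S N P Da) (qcl S M N Ga) = qcl S M P (Ga O Da)"
proof -
 interpret M: gmod S M by fact
 interpret N: gmod S N by fact
 interpret P: gmod S P by fact
 interpret MN: gmod2u S M N by unfold_locales
 interpret NP: gmod2u S N P by unfold_locales
 interpret MP: gmod2u S M P by unfold_locales
 note gc = grel_comp[OF assms(1-3)]
 have "q_rel S M P `` {q_comp g f} = qcl S M P (Ga O Da)" if f: "f \<in> qcl S M N Ga" and g: "g \<in> qcl S N P Da" for f g
 proof -
  have f': "f \<in> q_reps S M N" "geq S M N Ga (rel_of f)" using f MN.qcl_mem[OF Ga] by auto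
  have g': "g \<in> q_reps S N P" "geq S N P Da (rel_of g)" using g NP.qcl_mem[OF Da] by auto
  note rf = MN.q_reps_grel[OF f'(1)] and rg = NP.q_reps_grel[OF g'(1)]
  have "geq S M P (Ga O Da) (rel_of f O Da)"
   by (rule MN.geq_cong[OF Ga rf f'(2)]) (use gc Da MP.gmod2_axioms in auto)
  moreover have "geq S M P (rel_of f O Da) (rel_of f O rel_of g)"
   by (rule NP.geq_cong[OF Da rg g'(2)]) (use gc rf MP.gmod2_axioms in auto)
  ultimately have "geq S M P (Ga O Da) (rel_of f O rel_of g)"
   using MP.geq_trans gc MP.grel_glin Ga Da rf rg by meson
  then have e: "qcl S M P (Ga O Da) = qcl S M P (rel_of f O rel_of g)"
   using MP.qcl_eq_iff gc Ga Da rf rg by blast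
  obtain V1 W1 f1 V2 W2 g1 where fg: "f = (V1, W1, f1)" "g = (V2, W2, g1)" by (cases f, cases g) blast
  note r' = f'(1)[unfolded fg MN.q_reps_iff] and s' = g'(1)[unfolded fg NP.q_reps_iff]
  have q: "q_comp g f = ({x \<in> V1. f1 x \<inter> V2 \<noteq> {}}, \<Union>y\<in>W1 \<inter> V2. g1 y, %x. \<Union>y\<in>f1 x \<inter> V2. g1 y)"
   by (simp add: q_comp_def fg)
  have rel: "rel_of (q_comp g f) = rel_of f O rel_of g" by (rule rel_of_comp)
  have V2: "y \<in> V2 \<longleftrightarrow> (\<exists>z. z \<in> g1 y \<and> y \<in> V2)" for y using s' by (auto simp: rel_of_def)
  have dom: "{x \<in> V1. f1 x \<inter> V2 \<noteq> {}} = Domain (rel_of f O rel_of g)"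
  proof -
   have "Domain (rel_of f O rel_of g) = {x. \<exists>y\<in>Domain (rel_of g). (x, y) \<in> rel_of f}" by auto
   also have "Domain (rel_of g) = V2" using s' fg by simp
   finally show ?thesis by (auto simp: fg rel_of_def)
  qed
  have fib: "(\<Union>y\<in>W1 \<inter> V2. g1 y) = (rel_of f O rel_of g) `` {\<zero>[M]}"
  proof -
   have "(rel_of f O rel_of g) `` {\<zero>[M]} = rel_of g `` (rel_of f `` {\<zero>[M]})" by auto
   also have "rel_of f `` {\<zero>[M]} = W1" using r' fg by simp
   finally show ?thesis by (auto simp: fg rel_of_def)
  qed
  \<comment> \<open>The two submodules prescribed by \<open>q_comp\<close> are the domain and the
    fibre over zero of the composite relation.\<close>
  have "q_comp g f \<in> q_reps S M P"
   unfolding q MP.q_reps_iff rel[unfolded q] using dom fib gc[OF rf rg] by blast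
  then show ?thesis using MP.q_rel_class rel e by simp
 qed
 moreover have "qcl S M N Ga \<noteq> {}" "qcl S N P Da \<noteq> {}"
  using MN.qcl_mem[OF Ga, of "rep_of M Ga"] NP.qcl_mem[OF Da, of "rep_of N Da"] MN.rep_of_in NP.rep_of_in Ga Da
   MN.geq_refl NP.geq_refl by auto
 ultimately show ?thesis by (simp add: serre_quotient_def)
qed

lemma Idm_serre:
 assumes "gmod S M"
 shows "Idm (serre_quotient U S) M = qcl S M M (Id_on (carrier M))"
proof -
 interpret M: gmod S M by fact
 interpret MM: gmod2u S M M by unfold_locales
 have c: "{\<zero>[M]} +>[M] x = {x}" if "x \<in> carrier M" for x
  using that by (auto simp: M.coset_mem)
 have rel: "rel_of (q_id M) = Id_on (carrier M)" by (auto simp: rel_of_def q_id_def c)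
 have "Id_on (carrier M) `` {\<zero>[M]} = {\<zero>[M]}" by auto
 then have "q_id M \<in> q_reps S M M"
  unfolding q_id_def MM.q_reps_iff using rel[unfolded q_id_def] M.grel_Id by auto
 then show ?thesis using MM.q_rel_class rel by (simp add: serre_quotient_def)
qed

lemma (in galg) gmodI: "M \<in> Obj (serre_quotient U S) ==> gmod S M"
 by unfold_locales (simp add: serre_quotient_def mod_objects_def)

lemma (in galg) category_serre: "category (serre_quotient U S)"
proof -
 let ?C = "serre_quotient U S"
 have H: "Hom ?C A B = {qcl S A B Ga |Ga. grel S A B Ga}" if "A \<in> Obj ?C" "B \<in> Obj ?C" for A B
  using gmod2u.Hom_serre[of S A B U] gmodI[OF that(1)] gmodI[OF that(2)] by (simp add: gmod2u_def gmod2_def)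
 have I: "grel S A A (Id_on (carrier A))" if "A \<in> Obj ?C" for A using gmod.grel_Id gmodI that by blast
 have id: "Id_on (carrier A) O Ga = Ga" "Ga O Id_on (carrier B) = Ga" if "grel S A B Ga" for A B Ga
  using that by (auto simp: grel_def glin_def)
 show ?thesis unfolding category_def
 proof (intro conjI ballI)
  fix A assume "A \<in> Obj ?C"
  then show "Idm ?C A \<in> Hom ?C A A" using H I Idm_serre[OF gmodI, of A U U] by auto
 next
  fix A B Z f g assume o: "A \<in> Obj ?C" "B \<in> Obj ?C" "Z \<in> Obj ?C" and "f \<in> Hom ?C A B" "g \<in> Hom ?C B Z"
  then obtain Ga Da where *: "grel S A B Ga" "f = qcl S A B Ga" "grel S B Z Da" "g = qcl S B Z Da" using H by auto
  note g = o[THEN gmodI]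
  show "Comp ?C A B Z g f \<in> Hom ?C A Z"
   using Comp_serre[OF g *(1,3)] grel_comp[OF g *(1,3)] H[OF o(1,3)] *(2,4) by auto
 next
  fix A B f assume o: "A \<in> Obj ?C" "B \<in> Obj ?C" and "f \<in> Hom ?C A B"
  then obtain Ga where *: "grel S A B Ga" "f = qcl S A B Ga" using H by auto
  note g = o[THEN gmodI]
  show "Comp ?C A A B f (Idm ?C A) = f" "Comp ?C A B B (Idm ?C B) f = f"
   using Comp_serre[OF g(1,1,2) I[OF o(1)] *(1)] Comp_serre[OF g(1,2,2) *(1) I[OF o(2)]]
    Idm_serre[OF g(1)] Idm_serre[OF g(2)] id[OF *(1)] *(2) by simp_all
 next
  fix A B Z V f g h assume o: "A \<in> Obj ?C" "B \<in> Obj ?C" "Z \<in> Obj ?C" "V \<in> Obj ?C"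
   and "f \<in> Hom ?C A B" "g \<in> Hom ?C B Z" "h \<in> Hom ?C Z V"
  then obtain Ga Da \<Theta> where *: "grel S A B Ga" "f = qcl S A B Ga" "grel S B Z Da" "g = qcl S B Z Da"
   "grel S Z V \<Theta>" "h = qcl S Z V \<Theta>" using H by auto
  note g = o[THEN gmodI]
  have "Comp ?C A Z V h (Comp ?C A B Z g f) = qcl S A V ((Ga O Da) O \<Theta>)"
   using Comp_serre[OF g(1,2,3) *(1,3)] Comp_serre[OF g(1,3,4) grel_comp[OF g(1,2,3) *(1,3)] *(5)] *(2,4,6) by simp
  moreover have "Comp ?C A B V (Comp ?C B Z V h g) f = qcl S A V (Ga O (Da O \<Theta>))"
   using Comp_serre[OF g(2,3,4) *(3,5)] Comp_serre[OF g(1,2,4) *(1) grel_comp[OF g(2,3,4) *(3,5)]] *(2,4,6) by simp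
  ultimately show "Comp ?C A Z V h (Comp ?C A B Z g f) = Comp ?C A B V (Comp ?C B Z V h g) f"
   by (simp add: O_assoc)
 qed
qed

text \<open>Only an inclusion holds for the relations: on the right the two summands may pass
  through different intermediate points. An inclusion is enough by \<open>geq_sub\<close>.\<close>

lemma grel_O_rsum:
 assumes "gmod S M" "gmod S N" "gmod S P" "grel S M N Ga" "grel S N P Da" "grel S N P Da'"
 shows "geq S M P (Ga O rsum P Da Da') (rsum P (Ga O Da) (Ga O Da'))"
proof -
 interpret M: gmod S M by fact
 interpret N: gmod S N by fact
 interpret P: gmod S P by fact
 interpret MP: gmod2 S M P by unfold_locales
 interpret NP: gmod2 S N P by unfold_locales
 note c = grel_comp[OF assms(1-3)]
 show ?thesis
  by (rule MP.geq_sub) (use assms c NP.grel_rsum MP.grel_rsum in \<open>auto simp: rsum_def\<close>)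
qed

text \<open>Here additivity of \<open>Da\<close> gives the opposite inclusion: intermediate points
  are added along with the values.\<close>

lemma grel_rsum_O:
 assumes "gmod S M" "gmod S N" "gmod S P" "grel S M N Ga" "grel S M N Ga'" "grel S N P Da"
 shows "geq S M P (rsum N Ga Ga' O Da) (rsum P (Ga O Da) (Ga' O Da))"
proof -
 interpret M: gmod S M by fact
 interpret N: gmod S N by fact
 interpret P: gmod S P by fact
 interpret MP: gmod2 S M P by unfold_locales
 interpret NP: gmod2 S N P by unfold_locales
 interpret MN: gmod2 S M N by unfold_locales
 note c = grel_comp[OF assms(1-3)]
 have l: "glin S N P Da" using assms(6) by (simp add: grel_def)
 have sub: "rsum P (Ga O Da) (Ga' O Da) <= rsum N Ga Ga' O Da"
 proof clarify
  fix x w assume "(x, w) \<in> rsum P (Ga O Da) (Ga' O Da)"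
  then obtain y z y' z' where *: "(x, y) \<in> Ga" "(y, z) \<in> Da" "(x, y') \<in> Ga'" "(y', z') \<in> Da" "w = z \<oplus>[P] z'"
   unfolding rsum_def by blast
  have "(x, y \<oplus>[N] y') \<in> rsum N Ga Ga'" using * unfolding rsum_def by blast
  moreover have "(y \<oplus>[N] y', w) \<in> Da" using NP.glinD(4)[OF l] * by simp
  ultimately show "(x, w) \<in> rsum N Ga Ga' O Da" by blast
 qed
 have g: "grel S M P (rsum P (Ga O Da) (Ga' O Da))" "grel S M P (rsum N Ga Ga' O Da)"
  using assms c MP.grel_rsum MN.grel_rsum by auto
 show ?thesis using MP.geq_sym[OF _ _ MP.geq_sub[OF g sub]] g MP.grel_glin by blast
qed

section \<open>Equivalences of categories\<close>

text \<open>A fully faithful, essentially surjective functor has a quasi-inverse. Since the latter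
  must be additive too and \<open>cat\<close> imposes no law on \<open>Add\<close>, bilinearity of
  composition in \<open>D\<close> is assumed explicitly.\<close>

lemma equivalent_catsI:
 assumes F: "additive_functor C D Fo Fm"
  and bij: "\<And>A B. A \<in> Obj C ==> B \<in> Obj C ==> bij_betw (Fm A B) (Hom C A B) (Hom D (Fo A) (Fo B))"
  and ess: "\<And>Y. Y \<in> Obj D ==> \<exists>A\<in>Obj C. \<exists>f. iso_mor D Y (Fo A) f"
  and addC: "\<And>A B f g. A \<in> Obj C ==> B \<in> Obj C ==> f \<in> Hom C A B ==> g \<in> Hom C A B ==> Add C A B f g \<in> Hom C A B"
  and addD: "\<And>A B f g. A \<in> Obj D ==> B \<in> Obj D ==> f \<in> Hom D A B ==> g \<in> Hom D A B ==> Add D A B f g \<in> Hom D A B"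
  and distl: "\<And>A B Z f g h. A \<in> Obj D ==> B \<in> Obj D ==> Z \<in> Obj D ==> f \<in> Hom D A B ==> g \<in> Hom D A B ==> h \<in> Hom D B Z ==>
   Comp D A B Z h (Add D A B f g) = Add D A Z (Comp D A B Z h f) (Comp D A B Z h g)"
  and distr: "\<And>A B Z f g h. A \<in> Obj D ==> B \<in> Obj D ==> Z \<in> Obj D ==> f \<in> Hom D B Z ==> g \<in> Hom D B Z ==> h \<in> Hom D A B ==>
   Comp D A B Z (Add D B Z f g) h = Add D A Z (Comp D A B Z f h) (Comp D A B Z g h)"
 shows "equivalent_cats C D"
proof -
 have cC: "category C" and cD: "category D" using F by (auto simp: additive_functor_def)
 note catC = cC[unfolded category_def] and catD = cD[unfolded category_def]
 have compC: "Comp C A B Z g f \<in> Hom C A Z" if "A \<in> Obj C" "B \<in> Obj C" "Z \<in> Obj C" "f \<in> Hom C A B" "g \<in> Hom C B Z" for A B Z f g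
  using catC that by blast
 have idC: "Idm C A \<in> Hom C A A" if "A \<in> Obj C" for A using catC that by blast
 have idD: "Idm D A \<in> Hom D A A" if "A \<in> Obj D" for A using catD that by blast
 have compD: "Comp D A B Z g f \<in> Hom D A Z" if "A \<in> Obj D" "B \<in> Obj D" "Z \<in> Obj D" "f \<in> Hom D A B" "g \<in> Hom D B Z" for A B Z f g
  using catD that by blast
 have unitD: "Comp D A A B f (Idm D A) = f" "Comp D A B B (Idm D B) f = f" if "A \<in> Obj D" "B \<in> Obj D" "f \<in> Hom D A B" for A B f
  using catD that by blast+
 have assocD: "Comp D A Z V h (Comp D A B Z g f) = Comp D A B V (Comp D B Z V h g) f"
  if "A \<in> Obj D" "B \<in> Obj D" "Z \<in> Obj D" "V \<in> Obj D" "f \<in> Hom D A B" "g \<in> Hom D B Z" "h \<in> Hom D Z V" for A B Z V f g h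
  using catD that by blast
 have Fo: "Fo A \<in> Obj D" if "A \<in> Obj C" for A using F that by (auto simp: additive_functor_def)
 have Fm: "Fm A B f \<in> Hom D (Fo A) (Fo B)" if "A \<in> Obj C" "B \<in> Obj C" "f \<in> Hom C A B" for A B f
  using F that by (auto simp: additive_functor_def)
 have Fid: "Fm A A (Idm C A) = Idm D (Fo A)" if "A \<in> Obj C" for A using F that by (auto simp: additive_functor_def)
 have Fcomp: "Fm A Z (Comp C A B Z g f) = Comp D (Fo A) (Fo B) (Fo Z) (Fm B Z g) (Fm A B f)"
  if "A \<in> Obj C" "B \<in> Obj C" "Z \<in> Obj C" "f \<in> Hom C A B" "g \<in> Hom C B Z" for A B Z f g
  using F that unfolding additive_functor_def by blast
 have Fadd: "Fm A B (Add C A B f g) = Add D (Fo A) (Fo B) (Fm A B f) (Fm A B g)"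
  if "A \<in> Obj C" "B \<in> Obj C" "f \<in> Hom C A B" "g \<in> Hom C A B" for A B f g
  using F that unfolding additive_functor_def by blast
 have inj: "f = g" if "A \<in> Obj C" "B \<in> Obj C" "f \<in> Hom C A B" "g \<in> Hom C A B" "Fm A B f = Fm A B g" for A B f g
  using bij[OF that(1,2)] that by (auto simp: bij_betw_def inj_on_def)
 have "\<forall>Y. \<exists>A f f'. Y \<in> Obj D --> A \<in> Obj C \<and> f \<in> Hom D Y (Fo A) \<and> f' \<in> Hom D (Fo A) Y \<and>
   Comp D Y (Fo A) Y f' f = Idm D Y \<and> Comp D (Fo A) Y (Fo A) f f' = Idm D (Fo A)"
  using ess unfolding iso_mor_def by blast
 then obtain Go th ti where *: "\<And>Y. Y \<in> Obj D ==> Go Y \<in> Obj C \<and> th Y \<in> Hom D Y (Fo (Go Y)) \<and> ti Y \<in> Hom D (Fo (Go Y)) Y \<and>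
   Comp D Y (Fo (Go Y)) Y (ti Y) (th Y) = Idm D Y \<and> Comp D (Fo (Go Y)) Y (Fo (Go Y)) (th Y) (ti Y) = Idm D (Fo (Go Y))"
  by metis
 have Go: "\<And>Y. Y \<in> Obj D ==> Go Y \<in> Obj C" and th: "\<And>Y. Y \<in> Obj D ==> th Y \<in> Hom D Y (Fo (Go Y))"
  and ti: "\<And>Y. Y \<in> Obj D ==> ti Y \<in> Hom D (Fo (Go Y)) Y"
  and tith: "\<And>Y. Y \<in> Obj D ==> Comp D Y (Fo (Go Y)) Y (ti Y) (th Y) = Idm D Y"
  and thti: "\<And>Y. Y \<in> Obj D ==> Comp D (Fo (Go Y)) Y (Fo (Go Y)) (th Y) (ti Y) = Idm D (Fo (Go Y))"
  using * by blast+
 have FG: "\<And>Y. Y \<in> Obj D ==> Fo (Go Y) \<in> Obj D" using Fo Go by blast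
 \<comment> \<open>Conjugation of \<open>g\<close> by the chosen isomorphisms \<open>th\<close>
   gives a morphism between objects in the image of \<open>Fo\<close>; its preimage under
   \<open>Fm\<close> defines the inverse functor.\<close>
 define K where "K Y Z g = Comp D (Fo (Go Y)) Y (Fo (Go Z)) (Comp D Y Z (Fo (Go Z)) (th Z) g) (ti Y)" for Y Z g
 define Gm where "Gm Y Z g = inv_into (Hom C (Go Y) (Go Z)) (Fm (Go Y) (Go Z)) (K Y Z g)" for Y Z g
 have K: "K Y Z g \<in> Hom D (Fo (Go Y)) (Fo (Go Z))" if "Y \<in> Obj D" "Z \<in> Obj D" "g \<in> Hom D Y Z" for Y Z g
  unfolding K_def using compD FG th ti that by metis
 have G: "Gm Y Z g \<in> Hom C (Go Y) (Go Z)" "Fm (Go Y) (Go Z) (Gm Y Z g) = K Y Z g"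
  if "Y \<in> Obj D" "Z \<in> Obj D" "g \<in> Hom D Y Z" for Y Z g
  using bij[OF Go[OF that(1)] Go[OF that(2)]] K[OF that] unfolding Gm_def bij_betw_def
  by (auto simp: inv_into_into f_inv_into_f)
 have Kth: "Comp D Y (Fo (Go Y)) (Fo (Go Z)) (K Y Z g) (th Y) = Comp D Y Z (Fo (Go Z)) (th Z) g"
  if o: "Y \<in> Obj D" "Z \<in> Obj D" and g: "g \<in> Hom D Y Z" for Y Z g
 proof -
  let ?a = "Comp D Y Z (Fo (Go Z)) (th Z) g"
  have a: "?a \<in> Hom D Y (Fo (Go Z))" using compD o FG th g by blast
  have "Comp D Y (Fo (Go Y)) (Fo (Go Z)) (K Y Z g) (th Y) =
    Comp D Y Y (Fo (Go Z)) ?a (Comp D Y (Fo (Go Y)) Y (ti Y) (th Y))"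
   unfolding K_def using assocD[OF o(1) FG[OF o(1)] o(1) FG[OF o(2)] th[OF o(1)] ti[OF o(1)] a] by simp
  then show ?thesis using tith[OF o(1)] unitD[OF o(1) FG[OF o(2)] a] by simp
 qed
 have Kcomp: "K Y V (Comp D Y Z V h g) = Comp D (Fo (Go Y)) (Fo (Go Z)) (Fo (Go V)) (K Z V h) (K Y Z g)"
  if o: "Y \<in> Obj D" "Z \<in> Obj D" "V \<in> Obj D" and g: "g \<in> Hom D Y Z" and h: "h \<in> Hom D Z V" for Y Z V g h
 proof -
  let ?b = "Comp D Y Z (Fo (Go Z)) (th Z) g"
  have b: "?b \<in> Hom D Y (Fo (Go Z))" using compD o FG th g by blast
  have "Comp D (Fo (Go Y)) (Fo (Go Z)) (Fo (Go V)) (K Z V h) (K Y Z g) =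
   Comp D (Fo (Go Y)) Y (Fo (Go V)) (Comp D Y (Fo (Go Z)) (Fo (Go V)) (K Z V h) ?b) (ti Y)"
   unfolding K_def[of Y Z]
   using assocD[OF FG[OF o(1)] o(1) FG[OF o(2)] FG[OF o(3)] ti[OF o(1)] b K[OF o(2,3) h]] by simp
  also have "Comp D Y (Fo (Go Z)) (Fo (Go V)) (K Z V h) ?b =
    Comp D Y Z (Fo (Go V)) (Comp D Z (Fo (Go Z)) (Fo (Go V)) (K Z V h) (th Z)) g"
   using assocD[OF o(1,2) FG[OF o(2)] FG[OF o(3)] g th[OF o(2)] K[OF o(2,3) h]] by simp
  also have "\<dots> = Comp D Y Z (Fo (Go V)) (Comp D Z V (Fo (Go V)) (th V) h) g" using Kth[OF o(2,3) h] by simp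
  also have "\<dots> = Comp D Y V (Fo (Go V)) (th V) (Comp D Y Z V h g)"
   using assocD[OF o(1,2,3) FG[OF o(3)] g h th[OF o(3)]] by simp
  finally show ?thesis by (simp add: K_def)
 qed
 have Gf: "additive_functor D C Go Gm"
  unfolding additive_functor_def
 proof (intro conjI ballI)
  fix Y assume o: "Y \<in> Obj D"
  show "Go Y \<in> Obj C" using Go o .
  have "K Y Y (Idm D Y) = Idm D (Fo (Go Y))"
   unfolding K_def using unitD[OF o FG[OF o] th[OF o]] thti[OF o] by simp
  then show "Gm Y Y (Idm D Y) = Idm C (Go Y)"
   using inj[OF Go[OF o] Go[OF o] G(1)[OF o o idD[OF o]] idC[OF Go[OF o]]] G(2)[OF o o idD[OF o]] Fid[OF Go[OF o]] by simp
 next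
  fix Y Z g assume o: "Y \<in> Obj D" "Z \<in> Obj D" and g: "g \<in> Hom D Y Z"
  show "Gm Y Z g \<in> Hom C (Go Y) (Go Z)" using G o g by blast
 next
  fix Y Z V g h assume o: "Y \<in> Obj D" "Z \<in> Obj D" "V \<in> Obj D" and g: "g \<in> Hom D Y Z" and h: "h \<in> Hom D Z V"
  note hg = compD[OF o g h]
  show "Gm Y V (Comp D Y Z V h g) = Comp C (Go Y) (Go Z) (Go V) (Gm Z V h) (Gm Y Z g)"
  proof (rule inj[OF Go[OF o(1)] Go[OF o(3)] G(1)[OF o(1,3) hg]])
   show "Comp C (Go Y) (Go Z) (Go V) (Gm Z V h) (Gm Y Z g) \<in> Hom C (Go Y) (Go V)"
    using compC Go o G(1) g h by blast
   show "Fm (Go Y) (Go V) (Gm Y V (Comp D Y Z V h g)) =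
    Fm (Go Y) (Go V) (Comp C (Go Y) (Go Z) (Go V) (Gm Z V h) (Gm Y Z g))"
    using Fcomp[OF Go[OF o(1)] Go[OF o(2)] Go[OF o(3)] G(1)[OF o(1,2) g] G(1)[OF o(2,3) h]]
     G(2)[OF o(1,2) g] G(2)[OF o(2,3) h] G(2)[OF o(1,3) hg] Kcomp[OF o g h] by simp
  qed
 next
  fix Y Z f g assume o: "Y \<in> Obj D" "Z \<in> Obj D" and f: "f \<in> Hom D Y Z" and g: "g \<in> Hom D Y Z"
  note fg = addD[OF o f g]
  have "K Y Z (Add D Y Z f g) = Add D (Fo (Go Y)) (Fo (Go Z)) (K Y Z f) (K Y Z g)"
   unfolding K_def using distl[OF o FG[OF o(2)] f g th[OF o(2)]]
    distr[OF FG[OF o(1)] o(1) FG[OF o(2)] _ _ ti[OF o(1)]] compD[OF o FG[OF o(2)] _ th[OF o(2)]] f g by simp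
  then show "Gm Y Z (Add D Y Z f g) = Add C (Go Y) (Go Z) (Gm Y Z f) (Gm Y Z g)"
   using inj[OF Go[OF o(1)] Go[OF o(2)] G(1)[OF o fg] addC[OF Go[OF o(1)] Go[OF o(2)] G(1)[OF o f] G(1)[OF o g]]]
    G(2)[OF o fg] G(2)[OF o f] G(2)[OF o g] Fadd[OF Go[OF o(1)] Go[OF o(2)] G(1)[OF o f] G(1)[OF o g]] by simp
 qed (use cC cD in auto)
 \<comment> \<open>The unit at \<open>A\<close> is the preimage under \<open>Fm\<close> of the
   isomorphism \<open>th\<close> at \<open>Fo A\<close>, and \<open>ei\<close> is the preimage of
   its inverse.\<close>
 define et where "et A = inv_into (Hom C A (Go (Fo A))) (Fm A (Go (Fo A))) (th (Fo A))" for A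
 define ei where "ei A = inv_into (Hom C (Go (Fo A)) A) (Fm (Go (Fo A)) A) (ti (Fo A))" for A
 have et: "et A \<in> Hom C A (Go (Fo A))" "Fm A (Go (Fo A)) (et A) = th (Fo A)"
  and ei: "ei A \<in> Hom C (Go (Fo A)) A" "Fm (Go (Fo A)) A (ei A) = ti (Fo A)" if o: "A \<in> Obj C" for A
  using bij[OF o Go[OF Fo[OF o]]] th[OF Fo[OF o]] bij[OF Go[OF Fo[OF o]] o] ti[OF Fo[OF o]]
  unfolding et_def ei_def bij_betw_def by (auto simp: inv_into_into f_inv_into_f)
 have n1: "nat_iso_from_id C (Go \<circ> Fo) (%A B f. Gm (Fo A) (Fo B) (Fm A B f)) et"
  unfolding nat_iso_from_id_def
 proof (intro conjI ballI)
  fix A assume o: "A \<in> Obj C"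
  note o' = Go[OF Fo[OF o]]
  have 1: "Comp C A (Go (Fo A)) A (ei A) (et A) = Idm C A"
   by (rule inj[OF o o]) (use compC[OF o o' o et(1)[OF o] ei(1)[OF o]] idC[OF o]
    Fcomp[OF o o' o et(1)[OF o] ei(1)[OF o]] et(2)[OF o] ei(2)[OF o] tith[OF Fo[OF o]] Fid[OF o] in auto)
  have 2: "Comp C (Go (Fo A)) A (Go (Fo A)) (et A) (ei A) = Idm C (Go (Fo A))"
   by (rule inj[OF o' o']) (use compC[OF o' o o' ei(1)[OF o] et(1)[OF o]] idC[OF o']
    Fcomp[OF o' o o' ei(1)[OF o] et(1)[OF o]] et(2)[OF o] ei(2)[OF o] thti[OF Fo[OF o]] Fid[OF o'] in auto)
  show "iso_mor C A ((Go \<circ> Fo) A) (et A)" unfolding iso_mor_def using 1 2 et(1)[OF o] ei(1)[OF o] by auto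
 next
  fix A B f assume o: "A \<in> Obj C" "B \<in> Obj C" and f: "f \<in> Hom C A B"
  note oA = Go[OF Fo[OF o(1)]] and oB = Go[OF Fo[OF o(2)]]
  note Ff = Fm[OF o f]
  note g = G(1)[OF Fo[OF o(1)] Fo[OF o(2)] Ff]
  have "Comp C A B (Go (Fo B)) (et B) f = Comp C A (Go (Fo A)) (Go (Fo B)) (Gm (Fo A) (Fo B) (Fm A B f)) (et A)"
  proof (rule inj[OF o(1) oB])
   show "Fm A (Go (Fo B)) (Comp C A B (Go (Fo B)) (et B) f) =
    Fm A (Go (Fo B)) (Comp C A (Go (Fo A)) (Go (Fo B)) (Gm (Fo A) (Fo B) (Fm A B f)) (et A))"
    using Fcomp[OF o oB f et(1)[OF o(2)]] Fcomp[OF o(1) oA oB et(1)[OF o(1)] g] et(2)[OF o(1)] et(2)[OF o(2)]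
     G(2)[OF Fo[OF o(1)] Fo[OF o(2)] Ff] Kth[OF Fo[OF o(1)] Fo[OF o(2)] Ff] by simp
  qed (use compC[OF o oB f et(1)[OF o(2)]] compC[OF o(1) oA oB et(1)[OF o(1)] g] in auto)
  then show "Comp C A B ((Go \<circ> Fo) B) (et B) f =
   Comp C A ((Go \<circ> Fo) A) ((Go \<circ> Fo) B) (Gm (Fo A) (Fo B) (Fm A B f)) (et A)" by simp
 qed
 have n2: "nat_iso_from_id D (Fo \<circ> Go) (%Y Z g. Fm (Go Y) (Go Z) (Gm Y Z g)) th"
  unfolding nat_iso_from_id_def
 proof (intro conjI ballI)
  fix Y assume o: "Y \<in> Obj D"
  show "iso_mor D Y ((Fo \<circ> Go) Y) (th Y)"
   unfolding iso_mor_def using th[OF o] ti[OF o] tith[OF o] thti[OF o] by auto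
 next
  fix Y Z g assume o: "Y \<in> Obj D" "Z \<in> Obj D" and g: "g \<in> Hom D Y Z"
  show "Comp D Y Z ((Fo \<circ> Go) Z) (th Z) g =
    Comp D Y ((Fo \<circ> Go) Y) ((Fo \<circ> Go) Z) (Fm (Go Y) (Go Z) (Gm Y Z g)) (th Y)"
   using Kth[OF o g] G(2)[OF o g] by simp
 qed
 show ?thesis unfolding equivalent_cats_def using F Gf n1 n2 by blast
qed

section \<open>Spans\<close>

text \<open>The generated submodule, built one term at a time with repetitions allowed. This suits
  inductions and infinite generating sets; for finite sets it agrees with the sums in
  \<open>mod_objects\<close>.\<close>

inductive_set rspan :: "('r, 'a) ring_scheme => ('r, 'u, 'b) module_scheme => 'u set => 'u set"
 for R M B where
 rspan_zero: "\<zero>[M] \<in> rspan R M B"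
| rspan_step: "r \<in> carrier R ==> b \<in> B ==> x \<in> rspan R M B ==> r \<odot>[M] b \<oplus>[M] x \<in> rspan R M B"

context Module.module
begin

lemma rspan_closed: "x \<in> rspan R M B ==> B <= carrier M ==> x \<in> carrier M"
 by (induction rule: rspan.induct) auto

lemma rspan_add:
 assumes B: "B <= carrier M" and "x \<in> rspan R M B" "y \<in> rspan R M B"
 shows "x \<oplus>[M] y \<in> rspan R M B"
 using assms(2)
proof (induction rule: rspan.induct)
 case (rspan_step r b x)
 have "r \<odot>[M] b \<oplus>[M] x \<oplus>[M] y = r \<odot>[M] b \<oplus>[M] (x \<oplus>[M] y)"
  using rspan_step.hyps B rspan_closed[OF rspan_step.hyps(3) B] rspan_closed[OF assms(3) B]
  by (simp add: M.a_assoc subset_iff)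
 then show ?case using rspan_step rspan.rspan_step by metis
qed (use assms(3) rspan_closed[OF _ B] in auto)

lemma rspan_smult:
 assumes B: "B <= carrier M" and r: "r \<in> carrier R" and "x \<in> rspan R M B"
 shows "r \<odot>[M] x \<in> rspan R M B"
 using assms(3)
proof (induction rule: rspan.induct)
 case (rspan_step s b x)
 have b: "b \<in> carrier M" "x \<in> carrier M" using B rspan_step rspan_closed by auto
 have "r \<odot>[M] (s \<odot>[M] b \<oplus>[M] x) = (r \<otimes>[R] s) \<odot>[M] b \<oplus>[M] r \<odot>[M] x"
  using r rspan_step b by (simp add: smult_r_distr smult_assoc1)
 then show ?case using rspan_step r rspan.rspan_step[of "r \<otimes>[R] s" R b B "r \<odot>[M] x" M] by simp
qed (use r in \<open>auto intro: rspan.rspan_zero\<close>)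

lemma rspan_base: "B <= carrier M ==> b \<in> B ==> b \<in> rspan R M B"
 using rspan.rspan_step[of "\<one>[R]" R b B "\<zero>[M]" M] rspan.rspan_zero[of M R B] by (simp add: subset_iff)

lemma rspan_least:
 assumes "\<zero>[M] \<in> V" "\<And>x y. x \<in> V ==> y \<in> V ==> x \<oplus>[M] y \<in> V" "\<And>r x. r \<in> carrier R ==> x \<in> V ==> r \<odot>[M] x \<in> V" "B <= V"
 shows "rspan R M B <= V"
proof
 fix x assume "x \<in> rspan R M B"
 then show "x \<in> V" by (induction rule: rspan.induct) (use assms in auto)
qed

lemma rspan_trans:
 assumes "B <= carrier M" "C <= rspan R M B"
 shows "rspan R M C <= rspan R M B"
 by (rule rspan_least) (use assms rspan_add rspan_smult in \<open>auto intro: rspan.rspan_zero\<close>)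

lemma rspan_finite:
 assumes "finite B" "B <= carrier M"
 shows "x \<in> rspan R M B \<longleftrightarrow> (\<exists>c. c \<in> B \<rightarrow> carrier R \<and> x = (\<Oplus>\<^bsub>M\<^esub>b\<in>B. c b \<odot>[M] b))"
proof
 assume "x \<in> rspan R M B"
 then show "\<exists>c. c \<in> B \<rightarrow> carrier R \<and> x = (\<Oplus>\<^bsub>M\<^esub>b\<in>B. c b \<odot>[M] b)"
 proof (induction rule: rspan.induct)
  case rspan_zero
  have "(\<Oplus>\<^bsub>M\<^esub>b\<in>B. \<zero>[R] \<odot>[M] b) = \<zero>[M]" by (rule M.add.finprod_one_eqI) (use assms in auto)
  then show ?case by (intro exI[of _ "%_. \<zero>[R]"]) auto
 next
  case (rspan_step r b x)
  then obtain c where c: "c \<in> B \<rightarrow> carrier R" "x = (\<Oplus>\<^bsub>M\<^esub>b\<in>B. c b \<odot>[M] b)" by blast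
  let ?c = "%a. if b = a then r \<oplus>[R] c a else c a"
  have cB: "(%b. c b \<odot>[M] b) \<in> B \<rightarrow> carrier M" using c assms by auto
  let ?d = "%a. if b = a then r \<odot>[M] a else \<zero>[M]"
  have dB: "?d \<in> B \<rightarrow> carrier M" using rspan_step assms by auto
  have "(\<Oplus>\<^bsub>M\<^esub>a\<in>B. ?c a \<odot>[M] a) = (\<Oplus>\<^bsub>M\<^esub>a\<in>B. ?d a \<oplus>[M] c a \<odot>[M] a)"
   by (rule M.finsum_cong') (use c assms rspan_step in \<open>auto simp: smult_l_distr Pi_def subset_iff\<close>)
  also have "\<dots> = (\<Oplus>\<^bsub>M\<^esub>a\<in>B. ?d a) \<oplus>[M] x" using M.finsum_addf[OF dB cB] c by simp
  also have "(\<Oplus>\<^bsub>M\<^esub>a\<in>B. ?d a) = r \<odot>[M] b"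
   using M.finsum_singleton[OF rspan_step.hyps(2) assms(1), of "%a. r \<odot>[M] a"] rspan_step assms by auto
  finally show ?case using c rspan_step by (intro exI[of _ ?c]) (auto simp: Pi_def)
 qed
next
 assume "\<exists>c. c \<in> B \<rightarrow> carrier R \<and> x = (\<Oplus>\<^bsub>M\<^esub>b\<in>B. c b \<odot>[M] b)"
 then obtain c where c: "c \<in> B \<rightarrow> carrier R" "x = (\<Oplus>\<^bsub>M\<^esub>b\<in>B. c b \<odot>[M] b)" by blast
 have "(\<Oplus>\<^bsub>M\<^esub>b\<in>B. c b \<odot>[M] b) \<in> rspan R M B"
 proof (rule M.finsum_mem)
  show "(%b. c b \<odot>[M] b) \<in> B \<rightarrow> rspan R M B"
   using c rspan_smult[OF assms(2) _ rspan_base[OF assms(2)]] by auto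
 qed (use assms rspan_closed rspan_add in \<open>auto intro: rspan.rspan_zero\<close>)
 then show "x \<in> rspan R M B" using c by simp
qed

end

lemma mod_objects_iff: "M \<in> mod_objects S \<longleftrightarrow> graded_module S M \<and>
  (\<exists>B. finite B \<and> B <= carrier M \<and> carrier M <= rspan (ga_ring S) M B)"
proof -
 have "(\<exists>B. finite B \<and> B <= carrier M \<and> carrier M <= rspan (ga_ring S) M B) \<longleftrightarrow>
   (\<exists>B. finite B \<and> B <= carrier M \<and>
    (\<forall>x\<in>carrier M. \<exists>c. c \<in> B \<rightarrow> Rc S \<and> x = (\<Oplus>\<^bsub>M\<^esub>b\<in>B. c b \<odot>[M] b)))"
  if gr: "graded_module S M"
 proof -
  interpret Module.module "ga_ring S" M using gr by (simp add: graded_module_def)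
  show ?thesis using rspan_finite by (intro ex_cong1) (auto simp: subset_iff)
 qed
 then show ?thesis unfolding mod_objects_def by blast
qed

section \<open>Restriction of the degrees to a subgroup\<close>

definition reg :: "('k, 'g, 'r) graded_algebra => ('g, 'r, 'r) gmodule" where
 "reg S = \<lparr>carrier = Rc S, monoid.mult = monoid.mult (ga_ring S), one = one (ga_ring S),
   ring.zero = ring.zero (ga_ring S), ring.add = ring.add (ga_ring S),
   module.smult = monoid.mult (ga_ring S), gm_comp = ga_comp S\<rparr>"

lemma reg_simps [simp]:
 "carrier (reg S) = Rc S" "ring.zero (reg S) = ring.zero (ga_ring S)"
 "ring.add (reg S) = ring.add (ga_ring S)" "module.smult (reg S) = monoid.mult (ga_ring S)"
 "gm_comp (reg S) = ga_comp S"
 by (simp_all add: reg_def)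

definition hpart :: "('k, 'g, 'r) graded_algebra => 'g set => ('g, 'r, 'u) gmodule => 'u set" where
 "hpart S H M = {x \<in> carrier M. \<forall>g. g \<notin> H --> hc S M x g = \<zero>[M]}"

text \<open>The components are left alone in all degrees. This is harmless, as the restricted module
  is graded by \<open>H\<close> and only degrees in \<open>H\<close> are looked at.\<close>

definition res :: "('k, 'g, 'r) graded_algebra => 'g set => ('g, 'r, 'u) gmodule => ('g, 'r, 'u) gmodule" where
 "res S H M = M\<lparr>carrier := hpart S H M\<rparr>"

lemma res_simps [simp]:
 "carrier (res S H M) = hpart S H M" "ring.zero (res S H M) = ring.zero M" "ring.add (res S H M) = ring.add M"
 "module.smult (res S H M) = module.smult M" "gm_comp (res S H M) = gm_comp M"
 by (simp_all add: res_def)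

text \<open>The pair \<open>RA A\<close>, \<open>RW A w\<close> in the abstract. That scalars have
  trivial degree, \<open>emb_deg\<close>, keeps them inside the part with degrees in
  \<open>H\<close>.\<close>

locale grestr = galg S for S :: "('k::field, 'g, 'r) graded_algebra" +
 fixes S' :: "('k, 'g, 'r) graded_algebra" and H :: "'g set"
 assumes reg: "graded_module S (reg S)"
  and emb_deg: "ga_emb S c \<in> ga_comp S \<one>[ga_grp S]"
  and H: "subgroup H (ga_grp S)"
  and grp': "ga_grp S' = (ga_grp S)\<lparr>carrier := H\<rparr>"
  and ring': "ga_ring S' = (ga_ring S)\<lparr>carrier := hpart S H (reg S)\<rparr>"
  and emb': "ga_emb S' = ga_emb S"
  and comp': "h \<in> H ==> ga_comp S' h = ga_comp S h"

locale grmod = grestr S S' H + gmod S M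
 for S :: "('k::field, 'g, 'r) graded_algebra" and S' :: "('k, 'g, 'r) graded_algebra"
  and H :: "'g set" and M :: "('g, 'r, 'u) gmodule"
begin

sublocale Rg: gmod S "reg S" using reg by unfold_locales

lemma H_carrier: "h \<in> H ==> h \<in> Gc S"
 using subgroup.subset[OF H] by blast

lemma H_cancel_l: "h \<in> H ==> g \<in> Gc S ==> h \<otimes>[ga_grp S] g \<in> H ==> g \<in> H"
proof -
 assume h: "h \<in> H" "g \<in> Gc S" "h \<otimes>[ga_grp S] g \<in> H"
 have "inv[ga_grp S] h \<otimes>[ga_grp S] (h \<otimes>[ga_grp S] g) \<in> H"
  using h subgroup.m_closed[OF H] subgroup.m_inv_closed[OF H] by blast
 then show "g \<in> H" using h H_carrier by (simp add: G.m_assoc[symmetric])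
qed

lemma H_cancel_r: "h \<in> H ==> g \<in> Gc S ==> g \<otimes>[ga_grp S] h \<in> H ==> g \<in> H"
 using H_cancel_l H_carrier G.m_comm by metis

lemma smult_dec:
 assumes "r \<in> Rc S" "x \<in> carrier M"
 shows "r \<odot>[M] x = (\<Oplus>\<^bsub>M\<^esub>k\<in>{k. hc S (reg S) r k \<noteq> \<zero>[ga_ring S]}. hc S (reg S) r k \<odot>[M] x)"
proof -
 let ?A = "{k. hc S (reg S) r k \<noteq> \<zero>[ga_ring S]}"
 have "r = finsum (reg S) (hc S (reg S) r) ?A"
  using Rg.hc_sum[of r ?A] Rg.hc_finite[of r] assms by simp
 moreover have "finsum (reg S) (hc S (reg S) r) ?A \<odot>[M] x = (\<Oplus>\<^bsub>M\<^esub>k\<in>?A. hc S (reg S) r k \<odot>[M] x)"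
  by (rule finsum_additive[where \<phi> = "%r. r \<odot>[M] x"])
   (use assms Rg.hc_closed[of r] in \<open>auto intro: Rg.M.abelian_group_axioms M.abelian_group_axioms simp: smult_l_distr\<close>)
 ultimately show ?thesis by simp
qed

text \<open>A convolution formula: decompose \<open>r\<close> and apply the homogeneous case to each
  of its components.\<close>

lemma hc_smult_gen:
 assumes r: "r \<in> Rc S" and x: "x \<in> carrier M" and g: "g \<in> Gc S"
 shows "hc S M (r \<odot>[M] x) g = (\<Oplus>\<^bsub>M\<^esub>k\<in>{k. hc S (reg S) r k \<noteq> \<zero>[ga_ring S]}.
  hc S (reg S) r k \<odot>[M] hc S M x (inv[ga_grp S] k \<otimes>[ga_grp S] g))"
proof -
 let ?A = "{k. hc S (reg S) r k \<noteq> \<zero>[ga_ring S]}"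
 have A: "k \<in> Gc S" "hc S (reg S) r k \<in> ga_comp S k" "hc S (reg S) r k \<in> Rc S" if "k \<in> ?A" for k
  using Rg.hc_supp[of r] Rg.hc_comp[of r k] Rg.hc_closed[of r k] r that by auto
 have "hc S M (r \<odot>[M] x) g = (\<Oplus>\<^bsub>M\<^esub>k\<in>?A. hc S M (hc S (reg S) r k \<odot>[M] x) g)"
  unfolding smult_dec[OF r x] by (rule hc_finsum) (use A x in auto)
 also have "\<dots> = (\<Oplus>\<^bsub>M\<^esub>k\<in>?A. hc S (reg S) r k \<odot>[M] hc S M x (inv[ga_grp S] k \<otimes>[ga_grp S] g))"
 proof (rule M.finsum_cong')
  fix k assume k: "k \<in> ?A"
  have "k \<otimes>[ga_grp S] (inv[ga_grp S] k \<otimes>[ga_grp S] g) = g" using A(1)[OF k] g by (simp add: G.m_assoc[symmetric])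
  then show "hc S M (hc S (reg S) r k \<odot>[M] x) g = hc S (reg S) r k \<odot>[M] hc S M x (inv[ga_grp S] k \<otimes>[ga_grp S] g)"
   using hc_smult[OF A(1,2)[OF k] x, of "inv[ga_grp S] k \<otimes>[ga_grp S] g"] A(1)[OF k] g by simp
 qed (use A x in auto)
 finally show ?thesis .
qed

lemma eq_hcI:
 assumes "x \<in> carrier M" "y \<in> carrier M" "\<And>g. g \<in> Gc S ==> hc S M x g = hc S M y g"
 shows "x = y"
proof -
 have "hc S M x g = hc S M y g" for g
  using assms hc_out by (cases "g \<in> Gc S") auto
 then have "hc S M x = hc S M y" by (rule ext)
 then show ?thesis using hc_sum[OF assms(1) hc_finite[OF assms(1)]] hc_sum[OF assms(2) hc_finite[OF assms(2)]] by simp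
qed

lemma hpartD: "x \<in> hpart S H M ==> x \<in> carrier M" "x \<in> hpart S H M ==> g \<notin> H ==> hc S M x g = \<zero>[M]"
 by (auto simp: hpart_def)

lemma hpart_comp: "h \<in> H ==> x \<in> gm_comp M h ==> x \<in> hpart S H M"
 using hc_of_comp[OF H_carrier] comp_carrier[OF H_carrier] by (auto simp: hpart_def)

lemma hpart_zero: "\<zero>[M] \<in> hpart S H M"
 by (simp add: hpart_def)

lemma hpart_add: "x \<in> hpart S H M ==> y \<in> hpart S H M ==> x \<oplus>[M] y \<in> hpart S H M"
 by (simp add: hpart_def hc_add)

lemma hpart_minus: "x \<in> hpart S H M ==> \<ominus>[M] x \<in> hpart S H M"
 using M.minus_equality[of "\<zero>[M]" "\<zero>[M]"] by (simp add: hpart_def hc_minus)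

lemma hpart_hc: "x \<in> hpart S H M ==> hc S M x g \<in> hpart S H M"
 using hpart_comp[of g "hc S M x g"] hc_comp[of x g] hpartD[of x] hpart_zero H_carrier
 by (cases "g \<in> H") auto

lemma hpart_smult:
 assumes r: "r \<in> hpart S H (reg S)" and x: "x \<in> hpart S H M"
 shows "r \<odot>[M] x \<in> hpart S H M"
proof -
 have rR: "r \<in> Rc S" and xM: "x \<in> carrier M" using r x by (auto simp: hpart_def)
 have "hc S M (r \<odot>[M] x) g = \<zero>[M]" if g: "g \<notin> H" for g
 proof (cases "g \<in> Gc S")
  case True
  have "hc S (reg S) r k \<odot>[M] hc S M x (inv[ga_grp S] k \<otimes>[ga_grp S] g) = \<zero>[M]"
   if "hc S (reg S) r k \<noteq> \<zero>[ga_ring S]" for k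
  proof -
   have k: "k \<in> H" using r that by (auto simp: hpart_def)
   then have "inv[ga_grp S] k \<in> H" using subgroup.m_inv_closed[OF H] by blast
   then have "inv[ga_grp S] k \<otimes>[ga_grp S] g \<notin> H" using H_cancel_l True g by blast
   then show ?thesis using hpartD(2)[OF x] Rg.hc_closed[of r k] rR by simp
  qed
  then show ?thesis unfolding hc_smult_gen[OF rR xM True] by (intro M.add.finprod_one_eqI) simp
 qed (simp add: hc_out rR xM)
 then show ?thesis using rR xM by (simp add: hpart_def)
qed

definition prH where "prH x = (\<Oplus>\<^bsub>M\<^esub>g\<in>{g. hc S M x g \<noteq> \<zero>[M]} \<inter> H. hc S M x g)"

lemma prH_closed [simp]: "x \<in> carrier M ==> prH x \<in> carrier M"
 unfolding prH_def by (rule M.finsum_closed) auto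

lemma hc_prH:
 assumes x: "x \<in> carrier M"
 shows "hc S M (prH x) g = (if g \<in> H then hc S M x g else \<zero>[M])"
proof -
 let ?A = "{g. hc S M x g \<noteq> \<zero>[M]} \<inter> H"
 have "hc S M (prH x) g = (\<Oplus>\<^bsub>M\<^esub>k\<in>?A. hc S M (hc S M x k) g)"
  unfolding prH_def by (rule hc_finsum) (use x in auto)
 also have "\<dots> = (\<Oplus>\<^bsub>M\<^esub>k\<in>?A. if g = k then hc S M x k else \<zero>[M])"
  by (rule M.finsum_cong') (use x in \<open>auto simp: hc_hc\<close>)
 also have "\<dots> = (if g \<in> H then hc S M x g else \<zero>[M])"
 proof (cases "g \<in> ?A")
  case True
  then show ?thesis using M.finsum_singleton[OF True, of "hc S M x"] hc_finite[OF x] x by auto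
 next
  case False
  then have "(\<Oplus>\<^bsub>M\<^esub>k\<in>?A. if g = k then hc S M x k else \<zero>[M]) = \<zero>[M]"
   by (intro M.add.finprod_one_eqI) auto
  then show ?thesis using False by auto
 qed
 finally show ?thesis .
qed

lemma prH_hpart: "x \<in> carrier M ==> prH x \<in> hpart S H M"
 by (simp add: hpart_def hc_prH)

lemma prH_add:
 assumes "x \<in> carrier M" "y \<in> carrier M"
 shows "prH (x \<oplus>[M] y) = prH x \<oplus>[M] prH y"
 by (rule eq_hcI) (use assms in \<open>auto simp: hc_prH hc_add\<close>)

lemma prH_id: "x \<in> hpart S H M ==> prH x = x"
 by (rule eq_hcI) (auto simp: hc_prH hpartD)

end

context grestr
begin

lemma grmodI: "graded_module S M ==> grmod S S' H M"
 by unfold_locales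

lemma R'_simps [simp]: "Rc S' = hpart S H (reg S)"
 "ring.add (ga_ring S') = ring.add (ga_ring S)" "ring.zero (ga_ring S') = ring.zero (ga_ring S)"
 "monoid.mult (ga_ring S') = monoid.mult (ga_ring S)" "one (ga_ring S') = one (ga_ring S)"
 "Gc S' = H" "monoid.mult (ga_grp S') = monoid.mult (ga_grp S)" "one (ga_grp S') = one (ga_grp S)"
 by (simp_all add: ring' grp')

lemma galg': "galg S'"
proof -
 interpret Rg: grmod S S' H "reg S" using reg by (rule grmodI)
 have sub: "hpart S H (reg S) <= Rc S" using Rg.hpartD(1) by auto
 have e: "ga_emb S c \<in> hpart S H (reg S)" for c
  using Rg.hpart_comp[OF subgroup.one_closed[OF H], of "ga_emb S c"] emb_deg by simp
 have inv: "\<ominus>[reg S] x = \<ominus>[ga_ring S] x" if "x \<in> Rc S" for x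
  using Rg.M.minus_equality[of "\<ominus>[ga_ring S] x" x] that by (simp add: Rg.R.l_neg)
 have "subcring (hpart S H (reg S)) (ga_ring S)"
 proof (rule Rg.R.subcringI'[OF Rg.R.subringI])
  show "\<one>[ga_ring S] \<in> hpart S H (reg S)" using e[of 1] emb_one by simp
  show "\<ominus>[ga_ring S] h \<in> hpart S H (reg S)" if "h \<in> hpart S H (reg S)" for h
   using Rg.hpart_minus[OF that] inv[of h] sub that by auto
 qed (use sub Rg.hpart_add Rg.hpart_smult in auto)
 then have cr: "cring (ga_ring S')" using Rg.R.subcring_iff[OF sub] by (simp add: ring')
 have gr: "comm_group (ga_grp S')"
  unfolding grp' using G.subgroup_imp_group[OF H] subgroup.subset[OF H] G.m_comm
  by (intro group.group_comm_groupI) auto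
 show ?thesis
 proof (rule galg.intro)
  show "r \<in> Rc S'" if "g \<in> Gc S'" "r \<in> ga_comp S' g" for g r
   using that comp' Rg.hpart_comp[of g r] by auto
 qed (use cr gr e emb_add emb_mult emb_one in \<open>auto simp: emb'\<close>)
qed

end

sublocale grestr \<subseteq> S': galg S' by (rule galg')

context grmod
begin

lemma res_module: "Module.module (ga_ring S') (res S H M)"
proof (rule moduleI[OF S'.rng])
 have R: "r \<in> Rc S" if "r \<in> Rc S'" for r using that by (auto simp: hpart_def)
 have M: "x \<in> carrier M" if "x \<in> carrier (res S H M)" for x using that hpartD(1) by simp
 show "r \<odot>[res S H M] x \<in> carrier (res S H M)" if "r \<in> Rc S'" "x \<in> carrier (res S H M)" for r x
  using that hpart_smult by simp
 show "(r \<oplus>[ga_ring S'] s) \<odot>[res S H M] x = r \<odot>[res S H M] x \<oplus>[res S H M] s \<odot>[res S H M] x"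
  if "r \<in> Rc S'" "s \<in> Rc S'" "x \<in> carrier (res S H M)" for r s x
  using R[OF that(1)] R[OF that(2)] M[OF that(3)] by (simp add: smult_l_distr)
 show "r \<odot>[res S H M] (x \<oplus>[res S H M] y) = r \<odot>[res S H M] x \<oplus>[res S H M] r \<odot>[res S H M] y"
  if "r \<in> Rc S'" "x \<in> carrier (res S H M)" "y \<in> carrier (res S H M)" for r x y
  using R[OF that(1)] M[OF that(2)] M[OF that(3)] by (simp add: smult_r_distr)
 show "(r \<otimes>[ga_ring S'] s) \<odot>[res S H M] x = r \<odot>[res S H M] (s \<odot>[res S H M] x)"
  if "r \<in> Rc S'" "s \<in> Rc S'" "x \<in> carrier (res S H M)" for r s x
  using R[OF that(1)] R[OF that(2)] M[OF that(3)] by (simp add: smult_assoc1)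
 show "\<one>[ga_ring S'] \<odot>[res S H M] x = x" if "x \<in> carrier (res S H M)" for x using M[OF that] by simp
 show "abelian_group (res S H M)"
 proof (rule abelian_groupI)
  fix x assume "x \<in> carrier (res S H M)"
  then show "\<exists>y\<in>carrier (res S H M). y \<oplus>[res S H M] x = \<zero>[res S H M]"
   using hpart_minus[of x] hpartD(1)[of x] M.l_neg[of x] by auto
 qed (use hpart_add hpart_zero hpartD(1) in \<open>auto simp: M.a_ac\<close>)
qed

lemma res_graded: "graded_module S' (res S H M)" "x \<in> hpart S H M ==> hc S' (res S H M) x = hc S M x"
proof -
 interpret N: Module.module "ga_ring S'" "res S H M" by (rule res_module)
 have dec: "is_dec S' (res S H M) x (hc S M x)" if x: "x \<in> hpart S H M" for x
 proof (rule is_decI[where A = "{g. hc S M x g \<noteq> \<zero>[M]}"])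
  have xM: "x \<in> carrier M" using hpartD x by blast
  show "finite {g. hc S M x g \<noteq> \<zero>[M]}" using hc_finite[OF xM] .
  show "hc S M x g \<in> gm_comp (res S H M) g" if "g \<in> Gc S'" for g
   using hc_comp[OF xM] H_carrier that by simp
  show "hc S M x g = \<zero>[res S H M]" if "g \<notin> Gc S'" for g using hpartD(2)[OF x] that by simp
  show "hc S M x g \<in> carrier (res S H M)" for g using hpart_hc[OF x] by simp
  have "finsum (res S H M) (hc S M x) {g. hc S M x g \<noteq> \<zero>[M]} = finsum M (hc S M x) {g. hc S M x g \<noteq> \<zero>[M]}"
   by (rule finsum_additive[where \<phi> = "%x. x"])
    (use hpart_hc[OF x] hpartD in \<open>auto intro: N.abelian_group_axioms M.abelian_group_axioms\<close>)
  then show "x = finsum (res S H M) (hc S M x) {g. hc S M x g \<noteq> \<zero>[M]}"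
   using hc_sum[OF xM hc_finite[OF xM]] by simp
 qed (auto intro: N.abelian_group_axioms)
 show gr: "graded_module S' (res S H M)"
 proof (rule graded_moduleI[where pr = "hc S M"])
  show "subgroup (gm_comp (res S H M) g) (add_monoid (res S H M))" if "g \<in> Gc S'" for g
  proof (rule N.M.add_subgroupI)
   have g: "g \<in> H" "g \<in> Gc S" using that H_carrier by auto
   show "gm_comp (res S H M) g <= carrier (res S H M)" using hpart_comp[OF g(1)] by auto
   fix x assume x: "x \<in> gm_comp (res S H M) g"
   then have "\<ominus>[M] x \<in> gm_comp M g" using comp_minus[OF g(2)] by auto
   moreover have "\<ominus>[res S H M] x = \<ominus>[M] x"
    using x N.M.minus_equality[of "\<ominus>[M] x" x] hpart_comp[OF g(1)] hpart_minus comp_carrier[OF g(2)]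
    by (auto simp: M.l_neg)
   ultimately show "\<ominus>[res S H M] x \<in> gm_comp (res S H M) g" by simp
  qed (use that H_carrier comp_zero comp_add in auto)
  show "r \<odot>[res S H M] x \<in> gm_comp (res S H M) (g \<otimes>[ga_grp S'] h)"
   if "g \<in> Gc S'" "h \<in> Gc S'" "r \<in> ga_comp S' g" "x \<in> gm_comp (res S H M) h" for g h r x
   using that comp_smult[of g h r x] H_carrier comp' by simp
  show "hc S M x g' = (if g' = g then x else \<zero>[res S H M])"
   if "g \<in> Gc S'" "x \<in> gm_comp (res S H M) g" for g g' x
   using hc_of_comp[of g x g'] H_carrier[of g] that by simp
 qed (use N.module_axioms dec hpartD hc_add in auto)
 interpret N': gmod S' "res S H M" using gr by unfold_locales
 show "x \<in> hpart S H M ==> hc S' (res S H M) x = hc S M x"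
  using N'.hc_unique[OF _ dec] by simp
qed

sublocale N: gmod S' "res S H M"
 using res_graded(1) by unfold_locales

lemma esc_res: "esc S' (res S H M) = esc S M"
 by (auto simp: esc_def emb' fun_eq_iff)

lemma klin_res: "klin M (esc S M) (res S H M) (esc S' (res S H M)) (Id_on (hpart S H M))"
 using hpartD(1) hpart_zero hpart_add N.sc_closed esc_res by (auto simp: klin_def)

lemma fd_res: "V <= hpart S H M ==> W <= hpart S H M ==> fd (res S H M) (esc S' (res S H M)) V W \<longleftrightarrow> fd M (esc S M) V W"
proof -
 assume V: "V <= hpart S H M" "W <= hpart S H M"
 have "(Id_on (hpart S H M))\<inverse> `` V = V" "(Id_on (hpart S H M))\<inverse> `` W = W"
  "Id_on (hpart S H M) `` V = V" "Id_on (hpart S H M) `` W = W" using V by auto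
 then show ?thesis
  using fd_vimage[OF kspace_axioms N.kspace_axioms klin_res, of V W]
   fd_image[OF kspace_axioms N.kspace_axioms klin_res, of V W] by metis
qed

lemma finsum_res: "c \<in> A \<rightarrow> hpart S H M ==> finsum (res S H M) c A = finsum M c A"
 by (rule finsum_additive[where \<phi> = "%x. x"])
  (use hpartD in \<open>auto intro: N.M.abelian_group_axioms M.abelian_group_axioms\<close>)

lemma ksub_hpart: "ksub M (esc S M) (hpart S H M)"
 using hpartD(1) hpart_zero hpart_add N.sc_closed esc_res by (auto simp: ksub_def)

end

locale grmod2 = M: grmod S S' H M + N: grmod S S' H N
 for S :: "('k::field, 'g, 'r) graded_algebra" and S' :: "('k, 'g, 'r) graded_algebra"
  and H :: "'g set" and M :: "('g, 'r, 'u) gmodule" and N :: "('g, 'r, 'v) gmodule"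
begin

sublocale MN: gmod2 S M N by unfold_locales
sublocale MN': gmod2 S' "res S H M" "res S H N" by unfold_locales

definition resrel where "resrel Ga = Ga \<inter> hpart S H M \<times> hpart S H N"

text \<open>A graded relation contains all pairs of components of its pairs, hence also the pair of
  projections to the degrees in \<open>H\<close>. So restriction loses no point of the domain that
  lies in the \<open>H\<close>-part.\<close>

lemma resrel_pr:
 assumes "glin S M N Ga" "(x, y) \<in> Ga"
 shows "(M.prH x, N.prH y) \<in> resrel Ga"
proof -
 have c: "x \<in> carrier M" "y \<in> carrier N" using MN.glinD[OF assms(1)] assms(2) by auto
 let ?A = "({g. hc S M x g \<noteq> \<zero>[M]} \<union> {g. hc S N y g \<noteq> \<zero>[N]}) \<inter> H"
 have fin: "finite ?A" using M.hc_finite[OF c(1)] N.hc_finite[OF c(2)] by auto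
 have "M.prH x = finsum M (hc S M x) ?A"
  unfolding M.prH_def by (rule M.M.add.finprod_mono_neutral_cong_left) (use fin c in auto)
 moreover have "N.prH y = finsum N (hc S N y) ?A"
  unfolding N.prH_def by (rule N.M.add.finprod_mono_neutral_cong_left) (use fin c in auto)
 moreover have "(finsum M (hc S M x) ?A, finsum N (hc S N y) ?A) \<in> Ga"
  by (rule MN.glin_finsum[OF assms(1)]) (rule MN.glinD(6)[OF assms])
 ultimately show ?thesis using M.prH_hpart[OF c(1)] N.prH_hpart[OF c(2)] by (simp add: resrel_def)
qed

lemma glin_resrel:
 assumes "glin S M N Ga"
 shows "glin S' (res S H M) (res S H N) (resrel Ga)"
 unfolding glin_def resrel_def
proof (intro conjI allI impI ballI)
 show "Ga \<inter> hpart S H M \<times> hpart S H N <= carrier (res S H M) \<times> carrier (res S H N)" by auto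
next
 fix g x y assume a: "(x, y) \<in> Ga \<inter> hpart S H M \<times> hpart S H N"
 then show "(hc S' (res S H M) x g, hc S' (res S H N) y g) \<in> Ga \<inter> hpart S H M \<times> hpart S H N"
  using MN.glinD(6)[OF assms, of x y g] M.res_graded(2) N.res_graded(2) M.hpart_hc N.hpart_hc by auto
next
 fix r x y assume "r \<in> Rc S'" "(x, y) \<in> Ga \<inter> hpart S H M \<times> hpart S H N"
 then show "(r \<odot>[res S H M] x, r \<odot>[res S H N] y) \<in> Ga \<inter> hpart S H M \<times> hpart S H N"
  using MN.glinD(5)[OF assms] M.hpart_smult N.hpart_smult by (auto simp: hpart_def)
qed (use MN.glinD[OF assms] M.hpart_zero N.hpart_zero M.hpart_add N.hpart_add in auto)

lemma Domain_resrel: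
 assumes "glin S M N Ga"
 shows "Domain (resrel Ga) = hpart S H M \<inter> Domain Ga"
proof
 show "hpart S H M \<inter> Domain Ga <= Domain (resrel Ga)"
 proof clarify
  fix x y assume "x \<in> hpart S H M" "(x, y) \<in> Ga"
  then show "x \<in> Domain (resrel Ga)" using resrel_pr[OF assms, of x y] M.prH_id by auto
 qed
qed (auto simp: resrel_def)

lemma grel_resrel:
 assumes "grel S M N Ga"
 shows "grel S' (res S H M) (res S H N) (resrel Ga)"
proof -
 have l: "glin S M N Ga" using assms by (simp add: grel_def)
 have "fd M (esc S M) (hpart S H M \<inter> carrier M) (hpart S H M \<inter> Domain Ga)"
  using M.fd_Int[OF _ M.ksub_hpart] assms by (simp add: grel_def)
 moreover have "hpart S H M \<inter> carrier M = hpart S H M" using M.hpartD by auto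
 ultimately have 1: "fd (res S H M) (esc S' (res S H M)) (carrier (res S H M)) (Domain (resrel Ga))"
  using M.fd_res[of "hpart S H M" "hpart S H M \<inter> Domain Ga"] Domain_resrel[OF l] by simp
 have sub: "resrel Ga `` {\<zero>[M]} <= Ga `` {\<zero>[M]}" "resrel Ga `` {\<zero>[M]} <= hpart S H N" by (auto simp: resrel_def)
 have "fd N (esc S N) (resrel Ga `` {\<zero>[M]}) {\<zero>[N]}"
  by (rule fd_mono[OF _ sub(1) subset_refl]) (use assms in \<open>simp add: grel_def\<close>)
 then have "fd (res S H N) (esc S' (res S H N)) (resrel Ga `` {\<zero>[res S H M]}) {\<zero>[res S H N]}"
  using N.fd_res[OF sub(2), of "{\<zero>[N]}"] N.hpart_zero by simp
 then show ?thesis using 1 glin_resrel[OF l] by (simp add: grel_def)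
qed

text \<open>The largest graded relation with given restriction; it inverts \<open>resrel\<close> on morphisms.\<close>

definition star where
 "star Ga = {(x, y) \<in> carrier M \<times> carrier N. \<forall>g\<in>Gc S. \<forall>g'\<in>Gc S.
   g' \<otimes>[ga_grp S] g \<in> H --> (\<forall>s\<in>ga_comp S g'. (s \<odot>[M] hc S M x g, s \<odot>[N] hc S N y g) \<in> Ga)}"

lemma starD:
 assumes "(x, y) \<in> star Ga" "g \<in> Gc S" "g' \<in> Gc S" "g' \<otimes>[ga_grp S] g \<in> H" "s \<in> ga_comp S g'"
 shows "(s \<odot>[M] hc S M x g, s \<odot>[N] hc S N y g) \<in> Ga"
 using assms unfolding star_def by blast

lemma star_mono: "Ga <= Da ==> star Ga <= star Da"
 unfolding star_def by blast

text \<open>The delicate closure is that under an arbitrary, inhomogeneous ring element; it is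
  reduced to homogeneous multipliers by the convolution formula.\<close>

lemma glin_star:
 assumes Ga: "glin S' (res S H M) (res S H N) Ga"
 shows "glin S M N (star Ga)"
proof -
 have z: "(\<zero>[M], \<zero>[N]) \<in> Ga" using MN'.glinD(3)[OF Ga] by simp
 have ad: "(x \<oplus>[M] x', y \<oplus>[N] y') \<in> Ga" if "(x, y) \<in> Ga" "(x', y') \<in> Ga" for x y x' y'
  using MN'.glinD(4)[OF Ga that] by simp
 have cl: "s \<in> Rc S" if "g \<in> Gc S" "s \<in> ga_comp S g" for s g
  using M.ga_comp_closed that by blast
 show ?thesis unfolding glin_def
 proof (intro conjI allI impI ballI)
  show "star Ga <= carrier M \<times> carrier N" by (auto simp: star_def)
  show "(\<zero>[M], \<zero>[N]) \<in> star Ga" using z cl by (auto simp: star_def)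
 next
  fix x y x' y' assume "(x, y) \<in> star Ga" "(x', y') \<in> star Ga"
  then have c: "x \<in> carrier M" "y \<in> carrier N" "x' \<in> carrier M" "y' \<in> carrier N"
   and d: "\<And>g g' s. g \<in> Gc S ==> g' \<in> Gc S ==> g' \<otimes>[ga_grp S] g \<in> H ==> s \<in> ga_comp S g' ==>
    (s \<odot>[M] hc S M x g, s \<odot>[N] hc S N y g) \<in> Ga \<and> (s \<odot>[M] hc S M x' g, s \<odot>[N] hc S N y' g) \<in> Ga"
   by (auto simp: star_def)
  have "(s \<odot>[M] hc S M (x \<oplus>[M] x') g, s \<odot>[N] hc S N (y \<oplus>[N] y') g) \<in> Ga"
   if g: "g \<in> Gc S" "g' \<in> Gc S" "g' \<otimes>[ga_grp S] g \<in> H" "s \<in> ga_comp S g'" for g g' s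
   using ad d[OF g] cl[OF g(2,4)] c by (simp add: M.hc_add N.hc_add M.smult_r_distr N.smult_r_distr)
  then show "(x \<oplus>[M] x', y \<oplus>[N] y') \<in> star Ga" using c by (simp add: star_def)
 next
  fix g x y assume "(x, y) \<in> star Ga"
  then show "(hc S M x g, hc S N y g) \<in> star Ga"
   using z cl by (auto simp: star_def M.hc_hc N.hc_hc)
 next
  fix r x y assume r: "r \<in> Rc S" and xy: "(x, y) \<in> star Ga"
  then have c: "x \<in> carrier M" "y \<in> carrier N" by (auto simp: star_def)
  let ?A = "{k. hc S (reg S) r k \<noteq> \<zero>[ga_ring S]}"
  have A: "k \<in> Gc S" "hc S (reg S) r k \<in> ga_comp S k" "hc S (reg S) r k \<in> Rc S" if "k \<in> ?A" for k
   using M.Rg.hc_supp[of r] M.Rg.hc_comp[of r k] M.Rg.hc_closed[of r k] r that by auto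
  have "(s \<odot>[M] hc S M (r \<odot>[M] x) g, s \<odot>[N] hc S N (r \<odot>[N] y) g) \<in> Ga"
   if g: "g \<in> Gc S" "g' \<in> Gc S" "g' \<otimes>[ga_grp S] g \<in> H" and s: "s \<in> ga_comp S g'" for g g' s
  proof -
   have sR: "s \<in> Rc S" using cl g(2) s by blast
   \<comment> \<open>The multiplier \<open>?t k\<close> has degree \<open>g'\<close> times
     \<open>k\<close> and acts on the component of degree \<open>?q k\<close>; the product of these
     degrees is again that of \<open>g'\<close> and \<open>g\<close>, so it lies in
     \<open>H\<close>.\<close>
   let ?t = "%k. s \<otimes>[ga_ring S] hc S (reg S) r k" and ?q = "%k. inv[ga_grp S] k \<otimes>[ga_grp S] g"
   have eM: "s \<odot>[M] hc S M (r \<odot>[M] x) g = (\<Oplus>\<^bsub>M\<^esub>k\<in>?A. ?t k \<odot>[M] hc S M x (?q k))"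
   proof -
    have "s \<odot>[M] hc S M (r \<odot>[M] x) g = (\<Oplus>\<^bsub>M\<^esub>k\<in>?A. s \<odot>[M] (hc S (reg S) r k \<odot>[M] hc S M x (?q k)))"
     unfolding M.hc_smult_gen[OF r c(1) g(1)]
     by (rule finsum_additive) (use sR A c in \<open>auto intro: M.M.abelian_group_axioms simp: M.smult_r_distr\<close>)
    also have "\<dots> = (\<Oplus>\<^bsub>M\<^esub>k\<in>?A. ?t k \<odot>[M] hc S M x (?q k))"
     by (rule M.M.finsum_cong') (use sR A c in \<open>auto simp: M.smult_assoc1\<close>)
    finally show ?thesis .
   qed
   have eN: "s \<odot>[N] hc S N (r \<odot>[N] y) g = (\<Oplus>\<^bsub>N\<^esub>k\<in>?A. ?t k \<odot>[N] hc S N y (?q k))"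
   proof -
    have "s \<odot>[N] hc S N (r \<odot>[N] y) g = (\<Oplus>\<^bsub>N\<^esub>k\<in>?A. s \<odot>[N] (hc S (reg S) r k \<odot>[N] hc S N y (?q k)))"
     unfolding N.hc_smult_gen[OF r c(2) g(1)]
     by (rule finsum_additive) (use sR A c in \<open>auto intro: N.M.abelian_group_axioms simp: N.smult_r_distr\<close>)
    also have "\<dots> = (\<Oplus>\<^bsub>N\<^esub>k\<in>?A. ?t k \<odot>[N] hc S N y (?q k))"
     by (rule N.M.finsum_cong') (use sR A c in \<open>auto simp: N.smult_assoc1\<close>)
    finally show ?thesis .
   qed
   have t: "(?t k \<odot>[M] hc S M x (?q k), ?t k \<odot>[N] hc S N y (?q k)) \<in> Ga" if k: "k \<in> ?A" for k
   proof -
    have "?t k \<in> ga_comp S (g' \<otimes>[ga_grp S] k)" using M.Rg.comp_smult[OF g(2) A(1)[OF k] s] A(2)[OF k] by simp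
    moreover have "(g' \<otimes>[ga_grp S] k) \<otimes>[ga_grp S] ?q k = g' \<otimes>[ga_grp S] g"
    proof -
     have "(g' \<otimes>[ga_grp S] k) \<otimes>[ga_grp S] ?q k = g' \<otimes>[ga_grp S] ((k \<otimes>[ga_grp S] inv[ga_grp S] k) \<otimes>[ga_grp S] g)"
      using g A(1)[OF k] M.G.inv_closed[OF A(1)[OF k]] by (simp only: M.G.m_assoc M.G.m_closed)
     then show ?thesis using g A(1)[OF k] by simp
    qed
    ultimately show ?thesis using starD[OF xy, of "?q k" "g' \<otimes>[ga_grp S] k" "?t k"] g A(1)[OF k] by simp
   qed
   have f: "(%k. ?t k \<odot>[M] hc S M x (?q k)) \<in> ?A \<rightarrow> hpart S H M" "(%k. ?t k \<odot>[N] hc S N y (?q k)) \<in> ?A \<rightarrow> hpart S H N"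
    using MN'.glinD(1)[OF Ga t] MN'.glinD(2)[OF Ga t] by auto
   show ?thesis unfolding eM eN
    using MN'.glin_finsum[OF Ga, of ?A "%k. ?t k \<odot>[M] hc S M x (?q k)" "%k. ?t k \<odot>[N] hc S N y (?q k)"] t
    unfolding M.finsum_res[OF f(1)] N.finsum_res[OF f(2)] by blast
  qed
  then show "(r \<odot>[M] x, r \<odot>[N] y) \<in> star Ga" using r c by (auto simp: star_def)
 qed
qed

text \<open>If \<open>g\<close> lies in \<open>H\<close>, so does \<open>g'\<close>, and
  \<open>s\<close> belongs to the small ring, under which \<open>Ga\<close> is stable; if
  \<open>g\<close> lies outside, both components vanish.\<close>

lemma sub_star:
 assumes "glin S' (res S H M) (res S H N) Ga"
 shows "Ga <= star Ga"
proof clarify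
 fix x y assume xy: "(x, y) \<in> Ga"
 have h: "x \<in> hpart S H M" "y \<in> hpart S H N" using MN'.glinD(1,2)[OF assms xy] by auto
 have c: "x \<in> carrier M" "y \<in> carrier N" using h M.hpartD N.hpartD by auto
 have "(s \<odot>[M] hc S M x g, s \<odot>[N] hc S N y g) \<in> Ga"
  if g: "g \<in> Gc S" "g' \<in> Gc S" "g' \<otimes>[ga_grp S] g \<in> H" and s: "s \<in> ga_comp S g'" for g g' s
 proof (cases "g \<in> H")
  case True
  then have "g' \<in> H" using M.H_cancel_r g by blast
  then have "s \<in> Rc S'" using M.Rg.gm s M.S'.ga_comp_closed[of g' s] M.comp' by simp
  then show ?thesis using MN'.glinD(5)[OF assms _ MN'.glinD(6)[OF assms xy, of g]] M.res_graded(2)[OF h(1)] N.res_graded(2)[OF h(2)] by simp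
 next
  case False
  then show ?thesis using M.hpartD(2)[OF h(1)] N.hpartD(2)[OF h(2)] MN'.glinD(3)[OF assms] M.ga_comp_closed[OF g(2) s] by simp
 qed
 then show "(x, y) \<in> star Ga" using c by (auto simp: star_def)
qed

lemma resrel_star:
 assumes "glin S' (res S H M) (res S H N) Ga"
 shows "resrel (star Ga) = Ga"
proof
 show "Ga <= resrel (star Ga)" using sub_star[OF assms] assms by (auto simp: resrel_def glin_def)
next
 show "resrel (star Ga) <= Ga"
 proof clarify
  fix x y assume xy: "(x, y) \<in> resrel (star Ga)"
  then have h: "x \<in> hpart S H M" "y \<in> hpart S H N" and st: "(x, y) \<in> star Ga" by (auto simp: resrel_def)
  have c: "x \<in> carrier M" "y \<in> carrier N" using h M.hpartD N.hpartD by auto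
  have one: "\<one>[ga_ring S] \<in> ga_comp S \<one>[ga_grp S]" using M.emb_deg[of 1] M.emb_one by simp
  let ?A = "{g. hc S M x g \<noteq> \<zero>[M]} \<union> {g. hc S N y g \<noteq> \<zero>[N]}"
  have "(hc S M x g, hc S N y g) \<in> Ga" if "g \<in> ?A" for g
  proof -
   have g: "g \<in> H" using that M.hpartD(2)[OF h(1)] N.hpartD(2)[OF h(2)] by auto
   moreover have "\<one>[ga_grp S] \<otimes>[ga_grp S] g \<in> H" using g M.H_carrier[OF g] by simp
   ultimately have "(\<one>[ga_ring S] \<odot>[M] hc S M x g, \<one>[ga_ring S] \<odot>[N] hc S N y g) \<in> Ga"
    using st one M.H_carrier[OF g] M.G.one_closed unfolding star_def by blast
   then show ?thesis using c by simp
  qed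
  then have "(finsum (res S H M) (hc S M x) ?A, finsum (res S H N) (hc S N y) ?A) \<in> Ga"
   using MN'.glin_finsum[OF assms] by blast
  moreover have "finsum (res S H M) (hc S M x) ?A = x"
   using M.finsum_res[of "hc S M x" ?A] M.hpart_hc[OF h(1)] M.hc_sum[OF c(1), of ?A] M.hc_finite[OF c(1)] N.hc_finite[OF c(2)] by auto
  moreover have "finsum (res S H N) (hc S N y) ?A = y"
   using N.finsum_res[of "hc S N y" ?A] N.hpart_hc[OF h(2)] N.hc_sum[OF c(2), of ?A] M.hc_finite[OF c(1)] N.hc_finite[OF c(2)] by auto
  ultimately show "(x, y) \<in> Ga" by simp
 qed
qed

lemma star_resrel:
 assumes "glin S M N Ga"
 shows "Ga <= star (resrel Ga)"
proof clarify
 fix x y assume xy: "(x, y) \<in> Ga"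
 have c: "x \<in> carrier M" "y \<in> carrier N" using MN.glinD(1,2)[OF assms xy] by auto
 have "(s \<odot>[M] hc S M x g, s \<odot>[N] hc S N y g) \<in> resrel Ga"
  if g: "g \<in> Gc S" "g' \<in> Gc S" "g' \<otimes>[ga_grp S] g \<in> H" and s: "s \<in> ga_comp S g'" for g g' s
  using MN.glinD(5)[OF assms M.ga_comp_closed[OF g(2) s] MN.glinD(6)[OF assms xy]]
   M.hpart_comp[OF g(3) M.comp_smult[OF g(2,1) s M.hc_comp[OF c(1) g(1)]]]
   N.hpart_comp[OF g(3) N.comp_smult[OF g(2,1) s N.hc_comp[OF c(2) g(1)]]] by (simp add: resrel_def)
 then show "(x, y) \<in> star (resrel Ga)" using c by (auto simp: star_def)
qed

end

section \<open>Finite codimension of saturations\<close>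

text \<open>A decreasing sequence of naturals is constant beyond a place where its minimum is
  attained. Applied once per coordinate, this is Dickson's lemma for triples.\<close>

lemma nat_incseq_subseq:
 fixes f :: "nat => nat"
 shows "\<exists>r. strict_mono (r :: nat => nat) \<and> (\<forall>m n. m \<le> n --> f (r m) \<le> f (r n))"
proof -
 obtain r where r: "strict_mono r" "monoseq (%n. f (r n))" using seq_monosub[of f] by blast
 show ?thesis
 proof (cases "\<forall>m n. m \<le> n --> f (r m) \<le> f (r n)")
  case True
  then show ?thesis using r by blast
 next
  case False
  then have dec: "f (r n) \<le> f (r m)" if "m \<le> n" for m n using r(2) that unfolding monoseq_def by blast
  obtain N where N: "\<And>n. f (r N) \<le> f (r n)"
   using ex_has_least_nat[of "%_. True" _ "%n. f (r n)"] by auto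
  have "strict_mono (%n. r (N + n))" using r(1) by (auto simp: strict_mono_def)
  moreover have "f (r (N + m)) \<le> f (r (N + n))" for m n
   using dec[of N "N + m"] N[of "N + n"] by simp
  ultimately show ?thesis by blast
 qed
qed

text \<open>An infinite gap would contain a sequence that is nondecreasing in every coordinate. Its
  first term, moved by \<open>e\<close> in any direction, lies in the upward closed
  \<open>U\<close>, which confines all later terms to a finite box.\<close>

lemma finite_saturation_gap:
 fixes U :: "(nat \<times> nat \<times> nat) set"
 assumes up: "\<And>a b c d. (a, b, c) \<in> U ==> (a + d, b, c) \<in> U \<and> (a, b + d, c) \<in> U \<and> (a, b, c + d) \<in> U"
 shows "finite {(a, b, c). (a, b, c) \<notin> U \<and> (a + e, b, c) \<in> U \<and> (a, b + e, c) \<in> U \<and> (a, b, c + e) \<in> U}"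
  (is "finite ?D")
proof (rule ccontr)
 assume "infinite ?D"
 from infinite_countable_subset[OF this]
 obtain f :: "nat => nat \<times> nat \<times> nat" where f: "inj f" "range f <= ?D"
  by (elim exE conjE)
 define p where "p x = fst x" for x :: "nat \<times> nat \<times> nat"
 define q where "q x = fst (snd x)" for x :: "nat \<times> nat \<times> nat"
 define s where "s x = snd (snd x)" for x :: "nat \<times> nat \<times> nat"
 obtain r1 :: "nat => nat" where r1: "strict_mono r1" "\<forall>m n. m \<le> n --> p (f (r1 m)) \<le> p (f (r1 n))"
  using nat_incseq_subseq[of "%n. p (f n)"] by (elim exE conjE)
 obtain r2 :: "nat => nat" where r2: "strict_mono r2" "\<forall>m n. m \<le> n --> q (f (r1 (r2 m))) \<le> q (f (r1 (r2 n)))"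
  using nat_incseq_subseq[of "%n. q (f (r1 n))"] by (elim exE conjE)
 obtain r3 :: "nat => nat" where r3: "strict_mono r3" "\<forall>m n. m \<le> n --> s (f (r1 (r2 (r3 m)))) \<le> s (f (r1 (r2 (r3 n))))"
  using nat_incseq_subseq[of "%n. s (f (r1 (r2 n)))"] by (elim exE conjE)
 define g where "g n = f (r1 (r2 (r3 n)))" for n
 have inj: "inj g"
  by (simp add: inj_def g_def inj_eq[OF f(1)] strict_mono_eq[OF r1(1)] strict_mono_eq[OF r2(1)] strict_mono_eq[OF r3(1)])
 have gD: "g n \<in> ?D" for n unfolding g_def by (rule subsetD[OF f(2)]) (rule rangeI)
 have mono: "p (g 0) \<le> p (g n)" "q (g 0) \<le> q (g n)" "s (g 0) \<le> s (g n)" for n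
  unfolding g_def using r1(2) r2(2) r3(2) strict_mono_less_eq[OF r2(1)] strict_mono_less_eq[OF r3(1)] by auto
 have g0: "(p (g 0) + e, q (g 0), s (g 0)) \<in> U" "(p (g 0), q (g 0) + e, s (g 0)) \<in> U" "(p (g 0), q (g 0), s (g 0) + e) \<in> U"
  using gD[of 0] by (auto simp: p_def q_def s_def)
 have up': "(a', b', c') \<in> U" if "(a, b, c) \<in> U" "a \<le> a'" "b \<le> b'" "c \<le> c'" for a b c a' b' c'
 proof -
  have "(a + (a' - a), b, c) \<in> U" using up that(1) by blast
  then have "(a', b + (b' - b), c) \<in> U" using up that(2) by auto
  then have "(a', b', c + (c' - c)) \<in> U" using up that(3) by auto
  then show ?thesis using that(4) by auto
 qed
 have gn: "(p (g n), q (g n), s (g n)) \<notin> U" for n using gD[of n] by (auto simp: p_def q_def s_def)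
 have bd: "p (g n) < p (g 0) + e" "q (g n) < q (g 0) + e" "s (g n) < s (g 0) + e" for n
  using up'[OF g0(1), of "p (g n)" "q (g n)" "s (g n)"] up'[OF g0(2), of "p (g n)" "q (g n)" "s (g n)"]
   up'[OF g0(3), of "p (g n)" "q (g n)" "s (g n)"] gn[of n] mono[of n] by (auto simp: not_less[symmetric])
 have "range g <= {..<p (g 0) + e} \<times> {..<q (g 0) + e} \<times> {..<s (g 0) + e}"
 proof
  fix x assume "x \<in> range g"
  then obtain n where n: "x = g n" by blast
  have "x = (p (g n), q (g n), s (g n))" by (simp add: n p_def q_def s_def)
  then show "x \<in> {..<p (g 0) + e} \<times> {..<q (g 0) + e} \<times> {..<s (g 0) + e}" using bd[of n] by simp
 qed
 then have "finite (range g)" by (rule finite_subset) auto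
 then show False using inj finite_imageD by blast
qed

section \<open>Spans over the field and leading exponents\<close>

inductive_set kspan :: "('u, 'b) ring_scheme => ('k => 'u => 'u) => 'u set => 'u set" for M sc B where
 kspan_zero: "\<zero>[M] \<in> kspan M sc B"
| kspan_step: "b \<in> B ==> x \<in> kspan M sc B ==> sc c b \<oplus>[M] x \<in> kspan M sc B"

lemma kspan_mono: "x \<in> kspan M sc B ==> B <= C ==> x \<in> kspan M sc C"
 by (induction rule: kspan.induct) (auto intro: kspan.intros)

context kspace
begin

lemma kspan_closed: "x \<in> kspan M sc B ==> B <= carrier M ==> x \<in> carrier M"
 by (induction rule: kspan.induct) auto

lemma ksub_kspan:
 assumes B: "B <= carrier M"
 shows "ksub M sc (kspan M sc B)"
 unfolding ksub_def
proof (intro conjI ballI allI subsetI)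
 fix x y assume x: "x \<in> kspan M sc B" and y: "y \<in> kspan M sc B"
 show "x \<oplus> y \<in> kspan M sc B" using x
 proof (induction rule: kspan.induct)
  case (kspan_step b x c)
  have "sc c b \<oplus> x \<oplus> y = sc c b \<oplus> (x \<oplus> y)"
   using kspan_step B kspan_closed[OF kspan_step(2) B] kspan_closed[OF y B] by (simp add: a_assoc subset_iff)
  then show ?case using kspan.kspan_step[OF kspan_step(1) kspan_step.IH, of c] by simp
 qed (use y kspan_closed[OF y B] in simp)
next
 fix d x assume x: "x \<in> kspan M sc B"
 then show "sc d x \<in> kspan M sc B"
 proof (induction rule: kspan.induct)
  case (kspan_step b x c)
  have "sc d (sc c b \<oplus> x) = sc (d * c) b \<oplus> sc d x"
   using kspan_step B kspan_closed[OF kspan_step(2) B] by (simp add: sc_add mult_sc subset_iff)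
  then show ?case using kspan.kspan_step[OF kspan_step(1) kspan_step.IH, of "d * c"] by simp
 qed (simp add: kspan.kspan_zero)
qed (use kspan_closed B in \<open>auto intro: kspan.kspan_zero\<close>)

lemma kspan_base: "B <= carrier M ==> b \<in> B ==> b \<in> kspan M sc B"
 using kspan.kspan_step[of b B \<zero> M sc 1] kspan.kspan_zero[of M sc B] by (simp add: subset_iff)

lemma kspan_least: "ksub M sc V ==> B <= V ==> x \<in> kspan M sc B ==> x \<in> V"
 by (erule kspan.induct) (auto simp: ksub_def)

text \<open>Later adjoins to \<open>K\<close> one element for each leading exponent in a finite
  gap.\<close>

lemma finite_fd_extension:
 assumes "finite D" "t ` D <= carrier M" "ksub M sc K"
 shows "\<exists>Y. ksub M sc Y \<and> K <= Y \<and> t ` D <= Y \<and> fd M sc Y K"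
 using assms(1,2)
proof (induction D rule: finite_induct)
 case empty
 then show ?case using assms(3) by (auto intro: fd.fd_base)
next
 case (insert d D)
 then obtain Y where Y: "ksub M sc Y" "K <= Y" "t ` D <= Y" "fd M sc Y K" by auto
 have td: "t d \<in> carrier M" using insert by simp
 let ?L = "kspan M sc {t d}"
 have L: "ksub M sc ?L" "t d \<in> ?L" using ksub_kspan[of "{t d}"] kspan_base[of "{t d}"] td by auto
 have line: "\<exists>c. x = sc c (t d)" if "x \<in> ?L" for x
  using that
 proof (induction rule: kspan.induct)
  case kspan_zero
  then show ?case using zero_sc[OF td] by metis
 next
  case (kspan_step b x c)
  then obtain c' where "x = sc c' (t d)" by blast
  then have "sc c b \<oplus> x = sc (c + c') (t d)" using kspan_step td by (simp add: add_sc)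
  then show ?case by blast
 qed
 have "fd M sc (?L <+>[M] Y) K"
 proof (rule fd.fd_step[OF Y(4,1) td], intro ballI)
  fix x assume "x \<in> ?L <+>[M] Y"
  then obtain l y where *: "l \<in> ?L" "y \<in> Y" "x = l \<oplus> y" by (auto simp: set_add_iff)
  obtain c where "l = sc c (t d)" using line[OF *(1)] by blast
  then show "\<exists>c. \<exists>x\<^sub>0\<in>Y. x = sc c (t d) \<oplus> x\<^sub>0" using * by blast
 qed
 then show ?case using ksub_set_add[OF L(1) Y(1)] subset_set_add[OF L(1) Y(1)] L(2) Y(2,3)
  by (intro exI[of _ "?L <+>[M] Y"]) auto
qed

end

definition mon :: "('r, 'b) ring_scheme => (nat => 'r) => nat \<times> nat \<times> nat => 'r" where
 "mon R \<xi> m = (case m of (a, b, c) => \<xi> 0 [^][R] a \<otimes>[R] (\<xi> 1 [^][R] b \<otimes>[R] \<xi> 2 [^][R] c))"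

text \<open>The effect on exponents of multiplication by \<open>\<xi> j\<close> to the power
  \<open>d\<close>. A quadruple stands for a generator index followed by the exponent of a
  monomial.\<close>

fun shift :: "nat => nat => nat \<times> nat \<times> nat \<times> nat => nat \<times> nat \<times> nat \<times> nat" where
 "shift j d (i, a, b, c) = (if j = 0 then (i, a + d, b, c) else if j = 1 then (i, a, b + d, c) else (i, a, b, c + d))"

lemma shift_mono: "\<nu> < \<mu> ==> shift j d \<nu> < shift j d \<mu>"
 by (cases \<nu>; cases \<mu>) (auto simp: less_prod_def)

lemma fst_shift [simp]: "fst (shift j d \<mu>) = fst \<mu>"
 by (cases \<mu>) auto

text \<open>A finitely generated module is spanned by monomial multiples of the generators. With respect to
 the lexicographic order, an element of \<open>T\<close> whose leading term is not one of \<open>K\<close> has its leading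
 exponent in a finite gap between two sets closed under multiplication.\<close>

lemma (in gmod) saturation_fd:
 assumes \<xi>: "\<And>i. i < 3 ==> \<xi> i \<in> Rc S"
  and sp: "\<And>r. r \<in> Rc S ==> r \<in> kspan (reg S) (esc S (reg S)) (range (mon (ga_ring S) \<xi>))"
  and B: "finite B" "B <= carrier M" "carrier M <= rspan (ga_ring S) M B"
  and K: "K <= carrier M" "\<zero>[M] \<in> K" "\<And>x y. x \<in> K ==> y \<in> K ==> x \<oplus>[M] y \<in> K"
   "\<And>r x. r \<in> Rc S ==> x \<in> K ==> r \<odot>[M] x \<in> K"
 shows "fd M (esc S M) {x \<in> carrier M. \<forall>i<3. \<xi> i [^][ga_ring S] (e::nat) \<odot>[M] x \<in> K} K"
  (is "fd M ?sc ?T K")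
proof -
 have kK: "ksub M ?sc K" using K by (auto simp: ksub_def esc_def)
 have pw: "\<xi> i [^][ga_ring S] (d::nat) \<in> Rc S" if "i < 3" for i d using \<xi>[OF that] by simp
 have mon_cl: "mon (ga_ring S) \<xi> m \<in> Rc S" for m
  unfolding mon_def using pw[of 0] pw[of 1] pw[of 2] by (auto split: prod.splits)
 have smsc: "r \<odot>[M] ?sc c x = ?sc c (r \<odot>[M] x)" if "r \<in> Rc S" "x \<in> carrier M" for r c x
  unfolding esc_def using that by (simp add: smult_assoc1[symmetric] R.m_comm)
 have kT: "ksub M ?sc ?T"
  unfolding ksub_def
 proof (intro conjI ballI allI)
  show "\<zero>[M] \<in> ?T" using pw K(2) by auto
  fix x y assume x: "x \<in> ?T" and y: "y \<in> ?T"
  show "x \<oplus>[M] y \<in> ?T" using x y pw K(3) by (auto simp: smult_r_distr)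
 next
  fix c x assume x: "x \<in> ?T"
  show "?sc c x \<in> ?T" using x pw smsc kK by (auto simp: ksub_def)
 qed auto
 have KT: "K <= ?T" using K(1,4) pw by auto
 obtain n and b :: "nat => 'u" where b: "B = b ` {..<n}"
  using finite_imp_nat_seg_image_inj_on[OF B(1)] by (auto simp: lessThan_def)
 have bc: "b i \<in> carrier M" if "i < n" for i using b B(2) that by auto
 define v where "v \<mu> = mon (ga_ring S) \<xi> (snd \<mu>) \<odot>[M] b (fst \<mu>)" for \<mu>
 have vc: "v \<mu> \<in> carrier M" if "fst \<mu> < n" for \<mu> unfolding v_def using mon_cl bc that by simp
 \<comment> \<open>The elements with a representation by terms strictly before \<open>\<mu>\<close>.
   As the generator index comes first, \<open>(n, 0, 0, 0)\<close> bounds all terms.\<close>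
 define low where "low \<mu> = kspan M ?sc (v ` {\<nu>. \<nu> < \<mu> \<and> fst \<nu> < n})" for \<mu>
 have lowV: "v ` {\<nu>. \<nu> < \<mu> \<and> fst \<nu> < n} <= carrier M" for \<mu> using vc by auto
 have klow: "ksub M ?sc (low \<mu>)" for \<mu> unfolding low_def by (rule ksub_kspan[OF lowV])
 have lowc: "x \<in> carrier M" if "x \<in> low \<mu>" for x \<mu> using that klow[of \<mu>] by (auto simp: ksub_def)
 have low_mono: "x \<in> low \<mu>" if "x \<in> low \<nu>" "\<nu> \<le> \<mu>" for x \<mu> \<nu>
  using that(1) unfolding low_def by (rule kspan_mono) (use that(2) in auto)
 have low_v: "v \<nu> \<in> low \<mu>" if "\<nu> < \<mu>" "fst \<nu> < n" for \<nu> \<mu>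
  unfolding low_def by (rule kspan_base[OF lowV]) (use that in auto)
 have all_low: "x \<in> low (n, 0, 0, 0)" if x: "x \<in> carrier M" for x
 proof -
  have "rspan (ga_ring S) M B <= low (n, 0, 0, 0)"
  proof
   fix x assume "x \<in> rspan (ga_ring S) M B"
   then show "x \<in> low (n, 0, 0, 0)"
   proof (induction rule: rspan.induct)
    case rspan_zero
    then show ?case using klow by (simp add: ksub_def)
   next
    case (rspan_step r c x)
    obtain i where i: "c = b i" "i < n" using rspan_step(2) b by auto
    have "r \<in> kspan (reg S) (esc S (reg S)) (range (mon (ga_ring S) \<xi>))" using sp rspan_step(1) .
    then have "r \<in> Rc S \<and> r \<odot>[M] c \<in> low (n, 0, 0, 0)"
    proof (induction rule: kspan.induct)
     case kspan_zero
     then show ?case using i bc klow by (simp add: ksub_def)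
    next
     case (kspan_step m r a)
     obtain m' where m': "m = mon (ga_ring S) \<xi> m'" using kspan_step(1) by auto
     have "(esc S (reg S) a m \<oplus>[reg S] r) \<odot>[M] c = ?sc a (v (i, m')) \<oplus>[M] r \<odot>[M] c"
      using kspan_step m' mon_cl i bc by (simp add: esc_def v_def smult_l_distr smult_assoc1)
     moreover have "v (i, m') \<in> low (n, 0, 0, 0)" by (rule low_v) (use i in \<open>auto simp: less_prod_def\<close>)
     ultimately show ?case using kspan_step m' mon_cl klow[of "(n, 0, 0, 0)"] by (simp add: esc_def ksub_def)
    qed
    then show ?case using rspan_step klow[of "(n, 0, 0, 0)"] by (simp add: ksub_def)
   qed
  qed
  then show ?thesis using x B(3) by blast
 qed
 \<comment> \<open>Only a formal leading term: the coefficient \<open>c\<close> may be zero, a case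
   that is treated separately below.\<close>
 have low_dec: "x = \<zero>[M] \<or> (\<exists>\<nu><\<mu>. fst \<nu> < n \<and> (\<exists>c. \<exists>y\<in>low \<nu>. x = ?sc c (v \<nu>) \<oplus>[M] y))" if "x \<in> low \<mu>" for x \<mu>
  using that unfolding low_def[of \<mu>]
 proof (induction rule: kspan.induct)
  case (kspan_step w x c)
  then obtain \<nu> where \<nu>: "w = v \<nu>" "\<nu> < \<mu>" "fst \<nu> < n" by auto
  from kspan_step.IH show ?case
  proof
   assume x: "x = \<zero>[M]"
   have "\<zero>[M] \<in> low \<nu>" using klow by (simp add: ksub_def)
   then show ?thesis using \<nu> x by blast
  next
   assume "\<exists>\<nu><\<mu>. fst \<nu> < n \<and> (\<exists>c. \<exists>y\<in>low \<nu>. x = ?sc c (v \<nu>) \<oplus>[M] y)"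
   then obtain \<nu>' c' y where y: "\<nu>' < \<mu>" "fst \<nu>' < n" "y \<in> low \<nu>'" "x = ?sc c' (v \<nu>') \<oplus>[M] y" by blast
   note cc = vc[OF \<nu>(3)] vc[OF y(2)] lowc[OF y(3)]
   consider "\<nu> < \<nu>'" | "\<nu> = \<nu>'" | "\<nu>' < \<nu>" by (metis linorder_less_linear)
   then show ?thesis
   proof cases
    case 1
    have "?sc c w \<oplus>[M] x = ?sc c' (v \<nu>') \<oplus>[M] (?sc c (v \<nu>) \<oplus>[M] y)" using \<nu> y cc by (simp add: M.a_ac)
    moreover have "?sc c (v \<nu>) \<oplus>[M] y \<in> low \<nu>'" using klow[of \<nu>'] low_v[OF 1 \<nu>(3)] y by (simp add: ksub_def)
    ultimately show ?thesis using y by blast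
   next
    case 2
    have "?sc c w \<oplus>[M] x = ?sc (c + c') (v \<nu>') \<oplus>[M] y" using \<nu> y cc 2 by (simp add: M.a_assoc add_sc)
    then show ?thesis using y by blast
   next
    case 3
    have "x \<in> low \<nu>" using klow[of \<nu>] low_v[OF 3 y(2)] low_mono[OF y(3), of \<nu>] 3 y by (simp add: ksub_def)
    then show ?thesis using \<nu> by blast
   qed
  qed
 qed simp
 have v_shift: "v (shift j d \<mu>) = \<xi> j [^][ga_ring S] d \<odot>[M] v \<mu>" if j: "j < 3" and m: "fst \<mu> < n" for j d \<mu>
 proof -
  obtain i a a' a'' where \<mu>: "\<mu> = (i, a, a', a'')" by (cases \<mu>) auto
  have x: "\<xi> 0 \<in> Rc S" "\<xi> (Suc 0) \<in> Rc S" "\<xi> 2 \<in> Rc S" using \<xi> by auto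
  have "mon (ga_ring S) \<xi> (snd (shift j d \<mu>)) = \<xi> j [^][ga_ring S] d \<otimes>[ga_ring S] mon (ga_ring S) \<xi> (snd \<mu>)"
  proof -
   consider "j = 0" | "j = 1" | "j = 2" using j by linarith
   then show ?thesis
    using x by cases (simp_all add: \<mu> mon_def R.nat_pow_mult[symmetric] R.m_ac)
  qed
  then show ?thesis unfolding v_def using j m bc[of "fst \<mu>"] mon_cl pw by (simp add: smult_assoc1)
 qed
 have low_shift: "\<xi> j [^][ga_ring S] d \<odot>[M] x \<in> low (shift j d \<mu>)" if "j < 3" "x \<in> low \<mu>" for j d x \<mu>
  using that(2) unfolding low_def[of \<mu>]
 proof (induction rule: kspan.induct)
  case kspan_zero
  then show ?case using pw[OF that(1)] klow by (simp add: ksub_def)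
 next
  case (kspan_step w x c)
  then obtain \<nu> where \<nu>: "w = v \<nu>" "\<nu> < \<mu>" "fst \<nu> < n" by auto
  have xc: "x \<in> carrier M" using kspan_step(2) lowc[of x \<mu>] by (simp add: low_def)
  have "\<xi> j [^][ga_ring S] d \<odot>[M] (?sc c w \<oplus>[M] x) = ?sc c (v (shift j d \<nu>)) \<oplus>[M] \<xi> j [^][ga_ring S] d \<odot>[M] x"
   using pw[OF that(1)] xc vc[OF \<nu>(3)] \<nu> smsc v_shift[OF that(1) \<nu>(3)] by (simp add: smult_r_distr)
  moreover have "v (shift j d \<nu>) \<in> low (shift j d \<mu>)" using low_v shift_mono \<nu> by simp
  ultimately show ?case using kspan_step.IH klow[of "shift j d \<mu>"] by (simp add: ksub_def)
 qed
 \<comment> \<open>The vectors \<open>v \<mu>\<close> may be linearly dependent, so an element has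
   no unique leading exponent; all exponents that lead some representation with coefficient one are
   collected.\<close>
 define lead where "lead V = {\<mu>. fst \<mu> < n \<and> (\<exists>y\<in>low \<mu>. v \<mu> \<oplus>[M] y \<in> V)}" for V
 \<comment> \<open>Used twice: for \<open>V = ?T\<close> with \<open>d = e\<close>, which puts
   \<open>?D\<close> into the gap, and for \<open>V = K\<close> with any \<open>d\<close>, which
   makes the exponents of \<open>K\<close> upward closed.\<close>
 have up: "shift j d \<mu> \<in> lead K" if "j < 3" "\<mu> \<in> lead V" "\<forall>x\<in>V. \<xi> j [^][ga_ring S] d \<odot>[M] x \<in> K" for j d \<mu> V
 proof -
  have "\<exists>y\<in>low \<mu>. fst \<mu> < n \<and> v \<mu> \<oplus>[M] y \<in> V" using that(2) by (auto simp: lead_def)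
  then obtain y where y: "fst \<mu> < n" "y \<in> low \<mu>" "v \<mu> \<oplus>[M] y \<in> V" by blast
  have "\<xi> j [^][ga_ring S] d \<odot>[M] (v \<mu> \<oplus>[M] y) \<in> K" using that(3) y by blast
  then have "v (shift j d \<mu>) \<oplus>[M] \<xi> j [^][ga_ring S] d \<odot>[M] y \<in> K"
   using v_shift[OF that(1) y(1)] vc[OF y(1)] lowc[OF y(2)] pw[OF that(1)] by (simp add: smult_r_distr)
  then show ?thesis using low_shift[OF that(1) y(2)] y(1) by (auto simp: lead_def)
 qed
 let ?D = "lead ?T - lead K"
 have fin: "finite ?D"
 proof -
  define U where "U i = {m. (i, m) \<in> lead K}" for i
  define gap where "gap i = {(a, b, c). (a, b, c) \<notin> U i \<and> (a + e, b, c) \<in> U i \<and> (a, b + e, c) \<in> U i \<and> (a, b, c + e) \<in> U i}" for i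
  have sub: "?D <= (\<Union>i<n. Pair i ` gap i)"
  proof
   fix \<mu> assume \<mu>: "\<mu> \<in> ?D"
   obtain i a a' a'' where \<mu>e: "\<mu> = (i, a, a', a'')" by (cases \<mu>) auto
   have sh: "shift j e \<mu> \<in> lead K" if "j < 3" for j using up[OF that, of \<mu> ?T e] \<mu> that by auto
   have "(a, a', a'') \<in> gap i" using sh[of 0] sh[of 1] sh[of 2] \<mu> by (simp add: gap_def U_def \<mu>e)
   moreover have "i < n" using \<mu> by (simp add: lead_def \<mu>e)
   ultimately show "\<mu> \<in> (\<Union>i<n. Pair i ` gap i)" unfolding \<mu>e by (intro UN_I[of i] image_eqI) auto
  qed
  have "finite (gap i)" for i
   unfolding gap_def
  proof (rule finite_saturation_gap)
   fix a a' a'' d assume a: "(a, a', a'') \<in> U i"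
   have "shift j d (i, a, a', a'') \<in> lead K" if "j < 3" for j
    by (rule up[OF that, of _ K]) (use a K(4) pw[OF that] in \<open>auto simp: U_def\<close>)
   from this[of 0] this[of 1] this[of 2]
   show "(a + d, a', a'') \<in> U i \<and> (a, a' + d, a'') \<in> U i \<and> (a, a', a'' + d) \<in> U i" by (simp add: U_def)
  qed
  then have "finite (\<Union>i<n. Pair i ` gap i)" by simp
  then show ?thesis using sub by (rule rev_finite_subset)
 qed
 \<comment> \<open>One element of \<open>?T\<close> is chosen for each of the finitely many leading
   exponents that \<open>K\<close> misses; together with \<open>K\<close> they will span
   \<open>?T\<close>.\<close>
 have "\<exists>t. \<mu> \<in> ?D --> t \<in> ?T \<and> (\<exists>y\<in>low \<mu>. t = v \<mu> \<oplus>[M] y)" for \<mu>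
 proof (cases "\<mu> \<in> ?D")
  case True
  then obtain y where y: "y \<in> low \<mu>" "v \<mu> \<oplus>[M] y \<in> ?T" by (auto simp only: lead_def mem_Collect_eq Diff_iff)
  show ?thesis by (rule exI[of _ "v \<mu> \<oplus>[M] y"]) (intro impI conjI bexI[of _ y] y refl)
 qed (intro exI impI, erule notE)
 then have "\<exists>t. \<forall>\<mu>. \<mu> \<in> ?D --> t \<mu> \<in> ?T \<and> (\<exists>y\<in>low \<mu>. t \<mu> = v \<mu> \<oplus>[M] y)" by (intro choice allI)
 then obtain t where "\<forall>\<mu>. \<mu> \<in> ?D --> t \<mu> \<in> ?T \<and> (\<exists>y\<in>low \<mu>. t \<mu> = v \<mu> \<oplus>[M] y)" by (elim exE)
 then have t: "t \<mu> \<in> ?T \<and> (\<exists>y\<in>low \<mu>. t \<mu> = v \<mu> \<oplus>[M] y)" if "\<mu> \<in> ?D" for \<mu> using that by (simp only:)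
 have "t ` ?D <= carrier M" using t by blast
 then obtain Y where Y: "ksub M ?sc Y" "K <= Y" "t ` ?D <= Y" "fd M ?sc Y K"
  using finite_fd_extension[OF fin _ kK] by blast
 \<comment> \<open>In the lexicographic order an exponent can have infinitely many predecessors, but
   the order is a well-order, so subtracting leading terms comes to an end.\<close>
 have sub: "x \<in> Y" if "x \<in> ?T" "x \<in> low \<mu>" for x \<mu>
  using that
 proof (induction \<mu> arbitrary: x rule: less_induct)
  case (less \<mu>)
  \<comment> \<open>Subtract the multiple of \<open>w\<close> with the same leading term. The
    remainder is still in \<open>?T\<close> and lies in \<open>low \<nu>\<close>, where the
    induction hypothesis applies.\<close>
  have reduce: "x \<in> Y" if \<nu>: "\<nu> < \<mu>" "fst \<nu> < n" "y \<in> low \<nu>" "x = ?sc c (v \<nu>) \<oplus>[M] y"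
   and w: "w \<in> ?T" "w \<in> Y" "w = v \<nu> \<oplus>[M] z" "z \<in> low \<nu>" for \<nu> c y w z
  proof -
   have cc: "v \<nu> \<in> carrier M" "y \<in> carrier M" "z \<in> carrier M" using vc \<nu> lowc w by auto
   have wc: "w \<in> carrier M" using w cc by simp
   have e: "x = ?sc c w \<oplus>[M] (?sc (- c) z \<oplus>[M] y)"
   proof -
    have "?sc c w \<oplus>[M] (?sc (- c) z \<oplus>[M] y) = ?sc c (v \<nu>) \<oplus>[M] (?sc c z \<oplus>[M] ?sc (- c) z) \<oplus>[M] y"
     using w(3) cc by (simp add: sc_add M.a_assoc)
    also have "?sc c z \<oplus>[M] ?sc (- c) z = \<zero>[M]" using add_sc[of z c "- c"] cc by simp
    finally show ?thesis using \<nu>(4) cc by simp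
   qed
   have l: "?sc (- c) z \<oplus>[M] y \<in> low \<nu>" using klow[of \<nu>] w(4) \<nu>(3) by (simp add: ksub_def)
   have "?sc (- c) w \<oplus>[M] x \<in> ?T" using kT w(1) less.prems(1) unfolding ksub_def by blast
   moreover have "?sc (- c) w \<oplus>[M] x = ?sc (- c) z \<oplus>[M] y"
   proof -
    have "?sc (- c) w \<oplus>[M] x = (?sc (- c) w \<oplus>[M] ?sc c w) \<oplus>[M] (?sc (- c) z \<oplus>[M] y)"
     unfolding e using cc wc by (simp add: M.a_assoc)
    also have "?sc (- c) w \<oplus>[M] ?sc c w = \<zero>[M]" using add_sc[of w "- c" c] wc by simp
    finally show ?thesis using cc by simp
   qed
   ultimately have "?sc (- c) z \<oplus>[M] y \<in> Y" using less.IH[OF \<nu>(1) _ l] by simp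
   then show ?thesis using e Y(1) w(2) unfolding ksub_def by metis
  qed
  from low_dec[OF less.prems(2)] show ?case
  proof
   assume "x = \<zero>[M]"
   then show ?thesis using Y(1) by (simp add: ksub_def)
  next
   assume "\<exists>\<nu><\<mu>. fst \<nu> < n \<and> (\<exists>c. \<exists>y\<in>low \<nu>. x = ?sc c (v \<nu>) \<oplus>[M] y)"
   then obtain \<nu> c y where \<nu>: "\<nu> < \<mu>" "fst \<nu> < n" "y \<in> low \<nu>" "x = ?sc c (v \<nu>) \<oplus>[M] y" by blast
   have cc: "v \<nu> \<in> carrier M" "y \<in> carrier M" using vc \<nu> lowc by auto
   show ?thesis
   proof (cases "c = 0")
    case True
    then have "x = y" using \<nu> cc by simp
    then show ?thesis using less.IH[OF \<nu>(1) less.prems(1)] \<nu>(3) by simp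
   next
    case False
    have "?sc (inverse c) x = v \<nu> \<oplus>[M] ?sc (inverse c) y"
     using \<nu>(4) cc False by (simp add: sc_add mult_sc[symmetric])
    moreover have "?sc (inverse c) x \<in> ?T" using kT less.prems(1) unfolding ksub_def by blast
    moreover have "?sc (inverse c) y \<in> low \<nu>" using klow[of \<nu>] \<nu>(3) by (simp add: ksub_def)
    ultimately have lT: "\<nu> \<in> lead ?T" unfolding lead_def using \<nu>(2) by (intro CollectI conjI bexI[of _ "?sc (inverse c) y"]) auto
    show ?thesis
    proof (cases "\<nu> \<in> lead K")
     case True
     then obtain z where "z \<in> low \<nu>" "v \<nu> \<oplus>[M] z \<in> K" by (auto simp: lead_def)
     then show ?thesis using reduce[OF \<nu>, of "v \<nu> \<oplus>[M] z" z] KT Y(2) by blast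
    next
     case False
     then have "\<nu> \<in> ?D" using lT by blast
     then show ?thesis using reduce[OF \<nu>, of "t \<nu>"] t[of \<nu>] Y(3) by blast
    qed
   qed
  qed
 qed
 have "?T <= Y"
 proof
  fix x assume x: "x \<in> ?T"
  show "x \<in> Y" by (rule sub[OF x all_low]) (use x in blast)
 qed
 then show ?thesis using fd_mono[OF Y(4)] by blast
qed

section \<open>Restriction to a subgroup of the degrees with free action\<close>

text \<open>The assumption on \<open>\<xi> i [^] e\<close> says that the dual group of the quotient by \<open>H\<close> acts freely
 on the punctured spectrum.\<close>

locale veronese = grestr S S' H
 for S :: "('k::field, 'g, 'r) graded_algebra" and S' :: "('k, 'g, 'r) graded_algebra" and H :: "'g set" +
 fixes \<xi> :: "nat => 'r" and Bs :: "'r set" and e :: nat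
 assumes \<xi>_closed: "\<And>i. i < 3 ==> \<xi> i \<in> Rc S"
  and mon_span: "\<And>r. r \<in> Rc S ==> r \<in> kspan (reg S) (esc S (reg S)) (range (mon (ga_ring S) \<xi>))"
  and Bs_finite: "finite Bs" and Bs_hom: "\<And>b. b \<in> Bs ==> \<exists>g\<in>Gc S. b \<in> ga_comp S g"
  and Bs_span: "Rc S <= rspan (ga_ring S') (reg S) Bs"
  and prim: "\<And>g i. g \<in> Gc S ==> i < 3 ==> \<xi> i [^][ga_ring S] e \<in>
   Idl\<^bsub>ga_ring S\<^esub> (\<Union>g'\<in>{g' \<in> Gc S. g' \<otimes>[ga_grp S] g \<in> H}. ga_comp S g')"
  and card: "\<exists>f :: 'r => 'k. inj_on f (Rc S)" "infinite (UNIV :: 'k set)"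

locale vmod = veronese S S' H \<xi> Bs e + gmod S M
 for S :: "('k::field, 'g, 'r) graded_algebra" and S' :: "('k, 'g, 'r) graded_algebra" and H :: "'g set"
  and \<xi> Bs e and M :: "('g, 'r, 'u) gmodule"

sublocale vmod \<subseteq> grmod S S' H M by unfold_locales

context vmod
begin

lemma Bs_closed: "b \<in> Bs ==> b \<in> Rc S"
 using Bs_hom ga_comp_closed by blast

text \<open>A span over the field of finitely many multiples of \<open>V\<close>. For
  \<open>C = Bs\<close> and a \<open>V\<close> stable under the small ring it contains the submodule
  generated by \<open>V\<close> over the large ring.\<close>

definition pspan :: "'r set => 'u set => 'u set" where
 "pspan C V = kspan M (esc S M) {b \<odot>[M] v |b v. b \<in> C \<and> v \<in> V}"

lemma smult_esc: "r \<in> Rc S ==> x \<in> carrier M ==> r \<odot>[M] esc S M c x = esc S M c (r \<odot>[M] x)"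
 unfolding esc_def by (simp add: smult_assoc1[symmetric] R.m_comm)

lemma klin_smult: "r \<in> Rc S ==> klin M (esc S M) M (esc S M) ((%x. (x, r \<odot>[M] x)) ` carrier M)"
 unfolding klin_def using smult_esc by (auto simp: smult_r_distr image_iff)

lemma fd_smult:
 assumes "r \<in> Rc S" "fd M (esc S M) V W" "V <= carrier M" "W <= carrier M"
 shows "fd M (esc S M) ((%x. r \<odot>[M] x) ` V) ((%x. r \<odot>[M] x) ` W)"
proof -
 have "((%x. (x, r \<odot>[M] x)) ` carrier M) `` V = (%x. r \<odot>[M] x) ` V" if "V <= carrier M" for V using that by auto
 then show ?thesis using fd_image[OF kspace_axioms kspace_axioms klin_smult[OF assms(1)] assms(2)] assms(3,4) by simp
qed

lemma ksub_smult:
 assumes "r \<in> Rc S" "ksub M (esc S M) V"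
 shows "ksub M (esc S M) ((%x. r \<odot>[M] x) ` V)"
proof -
 have V: "V <= carrier M" using assms(2) by (simp add: ksub_def)
 have "(((%x. (x, r \<odot>[M] x)) ` carrier M)\<inverse>)\<inverse> `` V = (%x. r \<odot>[M] x) ` V" using V by auto
 then show ?thesis using klin_ksub_vimage[OF klin_converse[OF klin_smult[OF assms(1)]] assms(2)] by simp
qed

lemma set_add_comm: "V <= carrier M ==> W <= carrier M ==> V <+>[M] W = W <+>[M] V"
proof -
 have "A <+>[M] B <= B <+>[M] A" if "A <= carrier M" "B <= carrier M" for A B
 proof
  fix x assume "x \<in> A <+>[M] B"
  then obtain a b where *: "a \<in> A" "b \<in> B" "x = a \<oplus>[M] b" by (auto simp: set_add_iff)
  then have "x = b \<oplus>[M] a" using that M.a_comm by auto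
  then show "x \<in> B <+>[M] A" using * unfolding set_add_iff by blast
 qed
 then show "V <= carrier M ==> W <= carrier M ==> V <+>[M] W = W <+>[M] V" by blast
qed

lemma products_closed: "C <= Rc S ==> V <= carrier M ==> {b \<odot>[M] v |b v. b \<in> C \<and> v \<in> V} <= carrier M"
 by auto

lemma pspan_base:
 assumes "b \<in> C" "v \<in> V" "C <= Rc S" "V <= carrier M"
 shows "b \<odot>[M] v \<in> pspan C V"
 unfolding pspan_def by (rule kspan_base[OF products_closed[OF assms(3,4)]]) (use assms(1,2) in blast)

text \<open>One multiplier at a time: \<open>fd\<close> survives multiplication by a ring element
  and the addition of a fixed subspace.\<close>

lemma fd_pspan:
 assumes "finite C" "C <= Rc S" and V: "ksub M (esc S M) V" and W: "ksub M (esc S M) W"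
  and f: "fd M (esc S M) V W"
 shows "fd M (esc S M) (pspan C V) (pspan C W)"
 using assms(1,2)
proof (induction C rule: finite_induct)
 case empty
 have "x = \<zero>[M]" if "x \<in> pspan {} V" for x
  using that unfolding pspan_def by (induction rule: kspan.induct) auto
 then have "pspan {} V <= pspan {} W" unfolding pspan_def by (auto intro: kspan.kspan_zero)
 then show ?case by (rule fd.fd_base)
next
 case (insert b C)
 have c: "V <= carrier M" "W <= carrier M" "b \<in> Rc S" "C <= Rc S"
  using V W insert.prems by (auto simp: ksub_def)
 let ?b = "%V. (%x. b \<odot>[M] x) ` V"
 have kb: "ksub M (esc S M) (?b V)" "ksub M (esc S M) (?b W)" using ksub_smult c V W by auto
 have kp: "ksub M (esc S M) (pspan C V)" "ksub M (esc S M) (pspan C W)"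
  "ksub M (esc S M) (pspan (insert b C) W)"
  unfolding pspan_def using c by (auto intro!: ksub_kspan)
 have cc: "?b V <= carrier M" "?b W <= carrier M" "pspan C V <= carrier M" "pspan C W <= carrier M"
  using kb kp by (auto simp: ksub_def)
 have 1: "pspan (insert b C) V <= ?b V <+>[M] pspan C V"
 proof
  fix x assume "x \<in> pspan (insert b C) V"
  then show "x \<in> ?b V <+>[M] pspan C V"
   unfolding pspan_def[of "insert b C"]
  proof (rule kspan_least[OF ksub_set_add[OF kb(1) kp(1)], rotated])
   show "{b' \<odot>[M] v |b' v. b' \<in> insert b C \<and> v \<in> V} <= ?b V <+>[M] pspan C V"
    using subset_set_add[OF kb(1) kp(1)] pspan_base[of _ C _ V] c by auto
  qed
 qed
 have 2: "fd M (esc S M) (?b V <+>[M] pspan C V) (?b V <+>[M] pspan C W)"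
  using fd_set_add_left[OF kb(1) insert.IH cc(3)] c by simp
 have 3: "fd M (esc S M) (?b V <+>[M] pspan C W) (?b W <+>[M] pspan C W)"
  using fd_set_add_left[OF kp(2) fd_smult[OF c(3) f c(1,2)] cc(1)] set_add_comm cc by simp
 have 4: "?b W <+>[M] pspan C W <= pspan (insert b C) W"
 proof
  fix x assume "x \<in> ?b W <+>[M] pspan C W"
  then obtain w y where *: "w \<in> W" "y \<in> pspan C W" "x = b \<odot>[M] w \<oplus>[M] y" by (auto simp: set_add_iff)
  have "y \<in> pspan (insert b C) W" using *(2) unfolding pspan_def by (rule kspan_mono) auto
  moreover have "b \<odot>[M] w \<in> pspan (insert b C) W" by (rule pspan_base) (use * c in auto)
  ultimately show "x \<in> pspan (insert b C) W" using kp(3) * by (simp add: ksub_def)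
 qed
 show ?case by (rule fd_mono[OF fd_trans[OF 2 3] 1 4])
qed

lemma rspan_ksub: "V <= carrier M ==> ksub M (esc S M) (rspan (ga_ring S) M V)"
 using rspan_closed rspan_add rspan_smult[of V] by (auto simp: ksub_def esc_def intro: rspan.rspan_zero)

text \<open>\<open>Bs\<close> generates the large ring over the small one, so finitely many
  multiples of the stable space \<open>V\<close> already give all of its span. Finite codimension
  thus survives extension of scalars.\<close>

lemma fd_rspan:
 assumes V: "ksub M (esc S M) V" and W: "ksub M (esc S M) W" and f: "fd M (esc S M) V W"
  and V': "\<And>r v. r \<in> Rc S' ==> v \<in> V ==> r \<odot>[M] v \<in> V"
 shows "fd M (esc S M) (rspan (ga_ring S) M V) (rspan (ga_ring S) M W)"
proof -
 have c: "V <= carrier M" "W <= carrier M" "Bs <= Rc S" using V W Bs_closed by (auto simp: ksub_def)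
 have kp: "ksub M (esc S M) (pspan Bs V)" unfolding pspan_def using c by (auto intro!: ksub_kspan)
 have rv: "r \<in> Rc S \<and> r \<odot>[M] v \<in> pspan Bs V" if "r \<in> rspan (ga_ring S') (reg S) Bs" "v \<in> V" for r v
  using that(1)
 proof (induction rule: rspan.induct)
  case rspan_zero
  then show ?case using that(2) c kp by (auto simp: ksub_def)
 next
  case (rspan_step r' b s)
  have r': "r' \<in> Rc S" using rspan_step(1) by (auto simp: hpart_def)
  have b: "b \<in> Rc S" using rspan_step c by blast
  have v: "v \<in> carrier M" using that c by blast
  have "(r' \<odot>[reg S] b \<oplus>[reg S] s) \<odot>[M] v = b \<odot>[M] (r' \<odot>[M] v) \<oplus>[M] s \<odot>[M] v"
   using r' b v rspan_step.IH by (simp add: smult_l_distr smult_assoc1[symmetric] R.m_comm)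
  moreover have "b \<odot>[M] (r' \<odot>[M] v) \<in> pspan Bs V"
   by (rule pspan_base[OF rspan_step(2) V'[OF rspan_step(1) that(2)] c(3,1)])
  ultimately show ?case using r' b rspan_step.IH kp by (simp add: ksub_def)
 qed
 have "rspan (ga_ring S) M V <= pspan Bs V"
 proof
  fix x assume "x \<in> rspan (ga_ring S) M V"
  then show "x \<in> pspan Bs V"
   by (induction rule: rspan.induct) (use kp rv Bs_span in \<open>auto simp: ksub_def\<close>)
 qed
 moreover have "pspan Bs W <= rspan (ga_ring S) M W"
 proof
  fix x assume "x \<in> pspan Bs W"
  then show "x \<in> rspan (ga_ring S) M W" unfolding pspan_def
   by (rule kspan_least[OF rspan_ksub[OF c(2)], rotated])
    (use c rspan_smult[OF c(2) _ rspan_base[OF c(2)]] in auto)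
 qed
 ultimately show ?thesis using fd_mono[OF fd_pspan[OF Bs_finite c(3) V W f]] by blast
qed

text \<open>The ring elements that send \<open>x\<close> into the span form an ideal. It contains
  every component that moves the degree \<open>g\<close> into \<open>H\<close>, hence by
  \<open>prim\<close> the powers of the \<open>\<xi> i\<close>.\<close>

lemma prim_smult:
 assumes "x \<in> carrier M" "g \<in> Gc S" "i < 3" "K <= carrier M"
  and "\<And>g' s. g' \<in> Gc S ==> g' \<otimes>[ga_grp S] g \<in> H ==> s \<in> ga_comp S g' ==> s \<odot>[M] x \<in> rspan (ga_ring S) M K"
 shows "\<xi> i [^][ga_ring S] e \<odot>[M] x \<in> rspan (ga_ring S) M K"
proof -
 let ?I = "{r \<in> Rc S. r \<odot>[M] x \<in> rspan (ga_ring S) M K}"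
 have "ideal ?I (ga_ring S)"
 proof (rule idealI[OF R.ring_axioms])
  show "subgroup ?I (add_monoid (ga_ring S))"
  proof (rule R.add_subgroupI)
   fix r assume "r \<in> ?I"
   then have r: "r \<in> Rc S" "r \<odot>[M] x \<in> rspan (ga_ring S) M K" by auto
   have "(\<ominus>[ga_ring S] \<one>\<^bsub>ga_ring S\<^esub>) \<odot>[M] (r \<odot>[M] x) \<in> rspan (ga_ring S) M K"
    by (rule rspan_smult[OF assms(4) _ r(2)]) simp
   then show "\<ominus>[ga_ring S] r \<in> ?I" using r assms(1) by (simp add: smult_l_minus)
  qed (use assms(1,4) rspan_add in \<open>auto simp: smult_l_distr intro: rspan.rspan_zero\<close>)
 next
  fix a r assume a: "a \<in> ?I" "r \<in> Rc S"
  have "r \<odot>[M] (a \<odot>[M] x) \<in> rspan (ga_ring S) M K" by (rule rspan_smult[OF assms(4)]) (use a in auto)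
  then show "r \<otimes>[ga_ring S] a \<in> ?I" "a \<otimes>[ga_ring S] r \<in> ?I" using a assms(1) by (auto simp: smult_assoc1 R.m_comm[of a r])
 qed
 moreover have "(\<Union>g'\<in>{g' \<in> Gc S. g' \<otimes>[ga_grp S] g \<in> H}. ga_comp S g') <= ?I"
  using assms(5) ga_comp_closed by auto
 ultimately have "Idl\<^bsub>ga_ring S\<^esub> (\<Union>g'\<in>{g' \<in> Gc S. g' \<otimes>[ga_grp S] g \<in> H}. ga_comp S g') <= ?I"
  by (rule R.genideal_minimal)
 then show ?thesis using prim[OF assms(2,3)] by blast
qed

lemma fg_saturation:
 assumes M: "M \<in> mod_objects S" and K: "K <= carrier M"
 shows "fd M (esc S M) {x \<in> carrier M. \<forall>i<3. \<xi> i [^][ga_ring S] e \<odot>[M] x \<in> rspan (ga_ring S) M K} (rspan (ga_ring S) M K)"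
proof -
 obtain B where B: "finite B" "B <= carrier M" "carrier M <= rspan (ga_ring S) M B"
  using M unfolding mod_objects_iff by blast
 show ?thesis
  by (rule saturation_fd[OF \<xi>_closed mon_span B])
   (use K rspan_closed rspan_add[OF K] rspan_smult[OF K] in \<open>auto intro: rspan.rspan_zero\<close>)
qed

lemma prim_all:
 assumes x: "x \<in> carrier M" and i: "i < 3" and K: "K <= carrier M"
  and h: "\<And>g g' s. g \<in> Gc S ==> g' \<in> Gc S ==> g' \<otimes>[ga_grp S] g \<in> H ==> s \<in> ga_comp S g' ==>
   s \<odot>[M] hc S M x g \<in> rspan (ga_ring S) M K"
 shows "\<xi> i [^][ga_ring S] e \<odot>[M] x \<in> rspan (ga_ring S) M K"
proof -
 let ?A = "{g. hc S M x g \<noteq> \<zero>[M]}"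
 have r: "\<xi> i [^][ga_ring S] e \<in> Rc S" using \<xi>_closed[OF i] by simp
 have "\<xi> i [^][ga_ring S] e \<odot>[M] finsum M (hc S M x) ?A = (\<Oplus>\<^bsub>M\<^esub>g\<in>?A. \<xi> i [^][ga_ring S] e \<odot>[M] hc S M x g)"
  by (rule finsum_additive) (use r x in \<open>auto intro: M.abelian_group_axioms simp: smult_r_distr\<close>)
 moreover have "(\<Oplus>\<^bsub>M\<^esub>g\<in>?A. \<xi> i [^][ga_ring S] e \<odot>[M] hc S M x g) \<in> rspan (ga_ring S) M K"
 proof (rule M.finsum_mem)
  show "(%g. \<xi> i [^][ga_ring S] e \<odot>[M] hc S M x g) \<in> ?A \<rightarrow> rspan (ga_ring S) M K"
  proof
   fix g assume "g \<in> ?A"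
   then have g: "g \<in> Gc S" using hc_supp[OF x] by blast
   show "\<xi> i [^][ga_ring S] e \<odot>[M] hc S M x g \<in> rspan (ga_ring S) M K"
    by (rule prim_smult[OF hc_closed[OF x] g i K]) (rule h[OF g])
  qed
 qed (use K rspan_closed rspan_add[OF K] in \<open>auto intro: rspan.rspan_zero\<close>)
 ultimately show ?thesis using hc_sum[OF x hc_finite[OF x]] by simp
qed

text \<open>Fixed powers of the \<open>\<xi> i\<close> send all of \<open>M\<close> into the
  submodule generated by its \<open>H\<close>-part, which therefore has finite codimension by
  saturation; passing from the \<open>H\<close>-part to \<open>D\<close> costs finitely many
  dimensions more.\<close>

lemma fd_generated:
 assumes M: "M \<in> mod_objects S" and D: "gsub S' (res S H M) D" and f: "fd M (esc S M) (hpart S H M) D"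
 shows "fd M (esc S M) (carrier M) (rspan (ga_ring S) M D)"
proof -
 let ?h = "hpart S H M"
 have hc': "?h <= carrier M" using hpartD by blast
 have "carrier M <= {x \<in> carrier M. \<forall>i<3. \<xi> i [^][ga_ring S] e \<odot>[M] x \<in> rspan (ga_ring S) M ?h}"
 proof clarify
  fix x and i :: nat assume x: "x \<in> carrier M" and i: "i < 3"
  show "\<xi> i [^][ga_ring S] e \<odot>[M] x \<in> rspan (ga_ring S) M ?h"
  proof (rule prim_all[OF x i hc'])
   fix g g' s assume g: "g \<in> Gc S" "g' \<in> Gc S" "g' \<otimes>[ga_grp S] g \<in> H" and s: "s \<in> ga_comp S g'"
   show "s \<odot>[M] hc S M x g \<in> rspan (ga_ring S) M ?h"
    by (rule rspan_base[OF hc' hpart_comp[OF g(3) comp_smult[OF g(2,1) s hc_comp[OF x g(1)]]]])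
  qed
 qed
 then have 1: "fd M (esc S M) (carrier M) (rspan (ga_ring S) M ?h)"
  using fd_mono[OF fg_saturation[OF M hc']] by blast
 have kD: "ksub M (esc S M) D" using N.gsub_ksub[OF D] hc' unfolding esc_res by (auto simp: ksub_def)
 have "fd M (esc S M) (rspan (ga_ring S) M ?h) (rspan (ga_ring S) M D)"
  by (rule fd_rspan[OF ksub_hpart kD f]) (use hpart_smult in simp)
 then show ?thesis using 1 fd_trans by blast
qed

text \<open>Fixed powers of the \<open>\<xi> i\<close> send the set in question into the span of
  \<open>K\<close>. So it is finite dimensional modulo that span, and the span itself is finite
  dimensional.\<close>

lemma fd_cogenerated:
 assumes M: "M \<in> mod_objects S" and K: "gsub S' (res S H M) K" and f: "fd M (esc S M) K {\<zero>[M]}"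
 shows "fd M (esc S M) {x \<in> carrier M. \<forall>g\<in>Gc S. \<forall>g'\<in>Gc S. g' \<otimes>[ga_grp S] g \<in> H -->
  (\<forall>s\<in>ga_comp S g'. s \<odot>[M] hc S M x g \<in> K)} {\<zero>[M]}" (is "fd _ _ ?Z _")
proof -
 have hc': "hpart S H M <= carrier M" using hpartD by blast
 have kK: "ksub M (esc S M) K" using N.gsub_ksub[OF K] hc' unfolding esc_res by (auto simp: ksub_def)
 have Kc: "K <= carrier M" using kK by (simp add: ksub_def)
 have "?Z <= {x \<in> carrier M. \<forall>i<3. \<xi> i [^][ga_ring S] e \<odot>[M] x \<in> rspan (ga_ring S) M K}"
 proof
  fix x assume x: "x \<in> ?Z"
  have "\<xi> i [^][ga_ring S] e \<odot>[M] x \<in> rspan (ga_ring S) M K" if i: "i < 3" for i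
  proof (rule prim_all[OF _ i Kc])
   show "x \<in> carrier M" using x by simp
   fix g g' s assume "g \<in> Gc S" "g' \<in> Gc S" "g' \<otimes>[ga_grp S] g \<in> H" "s \<in> ga_comp S g'"
   then show "s \<odot>[M] hc S M x g \<in> rspan (ga_ring S) M K" using x rspan_base[OF Kc] by blast
  qed
  then show "x \<in> {x \<in> carrier M. \<forall>i<3. \<xi> i [^][ga_ring S] e \<odot>[M] x \<in> rspan (ga_ring S) M K}" using x by simp
 qed
 then have 1: "fd M (esc S M) ?Z (rspan (ga_ring S) M K)" using fd_mono[OF fg_saturation[OF M Kc]] by blast
 have 2: "fd M (esc S M) (rspan (ga_ring S) M K) (rspan (ga_ring S) M {\<zero>[M]})"
  by (rule fd_rspan[OF kK ksub_zero f]) (use N.gsubD(4)[OF K] in auto)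
 have 3: "rspan (ga_ring S) M {\<zero>[M]} <= {\<zero>[M]}" by (rule rspan_least) auto
 show ?thesis by (rule fd_mono[OF fd_trans[OF 1 2] subset_refl 3])
qed

text \<open>Products of homogeneous module generators with the homogeneous \<open>Bs\<close>
  generate \<open>M\<close> over the small ring; projecting to the \<open>H\<close>-part keeps
  exactly those products whose degree is in \<open>H\<close>.\<close>

lemma res_fg:
 assumes M: "M \<in> mod_objects S"
 shows "res S H M \<in> mod_objects S'"
proof -
 obtain B where B: "finite B" "B <= carrier M" "carrier M <= rspan (ga_ring S) M B"
  using M unfolding mod_objects_iff by blast
 define B' where "B' = (\<Union>b\<in>B. hc S M b ` {g. hc S M b g \<noteq> \<zero>[M]})"
 have B'fin: "finite B'" unfolding B'_def using B hc_finite by auto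
 have B'hom: "\<exists>g\<in>Gc S. b \<in> gm_comp M g" if "b \<in> B'" for b
  using that B(2) hc_supp hc_comp unfolding B'_def by blast
 have B'c: "B' <= carrier M" using B'hom comp_carrier by blast
 have "B <= rspan (ga_ring S) M B'"
 proof
  fix b assume b: "b \<in> B"
  have bc: "b \<in> carrier M" using b B by blast
  have "finsum M (hc S M b) {g. hc S M b g \<noteq> \<zero>[M]} \<in> rspan (ga_ring S) M B'"
  proof (rule M.finsum_mem)
   show "hc S M b \<in> {g. hc S M b g \<noteq> \<zero>[M]} \<rightarrow> rspan (ga_ring S) M B'"
    using b rspan_base[OF B'c] unfolding B'_def by blast
  qed (use B'c rspan_closed rspan_add[OF B'c] in \<open>auto intro: rspan.rspan_zero\<close>)
  then show "b \<in> rspan (ga_ring S) M B'" using hc_sum[OF bc hc_finite[OF bc]] by simp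
 qed
 then have gen: "carrier M <= rspan (ga_ring S) M B'" using rspan_trans[OF B'c] B(3) by blast
 define C where "C = {b \<odot>[M] c |b c. b \<in> Bs \<and> c \<in> B'}"
 have Cfin: "finite C"
 proof -
  have "C = (%(b, c). b \<odot>[M] c) ` (Bs \<times> B')" unfolding C_def by auto
  then show ?thesis using Bs_finite B'fin by simp
 qed
 have Chom: "\<exists>g\<in>Gc S. x \<in> gm_comp M g" if x: "x \<in> C" for x
 proof -
  obtain b c where bc: "x = b \<odot>[M] c" "b \<in> Bs" "c \<in> B'" using x by (auto simp: C_def)
  obtain g where g: "g \<in> Gc S" "b \<in> ga_comp S g" using Bs_hom bc by blast
  obtain g' where g': "g' \<in> Gc S" "c \<in> gm_comp M g'" using B'hom bc by blast
  show ?thesis using comp_smult[OF g(1) g'(1) g(2) g'(2)] g g' bc by (intro bexI[of _ "g \<otimes>[ga_grp S] g'"]) auto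
 qed
 have Cc: "C <= carrier M" using Chom comp_carrier by blast
 let ?N = "res S H M"
 let ?C = "C \<inter> hpart S H M"
 have Cn: "?C <= carrier ?N" by simp
 have pr: "prH (r \<odot>[M] x) \<in> rspan (ga_ring S') ?N ?C" if r: "r \<in> Rc S'" and x: "x \<in> C" for r x
 proof -
  obtain g where g: "g \<in> Gc S" "x \<in> gm_comp M g" using Chom x by blast
  have rR: "r \<in> hpart S H (reg S)" "r \<in> Rc S" using r by (auto simp: hpart_def)
  have xc: "x \<in> carrier M" using x Cc by blast
  show ?thesis
  proof (cases "g \<in> H")
   case True
   have xh: "x \<in> hpart S H M" using hpart_comp[OF True g(2)] .
   have "prH (r \<odot>[M] x) = r \<odot>[M] x" using prH_id[OF hpart_smult[OF rR(1) xh]] .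
   then show ?thesis using N.rspan_smult[OF Cn r N.rspan_base[OF Cn]] x xh by simp
  next
   \<comment> \<open>Multipliers from the small ring have degrees in \<open>H\<close>, so they
     cannot move a degree outside \<open>H\<close> into \<open>H\<close>.\<close>
   case False
   have "prH (r \<odot>[M] x) = \<zero>[M]"
   proof (rule eq_hcI)
    fix k assume k: "k \<in> Gc S"
    have "hc S M (r \<odot>[M] x) k = \<zero>[M]" if kH: "k \<in> H"
     unfolding hc_smult_gen[OF rR(2) xc k]
    proof (rule M.add.finprod_one_eqI)
     fix q assume "q \<in> {q. hc S (reg S) r q \<noteq> \<zero>[ga_ring S]}"
     then have q: "q \<in> H" using rR(1) by (auto simp: hpart_def)
     then have "inv[ga_grp S] q \<otimes>[ga_grp S] k \<in> H"
      using kH subgroup.m_closed[OF H] subgroup.m_inv_closed[OF H] by blast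
     then have "inv[ga_grp S] q \<otimes>[ga_grp S] k \<noteq> g" using False by blast
     then show "hc S (reg S) r q \<odot>[M] hc S M x (inv[ga_grp S] q \<otimes>[ga_grp S] k) = \<zero>[M]"
      using hc_of_comp[OF g] Rg.hc_closed[of r q] rR(2) by simp
    qed
    then show "hc S M (prH (r \<odot>[M] x)) k = hc S M \<zero>[M] k" using rR xc by (simp add: hc_prH)
   qed (use rR xc in auto)
   then show ?thesis using rspan.rspan_zero[of ?N "ga_ring S'" ?C] by simp
  qed
 qed
 have big: "r \<in> Rc S \<and> prH (r \<odot>[M] c) \<in> rspan (ga_ring S') ?N ?C"
  if "r \<in> rspan (ga_ring S') (reg S) Bs" "c \<in> B'" for r c
  using that(1)
 proof (induction rule: rspan.induct)
  case rspan_zero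
  have "c \<in> carrier M" using that B'c by blast
  then show ?case using prH_id[OF hpart_zero] rspan.rspan_zero[of ?N "ga_ring S'" ?C] by simp
 next
  case (rspan_step r' b s)
  have r': "r' \<in> Rc S" using rspan_step(1) by (auto simp: hpart_def)
  have b: "b \<in> Rc S" using rspan_step Bs_closed by blast
  have c: "c \<in> carrier M" using that B'c by blast
  have "(r' \<odot>[reg S] b \<oplus>[reg S] s) \<odot>[M] c = r' \<odot>[M] (b \<odot>[M] c) \<oplus>[M] s \<odot>[M] c"
   using r' b c rspan_step.IH by (simp add: smult_l_distr smult_assoc1)
  moreover have "b \<odot>[M] c \<in> C" using rspan_step that unfolding C_def by blast
  ultimately show ?case
   using pr[OF rspan_step(1)] N.rspan_add[OF Cn] r' b c rspan_step.IH by (simp add: prH_add)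
 qed
 have pr_all: "prH x \<in> rspan (ga_ring S') ?N ?C \<and> x \<in> carrier M" if "x \<in> rspan (ga_ring S) M B'" for x
  using that
 proof (induction rule: rspan.induct)
  case rspan_zero
  then show ?case using prH_id[OF hpart_zero] rspan.rspan_zero[of ?N "ga_ring S'" ?C] by simp
 next
  case (rspan_step r b x)
  have b: "b \<in> carrier M" using rspan_step B'c by blast
  have "prH (r \<odot>[M] b) \<in> rspan (ga_ring S') ?N ?C" using big[of r b] rspan_step Bs_span by blast
  then have "prH (r \<odot>[M] b) \<oplus>[?N] prH x \<in> rspan (ga_ring S') ?N ?C" using N.rspan_add[OF Cn] rspan_step.IH by blast
  then show ?case using b rspan_step by (simp add: prH_add)
 qed
 have "carrier ?N <= rspan (ga_ring S') ?N ?C"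
 proof
  fix x assume "x \<in> carrier ?N"
  then have x: "x \<in> hpart S H M" by simp
  then show "x \<in> rspan (ga_ring S') ?N ?C" using pr_all[of x] gen hpartD(1)[OF x] prH_id[OF x] by auto
 qed
 then show ?thesis unfolding mod_objects_iff using N.gm Cfin Cn by blast
qed

end

locale vmod2 = M: vmod S S' H \<xi> Bs e M + N: vmod S S' H \<xi> Bs e N
 for S :: "('k::field, 'g, 'r) graded_algebra" and S' :: "('k, 'g, 'r) graded_algebra" and H :: "'g set"
  and \<xi> Bs e and M :: "('g, 'r, 'u) gmodule" and N :: "('g, 'r, 'v) gmodule"

sublocale vmod2 \<subseteq> grmod2 S S' H M N by unfold_locales

context vmod2
begin

text \<open>The freeness assumption enters here: \<open>fd_generated\<close> controls the domain and
  \<open>fd_cogenerated\<close> the fibre over zero.\<close>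

lemma grel_star:
 assumes M: "M \<in> mod_objects S" and N: "N \<in> mod_objects S" and Ga: "grel S' (res S H M) (res S H N) Ga"
 shows "grel S M N (star Ga)"
proof -
 have l: "glin S' (res S H M) (res S H N) Ga" using Ga by (simp add: grel_def)
 note st = glin_star[OF l]
 let ?D = "Domain Ga"
 have D: "gsub S' (res S H M) ?D" using MN'.gsub_Domain[OF l] .
 have Dh: "?D <= hpart S H M" using M.N.gsubD(1)[OF D] by auto
 have "fd M (esc S M) (hpart S H M) ?D" using Ga M.fd_res[OF subset_refl Dh] by (simp add: grel_def)
 then have 1: "fd M (esc S M) (carrier M) (rspan (ga_ring S) M ?D)" using M.fd_generated[OF M D] by blast
 have "rspan (ga_ring S) M ?D <= Domain (star Ga)"
  by (rule M.rspan_least) (use M.gsubD[OF MN.gsub_Domain[OF st]] sub_star[OF l] in auto)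
 then have 1: "fd M (esc S M) (carrier M) (Domain (star Ga))" using fd_mono[OF 1] by blast
 let ?K = "Ga `` {\<zero>[M]}"
 have K: "gsub S' (res S H N) ?K" using MN'.gsub_fibre[OF l] by simp
 have Kh: "?K <= hpart S H N" using N.N.gsubD(1)[OF K] by auto
 have Kf: "fd N (esc S N) ?K {\<zero>[N]}" using Ga N.fd_res[OF Kh, of "{\<zero>[N]}"] N.hpart_zero by (simp add: grel_def)
 have "star Ga `` {\<zero>[M]} <= {x \<in> carrier N. \<forall>g\<in>Gc S. \<forall>g'\<in>Gc S. g' \<otimes>[ga_grp S] g \<in> H -->
  (\<forall>s\<in>ga_comp S g'. s \<odot>[N] hc S N x g \<in> ?K)}"
 proof
  fix y assume "y \<in> star Ga `` {\<zero>[M]}"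
  then have y: "(\<zero>[M], y) \<in> star Ga" by simp
  have "s \<odot>[N] hc S N y g \<in> ?K" if g: "g \<in> Gc S" "g' \<in> Gc S" "g' \<otimes>[ga_grp S] g \<in> H" "s \<in> ga_comp S g'" for g g' s
   using starD[OF y g] M.ga_comp_closed[OF g(2,4)] by simp
  moreover have "y \<in> carrier N" using MN.glinD(2)[OF st y] .
  ultimately show "y \<in> {x \<in> carrier N. \<forall>g\<in>Gc S. \<forall>g'\<in>Gc S. g' \<otimes>[ga_grp S] g \<in> H -->
   (\<forall>s\<in>ga_comp S g'. s \<odot>[N] hc S N x g \<in> ?K)}" by blast
 qed
 then have "fd N (esc S N) (star Ga `` {\<zero>[M]}) {\<zero>[N]}" using fd_mono[OF N.fd_cogenerated[OF N K Kf]] by blast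
 then show ?thesis using 1 st by (simp add: grel_def)
qed

end

section \<open>Isomorphisms and transport of structure\<close>

text \<open>Isomorphisms are relations as well, so that they are morphisms of the quotient without
  conversion and their inverses are converses. The two modules may live in different types.\<close>

definition giso :: "('k, 'g, 'r) graded_algebra => ('g, 'r, 'u) gmodule => ('g, 'r, 'v) gmodule => ('u \<times> 'v) set => bool" where
 "giso S M N Ga \<longleftrightarrow> glin S M N Ga \<and> Ga O Ga\<inverse> = Id_on (carrier M) \<and> Ga\<inverse> O Ga = Id_on (carrier N)"

lemma giso_converse: "giso S M N Ga ==> giso S N M (Ga\<inverse>)"
 unfolding giso_def using glin_converse by auto

lemma giso_comp:
 assumes "giso S M N Ga" "giso S N P Da"
 shows "giso S M P (Ga O Da)"
proof -
 have 1: "Ga O Ga\<inverse> = Id_on (carrier M)" "Ga\<inverse> O Ga = Id_on (carrier N)" "Da O Da\<inverse> = Id_on (carrier N)" "Da\<inverse> O Da = Id_on (carrier P)"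
  and l: "glin S M N Ga" "glin S N P Da"
  using assms by (auto simp: giso_def)
 have "Ga <= carrier M \<times> carrier N" "Da <= carrier N \<times> carrier P" using l by (auto simp: glin_def)
 then have 2: "Id_on (carrier N) O Ga\<inverse> = Ga\<inverse>" "Id_on (carrier N) O Da = Da" by auto
 have "(Ga O Da) O (Ga O Da)\<inverse> = Ga O ((Da O Da\<inverse>) O Ga\<inverse>)" by (simp add: converse_relcomp O_assoc)
 moreover have "(Ga O Da)\<inverse> O (Ga O Da) = Da\<inverse> O ((Ga\<inverse> O Ga) O Da)" by (simp add: converse_relcomp O_assoc)
 ultimately show ?thesis unfolding giso_def using glin_comp[OF l] 1 2 by simp
qed

lemma giso_Domain: "giso S M N Ga ==> Domain Ga = carrier M"
proof -
 assume g: "giso S M N Ga"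
 have "Domain Ga = Domain (Ga O Ga\<inverse>)" by auto
 then show ?thesis using g by (simp add: giso_def)
qed

lemma giso_inj: "giso S M N Ga ==> (x, y) \<in> Ga ==> (x', y) \<in> Ga ==> x = x'"
proof -
 assume "giso S M N Ga" "(x, y) \<in> Ga" "(x', y) \<in> Ga"
 moreover have "(x, x') \<in> Ga O Ga\<inverse>" using calculation(2,3) by (intro relcompI converseI)
 ultimately have "(x, x') \<in> Id_on (carrier M)" by (simp only: giso_def)
 then show ?thesis by (simp add: Id_on_iff)
qed

lemma giso_single: "giso S M N Ga ==> (x, y) \<in> Ga ==> (x, y') \<in> Ga ==> y = y'"
 by (rule giso_inj[OF giso_converse]) (auto intro: converseI)

lemma giso_grel:
 assumes "giso S M N Ga"
 shows "grel S M N Ga"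
proof -
 have l: "glin S M N Ga" using assms by (simp add: giso_def)
 have z: "(\<zero>[M], \<zero>[N]) \<in> Ga" using l by (simp add: glin_def)
 have "Ga `` {\<zero>[M]} <= {\<zero>[N]}" using giso_single[OF assms z] by auto
 then show ?thesis using l giso_Domain[OF assms] by (auto simp: grel_def intro: fd.fd_base)
qed

lemma giso_mod_objects:
 assumes "gmod S M" "gmod S N" and i: "giso S M N Ga" and M: "M \<in> mod_objects S"
 shows "N \<in> mod_objects S"
proof -
 interpret M: gmod S M by fact
 interpret N: gmod S N by fact
 interpret MN: gmod2 S M N by unfold_locales
 have l: "glin S M N Ga" using i by (simp add: giso_def)
 obtain B where B: "finite B" "B <= carrier M" "carrier M <= rspan (ga_ring S) M B"
  using M unfolding mod_objects_iff by blast
 have *: "\<exists>y'. (x, y') \<in> Ga \<and> y' \<in> rspan (ga_ring S) N (Ga `` B)" if "x \<in> rspan (ga_ring S) M B" for x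
  using that
 proof (induction rule: rspan.induct)
  case rspan_zero
  then show ?case using MN.glinD(3)[OF l] rspan.rspan_zero by blast
 next
  case (rspan_step r b x)
  then obtain y' where y': "(x, y') \<in> Ga" "y' \<in> rspan (ga_ring S) N (Ga `` B)" by blast
  have "b \<in> Domain Ga" using giso_Domain[OF i] B rspan_step(2) by blast
  then obtain b' where b': "(b, b') \<in> Ga" by blast
  show ?case
   using MN.glinD(4)[OF l MN.glinD(5)[OF l rspan_step(1) b'] y'(1)]
    rspan.rspan_step[OF rspan_step(1) _ y'(2), of b'] b' rspan_step(2) by blast
 qed
 have 1: "finite (Ga `` B)"
 proof -
  have "Ga `` B = (\<Union>b\<in>B. Ga `` {b})" by auto
  moreover have "finite (Ga `` {b})" for b
  proof (cases "\<exists>y. (b, y) \<in> Ga")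
   case True
   then obtain y where "(b, y) \<in> Ga" by blast
   then have "Ga `` {b} <= {y}" using giso_single[OF i] by blast
   then show ?thesis by (rule finite_subset) simp
  next
   case False
   then have "Ga `` {b} = {}" by blast
   then show ?thesis by simp
  qed
  ultimately show ?thesis using B(1) by simp
 qed
 have 2: "Ga `` B <= carrier N" using MN.glinD(2)[OF l] by blast
 have 3: "carrier N <= rspan (ga_ring S) N (Ga `` B)"
 proof
  fix y assume "y \<in> carrier N"
  then have "y \<in> Domain (Ga\<inverse>)" using giso_Domain[OF giso_converse[OF i]] by simp
  then obtain x where x: "(x, y) \<in> Ga" by blast
  have "x \<in> carrier M" using MN.glinD(1)[OF l x] .
  then obtain y' where "(x, y') \<in> Ga" "y' \<in> rspan (ga_ring S) N (Ga `` B)" using * B(3) by blast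
  then show "y \<in> rspan (ga_ring S) N (Ga `` B)" using giso_single[OF i x] by blast
 qed
 show ?thesis unfolding mod_objects_iff using N.gm 1 2 3 by blast
qed

text \<open>Transport of structure along an injection, to place a module into the prescribed
  universe type.\<close>

definition tr :: "('g, 'r, 'u) gmodule => ('u => 'v) => ('g, 'r, 'v) gmodule" where
 "tr M f = (let i = inv_into (carrier M) f in
   \<lparr>carrier = f ` carrier M, monoid.mult = undefined, one = undefined, ring.zero = f \<zero>[M],
   ring.add = (%x y. f (i x \<oplus>[M] i y)), module.smult = (%r x. f (r \<odot>[M] i x)),
   gm_comp = (%g. f ` gm_comp M g)\<rparr>)"

lemma (in gmod) tr_iso:
 fixes f :: "'u => 'v"
 assumes f: "inj_on f (carrier M)"
 shows "graded_module S (tr M f)" "giso S M (tr M f) ((%x. (x, f x)) ` carrier M)"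
proof -
 let ?N = "tr M f" and ?i = "inv_into (carrier M) f"
 have i [simp]: "?i (f x) = x" if "x \<in> carrier M" for x using f that by simp
 have simps: "carrier ?N = f ` carrier M" "ring.zero ?N = f \<zero>[M]" "ring.add ?N u v = f (?i u \<oplus>[M] ?i v)"
  "module.smult ?N r u = f (r \<odot>[M] ?i u)" "gm_comp ?N g = f ` gm_comp M g" for u v r g
  by (simp_all add: tr_def Let_def)
 note [simp] = simps
 have m: "Module.module (ga_ring S) ?N"
 proof (rule moduleI[OF rng])
  show "abelian_group ?N"
  proof (rule abelian_groupI)
   fix u assume "u \<in> carrier ?N"
   then obtain x where x: "x \<in> carrier M" "u = f x" by auto
   show "\<exists>v\<in>carrier ?N. v \<oplus>[?N] u = \<zero>[?N]"
    by (rule bexI[of _ "f (\<ominus>[M] x)"]) (use x in \<open>auto simp: M.l_neg\<close>)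
  qed (auto simp: M.a_ac)
 qed (auto simp: smult_l_distr smult_r_distr smult_assoc1)
 interpret N: Module.module "ga_ring S" ?N by (rule m)
 have dec: "is_dec S ?N (f x) (%g. f (hc S M x g))" if x: "x \<in> carrier M" for x
 proof (rule is_decI[where A = "{g. hc S M x g \<noteq> \<zero>[M]}"])
  show "finite {g. hc S M x g \<noteq> \<zero>[M]}" by (rule hc_finite[OF x])
  have "f (finsum M (hc S M x) {g. hc S M x g \<noteq> \<zero>[M]}) = finsum ?N (%g. f (hc S M x g)) {g. hc S M x g \<noteq> \<zero>[M]}"
   by (rule finsum_additive) (use x in \<open>auto intro: M.abelian_group_axioms N.abelian_group_axioms\<close>)
  then show "f x = finsum ?N (%g. f (hc S M x g)) {g. hc S M x g \<noteq> \<zero>[M]}"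
   using hc_sum[OF x hc_finite[OF x]] by simp
 qed (use x hc_comp[OF x] hc_out[OF x] in \<open>auto intro: N.abelian_group_axioms\<close>)
 show gr: "graded_module S ?N"
 proof (rule graded_moduleI[where pr = "%u g. f (hc S M (?i u) g)"])
  show "subgroup (gm_comp ?N g) (add_monoid ?N)" if g: "g \<in> Gc S" for g
  proof (rule N.M.add_subgroupI)
   show "gm_comp ?N g <= carrier ?N" using comp_carrier[OF g] by auto
   show "\<zero>[?N] \<in> gm_comp ?N g" using comp_zero[OF g] by simp
   show "u \<oplus>[?N] v \<in> gm_comp ?N g" if "u \<in> gm_comp ?N g" "v \<in> gm_comp ?N g" for u v
    using that comp_carrier[OF g] comp_add[OF g] by auto
   fix u assume "u \<in> gm_comp ?N g"
   then obtain x where x: "x \<in> gm_comp M g" "u = f x" by auto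
   have xc: "x \<in> carrier M" using x comp_carrier[OF g] by blast
   have "f (\<ominus>[M] x) \<oplus>[?N] u = \<zero>[?N]" using xc x by (simp add: M.l_neg)
   then have "\<ominus>[?N] u = f (\<ominus>[M] x)" using N.M.minus_equality xc x by auto
   then show "\<ominus>[?N] u \<in> gm_comp ?N g" using comp_minus[OF g x(1)] by simp
  qed
  show "is_dec S ?N u (%g. f (hc S M (?i u) g))" if "u \<in> carrier ?N" for u using that dec by auto
  show "f (hc S M (?i (u \<oplus>[?N] v)) g) = f (hc S M (?i u) g) \<oplus>[?N] f (hc S M (?i v) g)"
   if "u \<in> carrier ?N" "v \<in> carrier ?N" for u v g using that by (auto simp: hc_add)
  show "f (hc S M (?i u) g') = (if g' = g then u else \<zero>[?N])" if "g \<in> Gc S" "u \<in> gm_comp ?N g" for u g g'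
   using that comp_carrier[OF that(1)] by (auto simp: hc_of_comp)
  show "r \<odot>[?N] u \<in> gm_comp ?N (g \<otimes>[ga_grp S] h)"
   if "g \<in> Gc S" "h \<in> Gc S" "r \<in> ga_comp S g" "u \<in> gm_comp ?N h" for g h r u
   using that comp_smult[OF that(1,2,3)] comp_carrier[OF that(2)] by auto
 qed (rule m)
 interpret N': gmod S ?N using gr by unfold_locales
 have h: "hc S ?N (f x) = (%g. f (hc S M x g))" if "x \<in> carrier M" for x
  using N'.hc_unique[OF _ dec[OF that]] that by simp
 have "glin S M ?N ((%x. (x, f x)) ` carrier M)" unfolding glin_def by (auto simp: h image_iff)
 moreover have "((%x. (x, f x)) ` carrier M) O ((%x. (x, f x)) ` carrier M)\<inverse> = Id_on (carrier M)"
  using f by (auto dest: inj_onD)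
 moreover have "((%x. (x, f x)) ` carrier M)\<inverse> O ((%x. (x, f x)) ` carrier M) = Id_on (carrier ?N)" by auto
 ultimately show "giso S M ?N ((%x. (x, f x)) ` carrier M)" by (simp add: giso_def)
qed

lemma infinite_pair_inj:
 assumes "infinite (UNIV :: 'a set)"
 shows "\<exists>p :: 'a \<times> 'a => 'a. inj p"
proof -
 have "|UNIV \<times> UNIV :: ('a \<times> 'a) set| =o |UNIV :: 'a set|" using card_of_Times_same_infinite[OF assms] by simp
 then obtain p where "bij_betw p (UNIV \<times> UNIV :: ('a \<times> 'a) set) (UNIV :: 'a set)" using card_of_ordIso by blast
 then show ?thesis by (auto simp: bij_betw_def)
qed

text \<open>With one more generator \<open>b\<close>, an element is coded by a chosen coefficient of
  \<open>b\<close> and a chosen remainder; a pairing function on the infinite type combines the two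
  codes.\<close>

lemma (in gmod) fg_card:
 assumes R: "\<exists>f :: 'r => 'c. inj_on f (Rc S)" and inf: "infinite (UNIV :: 'c set)"
  and M: "M \<in> mod_objects S"
 shows "\<exists>f :: 'u => 'c. inj_on f (carrier M)"
proof -
 obtain fR :: "'r => 'c" where fR: "inj_on fR (Rc S)" using R by blast
 obtain p :: "'c \<times> 'c => 'c" where p: "inj p" using infinite_pair_inj[OF inf] by blast
 obtain B where B: "finite B" "B <= carrier M" "carrier M <= rspan (ga_ring S) M B"
  using M unfolding mod_objects_iff by blast
 have "\<exists>f :: 'u => 'c. inj_on f (rspan (ga_ring S) M B)"
  using B(1,2)
 proof (induction B rule: finite_induct)
  case empty
  have "x = \<zero>[M]" if "x \<in> rspan (ga_ring S) M {}" for x using that by (induction rule: rspan.induct) auto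
  then have "inj_on (%_. undefined) (rspan (ga_ring S) M {})" unfolding inj_on_def by blast
  then show ?case by blast
 next
  case (insert b B)
  then obtain f :: "'u => 'c" where f: "inj_on f (rspan (ga_ring S) M B)" by auto
  have b: "b \<in> carrier M" and Bc: "B <= carrier M" using insert.prems by auto
  have "\<exists>r x. r \<in> Rc S \<and> x \<in> rspan (ga_ring S) M B \<and> y = r \<odot>[M] b \<oplus>[M] x"
   if "y \<in> rspan (ga_ring S) M (insert b B)" for y
   using that
  proof (induction rule: rspan.induct)
   case rspan_zero
   show ?case by (rule exI[of _ "\<zero>[ga_ring S]"], rule exI[of _ "\<zero>[M]"]) (use b in \<open>auto intro: rspan.rspan_zero\<close>)
  next
   case (rspan_step s c y)
   then obtain r x where rx: "r \<in> Rc S" "x \<in> rspan (ga_ring S) M B" "y = r \<odot>[M] b \<oplus>[M] x" by blast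
   have xc: "x \<in> carrier M" using rspan_closed[OF rx(2) Bc] .
   show ?case
   proof (cases "c = b")
    case True
    have "s \<odot>[M] c \<oplus>[M] y = (s \<oplus>[ga_ring S] r) \<odot>[M] b \<oplus>[M] x"
     using rspan_step(1) rx b xc True by (simp add: smult_l_distr M.a_assoc)
    then show ?thesis using rspan_step(1) rx by blast
   next
    case False
    then have c: "c \<in> B" "c \<in> carrier M" using rspan_step(2) Bc by auto
    have "s \<odot>[M] c \<oplus>[M] y = r \<odot>[M] b \<oplus>[M] (s \<odot>[M] c \<oplus>[M] x)"
     using rspan_step(1) rx b xc c by (simp add: M.a_ac)
    then show ?thesis using rspan.rspan_step[OF rspan_step(1) c(1) rx(2)] rx(1) by blast
   qed
  qed
  then obtain r x where rx: "\<And>y. y \<in> rspan (ga_ring S) M (insert b B) ==>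
   r y \<in> Rc S \<and> x y \<in> rspan (ga_ring S) M B \<and> y = r y \<odot>[M] b \<oplus>[M] x y" by metis
  have "inj_on (%y. p (fR (r y), f (x y))) (rspan (ga_ring S) M (insert b B))"
  proof (rule inj_onI)
   fix y y' assume y: "y \<in> rspan (ga_ring S) M (insert b B)" "y' \<in> rspan (ga_ring S) M (insert b B)"
    and eq: "p (fR (r y), f (x y)) = p (fR (r y'), f (x y'))"
   have "fR (r y) = fR (r y')" "f (x y) = f (x y')" using injD[OF p eq] by auto
   then have "r y = r y'" "x y = x y'" using rx[OF y(1)] rx[OF y(2)] inj_onD[OF fR] inj_onD[OF f] by blast+
   then show "y = y'" using rx[OF y(1)] rx[OF y(2)] by metis
  qed
  then show ?case by blast
 qed
 then show ?thesis using B(3) inj_on_subset by blast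
qed

section \<open>Graded free modules and extension of scalars\<close>

locale gfree = grestr S S' H
 for S :: "('k::field, 'g, 'r) graded_algebra" and S' :: "('k, 'g, 'r) graded_algebra" and H :: "'g set" +
 fixes B :: "'b set" and d :: "'b => 'g"
 assumes B: "finite B" and d: "b \<in> B ==> d b \<in> H"
begin

text \<open>The free module with a generator of degree \<open>d b\<close> for each \<open>b\<close>.
  Coordinates off \<open>B\<close> are fixed at zero so that elements are plain functions. As all
  \<open>d b\<close> lie in \<open>H\<close>, an element lies in the \<open>H\<close>-part exactly
  when its coordinates do.\<close>

definition Fr :: "('g, 'r, 'b => 'r) gmodule" where
 "Fr = \<lparr>carrier = {c. (\<forall>b\<in>B. c b \<in> Rc S) \<and> (\<forall>b. b \<notin> B --> c b = \<zero>[ga_ring S])},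
   monoid.mult = undefined, one = undefined, ring.zero = (%_. \<zero>[ga_ring S]),
   ring.add = (%x y b. x b \<oplus>[ga_ring S] y b), module.smult = (%r x b. r \<otimes>[ga_ring S] x b),
   gm_comp = (%g. {c. (\<forall>b\<in>B. c b \<in> ga_comp S (g \<otimes>[ga_grp S] inv[ga_grp S] d b)) \<and> (\<forall>b. b \<notin> B --> c b = \<zero>[ga_ring S])})\<rparr>"

lemma Fr_simps [simp]:
 "c \<in> carrier Fr \<longleftrightarrow> (\<forall>b\<in>B. c b \<in> Rc S) \<and> (\<forall>b. b \<notin> B --> c b = \<zero>[ga_ring S])"
 "ring.zero Fr = (%_. \<zero>[ga_ring S])" "ring.add Fr = (%x y b. x b \<oplus>[ga_ring S] y b)"
 "module.smult Fr = (%r x b. r \<otimes>[ga_ring S] x b)"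
 "c \<in> gm_comp Fr g \<longleftrightarrow> (\<forall>b\<in>B. c b \<in> ga_comp S (g \<otimes>[ga_grp S] inv[ga_grp S] d b)) \<and> (\<forall>b. b \<notin> B --> c b = \<zero>[ga_ring S])"
 by (auto simp: Fr_def)

lemma Fr_val: "c \<in> carrier Fr ==> c b \<in> Rc S"
proof -
 interpret Rg: grmod S S' H "reg S" by (rule grmodI[OF reg])
 show "c \<in> carrier Fr ==> c b \<in> Rc S" by (cases "b \<in> B") auto
qed

lemma Fr_module: "Module.module (ga_ring S) Fr"
proof -
 interpret Rg: grmod S S' H "reg S" by (rule grmodI[OF reg])
 show ?thesis
 proof (rule moduleI[OF rng])
  show "abelian_group Fr"
  proof (rule abelian_groupI)
   fix x assume x: "x \<in> carrier Fr"
   have 0: "\<ominus>[ga_ring S] \<zero>[ga_ring S] = \<zero>[ga_ring S]"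
    using Rg.R.minus_equality[of "\<zero>[ga_ring S]" "\<zero>[ga_ring S]"] by simp
   show "\<exists>y\<in>carrier Fr. y \<oplus>[Fr] x = \<zero>[Fr]"
    by (rule bexI[of _ "%b. \<ominus>[ga_ring S] x b"]) (use x Fr_val[OF x] in \<open>auto simp: Rg.R.l_neg 0\<close>)
  next
   fix x y z assume "x \<in> carrier Fr" "y \<in> carrier Fr" "z \<in> carrier Fr"
   note v = this[THEN Fr_val]
   show "x \<oplus>[Fr] y \<oplus>[Fr] z = x \<oplus>[Fr] (y \<oplus>[Fr] z)" using v by (simp add: Rg.R.a_assoc)
  next
   fix x y assume "x \<in> carrier Fr" "y \<in> carrier Fr"
   note v = this[THEN Fr_val]
   show "x \<oplus>[Fr] y = y \<oplus>[Fr] x" using v by (simp add: Rg.R.a_comm)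
  next
   fix x assume "x \<in> carrier Fr"
   note v = this[THEN Fr_val]
   show "\<zero>[Fr] \<oplus>[Fr] x = x" using v by simp
  qed auto
 next
  fix r s x assume r: "r \<in> Rc S" "s \<in> Rc S" and "x \<in> carrier Fr"
  note v = this(3)[THEN Fr_val]
  show "(r \<oplus>[ga_ring S] s) \<odot>[Fr] x = r \<odot>[Fr] x \<oplus>[Fr] s \<odot>[Fr] x" using r v by (simp add: Rg.R.l_distr)
  show "(r \<otimes>[ga_ring S] s) \<odot>[Fr] x = r \<odot>[Fr] (s \<odot>[Fr] x)" using r v by (simp add: Rg.R.m_assoc)
 next
  fix r x y assume r: "r \<in> Rc S" and "x \<in> carrier Fr" "y \<in> carrier Fr"
  note v = this(2,3)[THEN Fr_val]
  show "r \<odot>[Fr] (x \<oplus>[Fr] y) = r \<odot>[Fr] x \<oplus>[Fr] r \<odot>[Fr] y" using r v by (simp add: Rg.R.r_distr)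
 next
  fix x assume "x \<in> carrier Fr"
  note v = this[THEN Fr_val]
  show "\<one>[ga_ring S] \<odot>[Fr] x = x" using v by simp
 qed auto
qed

lemma Fr_graded: "graded_module S Fr"
 "c \<in> carrier Fr ==> g \<in> Gc S ==> b \<in> B ==> hc S Fr c g b = hc S (reg S) (c b) (g \<otimes>[ga_grp S] inv[ga_grp S] d b)"
proof -
 interpret Rg: grmod S S' H "reg S" by (rule grmodI[OF reg])
 interpret F: Module.module "ga_ring S" Fr by (rule Fr_module)
 let ?G = "Gc S"
 have dG: "d b \<in> ?G" if "b \<in> B" for b using d[OF that] Rg.H_carrier by blast
 define pr where "pr c g = (%b. if g \<in> ?G \<and> b \<in> B then hc S (reg S) (c b) (g \<otimes>[ga_grp S] inv[ga_grp S] d b) else \<zero>[ga_ring S])" for c g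
 have bij: "g \<otimes>[ga_grp S] inv[ga_grp S] x \<otimes>[ga_grp S] x = g" "g \<otimes>[ga_grp S] x \<otimes>[ga_grp S] inv[ga_grp S] x = g" if "g \<in> ?G" "x \<in> ?G" for g x
  using that by (simp_all add: G.m_assoc)
 have prF: "pr c g \<in> carrier Fr" if "c \<in> carrier Fr" for c g
  using that Rg.hc_closed by (auto simp: pr_def)
 have dec: "is_dec S Fr c (pr c)" if c: "c \<in> carrier Fr" for c
 proof -
  \<comment> \<open>The degrees of an element: those of each coordinate, translated by the degree of
    the corresponding generator.\<close>
  define A where "A = (\<Union>b\<in>B. (%k. k \<otimes>[ga_grp S] d b) ` {k. hc S (reg S) (c b) k \<noteq> \<zero>[ga_ring S]})"
  have cb: "c b \<in> carrier (reg S)" for b using Fr_val[OF c] by simp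
  have Afin: "finite A" unfolding A_def using B Rg.hc_finite[OF cb] by auto
  have AG: "A <= ?G" unfolding A_def using Rg.hc_supp[OF cb] dG by auto
  show ?thesis
  proof (rule is_decI[OF F.M.abelian_group_axioms Afin])
   show "pr c g \<in> gm_comp Fr g" if "g \<in> ?G" for g
    using that Rg.hc_comp[OF cb] dG by (auto simp: pr_def)
   show "pr c g = \<zero>[Fr]" if "g \<notin> ?G" for g using that by (simp add: pr_def)
   show "pr c g = \<zero>[Fr]" if g: "g \<notin> A" for g
   proof
    fix b
    have "hc S (reg S) (c b) (g \<otimes>[ga_grp S] inv[ga_grp S] d b) = \<zero>[ga_ring S]" if b: "b \<in> B" "g \<in> ?G"
    proof (rule ccontr)
     assume "hc S (reg S) (c b) (g \<otimes>[ga_grp S] inv[ga_grp S] d b) \<noteq> \<zero>[ga_ring S]"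
     then have "g \<otimes>[ga_grp S] inv[ga_grp S] d b \<otimes>[ga_grp S] d b \<in> A" unfolding A_def using b by blast
     then show False using g bij(1)[OF b(2) dG[OF b(1)]] by simp
    qed
    then show "pr c g b = \<zero>[Fr] b" by (simp add: pr_def)
   qed
   show "pr c g \<in> carrier Fr" for g using prF[OF c] .
   show "c = finsum Fr (pr c) A"
   proof
    fix b
    have "finsum Fr (pr c) A b = finsum (reg S) (%g. pr c g b) A"
     by (rule finsum_additive[where \<phi> = "%c. c b"])
      (use prF[OF c] Fr_val in \<open>auto intro: F.M.abelian_group_axioms Rg.M.abelian_group_axioms\<close>)
    also have "\<dots> = c b"
    proof (cases "b \<in> B")
     case True
     let ?s = "%g. g \<otimes>[ga_grp S] inv[ga_grp S] d b"
     have inj: "inj_on ?s A" by (rule inj_onI) (use AG dG[OF True] in \<open>auto simp: subset_iff\<close>)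
     have "finsum (reg S) (%g. pr c g b) A = finsum (reg S) (%g. hc S (reg S) (c b) (?s g)) A"
      by (rule Rg.M.finsum_cong') (use AG True Rg.hc_closed[OF cb] in \<open>auto simp: pr_def subset_iff\<close>)
     also have "\<dots> = finsum (reg S) (hc S (reg S) (c b)) (?s ` A)"
      using Rg.M.finsum_reindex[OF _ inj, of "hc S (reg S) (c b)"] Rg.hc_closed[OF cb] by auto
     also have "\<dots> = c b"
     proof (rule Rg.hc_sum[OF cb, symmetric])
      show "finite (?s ` A)" using Afin by simp
      show "{k. hc S (reg S) (c b) k \<noteq> \<zero>[reg S]} <= ?s ` A"
      proof
       fix k assume k: "k \<in> {k. hc S (reg S) (c b) k \<noteq> \<zero>[reg S]}"
       then have kG: "k \<in> ?G" using Rg.hc_supp[OF cb] by blast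
       have "k \<otimes>[ga_grp S] d b \<in> A" unfolding A_def using k True by auto
       then show "k \<in> ?s ` A" using bij(2)[OF kG dG[OF True]] by (intro image_eqI[of _ _ "k \<otimes>[ga_grp S] d b"]) auto
      qed
     qed
     finally show ?thesis .
    next
     case False
     then have "finsum (reg S) (%g. pr c g b) A = \<zero>[ga_ring S]"
      using Rg.M.add.finprod_one_eqI[of A "%g. pr c g b"] by (simp add: pr_def)
     then show ?thesis using c False by simp
    qed
    finally show "c b = finsum Fr (pr c) A b" by simp
   qed
  qed
 qed
 show gr: "graded_module S Fr"
 proof (rule graded_moduleI[where pr = pr])
  show "subgroup (gm_comp Fr g) (add_monoid Fr)" if g: "g \<in> ?G" for g
  proof (rule F.M.add_subgroupI)
   have gd: "g \<otimes>[ga_grp S] inv[ga_grp S] d b \<in> ?G" if "b \<in> B" for b using g dG[OF that] by simp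
   have gF: "x \<in> carrier Fr" if "x \<in> gm_comp Fr g" for x
    using that ga_comp_closed[OF gd] by simp
   show "gm_comp Fr g <= carrier Fr" using gF by blast
   show "\<zero>[Fr] \<in> gm_comp Fr g" using Rg.comp_zero[OF gd] by simp
   show "x \<oplus>[Fr] y \<in> gm_comp Fr g" if "x \<in> gm_comp Fr g" "y \<in> gm_comp Fr g" for x y
    using that Rg.comp_add[OF gd] by simp
   fix x assume x: "x \<in> gm_comp Fr g"
   have xF: "x \<in> carrier Fr" using gF[OF x] .
   have 0: "\<ominus>[reg S] \<zero>[ga_ring S] = \<zero>[ga_ring S]"
    using Rg.M.minus_equality[of "\<zero>[reg S]" "\<zero>[reg S]"] by simp
   have m: "(%b. \<ominus>[reg S] x b) \<in> gm_comp Fr g" using x Rg.comp_minus[OF gd] 0 by simp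
   have "(%b. \<ominus>[reg S] x b) \<in> carrier Fr" using gF[OF m] .
   moreover have "(%b. \<ominus>[reg S] x b) \<oplus>[Fr] x = \<zero>[Fr]" using Rg.M.l_neg[of "x _"] Fr_val[OF xF] by (simp add: fun_eq_iff)
   ultimately have "\<ominus>[Fr] x = (%b. \<ominus>[reg S] x b)" using F.M.minus_equality xF by blast
   then show "\<ominus>[Fr] x \<in> gm_comp Fr g" using m by simp
  qed
  show "pr (x \<oplus>[Fr] y) g = pr x g \<oplus>[Fr] pr y g" if "x \<in> carrier Fr" "y \<in> carrier Fr" for x y g
   using Rg.hc_add[of "x _" "y _"] Fr_val[OF that(1)] Fr_val[OF that(2)] by (auto simp: pr_def fun_eq_iff)
  show "pr x g' = (if g' = g then x else \<zero>[Fr])" if g: "g \<in> ?G" and x: "x \<in> gm_comp Fr g" for g g' x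
  proof
   fix b
   show "pr x g' b = (if g' = g then x else \<zero>[Fr]) b"
   proof (cases "b \<in> B \<and> g' \<in> ?G")
    case True
    have gd: "g \<otimes>[ga_grp S] inv[ga_grp S] d b \<in> ?G" using g dG True by simp
    have xb: "x b \<in> gm_comp (reg S) (g \<otimes>[ga_grp S] inv[ga_grp S] d b)" using x True by simp
    have "g' \<otimes>[ga_grp S] inv[ga_grp S] d b = g \<otimes>[ga_grp S] inv[ga_grp S] d b \<longleftrightarrow> g' = g" using g dG True by simp
    then show ?thesis using Rg.hc_of_comp[OF gd xb] True by (simp add: pr_def)
   next
    case False
    then show ?thesis using x g by (auto simp: pr_def)
   qed
  qed
  show "r \<odot>[Fr] x \<in> gm_comp Fr (g \<otimes>[ga_grp S] h)"
   if "g \<in> ?G" "h \<in> ?G" "r \<in> ga_comp S g" "x \<in> gm_comp Fr h" for g h r x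
  proof -
   have "r \<otimes>[ga_ring S] x b \<in> ga_comp S (g \<otimes>[ga_grp S] h \<otimes>[ga_grp S] inv[ga_grp S] d b)" if "b \<in> B" for b
    using Rg.comp_smult[of g "h \<otimes>[ga_grp S] inv[ga_grp S] d b" r "x b"] \<open>x \<in> gm_comp Fr h\<close> \<open>g \<in> ?G\<close> \<open>h \<in> ?G\<close> \<open>r \<in> ga_comp S g\<close>
     that dG[OF that] by (simp add: G.m_assoc)
   then show ?thesis using that ga_comp_closed[OF that(1,3)] by simp
  qed
 qed (use F.module_axioms dec in auto)
 interpret F': gmod S Fr using gr by unfold_locales
 show "hc S Fr c g b = hc S (reg S) (c b) (g \<otimes>[ga_grp S] inv[ga_grp S] d b)" if "c \<in> carrier Fr" "g \<in> ?G" "b \<in> B"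
  using F'.hc_unique[OF that(1) dec[OF that(1)]] that by (simp add: pr_def)
qed

lemma Fr_fg: "Fr \<in> mod_objects S"
proof -
 interpret Rg: grmod S S' H "reg S" by (rule grmodI[OF reg])
 interpret F: gmod S Fr using Fr_graded(1) by unfold_locales
 define u where "u b = (%a. if a = b then \<one>[ga_ring S] else \<zero>[ga_ring S])" for b :: 'b
 have uF: "u ` B <= carrier Fr" by (auto simp: u_def)
 have "c \<in> rspan (ga_ring S) Fr (u ` B)" if "finite C" "C <= B" "c \<in> carrier Fr" "\<forall>b. b \<notin> C --> c b = \<zero>[ga_ring S]" for C c
  using that
 proof (induction C arbitrary: c rule: finite_induct)
  case empty
  then have "c = \<zero>[Fr]" by auto
  then show ?case using rspan.rspan_zero by metis
 next
  case (insert b C)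
  have b: "b \<in> B" using insert by auto
  let ?c = "c(b := \<zero>[ga_ring S])"
  have "?c \<in> rspan (ga_ring S) Fr (u ` B)" by (rule insert.IH) (use insert.prems in auto)
  then have "c b \<odot>[Fr] u b \<oplus>[Fr] ?c \<in> rspan (ga_ring S) Fr (u ` B)"
   using rspan.rspan_step[OF Fr_val[OF insert.prems(2)], of "u b" "u ` B" _ Fr b] b by blast
  moreover have "c b \<odot>[Fr] u b \<oplus>[Fr] ?c = c"
   using Fr_val[OF insert.prems(2)] by (auto simp: u_def fun_eq_iff)
  ultimately show ?case by simp
 qed
 from this[OF B subset_refl] have "carrier Fr <= rspan (ga_ring S) Fr (u ` B)" by auto
 then show ?thesis unfolding mod_objects_iff using F.gm uF B by blast
qed

end

section \<open>Addition of morphisms in the Serre quotient\<close>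

context galg
begin

lemma Hom_serre': "A \<in> Obj (serre_quotient U S) ==> B \<in> Obj (serre_quotient U S) ==>
  Hom (serre_quotient U S) A B = {qcl S A B Ga |Ga. grel S A B Ga}"
 using gmod2u.Hom_serre[of S A B U] gmodI[of A U] gmodI[of B U] by (simp add: gmod2u_def gmod2_def)

lemma Add_serre':
 assumes "A \<in> Obj (serre_quotient U S)" "B \<in> Obj (serre_quotient U S)" "grel S A B Ga" "grel S A B Da"
 shows "Add (serre_quotient U S) A B (qcl S A B Ga) (qcl S A B Da) = qcl S A B (rsum B Ga Da)" "grel S A B (rsum B Ga Da)"
proof -
 interpret gmod2u S A B using gmodI[OF assms(1)] gmodI[OF assms(2)] by (simp add: gmod2u_def gmod2_def)
 show "Add (serre_quotient U S) A B (qcl S A B Ga) (qcl S A B Da) = qcl S A B (rsum B Ga Da)" "grel S A B (rsum B Ga Da)"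
  using Add_serre grel_rsum assms by blast+
qed

lemma Add_closed_serre:
 assumes "A \<in> Obj (serre_quotient U S)" "B \<in> Obj (serre_quotient U S)"
  "f \<in> Hom (serre_quotient U S) A B" "g \<in> Hom (serre_quotient U S) A B"
 shows "Add (serre_quotient U S) A B f g \<in> Hom (serre_quotient U S) A B"
 using assms(3,4) Add_serre'[OF assms(1,2)] unfolding Hom_serre'[OF assms(1,2)] by auto

lemma qcl_eqI:
 assumes "A \<in> Obj (serre_quotient U S)" "B \<in> Obj (serre_quotient U S)" "grel S A B Ga" "grel S A B Da" "geq S A B Ga Da"
 shows "qcl S A B Ga = qcl S A B Da"
proof -
 interpret gmod2u S A B using gmodI[OF assms(1)] gmodI[OF assms(2)] by (simp add: gmod2u_def gmod2_def)
 show ?thesis using qcl_eq_iff assms by blast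
qed

lemma dist_serre:
 assumes o: "A \<in> Obj (serre_quotient U S)" "B \<in> Obj (serre_quotient U S)" "Z \<in> Obj (serre_quotient U S)"
 shows "f \<in> Hom (serre_quotient U S) A B ==> g \<in> Hom (serre_quotient U S) A B ==> h \<in> Hom (serre_quotient U S) B Z ==>
   Comp (serre_quotient U S) A B Z h (Add (serre_quotient U S) A B f g) =
   Add (serre_quotient U S) A Z (Comp (serre_quotient U S) A B Z h f) (Comp (serre_quotient U S) A B Z h g)"
  "f \<in> Hom (serre_quotient U S) B Z ==> g \<in> Hom (serre_quotient U S) B Z ==> h \<in> Hom (serre_quotient U S) A B ==>
   Comp (serre_quotient U S) A B Z (Add (serre_quotient U S) B Z f g) h =
   Add (serre_quotient U S) A Z (Comp (serre_quotient U S) A B Z f h) (Comp (serre_quotient U S) A B Z g h)"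
proof -
 note m = o[THEN gmodI]
 note c = grel_comp[OF m] and C = Comp_serre[OF m, of _ _ U]
 {
  assume "f \<in> Hom (serre_quotient U S) A B" "g \<in> Hom (serre_quotient U S) A B" "h \<in> Hom (serre_quotient U S) B Z"
  then obtain Ga Ga' Da where *: "grel S A B Ga" "f = qcl S A B Ga" "grel S A B Ga'" "g = qcl S A B Ga'" "grel S B Z Da" "h = qcl S B Z Da"
   using Hom_serre'[OF o(1,2)] Hom_serre'[OF o(2,3)] by auto
  note a = Add_serre'[OF o(1,2) *(1,3)] and a' = Add_serre'[OF o(1,3) c[OF *(1,5)] c[OF *(3,5)]]
  show "Comp (serre_quotient U S) A B Z h (Add (serre_quotient U S) A B f g) =
   Add (serre_quotient U S) A Z (Comp (serre_quotient U S) A B Z h f) (Comp (serre_quotient U S) A B Z h g)"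
   unfolding *(2,4,6) a(1) C[OF a(2) *(5)] C[OF *(1,5)] C[OF *(3,5)] a'(1)
   by (rule qcl_eqI[OF o(1,3) c[OF a(2) *(5)] a'(2) grel_rsum_O[OF m *(1,3,5)]])
 next
  assume "f \<in> Hom (serre_quotient U S) B Z" "g \<in> Hom (serre_quotient U S) B Z" "h \<in> Hom (serre_quotient U S) A B"
  then obtain Ga Ga' Da where *: "grel S B Z Ga" "f = qcl S B Z Ga" "grel S B Z Ga'" "g = qcl S B Z Ga'" "grel S A B Da" "h = qcl S A B Da"
   using Hom_serre'[OF o(1,2)] Hom_serre'[OF o(2,3)] by auto
  note a = Add_serre'[OF o(2,3) *(1,3)] and a' = Add_serre'[OF o(1,3) c[OF *(5,1)] c[OF *(5,3)]]
  show "Comp (serre_quotient U S) A B Z (Add (serre_quotient U S) B Z f g) h =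
   Add (serre_quotient U S) A Z (Comp (serre_quotient U S) A B Z f h) (Comp (serre_quotient U S) A B Z g h)"
   unfolding *(2,4,6) a(1) C[OF *(5) a(2)] C[OF *(5,1)] C[OF *(5,3)] a'(1)
   by (rule qcl_eqI[OF o(1,3) c[OF *(5) a(2)] a'(2) grel_O_rsum[OF m *(5,1,3)]])
 }
qed

end

lemma (in grmod2) giso_resrel:
 assumes i: "giso S M N Ga"
 shows "giso S' (res S H M) (res S H N) (resrel Ga)"
proof -
 have l: "glin S M N Ga" using i by (simp add: giso_def)
 have 1: "resrel Ga O (resrel Ga)\<inverse> = Id_on (hpart S H M)"
 proof
  show "resrel Ga O (resrel Ga)\<inverse> <= Id_on (hpart S H M)"
   using giso_inj[OF i] by (auto simp: resrel_def)
  show "Id_on (hpart S H M) <= resrel Ga O (resrel Ga)\<inverse>"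
  proof clarify
   fix x assume x: "x \<in> hpart S H M"
   then have "x \<in> Domain Ga" using giso_Domain[OF i] M.hpartD(1) by simp
   then have "x \<in> Domain (resrel Ga)" using Domain_resrel[OF l] x by simp
   then show "(x, x) \<in> resrel Ga O (resrel Ga)\<inverse>" by blast
  qed
 qed
 have 2: "(resrel Ga)\<inverse> O resrel Ga = Id_on (hpart S H N)"
 proof
  show "(resrel Ga)\<inverse> O resrel Ga <= Id_on (hpart S H N)"
   using giso_single[OF i] by (auto simp: resrel_def)
  show "Id_on (hpart S H N) <= (resrel Ga)\<inverse> O resrel Ga"
  proof clarify
   fix y assume y: "y \<in> hpart S H N"
   then have "y \<in> Domain (Ga\<inverse>)" using giso_Domain[OF giso_converse[OF i]] N.hpartD(1) by simp
   then obtain x where "(x, y) \<in> Ga" by blast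
   then have "(M.prH x, y) \<in> resrel Ga" using resrel_pr[OF l] N.prH_id[OF y] by metis
   then show "(y, y) \<in> (resrel Ga)\<inverse> O resrel Ga" by blast
  qed
 qed
 show ?thesis unfolding giso_def using glin_resrel[OF l] 1 2 by simp
qed

lemma (in gmod) quot_fg:
 assumes M: "M \<in> mod_objects S" and V: "gsub S M V"
 shows "quot_gmod M V \<in> mod_objects S"
proof -
 obtain B where B: "finite B" "B <= carrier M" "carrier M <= rspan (ga_ring S) M B"
  using M unfolding mod_objects_iff by blast
 let ?Q = "quot_gmod M V" and ?q = "%x. V +>[M] x"
 have "x \<in> carrier M \<and> ?q x \<in> rspan (ga_ring S) ?Q (?q ` B)" if "x \<in> rspan (ga_ring S) M B" for x
  using that
 proof (induction rule: rspan.induct)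
  case rspan_zero
  then show ?case using coset_zero[OF V] rspan.rspan_zero[of ?Q] by simp
 next
  case (rspan_step r b x)
  have b: "b \<in> carrier M" using B rspan_step by blast
  have "r \<odot>[?Q] ?q b \<oplus>[?Q] ?q x \<in> rspan (ga_ring S) ?Q (?q ` B)"
   by (rule rspan.rspan_step) (use rspan_step in auto)
  moreover have "r \<odot>[?Q] ?q b \<oplus>[?Q] ?q x = ?q (r \<odot>[M] b \<oplus>[M] x)"
   using b rspan_step coset_smult[OF V rspan_step(1) b] coset_sum[OF V V subset_refl, of "r \<odot>[M] b" x] by simp
  ultimately show ?case using b rspan_step by simp
 qed
 then have "carrier ?Q <= rspan (ga_ring S) ?Q (?q ` B)" using B(3) by auto
 moreover have "?q ` B <= carrier ?Q" using B(2) by auto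
 ultimately show ?thesis unfolding mod_objects_iff using quot_graded(1)[OF V] B(1) by blast
qed

context grestr
begin

text \<open>\<open>N\<close> is the quotient of the \<open>H\<close>-part of a graded free module by
  a kernel \<open>K\<close>. Dividing the free module by the largest graded submodule
  \<open>Z\<close> that meets its \<open>H\<close>-part in \<open>K\<close> gives a module whose
  \<open>H\<close>-part is \<open>N\<close>.\<close>

lemma extension_exists:
 fixes N :: "('g, 'r, 'v) gmodule"
 assumes N: "N \<in> mod_objects S'"
 shows "\<exists>(M :: ('g, 'r, ('v => 'r) set) gmodule) J. M \<in> mod_objects S \<and> giso S' N (res S H M) J"
proof -
 interpret N: gmod S' N using N by unfold_locales (simp add: mod_objects_def)
 obtain B0 where B0: "finite B0" "B0 <= carrier N" "carrier N <= rspan (ga_ring S') N B0"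
  using N unfolding mod_objects_iff by blast
 \<comment> \<open>Homogeneous generators, so that the free module can be graded to make the map
   onto \<open>N\<close> preserve degrees.\<close>
 define B where "B = (\<Union>b\<in>B0. hc S' N b ` {g. hc S' N b g \<noteq> \<zero>[N]})"
 have Bfin: "finite B" unfolding B_def using B0 N.hc_finite by auto
 have "\<exists>g. b \<in> B --> g \<in> H \<and> b \<in> gm_comp N g" for b
 proof (cases "b \<in> B")
  case True
  then obtain b0 g where *: "b0 \<in> B0" "b = hc S' N b0 g" "hc S' N b0 g \<noteq> \<zero>[N]" unfolding B_def by blast
  then have "g \<in> Gc S'" using N.hc_supp[of b0] B0 by auto
  then show ?thesis using N.hc_comp[of b0 g] * B0(2) by auto
 qed simp
 then have "\<exists>d. \<forall>b. b \<in> B --> d b \<in> H \<and> b \<in> gm_comp N (d b)" by (intro choice allI)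
 then obtain d where d: "\<And>b. b \<in> B ==> d b \<in> H" "\<And>b. b \<in> B ==> b \<in> gm_comp N (d b)" by blast
 have Bc: "B <= carrier N" using N.comp_carrier[of "d _"] d by auto
 have "B0 <= rspan (ga_ring S') N B"
 proof
  fix b assume b: "b \<in> B0"
  have bc: "b \<in> carrier N" using b B0 by blast
  have "finsum N (hc S' N b) {g. hc S' N b g \<noteq> \<zero>[N]} \<in> rspan (ga_ring S') N B"
  proof (rule N.M.finsum_mem)
   show "hc S' N b \<in> {g. hc S' N b g \<noteq> \<zero>[N]} \<rightarrow> rspan (ga_ring S') N B"
    using b N.rspan_base[OF Bc] unfolding B_def by blast
  qed (use Bc N.rspan_closed N.rspan_add[OF Bc] in \<open>auto intro: rspan.rspan_zero\<close>)
  then show "b \<in> rspan (ga_ring S') N B" using N.hc_sum[OF bc N.hc_finite[OF bc]] by simp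
 qed
 then have gen: "carrier N <= rspan (ga_ring S') N B" using N.rspan_trans[OF Bc] B0(3) by blast
 interpret Fre: gfree S S' H B d using Bfin d(1) by unfold_locales
 let ?F = "Fre.Fr"
 interpret F: grmod S S' H ?F by (rule grmodI[OF Fre.Fr_graded(1)])
 interpret FF: grmod2 S S' H ?F ?F by unfold_locales
 let ?hF = "hpart S H ?F"
 \<comment> \<open>Evaluation at the generators. It makes sense on the \<open>H\<close>-part only,
   where the coordinates belong to the small ring that acts on \<open>N\<close>.\<close>
 define \<pi> where "\<pi> c = (\<Oplus>\<^bsub>N\<^esub>b\<in>B. c b \<odot>[N] b)" for c
 have hF: "c \<in> ?hF \<longleftrightarrow> c \<in> carrier ?F \<and> (\<forall>b\<in>B. c b \<in> hpart S H (reg S))" for c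
 proof
  assume c: "c \<in> ?hF"
  then have cF: "c \<in> carrier ?F" using F.hpartD by blast
  have "c b \<in> hpart S H (reg S)" if b: "b \<in> B" for b
  proof -
   have "hc S (reg S) (c b) k = \<zero>[ga_ring S]" if k: "k \<notin> H" for k
   proof (cases "k \<in> Gc S")
    case True
    have dG: "d b \<in> Gc S" using d(1)[OF b] F.H_carrier by blast
    have "k \<otimes>[ga_grp S] d b \<notin> H" using F.H_cancel_r[OF d(1)[OF b] True] k by blast
    then have "hc S ?F c (k \<otimes>[ga_grp S] d b) b = \<zero>[ga_ring S]" using F.hpartD(2)[OF c] by simp
    then show ?thesis using Fre.Fr_graded(2)[OF cF _ b, of "k \<otimes>[ga_grp S] d b"] True dG by (simp add: G.m_assoc)
   next
    case False
    then show ?thesis using F.Rg.hc_out[of "c b" k] Fre.Fr_val[OF cF] by simp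
   qed
   then show ?thesis using Fre.Fr_val[OF cF] by (simp add: hpart_def)
  qed
  then show "c \<in> carrier ?F \<and> (\<forall>b\<in>B. c b \<in> hpart S H (reg S))" using cF by blast
 next
  assume c: "c \<in> carrier ?F \<and> (\<forall>b\<in>B. c b \<in> hpart S H (reg S))"
  have "hc S ?F c g = \<zero>[?F]" if g: "g \<notin> H" for g
  proof (cases "g \<in> Gc S")
   case True
   have hcF: "hc S ?F c g \<in> carrier ?F" using F.hc_closed c by blast
   show ?thesis
   proof
    fix b
    show "hc S ?F c g b = \<zero>[?F] b"
    proof (cases "b \<in> B")
     case b: True
     have "inv[ga_grp S] d b \<in> H" using subgroup.m_inv_closed[OF H d(1)[OF b]] .
     then have "g \<otimes>[ga_grp S] inv[ga_grp S] d b \<notin> H" using F.H_cancel_r True g by blast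
     then show ?thesis using Fre.Fr_graded(2)[OF _ True b] c b by (simp add: hpart_def)
    next
     case False
     then show ?thesis using hcF by simp
    qed
   qed
  next
   case False
   then show ?thesis using F.hc_out c by blast
  qed
  then show "c \<in> ?hF" using c by (simp add: hpart_def)
 qed
 have cbB: "(%b. c b \<odot>[N] b) \<in> B \<rightarrow> carrier N" if "c \<in> ?hF" for c
  using that hF[of c] Bc N.smult_closed by auto
 have \<pi>c: "\<pi> c \<in> carrier N" if "c \<in> ?hF" for c unfolding \<pi>_def by (rule N.M.finsum_closed[OF cbB[OF that]])
 have \<pi>add: "\<pi> (c \<oplus>[?F] c') = \<pi> c \<oplus>[N] \<pi> c'" if c: "c \<in> ?hF" "c' \<in> ?hF" for c c'
 proof -
  have "\<pi> (c \<oplus>[?F] c') = (\<Oplus>\<^bsub>N\<^esub>b\<in>B. c b \<odot>[N] b \<oplus>[N] c' b \<odot>[N] b)"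
   unfolding \<pi>_def
  proof (rule N.M.finsum_cong')
   show "(c \<oplus>[?F] c') b \<odot>[N] b = c b \<odot>[N] b \<oplus>[N] c' b \<odot>[N] b" if b: "b \<in> B" for b
    using N.smult_l_distr[of "c b" "c' b" b] b Bc c hF[of c] hF[of c'] by auto
  qed (use cbB[OF c(1)] cbB[OF c(2)] in auto)
  then show ?thesis using N.M.finsum_addf[OF cbB[OF c(1)] cbB[OF c(2)]] by (simp add: \<pi>_def)
 qed
 have \<pi>sm: "\<pi> (r \<odot>[?F] c) = r \<odot>[N] \<pi> c" if r: "r \<in> Rc S'" and c: "c \<in> ?hF" for r c
 proof -
  have "r \<odot>[N] \<pi> c = (\<Oplus>\<^bsub>N\<^esub>b\<in>B. r \<odot>[N] (c b \<odot>[N] b))"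
   unfolding \<pi>_def by (rule finsum_additive) (use r cbB[OF c] in \<open>auto intro: N.M.abelian_group_axioms simp: N.smult_r_distr\<close>)
  also have "\<dots> = \<pi> (r \<odot>[?F] c)"
   unfolding \<pi>_def
  proof (rule N.M.finsum_cong')
   show "r \<odot>[N] (c b \<odot>[N] b) = (r \<odot>[?F] c) b \<odot>[N] b" if b: "b \<in> B" for b
    using N.smult_assoc1[of r "c b" b] b Bc r c hF[of c] by auto
  qed (use cbB[OF F.hpart_smult[OF _ c, of r]] r in auto)
  finally show ?thesis by simp
 qed
 have \<pi>hom: "\<pi> c \<in> gm_comp N g" if g: "g \<in> Gc S'" and c: "c \<in> gm_comp (res S H ?F) g" for g c
  unfolding \<pi>_def
 proof (rule N.M.finsum_mem)
  show "(%b. c b \<odot>[N] b) \<in> B \<rightarrow> gm_comp N g"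
  proof
   fix b assume b: "b \<in> B"
   have gG: "g \<in> H" "g \<in> Gc S" using g F.H_carrier by auto
   have dH: "d b \<in> H" "d b \<in> Gc S" using d(1)[OF b] F.H_carrier by auto
   have gd: "g \<otimes>[ga_grp S] inv[ga_grp S] d b \<in> H"
    using gG dH subgroup.m_closed[OF H] subgroup.m_inv_closed[OF H] by blast
   have "c b \<in> ga_comp S' (g \<otimes>[ga_grp S] inv[ga_grp S] d b)" using c b comp'[OF gd] by simp
   then have "c b \<odot>[N] b \<in> gm_comp N (g \<otimes>[ga_grp S] inv[ga_grp S] d b \<otimes>[ga_grp S] d b)"
    using N.comp_smult[of "g \<otimes>[ga_grp S] inv[ga_grp S] d b" "d b" "c b" b] gd dH d(2)[OF b] by simp
   then show "c b \<odot>[N] b \<in> gm_comp N g" using gG dH by (simp add: G.m_assoc)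
  qed
 qed (use N.comp_carrier[OF g] N.comp_zero[OF g] N.comp_add[OF g] in auto)
 have \<pi>hc: "hc S' N (\<pi> c) g = \<pi> (hc S ?F c g)" if c: "c \<in> ?hF" for c g
 proof -
  have "hc S' N (\<pi> c) g = \<pi> (hc S' (res S H ?F) c g)"
   by (rule graded_map_hc[OF F.N.gmod_axioms N.gmod_axioms]) (use \<pi>c \<pi>add \<pi>hom c in auto)
  then show ?thesis using F.res_graded(2)[OF c] by simp
 qed
 have \<pi>surj: "\<exists>c\<in>?hF. \<pi> c = y" if y: "y \<in> carrier N" for y
 proof -
  obtain c where c: "c \<in> B \<rightarrow> Rc S'" "y = (\<Oplus>\<^bsub>N\<^esub>b\<in>B. c b \<odot>[N] b)"
   using gen y N.rspan_finite[OF Bfin Bc] by blast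
  let ?c = "%b. if b \<in> B then c b else \<zero>[ga_ring S]"
  have "?c \<in> ?hF" unfolding hF using c(1) by (auto simp: hpart_def Pi_iff)
  moreover have "\<pi> ?c = y" unfolding \<pi>_def c(2) by (rule N.M.finsum_cong') (use c(1) Bc N.smult_closed in \<open>auto simp: Pi_iff subset_iff\<close>)
  ultimately show ?thesis by blast
 qed
 have \<pi>0: "\<pi> \<zero>[?F] = \<zero>[N]"
 proof -
  have "\<pi> \<zero>[?F] \<oplus>[N] \<pi> \<zero>[?F] = \<pi> \<zero>[?F]"
   using \<pi>add[OF F.hpart_zero F.hpart_zero] F.M.l_zero[OF F.M.zero_closed] by simp
  then show ?thesis using N.M.add.r_cancel_one'[OF \<pi>c[OF F.hpart_zero] \<pi>c[OF F.hpart_zero]] by metis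
 qed
 define K where "K = {c \<in> ?hF. \<pi> c = \<zero>[N]}"
 have K: "gsub S' (res S H ?F) K"
  unfolding gsub_def K_def
 proof (intro conjI ballI)
  show "\<zero>[res S H ?F] \<in> {c \<in> ?hF. \<pi> c = \<zero>[N]}" using \<pi>0 F.hpart_zero by simp
  fix x g assume x: "x \<in> {c \<in> ?hF. \<pi> c = \<zero>[N]}" and g: "g \<in> Gc S'"
  show "hc S' (res S H ?F) x g \<in> {c \<in> ?hF. \<pi> c = \<zero>[N]}"
   using x F.res_graded(2)[of x] F.hpart_hc[of x g] \<pi>hc[of x g] by simp
 next
  fix r x assume r: "r \<in> Rc S'" and x: "x \<in> {c \<in> ?hF. \<pi> c = \<zero>[N]}"
  show "r \<odot>[res S H ?F] x \<in> {c \<in> ?hF. \<pi> c = \<zero>[N]}"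
   using x r F.hpart_smult[of r x] \<pi>sm[of r x] by simp
 next
  fix x y assume "x \<in> {c \<in> ?hF. \<pi> c = \<zero>[N]}" "y \<in> {c \<in> ?hF. \<pi> c = \<zero>[N]}"
  then show "x \<oplus>[res S H ?F] y \<in> {c \<in> ?hF. \<pi> c = \<zero>[N]}"
   using F.hpart_add[of x y] \<pi>add[of x y] by simp
 qed auto
 \<comment> \<open>Turning \<open>K\<close> into a relation with trivial source lets
   \<open>star\<close> produce the largest graded submodule over it, as a fibre over zero.\<close>
 let ?Ga = "{\<zero>[?F]} \<times> K"
 note K' = F.N.gsubD[OF K]
 have "glin S' (res S H ?F) (res S H ?F) ?Ga"
  unfolding glin_def
 proof (intro conjI allI impI ballI)
  show "?Ga <= carrier (res S H ?F) \<times> carrier (res S H ?F)" using K'(1) F.hpart_zero by auto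
  show "(\<zero>[res S H ?F], \<zero>[res S H ?F]) \<in> ?Ga" using K'(2) by simp
 next
  fix x y x' y' assume "(x, y) \<in> ?Ga" "(x', y') \<in> ?Ga"
  then show "(x \<oplus>[res S H ?F] x', y \<oplus>[res S H ?F] y') \<in> ?Ga"
   using K'(3)[of y y'] F.N.M.l_zero[OF F.N.M.zero_closed] by auto
 next
  fix r x y assume r: "r \<in> Rc S'" "(x, y) \<in> ?Ga"
  then show "(r \<odot>[res S H ?F] x, r \<odot>[res S H ?F] y) \<in> ?Ga"
   using K'(4)[of r y] F.N.smult_r_null[of r] by auto
 next
  fix g x y assume "(x, y) \<in> ?Ga"
  then show "(hc S' (res S H ?F) x g, hc S' (res S H ?F) y g) \<in> ?Ga"
   using K'(5)[of y g] F.N.hc_zero[of g] by auto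
 qed
 note st = FF.glin_star[OF this] and rs = FF.resrel_star[OF this]
 define Z where "Z = FF.star ?Ga `` {\<zero>[?F]}"
 have Z: "gsub S ?F Z" unfolding Z_def by (rule FF.MN.gsub_fibre[OF st])
 have ZK: "x \<in> Z \<and> x \<in> ?hF \<longleftrightarrow> x \<in> K" for x
 proof -
  have "(\<zero>[?F], x) \<in> FF.resrel (FF.star ?Ga) \<longleftrightarrow> x \<in> Z \<and> x \<in> ?hF"
   using F.hpart_zero by (auto simp: FF.resrel_def Z_def)
  then show ?thesis unfolding rs by auto
 qed
 define M where "M = quot_gmod ?F Z"
 have M: "M \<in> mod_objects S" unfolding M_def by (rule F.quot_fg[OF Fre.Fr_fg Z])
 interpret M: grmod S S' H M using M by (intro grmodI) (simp add: mod_objects_def)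
 let ?q = "%x. Z +>[?F] x"
 have Mc: "carrier M = ?q ` carrier ?F" unfolding M_def by simp
 have hcq: "hc S M (?q x) g = ?q (hc S ?F x g)" if "x \<in> carrier ?F" for x g
  unfolding M_def by (rule F.quot_graded(2)[OF Z that])
 have qz: "?q x = \<zero>[M] \<longleftrightarrow> x \<in> Z" if "x \<in> carrier ?F" for x
 proof -
  have "?q x = ?q \<zero>[?F] \<longleftrightarrow> x \<ominus>[?F] \<zero>[?F] \<in> Z" by (rule F.coset_eq[OF Z that F.M.zero_closed])
  moreover have "x \<ominus>[?F] \<zero>[?F] = x"
   using that F.M.minus_equality[OF F.M.l_zero[OF F.M.zero_closed] F.M.zero_closed F.M.zero_closed] F.M.r_zero[OF that]
   unfolding a_minus_def by simp
  moreover have "\<zero>[M] = Z" unfolding M_def by simp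
  ultimately show ?thesis using F.coset_zero[OF Z] by simp
 qed
 have qh: "?q c \<in> hpart S H M" if c: "c \<in> ?hF" for c
 proof -
  have cF: "c \<in> carrier ?F" using F.hpartD(1)[OF c] .
  have "hc S M (?q c) g = \<zero>[M]" if "g \<notin> H" for g
   using hcq[OF cF, of g] F.hpartD(2)[OF c that] qz[OF F.M.zero_closed] F.gsubD(2)[OF Z] by simp
  then show ?thesis using cF Mc by (auto simp: hpart_def)
 qed
 have qsurj: "\<exists>c\<in>?hF. ?q c = C" if C: "C \<in> hpart S H M" for C
 proof -
  obtain c where c: "c \<in> carrier ?F" "C = ?q c" using M.hpartD(1)[OF C] Mc by auto
  have pc: "F.prH c \<in> carrier ?F" using F.prH_closed[OF c(1)] .
  \<comment> \<open>The components of \<open>c\<close> outside \<open>H\<close> vanish in the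
    quotient, so a coset in the \<open>H\<close>-part has a representative in the
    \<open>H\<close>-part.\<close>
  have "c \<ominus>[?F] F.prH c \<in> Z"
  proof (rule F.gsub_hcI[OF Z F.M.minus_closed[OF c(1) pc]])
   fix g assume g: "g \<in> Gc S"
   have e: "hc S ?F (c \<ominus>[?F] F.prH c) g = hc S ?F c g \<oplus>[?F] (\<ominus>[?F] (if g \<in> H then hc S ?F c g else \<zero>[?F]))"
    unfolding a_minus_def F.hc_add[OF c(1) F.M.a_inv_closed[OF pc]] F.hc_minus[OF pc] F.hc_prH[OF c(1)] ..
   show "hc S ?F (c \<ominus>[?F] F.prH c) g \<in> Z"
   proof (cases "g \<in> H")
    case True
    then have "hc S ?F (c \<ominus>[?F] F.prH c) g = \<zero>[?F]" unfolding e using F.M.r_neg[OF F.hc_closed[OF c(1), of g]] by simp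
    then show ?thesis using F.gsubD(2)[OF Z] by simp
   next
    case False
    have "?q (hc S ?F c g) = \<zero>[M]" using hcq[OF c(1)] M.hpartD(2)[OF C False] c(2) by simp
    then have hz: "hc S ?F c g \<in> Z" using qz[OF F.hc_closed[OF c(1)]] by blast
    have "hc S ?F c g \<oplus>[?F] (\<ominus>[?F] \<zero>[?F]) \<in> Z"
     using F.gsubD(3)[OF Z hz F.gsubD(6)[OF Z F.gsubD(2)[OF Z]]] .
    then show ?thesis unfolding e using False by simp
   qed
  qed
  then have "?q c = ?q (F.prH c)" using F.coset_eq[OF Z c(1) pc] by blast
  then show ?thesis using F.prH_hpart[OF c(1)] c(2) by blast
 qed
 define J where "J = (%c. (\<pi> c, ?q c)) ` ?hF"
 have Jmem: "(x, C) \<in> J \<longleftrightarrow> (\<exists>c\<in>?hF. x = \<pi> c \<and> C = ?q c)" for x C by (auto simp: J_def)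
 have qadd: "?q (c \<oplus>[?F] c') = ?q c \<oplus>[M] ?q c'" if "c \<in> carrier ?F" "c' \<in> carrier ?F" for c c'
  using F.coset_sum[OF Z Z subset_refl that] unfolding M_def by simp
 have qsm: "?q (r \<odot>[?F] c) = r \<odot>[M] ?q c" if "r \<in> Rc S" "c \<in> carrier ?F" for r c
  using F.coset_smult[OF Z that] unfolding M_def by simp
 have "glin S' N (res S H M) J"
  unfolding glin_def
 proof (intro conjI allI impI ballI)
  show "J <= carrier N \<times> carrier (res S H M)" using \<pi>c qh by (auto simp: J_def)
  have "?q \<zero>[?F] = \<zero>[M]" using qz[OF F.M.zero_closed] F.gsubD(2)[OF Z] by blast
  then show "(\<zero>[N], \<zero>[res S H M]) \<in> J" unfolding Jmem using \<pi>0 F.hpart_zero by (intro bexI[of _ "\<zero>[?F]"]) auto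
 next
  fix x C x' C' assume "(x, C) \<in> J" "(x', C') \<in> J"
  then obtain c c' where *: "c \<in> ?hF" "x = \<pi> c" "C = ?q c" "c' \<in> ?hF" "x' = \<pi> c'" "C' = ?q c'" unfolding Jmem by blast
  then show "(x \<oplus>[N] x', C \<oplus>[res S H M] C') \<in> J"
   unfolding Jmem using F.hpart_add[OF *(1,4)] \<pi>add[OF *(1,4)] qadd[OF F.hpartD(1)[OF *(1)] F.hpartD(1)[OF *(4)]]
   by (intro bexI[of _ "c \<oplus>[?F] c'"]) auto
 next
  fix r x C assume r: "r \<in> Rc S'" and "(x, C) \<in> J"
  then obtain c where *: "c \<in> ?hF" "x = \<pi> c" "C = ?q c" unfolding Jmem by blast
  have r': "r \<in> hpart S H (reg S)" "r \<in> Rc S" using r by (auto simp: hpart_def)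
  show "(r \<odot>[N] x, r \<odot>[res S H M] C) \<in> J"
   unfolding Jmem using F.hpart_smult[OF r'(1) *(1)] \<pi>sm[OF r *(1)] qsm[OF r'(2) F.hpartD(1)[OF *(1)]] *
   by (intro bexI[of _ "r \<odot>[?F] c"]) auto
 next
  fix g x C assume "(x, C) \<in> J"
  then obtain c where *: "c \<in> ?hF" "x = \<pi> c" "C = ?q c" unfolding Jmem by blast
  show "(hc S' N x g, hc S' (res S H M) C g) \<in> J"
   unfolding Jmem using F.hpart_hc[OF *(1)] \<pi>hc[OF *(1)] hcq[OF F.hpartD(1)[OF *(1)]] * M.res_graded(2)[OF qh[OF *(1)]]
   by (intro bexI[of _ "hc S ?F c g"]) auto
 qed
 \<comment> \<open>Both sides say that the difference lies in the kernel, since \<open>Z\<close> and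
   \<open>K\<close> agree on the \<open>H\<close>-part. This makes \<open>J\<close> well defined and
   bijective.\<close>
 moreover have key: "\<pi> c = \<pi> c' \<longleftrightarrow> ?q c = ?q c'" if c: "c \<in> ?hF" "c' \<in> ?hF" for c c'
 proof -
  note cF = F.hpartD(1)[OF c(1)] F.hpartD(1)[OF c(2)]
  have mh: "\<ominus>[?F] c' \<in> ?hF" using F.hpart_minus[OF c(2)] .
  have dh: "c \<ominus>[?F] c' \<in> ?hF" unfolding a_minus_def by (rule F.hpart_add[OF c(1) mh])
  have "\<pi> (\<ominus>[?F] c') \<oplus>[N] \<pi> c' = \<zero>[N]" using \<pi>add[OF mh c(2)] F.M.l_neg[OF cF(2)] \<pi>0 by simp
  then have "\<pi> (\<ominus>[?F] c') = \<ominus>[N] \<pi> c'" using N.M.minus_equality[of "\<pi> (\<ominus>[?F] c')" "\<pi> c'"] \<pi>c mh c by simp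
  then have "\<pi> (c \<ominus>[?F] c') = \<pi> c \<ominus>[N] \<pi> c'" unfolding a_minus_def using \<pi>add[OF c(1) mh] by simp
  moreover have "\<pi> c \<ominus>[N] \<pi> c' = \<zero>[N] \<longleftrightarrow> \<pi> c = \<pi> c'"
  proof
   assume "\<pi> c \<ominus>[N] \<pi> c' = \<zero>[N]"
   moreover have "\<pi> c = (\<pi> c \<ominus>[N] \<pi> c') \<oplus>[N] \<pi> c'"
    using \<pi>c[OF c(1)] \<pi>c[OF c(2)] by (simp add: N.M.minus_eq N.M.a_assoc N.M.l_neg)
   ultimately show "\<pi> c = \<pi> c'" using \<pi>c[OF c(2)] by simp
  qed (use \<pi>c[OF c(2)] in \<open>simp add: N.M.minus_eq N.M.r_neg\<close>)
  ultimately have "\<pi> c = \<pi> c' \<longleftrightarrow> c \<ominus>[?F] c' \<in> K" using dh by (auto simp: K_def)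
  also have "\<dots> \<longleftrightarrow> c \<ominus>[?F] c' \<in> Z" using ZK dh by blast
  also have "\<dots> \<longleftrightarrow> ?q c = ?q c'" using F.coset_eq[OF Z cF] by simp
  finally show ?thesis .
 qed
 moreover have "J O J\<inverse> = Id_on (carrier N)"
 proof
  show "J O J\<inverse> <= Id_on (carrier N)"
  proof clarify
   fix x x' C assume "(x, C) \<in> J" "(x', C) \<in> J"
   then obtain c c' where "c \<in> ?hF" "x = \<pi> c" "C = ?q c" "c' \<in> ?hF" "x' = \<pi> c'" "C = ?q c'" unfolding Jmem by blast
   then show "(x, x') \<in> Id_on (carrier N)" using key[of c c'] \<pi>c[of c] by (simp add: Id_on_iff)
  qed
  show "Id_on (carrier N) <= J O J\<inverse>"
  proof clarify
   fix x assume "x \<in> carrier N"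
   then obtain c where "c \<in> ?hF" "\<pi> c = x" using \<pi>surj by blast
   then have "(x, ?q c) \<in> J" unfolding Jmem by blast
   then show "(x, x) \<in> J O J\<inverse>" by blast
  qed
 qed
 moreover have "J\<inverse> O J = Id_on (carrier (res S H M))"
 proof
  show "J\<inverse> O J <= Id_on (carrier (res S H M))"
  proof clarify
   fix C C' x assume "(x, C) \<in> J" "(x, C') \<in> J"
   then obtain c c' where "c \<in> ?hF" "x = \<pi> c" "C = ?q c" "c' \<in> ?hF" "x = \<pi> c'" "C' = ?q c'" unfolding Jmem by blast
   then show "(C, C') \<in> Id_on (carrier (res S H M))" using key[of c c'] qh[of c] by (simp add: Id_on_iff)
  qed
  show "Id_on (carrier (res S H M)) <= J\<inverse> O J"
  proof clarify
   fix C assume "C \<in> carrier (res S H M)"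
   then obtain c where "c \<in> ?hF" "?q c = C" using qsurj by auto
   then have "(\<pi> c, C) \<in> J" unfolding Jmem by blast
   then show "(C, C) \<in> J\<inverse> O J" by blast
  qed
 qed
 ultimately have "giso S' N (res S H M) J" by (simp add: giso_def)
 then show ?thesis using M by blast
qed

end

section \<open>The equivalence\<close>

context vmod2
begin

text \<open>Both directions are monotonicity. For the converse, \<open>star\<close> carries the
  equivalence back, and each relation is contained in the \<open>star\<close> of its
  restriction.\<close>

lemma geq_resrel_iff:
 assumes M: "M \<in> mod_objects S" and N: "N \<in> mod_objects S" and Ga: "grel S M N Ga" and Da: "grel S M N Da"
 shows "geq S' (res S H M) (res S H N) (resrel Ga) (resrel Da) \<longleftrightarrow> geq S M N Ga Da"
proof
 assume g: "geq S M N Ga Da"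
 show "geq S' (res S H M) (res S H N) (resrel Ga) (resrel Da)"
  by (rule MN.geq_cong[OF Ga Da g grel_resrel _ MN'.gmod2_axioms]) (auto simp: resrel_def)
next
 assume g: "geq S' (res S H M) (res S H N) (resrel Ga) (resrel Da)"
 note s = grel_star[OF M N]
 have 1: "geq S M N (star (resrel Ga)) (star (resrel Da))"
  by (rule MN'.geq_cong[OF grel_resrel[OF Ga] grel_resrel[OF Da] g s star_mono MN.gmod2_axioms])
 have Gas: "grel S M N (star (resrel Ga))" and Das: "grel S M N (star (resrel Da))"
  using s grel_resrel Ga Da by blast+
 have 2: "geq S M N Ga (star (resrel Ga))" using MN.geq_sub[OF Ga Gas star_resrel[OF MN.grel_glin[OF Ga]]] .
 have 3: "geq S M N Da (star (resrel Da))" using MN.geq_sub[OF Da Das star_resrel[OF MN.grel_glin[OF Da]]] .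
 note l = MN.grel_glin[OF Ga] MN.grel_glin[OF Da] MN.grel_glin[OF Gas] MN.grel_glin[OF Das]
 show "geq S M N Ga Da"
  using MN.geq_trans[OF l(1,3,2) 2 MN.geq_trans[OF l(3,4,2) 1 MN.geq_sym[OF l(2,4) 3]]] .
qed

end

lemma giso_conj:
 assumes "gmod S A" "gmod S A'" "gmod S B" "gmod S B'" "giso S A A' j" "giso S B B' j'" "grel S A B Ga"
 shows "grel S A' B' (j\<inverse> O (Ga O j'))" "j O ((j\<inverse> O (Ga O j')) O j'\<inverse>) = Ga"
proof -
 show "grel S A' B' (j\<inverse> O (Ga O j'))"
  by (rule grel_comp[OF assms(2,1,4) giso_grel[OF giso_converse[OF assms(5)]] grel_comp[OF assms(1,3,4,7) giso_grel[OF assms(6)]]])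
 have "j O ((j\<inverse> O (Ga O j')) O j'\<inverse>) = (j O j\<inverse>) O (Ga O (j' O j'\<inverse>))" by (simp add: O_assoc)
 also have "\<dots> = Id_on (carrier A) O (Ga O Id_on (carrier B))" using assms(5,6) by (simp add: giso_def)
 also have "\<dots> = Ga" using assms(7) by (auto simp: grel_def glin_def)
 finally show "j O ((j\<inverse> O (Ga O j')) O j'\<inverse>) = Ga" .
qed

text \<open>The functor restricts to degrees in \<open>H\<close> and then moves the result into the
  type \<open>'v\<close>. It is full because \<open>star\<close> extends relations, faithful by
  \<open>geq_resrel_iff\<close>, and essentially surjective by
  \<open>extension_exists\<close>.\<close>

theorem (in veronese) serre_equivalence:
 assumes u: "\<exists>f :: 'k => 'u. inj f" and v: "\<exists>f :: 'k => 'v. inj f"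
 shows "equivalent_cats (serre_quotient TYPE('u) S) (serre_quotient TYPE('v) S')"
proof -
 let ?C = "serre_quotient TYPE('u) S" and ?D = "serre_quotient TYPE('v) S'"
 have oC: "Obj ?C = mod_objects S" and oD: "Obj ?D = mod_objects S'" by (simp_all add: serre_quotient_def)
 have vm: "vmod S S' H \<xi> Bs e M" if "M \<in> mod_objects S" for M :: "('g, 'r, 'w) gmodule"
  using that by unfold_locales (simp add: mod_objects_def)
 have inj_ex: "\<exists>f :: 'a => 'b. inj_on f (carrier M)"
  if M: "M \<in> mod_objects S" and b: "\<exists>f :: 'k => 'b. inj f" for M :: "('g, 'r, 'a) gmodule"
 proof -
  interpret gmod S M using M by unfold_locales (simp add: mod_objects_def)
  obtain f1 :: "'a => 'k" where f1: "inj_on f1 (carrier M)" using fg_card[OF card M] by blast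
  obtain f2 :: "'k => 'b" where f2: "inj f2" using b by blast
  have "inj_on (f2 \<circ> f1) (carrier M)" using f1 f2 by (meson comp_inj_on inj_on_subset subset_UNIV)
  then show ?thesis by blast
 qed
 \<comment> \<open>One injection per object is fixed once and for all; it need not be compatible
   with morphisms, as these are conjugated by the transport isomorphisms.\<close>
 have "\<exists>f :: 'u => 'v. M \<in> mod_objects S --> inj_on f (carrier M)" for M :: "('g, 'r, 'u) gmodule"
  using inj_ex[OF _ v] by blast
 then have "\<exists>E. \<forall>M :: ('g, 'r, 'u) gmodule. M \<in> mod_objects S --> inj_on (E M :: 'u => 'v) (carrier M)" by (intro choice allI)
 then obtain E :: "('g, 'r, 'u) gmodule => 'u => 'v" where E: "\<And>M. M \<in> mod_objects S ==> inj_on (E M) (carrier M)" by blast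
 define Fo where "Fo M = tr (res S H M) (E M)" for M
 define j where "j M = (%x. (x, E M x)) ` hpart S H M" for M
 have gS: "gmod S M" and gR: "gmod S' (res S H M)" and gF: "gmod S' (Fo M)" and jiso: "giso S' (res S H M) (Fo M) (j M)"
  and FoD: "Fo M \<in> mod_objects S'" if M: "M \<in> mod_objects S" for M
 proof -
  interpret vmod S S' H \<xi> Bs e M by (rule vm[OF M])
  have e: "inj_on (E M) (carrier (res S H M))" using E[OF M] hpartD(1) by (auto simp: inj_on_def)
  show "gmod S M" "gmod S' (res S H M)" by unfold_locales
  show gF: "gmod S' (Fo M)" unfolding Fo_def using N.tr_iso(1)[OF e] by unfold_locales
  show i: "giso S' (res S H M) (Fo M) (j M)" unfolding Fo_def j_def using N.tr_iso(2)[OF e] by simp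
  show "Fo M \<in> mod_objects S'" by (rule giso_mod_objects[OF N.gmod_axioms gF i res_fg[OF M]])
 qed
 \<comment> \<open>The relation \<open>resrel\<close> as a function of both modules, so that it can
   be applied to varying objects outside the locale of a fixed pair.\<close>
 define RR where "RR M N Ga = Ga \<inter> hpart S H M \<times> hpart S H N" for M N :: "('g, 'r, 'u) gmodule" and Ga
 have RR: "grel S M N Ga ==> grel S' (res S H M) (res S H N) (RR M N Ga)"
  "grel S M N Ga ==> grel S M N Da ==> geq S' (res S H M) (res S H N) (RR M N Ga) (RR M N Da) \<longleftrightarrow> geq S M N Ga Da"
  "grel S' (res S H M) (res S H N) Ga' ==> \<exists>Ga. grel S M N Ga \<and> RR M N Ga = Ga'"
  if M: "M \<in> mod_objects S" and N: "N \<in> mod_objects S" for M N Ga Da Ga'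
 proof -
  interpret vmod2 S S' H \<xi> Bs e M N using vm[OF M] vm[OF N] by (simp add: vmod2_def)
  have rr: "RR M N = resrel" by (simp add: RR_def resrel_def fun_eq_iff)
  show "grel S M N Ga ==> grel S' (res S H M) (res S H N) (RR M N Ga)" unfolding rr by (rule grel_resrel)
  show "grel S M N Ga ==> grel S M N Da ==> geq S' (res S H M) (res S H N) (RR M N Ga) (RR M N Da) \<longleftrightarrow> geq S M N Ga Da"
   unfolding rr by (rule geq_resrel_iff[OF M N])
  show "\<exists>Ga. grel S M N Ga \<and> RR M N Ga = Ga'" if "grel S' (res S H M) (res S H N) Ga'"
   unfolding rr using grel_star[OF M N that] resrel_star[OF MN'.grel_glin[OF that]] by blast
 qed
 have RRcomp: "RR M P (Ga O Da) = RR M N Ga O RR N P Da"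
  if o: "M \<in> mod_objects S" "N \<in> mod_objects S" "P \<in> mod_objects S" and g: "grel S M N Ga" "grel S N P Da" for M N P Ga Da
 proof -
  interpret MN: vmod2 S S' H \<xi> Bs e M N using vm[OF o(1)] vm[OF o(2)] by (simp add: vmod2_def)
  interpret NP: vmod2 S S' H \<xi> Bs e N P using vm[OF o(2)] vm[OF o(3)] by (simp add: vmod2_def)
  show ?thesis
  proof
   \<comment> \<open>An intermediate point of the composite may have components outside
     \<open>H\<close>; its projection serves as well, because the end points are fixed by
     projection.\<close>
   show "RR M P (Ga O Da) <= RR M N Ga O RR N P Da"
   proof clarify
    fix x z assume "(x, z) \<in> RR M P (Ga O Da)"
    then obtain y where y: "(x, y) \<in> Ga" "(y, z) \<in> Da" "x \<in> hpart S H M" "z \<in> hpart S H P" by (auto simp: RR_def)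
    have "(x, MN.N.prH y) \<in> RR M N Ga" "(MN.N.prH y, z) \<in> RR N P Da"
     using MN.resrel_pr[OF MN.MN.grel_glin[OF g(1)] y(1)] NP.resrel_pr[OF NP.MN.grel_glin[OF g(2)] y(2)]
      MN.M.prH_id[OF y(3)] NP.N.prH_id[OF y(4)] by (simp_all add: RR_def MN.resrel_def NP.resrel_def)
    then show "(x, z) \<in> RR M N Ga O RR N P Da" by blast
   qed
  qed (auto simp: RR_def)
 qed
 have RRsum: "rsum (res S H N) (RR M N Ga) (RR M N Da) <= RR M N (rsum N Ga Da)"
  if o: "N \<in> mod_objects S" for M N Ga Da
 proof -
  interpret N: vmod S S' H \<xi> Bs e N by (rule vm[OF o])
  show ?thesis using N.hpart_add by (auto simp: RR_def rsum_def)
 qed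
 have RRid: "RR M M (Id_on (carrier M)) = Id_on (hpart S H M)" for M
  by (auto simp: RR_def hpart_def)
 \<comment> \<open>The restricted relation, conjugated by the transport isomorphisms
   \<open>j\<close>.\<close>
 define T where "T M N Ga = (j M)\<inverse> O (RR M N Ga O j N)" for M N Ga
 have gT: "grel S' (Fo M) (Fo N) (T M N Ga)" "j M O (T M N Ga O (j N)\<inverse>) = RR M N Ga"
  if o: "M \<in> mod_objects S" "N \<in> mod_objects S" and Ga: "grel S M N Ga" for M N Ga
  unfolding T_def
  using giso_conj[OF gR[OF o(1)] gF[OF o(1)] gR[OF o(2)] gF[OF o(2)] jiso[OF o(1)] jiso[OF o(2)] RR(1)[OF o Ga]] by blast+
 have g2: "gmod2 S' A B" if "gmod S' A" "gmod S' B" for A :: "('g, 'r, 'a) gmodule" and B :: "('g, 'r, 'b) gmodule"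
  using that by (simp add: gmod2_def)
 have geqT: "geq S' (Fo M) (Fo N) (T M N Ga) (T M N Da) \<longleftrightarrow> geq S M N Ga Da"
  if o: "M \<in> mod_objects S" "N \<in> mod_objects S" and Ga: "grel S M N Ga" "grel S M N Da" for M N Ga Da
 proof -
  interpret RM: gmod2 S' "res S H M" "res S H N" using g2 gR o by blast
  interpret FM: gmod2 S' "Fo M" "Fo N" using g2 gF o by blast
  have "geq S' (Fo M) (Fo N) (T M N Ga) (T M N Da) \<longleftrightarrow> geq S' (res S H M) (res S H N) (RR M N Ga) (RR M N Da)"
  proof
   assume g: "geq S' (res S H M) (res S H N) (RR M N Ga) (RR M N Da)"
   show "geq S' (Fo M) (Fo N) (T M N Ga) (T M N Da)"
    unfolding T_def
    by (rule RM.geq_cong[OF RR(1)[OF o Ga(1)] RR(1)[OF o Ga(2)] g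
      giso_conj(1)[OF gR[OF o(1)] gF[OF o(1)] gR[OF o(2)] gF[OF o(2)] jiso[OF o(1)] jiso[OF o(2)]] _ FM.gmod2_axioms])
     auto
  next
   assume g: "geq S' (Fo M) (Fo N) (T M N Ga) (T M N Da)"
   have c: "grel S' (res S H M) (res S H N) (j M O (\<Theta> O (j N)\<inverse>))" if "grel S' (Fo M) (Fo N) \<Theta>" for \<Theta>
    by (rule grel_comp[OF gR[OF o(1)] gF[OF o(1)] gR[OF o(2)] giso_grel[OF jiso[OF o(1)]]
      grel_comp[OF gF[OF o(1)] gF[OF o(2)] gR[OF o(2)] that giso_grel[OF giso_converse[OF jiso[OF o(2)]]]]])
   have "geq S' (res S H M) (res S H N) (j M O (T M N Ga O (j N)\<inverse>)) (j M O (T M N Da O (j N)\<inverse>))"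
    by (rule FM.geq_cong[OF gT(1)[OF o Ga(1)] gT(1)[OF o Ga(2)] g c _ RM.gmod2_axioms]) auto
   then show "geq S' (res S H M) (res S H N) (RR M N Ga) (RR M N Da)"
    unfolding gT(2)[OF o Ga(1)] gT(2)[OF o Ga(2)] .
  qed
  then show ?thesis using RR(2)[OF o Ga] by simp
 qed
 have qC: "qcl S M N Ga = qcl S M N Da \<longleftrightarrow> geq S M N Ga Da"
  if o: "M \<in> mod_objects S" "N \<in> mod_objects S" and Ga: "grel S M N Ga" "grel S M N Da"
  for M N :: "('g, 'r, 'u) gmodule" and Ga Da
 proof -
  interpret gmod2u S M N using gS[OF o(1)] gS[OF o(2)] by (simp add: gmod2u_def gmod2_def)
  show ?thesis by (rule qcl_eq_iff[OF Ga])
 qed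
 have qD: "qcl S' A B Ga = qcl S' A B Da \<longleftrightarrow> geq S' A B Ga Da"
  if o: "gmod S' A" "gmod S' B" and Ga: "grel S' A B Ga" "grel S' A B Da"
  for A B :: "('g, 'r, 'v) gmodule" and Ga Da
 proof -
  interpret gmod2u S' A B using o by (simp add: gmod2u_def gmod2_def)
  show ?thesis by (rule qcl_eq_iff[OF Ga])
 qed
 \<comment> \<open>A representing relation is chosen; by \<open>geqT\<close> the resulting class
   does not depend on the choice.\<close>
 define Fm where "Fm M N c = qcl S' (Fo M) (Fo N) (T M N (SOME Ga. grel S M N Ga \<and> c = qcl S M N Ga))" for M N c
 have Fm: "Fm M N (qcl S M N Ga) = qcl S' (Fo M) (Fo N) (T M N Ga)"
  if o: "M \<in> mod_objects S" "N \<in> mod_objects S" and Ga: "grel S M N Ga" for M N Ga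
 proof -
  define Da where "Da = (SOME Da. grel S M N Da \<and> qcl S M N Ga = qcl S M N Da)"
  have Da: "grel S M N Da \<and> qcl S M N Ga = qcl S M N Da"
   unfolding Da_def by (rule someI[of _ Ga]) (use Ga in simp)
  then have "geq S M N Ga Da" using qC[OF o Ga] by blast
  then have "qcl S' (Fo M) (Fo N) (T M N Ga) = qcl S' (Fo M) (Fo N) (T M N Da)"
   using qD[OF gF[OF o(1)] gF[OF o(2)] gT(1)[OF o Ga] gT(1)[OF o]] geqT[OF o Ga] Da by blast
  then show ?thesis by (simp add: Fm_def Da_def)
 qed
 have HC: "Hom ?C M N = {qcl S M N Ga |Ga. grel S M N Ga}" if "M \<in> mod_objects S" "N \<in> mod_objects S" for M N
  using Hom_serre'[of M "TYPE('u)" N] that unfolding oC by blast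
 have HD: "Hom ?D M N = {qcl S' M N Ga |Ga. grel S' M N Ga}" if "M \<in> mod_objects S'" "N \<in> mod_objects S'" for M N
  using S'.Hom_serre'[of M "TYPE('v)" N] that unfolding oD by blast
 have isF: "additive_functor ?C ?D Fo Fm"
  unfolding additive_functor_def oC oD
 proof (intro conjI ballI)
  show "category ?C" "category ?D" by (rule category_serre, rule S'.category_serre)
 next
  fix M :: "('g, 'r, 'u) gmodule" assume o: "M \<in> mod_objects S"
  show "Fo M \<in> mod_objects S'" by (rule FoD[OF o])
  interpret gmod S M by (rule gS[OF o])
  have "T M M (Id_on (carrier M)) = Id_on (carrier (Fo M))"
  proof -
   have "T M M (Id_on (carrier M)) = (j M)\<inverse> O j M" unfolding T_def RRid by (auto simp: j_def)
   then show ?thesis using jiso[OF o] by (simp add: giso_def)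
  qed
  then show "Fm M M (Idm ?C M) = Idm ?D (Fo M)"
   using Fm[OF o o grel_Id] Idm_serre[OF gS[OF o]] Idm_serre[OF gF[OF o]] by simp
 next
  fix M N f assume o: "M \<in> mod_objects S" "N \<in> mod_objects S" and "f \<in> Hom ?C M N"
  then obtain Ga where *: "grel S M N Ga" "f = qcl S M N Ga" using HC[OF o] by blast
  show "Fm M N f \<in> Hom ?D (Fo M) (Fo N)"
   unfolding *(2) Fm[OF o *(1)] HD[OF FoD[OF o(1)] FoD[OF o(2)]]
   using gT(1)[OF o *(1)] by (intro CollectI exI[of _ "T M N Ga"] conjI refl)
 next
  fix M N P f g assume o: "M \<in> mod_objects S" "N \<in> mod_objects S" "P \<in> mod_objects S"
   and f: "f \<in> Hom ?C M N" and g: "g \<in> Hom ?C N P"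
  obtain Ga where Ga: "grel S M N Ga" "f = qcl S M N Ga" using f HC[OF o(1,2)] by blast
  obtain Da where Da: "grel S N P Da" "g = qcl S N P Da" using g HC[OF o(2,3)] by blast
  note * = Ga Da
  have T: "T M P (Ga O Da) = T M N Ga O T N P Da"
  proof -
   have "T M N Ga O T N P Da = (j M)\<inverse> O (RR M N Ga O ((j N O (j N)\<inverse>) O (RR N P Da O j P)))" unfolding T_def by (simp add: O_assoc)
   also have "j N O (j N)\<inverse> = Id_on (hpart S H N)" using jiso[OF o(2)] by (simp add: giso_def)
   also have "Id_on (hpart S H N) O (RR N P Da O j P) = RR N P Da O j P" by (auto simp: RR_def)
   finally show ?thesis unfolding T_def RRcomp[OF o *(1,3)] by (simp add: O_assoc)
  qed
  show "Fm M P (Comp ?C M N P g f) = Comp ?D (Fo M) (Fo N) (Fo P) (Fm N P g) (Fm M N f)"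
   unfolding *(2,4) Comp_serre[OF gS[OF o(1)] gS[OF o(2)] gS[OF o(3)] *(1,3)]
    Fm[OF o(1,2) *(1)] Fm[OF o(2,3) *(3)] Fm[OF o(1,3) grel_comp[OF gS[OF o(1)] gS[OF o(2)] gS[OF o(3)] *(1,3)]]
    Comp_serre[OF gF[OF o(1)] gF[OF o(2)] gF[OF o(3)] gT(1)[OF o(1,2) *(1)] gT(1)[OF o(2,3) *(3)]] T ..
 next
  fix M N f g assume o: "M \<in> mod_objects S" "N \<in> mod_objects S" and f: "f \<in> Hom ?C M N" and g: "g \<in> Hom ?C M N"
  obtain Ga where Ga: "grel S M N Ga" "f = qcl S M N Ga" using f HC[OF o] by blast
  obtain Da where Da: "grel S M N Da" "g = qcl S M N Da" using g HC[OF o] by blast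
  note * = Ga Da
  note aC = Add_serre'[of M "TYPE('u)" N, unfolded oC, OF o *(1,3)]
  note t = gT(1)[OF o *(1)] gT(1)[OF o *(3)]
  note aD = S'.Add_serre'[of "Fo M" "TYPE('v)" "Fo N", unfolded oD, OF FoD[OF o(1)] FoD[OF o(2)] t]
  \<comment> \<open>For sums an inclusion of relations is shown, which is enough for equality of
    classes.\<close>
  have sub: "rsum (Fo N) (T M N Ga) (T M N Da) <= T M N (rsum N Ga Da)"
  proof clarify
   fix a b assume "(a, b) \<in> rsum (Fo N) (T M N Ga) (T M N Da)"
   then obtain b1 b2 x y x' z where **: "(x, a) \<in> j M" "(x, y) \<in> RR M N Ga" "(y, b1) \<in> j N"
    "(x', a) \<in> j M" "(x', z) \<in> RR M N Da" "(z, b2) \<in> j N" "b = b1 \<oplus>[Fo N] b2"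
    unfolding rsum_def T_def by blast
   have x: "x' = x" using giso_inj[OF jiso[OF o(1)] **(4,1)] .
   have l: "glin S' (res S H N) (Fo N) (j N)" using jiso[OF o(2)] by (simp add: giso_def)
   have "(y \<oplus>[res S H N] z, b) \<in> j N" using l **(3,6,7) unfolding glin_def by blast
   moreover have "(x, y \<oplus>[res S H N] z) \<in> RR M N (rsum N Ga Da)"
    using RRsum[OF o(2), of M Ga Da] ** x unfolding rsum_def by blast
   ultimately show "(a, b) \<in> T M N (rsum N Ga Da)" unfolding T_def using **(1) by blast
  qed
  interpret FM: gmod2 S' "Fo M" "Fo N" using g2 gF o by blast
  have "geq S' (Fo M) (Fo N) (rsum (Fo N) (T M N Ga) (T M N Da)) (T M N (rsum N Ga Da))"
   by (rule FM.geq_sub[OF aD(2) gT(1)[OF o aC(2)] sub])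
  then have "qcl S' (Fo M) (Fo N) (rsum (Fo N) (T M N Ga) (T M N Da)) = qcl S' (Fo M) (Fo N) (T M N (rsum N Ga Da))"
   using qD[OF gF[OF o(1)] gF[OF o(2)] aD(2) gT(1)[OF o aC(2)]] by blast
  then show "Fm M N (Add ?C M N f g) = Add ?D (Fo M) (Fo N) (Fm M N f) (Fm M N g)"
   unfolding *(2,4) aC(1) Fm[OF o aC(2)] Fm[OF o *(1)] Fm[OF o *(3)] aD(1) by simp
 qed
 show ?thesis
 proof (rule equivalent_catsI[OF isF])
  fix M N assume "M \<in> Obj ?C" "N \<in> Obj ?C"
  then have o: "M \<in> mod_objects S" "N \<in> mod_objects S" unfolding oC by auto
  show "bij_betw (Fm M N) (Hom ?C M N) (Hom ?D (Fo M) (Fo N))"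
   unfolding bij_betw_def
  proof
   show "inj_on (Fm M N) (Hom ?C M N)"
   proof (rule inj_onI)
    fix f g assume f: "f \<in> Hom ?C M N" and g: "g \<in> Hom ?C M N" and eq: "Fm M N f = Fm M N g"
    obtain Ga where Ga: "grel S M N Ga" "f = qcl S M N Ga" using f HC[OF o] by blast
    obtain Da where Da: "grel S M N Da" "g = qcl S M N Da" using g HC[OF o] by blast
    note * = Ga Da
    have "qcl S' (Fo M) (Fo N) (T M N Ga) = qcl S' (Fo M) (Fo N) (T M N Da)"
     using eq unfolding *(2,4) Fm[OF o *(1)] Fm[OF o *(3)] .
    then show "f = g" using qD[OF gF[OF o(1)] gF[OF o(2)] gT(1)[OF o *(1)] gT(1)[OF o *(3)]]
      geqT[OF o *(1,3)] qC[OF o *(1,3)] *(2,4) by blast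
   qed
   show "Fm M N ` Hom ?C M N = Hom ?D (Fo M) (Fo N)"
   proof
    show "Fm M N ` Hom ?C M N <= Hom ?D (Fo M) (Fo N)"
    proof
     fix h assume "h \<in> Fm M N ` Hom ?C M N"
     then obtain f where f: "f \<in> Hom ?C M N" "h = Fm M N f" by blast
     then obtain Ga where *: "grel S M N Ga" "f = qcl S M N Ga" using HC[OF o] by blast
     show "h \<in> Hom ?D (Fo M) (Fo N)"
      unfolding f(2) *(2) Fm[OF o *(1)] HD[OF FoD[OF o(1)] FoD[OF o(2)]]
   using gT(1)[OF o *(1)] by (intro CollectI exI[of _ "T M N Ga"] conjI refl)
    qed
    show "Hom ?D (Fo M) (Fo N) <= Fm M N ` Hom ?C M N"
    proof
     fix h assume "h \<in> Hom ?D (Fo M) (Fo N)"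
     then obtain \<Theta> where \<Theta>: "grel S' (Fo M) (Fo N) \<Theta>" "h = qcl S' (Fo M) (Fo N) \<Theta>"
      using HD[OF FoD[OF o(1)] FoD[OF o(2)]] by blast
     note k = giso_conj[OF gF[OF o(1)] gR[OF o(1)] gF[OF o(2)] gR[OF o(2)] giso_converse[OF jiso[OF o(1)]]
       giso_converse[OF jiso[OF o(2)]] \<Theta>(1)]
     obtain Ga where Ga: "grel S M N Ga" "RR M N Ga = ((j M)\<inverse>)\<inverse> O (\<Theta> O (j N)\<inverse>)" using RR(3)[OF o k(1)] by blast
     have "T M N Ga = \<Theta>" unfolding T_def Ga(2) using k(2) by simp
     then show "h \<in> Fm M N ` Hom ?C M N"
      using Fm[OF o Ga(1)] \<Theta>(2) Ga(1) unfolding HC[OF o] by (intro image_eqI[of _ _ "qcl S M N Ga"]) auto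
    qed
   qed
  qed
 next
  fix Y assume "Y \<in> Obj ?D"
  then have Y: "Y \<in> mod_objects S'" unfolding oD .
  \<comment> \<open>The extension lives in a type of sets of functions. It is finitely generated, so
    its carrier injects into \<open>'u\<close> and it can be transported there.\<close>
  obtain M1 :: "('g, 'r, ('v => 'r) set) gmodule" and J where M1: "M1 \<in> mod_objects S" "giso S' Y (res S H M1) J"
   using extension_exists[OF Y] by blast
  obtain f :: "('v => 'r) set => 'u" where f: "inj_on f (carrier M1)" using inj_ex[OF M1(1) u] by blast
  interpret M1: vmod S S' H \<xi> Bs e M1 by (rule vm[OF M1(1)])
  define M0 where "M0 = tr M1 f"
  define \<Theta> where "\<Theta> = (%x. (x, f x)) ` carrier M1"
  have gm0: "gmod S M0" unfolding M0_def using M1.tr_iso(1)[OF f] by unfold_locales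
  have \<Theta>: "giso S M1 M0 \<Theta>" unfolding M0_def \<Theta>_def by (rule M1.tr_iso(2)[OF f])
  have M0: "M0 \<in> mod_objects S" by (rule giso_mod_objects[OF M1.gmod_axioms gm0 \<Theta> M1(1)])
  interpret vmod2 S S' H \<xi> Bs e M1 M0 using vm[OF M1(1)] vm[OF M0] by (simp add: vmod2_def)
  define Q where "Q = J O (resrel \<Theta> O j M0)"
  have Q: "giso S' Y (Fo M0) Q"
   unfolding Q_def by (rule giso_comp[OF M1(2) giso_comp[OF giso_resrel[OF \<Theta>] jiso[OF M0]]])
  have gY: "gmod S' Y" using Y by unfold_locales (simp add: mod_objects_def)
  note q = giso_grel[OF Q] giso_grel[OF giso_converse[OF Q]]
  have 1: "Comp ?D Y (Fo M0) Y (qcl S' (Fo M0) Y (Q\<inverse>)) (qcl S' Y (Fo M0) Q) = Idm ?D Y"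
   unfolding Comp_serre[OF gY gF[OF M0] gY q] Idm_serre[OF gY] using Q by (simp add: giso_def)
  have 2: "Comp ?D (Fo M0) Y (Fo M0) (qcl S' Y (Fo M0) Q) (qcl S' (Fo M0) Y (Q\<inverse>)) = Idm ?D (Fo M0)"
   unfolding Comp_serre[OF gF[OF M0] gY gF[OF M0] q(2,1)] Idm_serre[OF gF[OF M0]] using Q by (simp add: giso_def)
  have "iso_mor ?D Y (Fo M0) (qcl S' Y (Fo M0) Q)"
   unfolding iso_mor_def HD[OF Y FoD[OF M0]] HD[OF FoD[OF M0] Y] using 1 2 q by blast
  then show "\<exists>A\<in>Obj ?C. \<exists>f. iso_mor ?D Y (Fo A) f" using M0 oC by blast
 next
  fix A B f g assume "A \<in> Obj ?C" "B \<in> Obj ?C" "f \<in> Hom ?C A B" "g \<in> Hom ?C A B"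
  then show "Add ?C A B f g \<in> Hom ?C A B" by (rule Add_closed_serre)
 next
  fix A B f g assume "A \<in> Obj ?D" "B \<in> Obj ?D" "f \<in> Hom ?D A B" "g \<in> Hom ?D A B"
  then show "Add ?D A B f g \<in> Hom ?D A B" by (rule S'.Add_closed_serre)
 next
  fix A B Z f g h assume "A \<in> Obj ?D" "B \<in> Obj ?D" "Z \<in> Obj ?D" "f \<in> Hom ?D A B" "g \<in> Hom ?D A B" "h \<in> Hom ?D B Z"
  then show "Comp ?D A B Z h (Add ?D A B f g) = Add ?D A Z (Comp ?D A B Z h f) (Comp ?D A B Z h g)"
   by (rule S'.dist_serre(1))
 next
  fix A B Z f g h assume "A \<in> Obj ?D" "B \<in> Obj ?D" "Z \<in> Obj ?D" "f \<in> Hom ?D B Z" "g \<in> Hom ?D B Z" "h \<in> Hom ?D A B"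
  then show "Comp ?D A B Z (Add ?D B Z f g) h = Add ?D A Z (Comp ?D A B Z f h) (Comp ?D A B Z g h)"
   by (rule S'.dist_serre(2))
 qed
qed

section \<open>The group \<open>L(A)\<close> and its principal lattice\<close>

abbreviation lk :: "('a \<Rightarrow>\<^sub>0 'b::zero) => 'a => 'b" where "lk \<equiv> Poly_Mapping.lookup"

lemma UNIV_3: "(UNIV :: 3 set) = {1, 2, 3}"
proof -
 have "x = 1 \<or> x = 2 \<or> x = 3" for x :: 3
 proof (induct x)
  case (of_int z)
  then have "z = 0 \<or> z = 1 \<or> z = 2" by simp arith
  then show ?case by auto
 qed
 then show ?thesis by auto
qed

lemma neq_3 [simp]: "(1::3) \<noteq> 2" "(1::3) \<noteq> 3" "(2::3) \<noteq> 3" "(2::3) \<noteq> 1" "(3::3) \<noteq> 1" "(3::3) \<noteq> 2"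
proof -
 have c: "card {1, 2, 3 :: 3} = 3" unfolding UNIV_3[symmetric] by simp
 have "(1::3) \<noteq> 2 \<and> (1::3) \<noteq> 3 \<and> (2::3) \<noteq> 3"
 proof (intro conjI notI)
  assume "(1::3) = 2" then have "{1, 2, 3 :: 3} = {2, 3}" by auto
  then show False using c card_insert_le_m1[of 2 "{3}" "2::3"] by (simp add: card_insert_if split: if_splits)
 next
  assume "(1::3) = 3" then have "{1, 2, 3 :: 3} = {2, 3}" by auto
  then show False using c by (simp add: card_insert_if split: if_splits)
 next
  assume "(2::3) = 3" then have "{1, 2, 3 :: 3} = {1, 3}" by auto
  then show False using c by (simp add: card_insert_if split: if_splits)
 qed
 then show "(1::3) \<noteq> 2" "(1::3) \<noteq> 3" "(2::3) \<noteq> 3" "(2::3) \<noteq> 1" "(3::3) \<noteq> 1" "(3::3) \<noteq> 2" by metis+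
qed

lemma sum_3: "(\<Sum>i\<in>UNIV. f i) = f 1 + f 2 + f (3::3)"
 unfolding UNIV_3 by (simp add: add.assoc)

lemma prod_3: "(\<Prod>i\<in>UNIV. f i) = f 1 * f 2 * f (3::3)"
 unfolding UNIV_3 by (simp add: mult.assoc)

lemma all_3: "(\<forall>i. P (i::3)) \<longleftrightarrow> P 1 \<and> P 2 \<and> P 3"
 using UNIV_3 by (metis UNIV_I insertE singletonD)

lemma ex_3: "(\<exists>i. P (i::3)) \<longleftrightarrow> P 1 \<or> P 2 \<or> P 3"
 using all_3[of "%i. \<not> P i"] by blast

lemma delta_3: "(\<Sum>s\<in>UNIV. if s = i then f s else 0) = (f (i::3) :: int)"
 "(\<Sum>s\<in>UNIV. if i = s then f s else 0) = (f (i::3) :: int)"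
 "(\<Sum>s\<in>UNIV. (if s = i then 1 else 0) * f s) = (f (i::3) :: int)"
proof -
 have "\<forall>i. (\<Sum>s\<in>UNIV. if s = i then f s else 0) = f i \<and> (\<Sum>s\<in>UNIV. if i = s then f s else 0) = f i \<and>
  (\<Sum>s\<in>UNIV. (if s = i then 1 else 0) * f s) = f i"
  unfolding all_3 sum_3 by simp
 then show "(\<Sum>s\<in>UNIV. if s = i then f s else 0) = f i" "(\<Sum>s\<in>UNIV. if i = s then f s else 0) = f i"
  "(\<Sum>s\<in>UNIV. (if s = i then 1 else 0) * f s) = f i" by blast+
qed

lemma tri_simps [simp]: "tri x y z 1 = x" "tri x y z 2 = y" "tri x y z 3 = z"
 by (simp_all add: tri_def)

definition vec :: "(3 => 'a::comm_monoid_add) => (3 \<Rightarrow>\<^sub>0 'a)" where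
 "vec f = (\<Sum>s\<in>UNIV. Poly_Mapping.single s (f s))"

lemma lookup_vec [simp]: "lk (vec f) s = f s"
 unfolding vec_def by (simp add: lookup_sum lookup_single when_def)

lemma vec_lookup [simp]: "vec (lk v) = v"
 by (rule poly_mapping_eqI) simp

text \<open>The subgroup generated by the differences of the \<open>A i\<close> times
  \<open>X\<^sub>i\<close>, in closed form: multiples of these vectors with coefficient sum
  zero.\<close>

definition rels :: "(3 => nat) => (3 => int) set" where
 "rels A = {v. \<exists>n :: 3 => int. (\<Sum>s\<in>UNIV. n s) = 0 \<and> (\<forall>s. v s = n s * int (A s))}"

interpretation FA: comm_group "free_Abelian_group (UNIV :: 3 set)"
 by (rule abelian_free_Abelian_group)

lemma rels_add: "v \<in> rels A ==> w \<in> rels A ==> (%s. v s + w s) \<in> rels A"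
proof -
 assume "v \<in> rels A" "w \<in> rels A"
 then obtain n m where *: "(\<Sum>s\<in>UNIV. n s) = 0" "\<forall>s. v s = n s * int (A s)" "(\<Sum>s\<in>UNIV. m s) = 0" "\<forall>s. w s = m s * int (A s)"
  unfolding rels_def by blast
 then have "(\<Sum>s\<in>UNIV. n s + m s) = 0" "\<forall>s. v s + w s = (n s + m s) * int (A s)" by (auto simp: sum.distrib algebra_simps)
 then show ?thesis unfolding rels_def by blast
qed

lemma rels_cmul: "v \<in> rels A ==> (%s. c * v s) \<in> rels A"
proof -
 assume "v \<in> rels A"
 then obtain n where *: "(\<Sum>s\<in>UNIV. n s) = 0" "\<forall>s. v s = n s * int (A s)" unfolding rels_def by blast
 then have "(\<Sum>s\<in>UNIV. c * n s) = 0" "\<forall>s. c * v s = (c * n s) * int (A s)" by (auto simp: sum_distrib_left[symmetric] algebra_simps)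
 then show ?thesis unfolding rels_def by blast
qed

lemma L_relations_subgroup: "subgroup (L_relations A) (free_Abelian_group UNIV)"
 unfolding L_relations_def by (rule FA.generate_is_subgroup) auto

text \<open>One inclusion holds because the closed form is a subgroup containing the generators, the
  other because the differences with the third generator already suffice.\<close>

lemma L_relations_iff: "v \<in> L_relations A \<longleftrightarrow> lk v \<in> rels A"
proof
 let ?H = "{v :: 3 \<Rightarrow>\<^sub>0 int. lk v \<in> rels A}"
 have z: "(%s. 0) \<in> rels A" unfolding rels_def by (auto intro!: exI[of _ "%_. 0"])
 have "subgroup ?H (free_Abelian_group UNIV)"
 proof (rule FA.subgroupI)
  show "?H <= carrier (free_Abelian_group UNIV)" by auto
  show "?H \<noteq> {}" using z by (auto intro!: exI[of _ 0] simp: zero_poly_mapping.rep_eq)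
 next
  fix x :: "3 \<Rightarrow>\<^sub>0 int" assume "x \<in> ?H"
  then have "(%s. (- 1) * lk x s) \<in> rels A" by (intro rels_cmul) simp
  moreover have "(%s. (- 1) * lk x s) = lk (- x)" by (simp add: fun_eq_iff)
  ultimately show "inv[free_Abelian_group UNIV] x \<in> ?H" by simp
 next
  fix x y :: "3 \<Rightarrow>\<^sub>0 int" assume "x \<in> ?H" "y \<in> ?H"
  then have "(%s. lk x s + lk y s) \<in> rels A" by (intro rels_add) auto
  moreover have "(%s. lk x s + lk y s) = lk (x + y)" by (simp add: fun_eq_iff lookup_add)
  ultimately show "x \<otimes>[free_Abelian_group UNIV] y \<in> ?H" by simp
 qed
 moreover have "{gX (A i) i - gX (A j) j |i j. True} <= ?H"
 proof clarify
  fix i j :: 3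
  let ?n = "%s. (if s = i then 1 else 0) - (if s = j then 1 else 0 :: int)"
  have "(\<Sum>s\<in>UNIV. ?n s) = 0" by (simp add: sum_subtractf delta_3)
  moreover have "\<forall>s. lk (gX (A i) i - gX (A j) j) s = ?n s * int (A s)"
   by (auto simp: lookup_minus lookup_single when_def)
  ultimately show "lk (gX (A i) i - gX (A j) j) \<in> rels A" unfolding rels_def by blast
 qed
 ultimately have "L_relations A <= ?H" unfolding L_relations_def by (intro FA.generate_subgroup_incl)
 then show "v \<in> L_relations A ==> lk v \<in> rels A" by blast
next
 assume "lk v \<in> rels A"
 then obtain n where n: "(\<Sum>s\<in>UNIV. n s) = 0" "\<forall>s. lk v s = n s * int (A s)" unfolding rels_def by blast
 interpret L: subgroup "L_relations A" "free_Abelian_group UNIV" by (rule L_relations_subgroup)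
 have g: "gX (A i) i - gX (A j) j \<in> L_relations A" for i j
  unfolding L_relations_def by (rule generate.incl) blast
 have c: "frag_cmul k x \<in> L_relations A" if "x \<in> L_relations A" for k x
  using FA.subgroup_int_pow_closed[OF L_relations_subgroup that, of k] int_pow_free_Abelian_group[of x UNIV k] by simp
 have "frag_cmul (n 1) (gX (A 1) 1 - gX (A 3) 3) + frag_cmul (n 2) (gX (A 2) 2 - gX (A 3) 3) \<in> L_relations A"
  using L.m_closed[OF c[OF g] c[OF g]] by simp
 moreover have "v = frag_cmul (n 1) (gX (A 1) 1 - gX (A 3) 3) + frag_cmul (n 2) (gX (A 2) 2 - gX (A 3) 3)"
 proof (rule poly_mapping_eqI)
  fix s :: 3
  have n3: "n 3 = - n 1 - n 2" using n(1) by (simp add: sum_3)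
  have "\<forall>s. lk v s =
   lk (frag_cmul (n 1) (gX (A 1) 1 - gX (A 3) 3) + frag_cmul (n 2) (gX (A 2) 2 - gX (A 3) 3)) s"
   unfolding all_3 using n(2) by (auto simp: n3 lookup_add lookup_minus lookup_single when_def algebra_simps)
  then show "lk v s =
   lk (frag_cmul (n 1) (gX (A 1) 1 - gX (A 3) 3) + frag_cmul (n 2) (gX (A 2) 2 - gX (A 3) 3)) s" by blast
 qed
 ultimately show "v \<in> L_relations A" by simp
qed

lemma L_normal: "L_relations A \<lhd> free_Abelian_group UNIV"
 using L_relations_subgroup FA.subgroup_imp_normal by blast

lemma L_comm_group: "comm_group (L_group A)"
 unfolding L_group_def by (rule FA.abelian_FactGroup[OF L_relations_subgroup])

lemma carrier_L: "carrier (L_group A) = range (L_class A)"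
 unfolding L_group_def carrier_FactGroup L_class_def by auto

lemma L_class_eq: "L_class A v = L_class A w \<longleftrightarrow> lk (v - w) \<in> rels A"
proof -
 interpret L: subgroup "L_relations A" "free_Abelian_group UNIV" by (rule L_relations_subgroup)
 have mem: "v \<in> L_class A w \<longleftrightarrow> v - w \<in> L_relations A"
 proof
  assume "v \<in> L_class A w"
  then obtain x where "x \<in> L_relations A" "v = x + w" unfolding L_class_def r_coset_def by auto
  then show "v - w \<in> L_relations A" by simp
 next
  assume "v - w \<in> L_relations A"
  then show "v \<in> L_class A w" unfolding L_class_def r_coset_def by (intro UN_I[of "v - w"]) auto
 qed
 have "L_class A v = L_class A w \<longleftrightarrow> v \<in> L_class A w"
  using FA.repr_independence[of v "L_relations A" w] FA.rcos_self[of v "L_relations A"] L_relations_subgroup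
  unfolding L_class_def by auto
 then show ?thesis using mem L_relations_iff by blast
qed

lemma L_class_mult: "L_class A v \<otimes>[L_group A] L_class A w = L_class A (v + w)"
 unfolding L_group_def L_class_def using normal.rcos_sum[OF L_normal, of v w] by simp

lemma L_one: "\<one>[L_group A] = L_class A 0"
 unfolding L_group_def L_class_def
 using FA.coset_join2[OF FA.one_closed L_relations_subgroup subgroup.one_closed[OF L_relations_subgroup]] by simp

lemma L_class_closed [simp]: "L_class A v \<in> carrier (L_group A)"
 by (simp add: carrier_L)

lemma L_hom: "group_hom (free_Abelian_group UNIV) (L_group A) (L_class A)"
proof -
 interpret comm_group "L_group A" by (rule L_comm_group)
 show ?thesis by unfold_locales (auto simp: hom_def L_class_mult)
qed

lemma L_class_pow: "L_class A v [^][L_group A] (n::int) = L_class A (frag_cmul n v)"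
 using group_hom.hom_int_pow[OF L_hom[of A], of v n] int_pow_free_Abelian_group[of v UNIV n] by simp

text \<open>The total amount by which coordinates are negative. It is the termination measure for
  rewriting monomials in terms of the principal generators.\<close>

definition negs :: "(3 => int) => nat" where
 "negs n = (\<Sum>j\<in>UNIV. nat (- n j))"

text \<open>
 The common shape of the five types: \<open>lam j\<close> is the exponent vector of the \<open>j\<close>-th principal
 generator, \<open>E i\<close> the exponent vector of the monomial of \<open>f\<^sub>W\<close> that is the image of \<open>X\<^sub>i ^ A i\<close>
 times the monomial with exponent \<open>(\<Sum>j. lam j) - (1, 1, 1)\<close>.
\<close>

locale wcore =
 fixes a :: "3 => nat" and h :: nat and A :: "3 => nat" and lam :: "3 => 3 => nat" and E :: "3 => 3 => nat"
 assumes Apos: "0 < A i"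
  and rel: "(\<Sum>j\<in>UNIV. E i j * lam j s) + 1 = (\<Sum>j\<in>UNIV. lam j s) + (if s = i then A i else 0)"
  and hE: "(\<Sum>j\<in>UNIV. E i j * a j) = h"
  and lam_one: "\<exists>j. lam j s = 1"
  and E_zero: "\<exists>i. E i j = 0"
  and indep: "(\<forall>s. (\<Sum>j\<in>UNIV. n j * int (lam j s)) = 0) ==> n j = 0"
  and red: "(\<forall>s. 0 \<le> (\<Sum>j\<in>UNIV. n j * int (lam j s))) ==> \<exists>j. n j < 0 ==>
   \<exists>i. int (A i) \<le> (\<Sum>j\<in>UNIV. n j * int (lam j i)) \<and>
    (\<forall>i'. i' \<noteq> i --> negs (%j. n j - int (E i j) + int (E i' j)) < negs n)"
  and pair: "(%s. int (a i) * int (lam j s) - int (a j) * int (lam i s)) \<in> rels A"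

text \<open>Kept apart from \<open>wcore\<close>: these two conditions come from the regularity of
  the weights, whereas \<open>wcore\<close> is verified type by type.\<close>

locale wdata = wcore +
 assumes gcd1: "gcd (a 1) (gcd (a 2) (gcd (a 3) h)) = 1"
  and apos: "0 < a i"
begin

text \<open>The exponent vector with coordinates \<open>n\<close> with respect to the principal
  generators. By \<open>indep\<close> the coordinates are unique.\<close>

definition comb :: "(3 => int) => 3 => int" where
 "comb n s = (\<Sum>j\<in>UNIV. n j * int (lam j s))"

lemma comb_add: "comb n s + comb m s = comb (%j. n j + m j) s"
 by (simp add: comb_def sum.distrib algebra_simps)

lemma comb_cmul: "c * comb n s = comb (%j. c * n j) s"
 by (simp add: comb_def sum_distrib_left algebra_simps)

lemma comb_diff: "comb n s - comb m s = comb (%j. n j - m j) s"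
 by (simp add: comb_def sum_subtractf algebra_simps)

lemma comb_delta: "comb (%j. if j = k then 1 else 0) s = int (lam k s)"
 by (simp add: comb_def delta_3)

lemma comb_inj: "(\<And>s. comb n s = comb m s) ==> n = m"
proof
 fix j assume e: "\<And>s. comb n s = comb m s"
 have "\<forall>s. (\<Sum>j\<in>UNIV. (n j - m j) * int (lam j s)) = 0"
  using e by (simp add: comb_def sum_subtractf left_diff_distrib)
 then have "n j - m j = 0" using indep[of "%j. n j - m j" j] by simp
 then show "n j = m j" by simp
qed

text \<open>The exponent of the monomial by which \<open>F\<close> is multiplied. The subtraction
  does not truncate, as \<open>lam_one\<close> makes the sum positive.\<close>

definition Mexp :: "3 => nat" where
 "Mexp s = (\<Sum>j\<in>UNIV. lam j s) - 1"

lemma Mexp: "Mexp s + 1 = (\<Sum>j\<in>UNIV. lam j s)"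
proof -
 obtain j where "lam j s = 1" using lam_one by blast
 then have "1 \<le> (\<Sum>j\<in>UNIV. lam j s)" using member_le_sum[of j UNIV "%j. lam j s"] by simp
 then show ?thesis by (simp add: Mexp_def)
qed

lemma rel_nat: "(\<Sum>j\<in>UNIV. E i j * lam j s) = Mexp s + (if s = i then A i else 0)"
 using rel[of i s] Mexp[of s] by simp

lemma rel_comb: "comb (%j. int (E i j)) s = int (Mexp s) + (if s = i then int (A i) else 0)"
 using arg_cong[OF rel_nat[of i s], of int] unfolding comb_def by (auto simp: of_nat_sum)

text \<open>By \<open>rel\<close>, the image of a row of \<open>E\<close> is the common vector
  \<open>Mexp\<close> plus \<open>A i\<close> times a unit vector. With coefficient sum zero the
  common part cancels, so every relation lies in the lattice of principal generators.\<close>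

lemma rels_comb:
 assumes "v \<in> rels A"
 obtains n where "\<And>s. v s = comb n s"
proof -
 obtain k where k: "(\<Sum>s\<in>UNIV. k s) = 0" "\<forall>s. v s = k s * int (A s)" using assms unfolding rels_def by blast
 have "v s = comb (%j. \<Sum>i\<in>UNIV. k i * int (E i j)) s" for s
 proof -
  have "comb (%j. \<Sum>i\<in>UNIV. k i * int (E i j)) s = (\<Sum>i\<in>UNIV. k i * comb (%j. int (E i j)) s)"
   unfolding comb_def by (simp add: sum_3 algebra_simps)
  also have "\<dots> = (\<Sum>i\<in>UNIV. k i) * int (Mexp s) + k s * int (A s)"
  proof -
   have "\<forall>s. (\<Sum>i\<in>UNIV. k i * (int (Mexp s) + (if s = i then int (A i) else 0))) = (\<Sum>i\<in>UNIV. k i) * int (Mexp s) + k s * int (A s)"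
    unfolding all_3 sum_3 by (simp add: algebra_simps)
   then show ?thesis unfolding rel_comb by blast
  qed
  finally show ?thesis using k by simp
 qed
 then show thesis using that by blast
qed

text \<open>A common divisor of the weights divides \<open>h\<close>, because \<open>h\<close> is
  the weighted degree of a monomial (\<open>hE\<close>); so the three weights alone are
  coprime.\<close>

lemma bezout: "\<exists>u :: 3 => int. (\<Sum>j\<in>UNIV. u j * int (a j)) = 1"
proof -
 let ?g = "gcd (a 1) (gcd (a 2) (a 3))"
 have "?g dvd a j" for j
 proof -
  have "\<forall>j. ?g dvd a j" unfolding all_3 by (meson dvd_trans gcd_dvd1 gcd_dvd2)
  then show ?thesis by blast
 qed
 then have "?g dvd h" unfolding hE[of 1, symmetric] by (intro dvd_sum) simp
 then have "?g dvd gcd (a 1) (gcd (a 2) (gcd (a 3) h))" by (meson dvd_trans gcd_dvd1 gcd_dvd2 gcd_greatest)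
 then have g: "?g = 1" using gcd1 by simp
 obtain x y where xy: "x * int (a 2) + y * int (a 3) = gcd (int (a 2)) (int (a 3))" using bezout_int by blast
 obtain x' y' where xy': "x' * int (a 1) + y' * gcd (int (a 2)) (int (a 3)) = gcd (int (a 1)) (gcd (int (a 2)) (int (a 3)))"
  using bezout_int by blast
 have "gcd (int (a 1)) (gcd (int (a 2)) (int (a 3))) = 1" using g by (metis gcd_int_int_eq of_nat_1)
 then have "(\<Sum>j\<in>UNIV. tri x' (y' * x) (y' * y) j * int (a j)) = 1"
  using xy' unfolding xy[symmetric] by (simp add: sum_3 algebra_simps)
 then show ?thesis by blast
qed

definition bz :: "3 => int" where
 "bz = (SOME u. (\<Sum>j\<in>UNIV. u j * int (a j)) = 1)"

lemma bz: "(\<Sum>j\<in>UNIV. bz j * int (a j)) = 1"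
 unfolding bz_def using bezout by (rule someI_ex)

text \<open>The choice is forced: an element whose multiples by the \<open>a j\<close> are the
  principal generators equals their combination with the Bezout coefficients.\<close>

definition wv :: "3 \<Rightarrow>\<^sub>0 int" where
 "wv = vec (comb bz)"

definition w :: "(3 \<Rightarrow>\<^sub>0 int) set" where
 "w = L_class A wv"

lemma rels_sum: "finite I ==> (\<And>i. i \<in> I ==> v i \<in> rels A) ==> (%s. \<Sum>i\<in>I. v i s) \<in> rels A"
proof (induction I rule: finite_induct)
 case empty
 show ?case unfolding rels_def by (auto intro!: exI[of _ "%_. 0"])
next
 case (insert x F)
 then show ?case using rels_add[of "v x" A "%s. \<Sum>i\<in>F. v i s"] by simp
qed

text \<open>The difference of the two sides is a double sum of the expressions in
  \<open>pair\<close> with coefficients \<open>bz i * n j\<close>, because the Bezout sum is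
  one.\<close>

lemma comb_class: "L_class A (vec (comb n)) = w [^][L_group A] (\<Sum>j\<in>UNIV. n j * int (a j))"
proof -
 let ?d = "\<Sum>j\<in>UNIV. n j * int (a j)"
 have "(%s. comb n s - ?d * comb bz s) \<in> rels A"
 proof -
  have "(%s. \<Sum>i\<in>UNIV. \<Sum>j\<in>UNIV. (bz i * n j) * (int (a i) * int (lam j s) - int (a j) * int (lam i s))) \<in> rels A"
   by (intro rels_sum rels_cmul pair) auto
  moreover have "(\<Sum>i\<in>UNIV. \<Sum>j\<in>UNIV. (bz i * n j) * (int (a i) * int (lam j s) - int (a j) * int (lam i s))) =
    comb n s - ?d * comb bz s" for s
  proof -
   have "(\<Sum>i\<in>UNIV. \<Sum>j\<in>UNIV. (bz i * n j) * (int (a i) * int (lam j s) - int (a j) * int (lam i s))) =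
    (\<Sum>i\<in>UNIV. bz i * int (a i)) * comb n s - ?d * comb bz s"
    unfolding comb_def by (simp add: sum_3 algebra_simps)
   then show ?thesis using bz by simp
  qed
  ultimately show ?thesis by simp
 qed
 moreover have "lk (vec (comb n) - frag_cmul ?d wv) = (%s. comb n s - ?d * comb bz s)"
  by (simp add: fun_eq_iff lookup_minus wv_def)
 ultimately show ?thesis unfolding w_def L_class_pow L_class_eq by simp
qed

lemma w_closed: "w \<in> carrier (L_group A)" by (simp add: w_def)

text \<open>Membership of a degree in the principal lattice can be tested on any exponent vector,
  since the relations of \<open>L(A)\<close> belong to the lattice spanned by the
  \<open>lam j\<close>.\<close>

lemma class_in_H: "L_class A v \<in> range (%d::int. w [^][L_group A] d) \<longleftrightarrow> (\<exists>n. \<forall>s. lk v s = comb n s)"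
proof
 assume "L_class A v \<in> range (%d::int. w [^][L_group A] d)"
 then obtain d :: int where "L_class A v = w [^][L_group A] d" by blast
 then have "lk (v - frag_cmul d wv) \<in> rels A" unfolding w_def L_class_pow L_class_eq .
 then obtain n where n: "\<And>s. lk (v - frag_cmul d wv) s = comb n s" using rels_comb by blast
 have "lk v s = comb (%j. n j + d * bz j) s" for s
  using n[of s] by (simp add: lookup_minus wv_def comb_add[symmetric] comb_cmul[symmetric])
 then show "\<exists>n. \<forall>s. lk v s = comb n s" by blast
next
 assume "\<exists>n. \<forall>s. lk v s = comb n s"
 then obtain n where "\<forall>s. lk v s = comb n s" by blast
 then have "v = vec (comb n)" by (intro poly_mapping_eqI) simp
 then show "L_class A v \<in> range (%d::int. w [^][L_group A] d)" using comb_class by auto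
qed

text \<open>The degree homomorphism on \<open>L(A)\<close>: \<open>X\<^sub>i\<close> goes to the
  product of the other two \<open>A j\<close>, so all \<open>A i\<close> times
  \<open>X\<^sub>i\<close> have the same image.\<close>

definition ldeg :: "(3 => int) => int" where
 "ldeg v = v 1 * int (A 2 * A 3) + v 2 * int (A 1 * A 3) + v 3 * int (A 1 * A 2)"

lemma ldeg_rels: "v \<in> rels A ==> ldeg v = 0"
proof -
 assume "v \<in> rels A"
 then obtain n where n: "(\<Sum>s\<in>UNIV. n s) = 0" "\<forall>s. v s = n s * int (A s)" unfolding rels_def by blast
 have "ldeg v = (\<Sum>s\<in>UNIV. n s) * int (A 1 * A 2 * A 3)" using n(2) by (simp add: ldeg_def sum_3 algebra_simps)
 then show ?thesis using n(1) by simp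
qed

lemma lam_nonzero: "\<exists>s. 0 < lam j s"
proof (rule ccontr)
 assume "\<not> (\<exists>s. 0 < lam j s)"
 then have z: "lam j s = 0" for s by auto
 have "\<forall>s. (\<Sum>i\<in>UNIV. (if i = j then 1 else 0 :: int) * int (lam i s)) = 0" using z by (simp add: delta_3)
 then have "(if j = j then 1 else 0 :: int) = 0" using indep[of "%i. if i = j then 1 else 0" j] by simp
 then show False by simp
qed

lemma ldeg_lam: "0 < ldeg (%s. int (lam j s))"
proof -
 have "0 < lam j 1 \<or> 0 < lam j 2 \<or> 0 < lam j 3" using lam_nonzero[of j] unfolding ex_3 .
 moreover have "0 < A 1" "0 < A 2" "0 < A 3" using Apos by auto
 ultimately have "0 < lam j 1 * (A 2 * A 3) + lam j 2 * (A 1 * A 3) + lam j 3 * (A 1 * A 2)" by auto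
 then have "0 < int (lam j 1 * (A 2 * A 3) + lam j 2 * (A 1 * A 3) + lam j 3 * (A 1 * A 2))" by linarith
 then show ?thesis by (simp add: ldeg_def)
qed

lemma ldeg_w: "0 < ldeg (comb bz)"
proof -
 have "lk (vec (comb (%j. if j = 1 then 1 else 0)) - frag_cmul (int (a 1)) wv) \<in> rels A"
  using comb_class[of "%j. if j = 1 then 1 else 0"] unfolding w_def L_class_pow L_class_eq by (simp add: sum_3)
 then have "ldeg (%s. int (lam 1 s) - int (a 1) * comb bz s) = 0"
  using ldeg_rels by (fastforce simp: lookup_minus wv_def comb_def[of "%j. if j = 1 then 1 else 0"] sum_3 ldeg_def)
 then have "ldeg (%s. int (lam 1 s)) = int (a 1) * ldeg (comb bz)" by (simp add: ldeg_def algebra_simps)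
 then show ?thesis using ldeg_lam[of 1] apos[of 1] by (simp add: zero_less_mult_iff)
qed

text \<open>\<open>ldeg\<close> is positive on \<open>wv\<close> and nonnegative on exponents of
  monomials. Hence the restriction to \<open>d \<ge> 0\<close> in the definition of
  \<open>RW\<close> discards no monomial.\<close>

lemma class_nat_pow:
 assumes v: "\<And>s. 0 \<le> lk v s" and "L_class A v = w [^][L_group A] (d::int)"
 shows "0 \<le> d"
proof -
 have "lk (v - frag_cmul d wv) \<in> rels A" using assms(2) unfolding w_def L_class_pow L_class_eq .
 then have "ldeg (lk (v - frag_cmul d wv)) = 0" by (rule ldeg_rels)
 then have "ldeg (lk v) = d * ldeg (comb bz)" by (simp add: ldeg_def lookup_minus wv_def algebra_simps)
 moreover have "0 \<le> ldeg (lk v)" using v by (simp add: ldeg_def)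
 ultimately show ?thesis using ldeg_w by (simp add: zero_le_mult_iff)
qed

text \<open>The principal generators span a lattice of finite index; \<open>N\<close> annihilates
  the quotient.\<close>

lemma exponent: "\<exists>N>0. \<forall>v. \<exists>n. \<forall>s. int N * v s = comb n s"
proof -
 have diff: "\<exists>n. \<forall>s. (if s = i then int (A i) else 0) - (if s = t then int (A t) else 0) = comb n s" for i t
 proof
  show "\<forall>s. (if s = i then int (A i) else 0) - (if s = t then int (A t) else 0) = comb (%j. int (E i j) - int (E t j)) s"
   unfolding comb_diff[symmetric] rel_comb by simp
 qed
 \<comment> \<open>\<open>K\<close> is \<open>ldeg\<close> of the first principal generator: in
   \<open>A 1 * A 2 * A 3\<close> times that generator, every \<open>A i\<close> times
   \<open>X\<^sub>i\<close> may be traded for \<open>A t\<close> times \<open>X\<^sub>t\<close>,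
   which leaves \<open>K\<close> copies of the latter.\<close>
 define K where "K = lam 1 1 * (A 2 * A 3) + lam 1 2 * (A 1 * A 3) + lam 1 3 * (A 1 * A 2)"
 have Kp: "0 < K" using ldeg_lam[of 1] unfolding ldeg_def K_def by (simp add: of_nat_add[symmetric] of_nat_mult[symmetric] del: of_nat_add of_nat_mult)
 have KA: "\<exists>n. \<forall>s. (if s = t then int K * int (A t) else 0) = comb n s" for t
 proof -
  obtain n1 n2 n3 where n: "\<forall>s. (if s = 1 then int (A 1) else 0) - (if s = t then int (A t) else 0) = comb n1 s"
   "\<forall>s. (if s = 2 then int (A 2) else 0) - (if s = t then int (A t) else 0) = comb n2 s"
   "\<forall>s. (if s = 3 then int (A 3) else 0) - (if s = t then int (A t) else 0) = comb n3 s"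
   using diff by metis
  let ?c1 = "int (lam 1 1) * int (A 2) * int (A 3)" and ?c2 = "int (lam 1 2) * int (A 1) * int (A 3)"
   and ?c3 = "int (lam 1 3) * int (A 1) * int (A 2)"
  let ?m = "%j. (int (A 1) * int (A 2) * int (A 3)) * (if j = 1 then 1 else 0) + ((- ?c1) * n1 j + ((- ?c2) * n2 j + (- ?c3) * n3 j))"
  have "(if s = t then int K * int (A t) else 0) = comb ?m s" for s
  proof -
   have l: "comb (%j. if j = 1 then 1 else 0) s = int (lam 1 s)" by (simp add: comb_def sum_3)
   have "comb ?m s = (int (A 1) * int (A 2) * int (A 3)) * int (lam 1 s) +
     ((- ?c1) * comb n1 s + ((- ?c2) * comb n2 s + (- ?c3) * comb n3 s))"
    by (simp only: comb_add[symmetric] comb_cmul[symmetric] l)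
   also have "\<dots> = (if s = t then int K * int (A t) else 0)"
   proof -
    have "\<forall>s. (int (A 1) * int (A 2) * int (A 3)) * int (lam 1 s) +
     ((- ?c1) * comb n1 s + ((- ?c2) * comb n2 s + (- ?c3) * comb n3 s)) = (if s = t then int K * int (A t) else 0)"
     unfolding all_3 n[rule_format, symmetric] K_def by (auto simp: algebra_simps)
    then show ?thesis by blast
   qed
   finally show ?thesis by simp
  qed
  then show ?thesis by blast
 qed
 then obtain m where m: "\<And>t s. (if s = t then int K * int (A t) else 0) = comb (m t) s" by metis
 define N where "N = K * (A 1 * A 2 * A 3)"
 have "\<exists>n. \<forall>s. int N * v s = comb n s" for v
 proof -
  let ?k = "%j. (int (A 2) * int (A 3) * v 1) * m 1 j + ((int (A 1) * int (A 3) * v 2) * m 2 j + (int (A 1) * int (A 2) * v 3) * m 3 j)"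
  have "\<forall>s. int N * v s = (int (A 2) * int (A 3) * v 1) * comb (m 1) s + ((int (A 1) * int (A 3) * v 2) * comb (m 2) s +
    (int (A 1) * int (A 2) * v 3) * comb (m 3) s)"
   unfolding all_3 m[symmetric] N_def by (simp add: algebra_simps)
  then have "\<forall>s. int N * v s = comb ?k s" unfolding comb_add[symmetric] comb_cmul[symmetric] .
  then show ?thesis by blast
 qed
 moreover have "0 < N" unfolding N_def using Kp Apos by simp
 ultimately show ?thesis by blast
qed

definition N :: nat where "N = (SOME N. N > 0 \<and> (\<forall>v. \<exists>n. \<forall>s. int N * v s = comb n s))"

lemma N: "0 < N" "\<exists>n. \<forall>s. int N * v s = comb n s"
 using someI_ex[OF exponent] unfolding N_def by blast+

text \<open>The coordinate of index \<open>s\<close> can be cleared by a principal generator, and the others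
 be made to lie in \<open>{0..<N}\<close> since \<open>N\<close> kills the quotient.\<close>

lemma pair_monomial:
 assumes ij: "i \<noteq> j"
 shows "\<exists>(p::nat) (q::nat) n. p < N \<and> q < N \<and>
  (\<forall>s. v s + (if s = i then int p else 0) + (if s = j then int q else 0) = comb n s)"
proof -
 obtain s where s: "s \<noteq> i" "s \<noteq> j" "\<forall>t. t = i \<or> t = j \<or> t = s"
 proof -
  have "\<exists>s. s \<noteq> i \<and> s \<noteq> j \<and> (\<forall>t. t = i \<or> t = j \<or> t = s)"
  proof -
   have "\<forall>i j::3. i \<noteq> j --> (\<exists>s. s \<noteq> i \<and> s \<noteq> j \<and> (\<forall>t. t = i \<or> t = j \<or> t = s))"
    unfolding all_3 ex_3 by simp
   then show ?thesis using ij by blast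
  qed
  then show thesis using that by blast
 qed
 obtain k where k: "lam k s = 1" using lam_one by blast
 define v' where "v' t = v t - v s * int (lam k t)" for t
 have v's: "v' s = 0" using k by (simp add: v'_def)
 note lk = comb_delta[of k]
 define p where "p = (- v' i) mod int N"
 define q where "q = (- v' j) mod int N"
 have pq: "0 \<le> p" "p < int N" "0 \<le> q" "q < int N" using N(1) by (simp_all add: p_def q_def)
 have "int N dvd v' i + p" "int N dvd v' j + q"
  unfolding p_def q_def by (metis add.commute add.right_inverse dvd_eq_mod_eq_0 mod_0 mod_add_right_eq)+
 then obtain x y where xy: "v' i + p = int N * x" "v' j + q = int N * y" by (auto elim!: dvdE)
 obtain n where n: "\<forall>t. int N * (if t = i then x else if t = j then y else 0) = comb n t"
  using N(2)[of "%t. if t = i then x else if t = j then y else 0"] by blast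
 have "v t + (if t = i then int (nat p) else 0) + (if t = j then int (nat q) else 0) =
   comb (%j. v s * (if j = k then 1 else 0) + n j) t" for t
 proof -
  have "comb (%j. v s * (if j = k then 1 else 0) + n j) t = v s * int (lam k t) + comb n t"
   by (simp only: comb_add[symmetric] comb_cmul[symmetric] lk)
  also have "\<dots> = v s * int (lam k t) + (v' t + (if t = i then p else 0) + (if t = j then q else 0))"
  proof -
   have "comb n t = v' t + (if t = i then p else 0) + (if t = j then q else 0)"
    using s(3)[rule_format, of t] xy ij s(1,2) v's unfolding n[rule_format, symmetric] by auto
   then show ?thesis by simp
  qed
  finally show ?thesis using pq by (simp add: v'_def)
 qed
 then show ?thesis using pq by (intro exI[of _ "nat p"] exI[of _ "nat q"] exI[of _ "%j. v s * (if j = k then 1 else 0) + n j"]) auto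
qed

text \<open>Uniqueness comes from the Bezout combination, which recovers an element from its three
  multiples; existence is a computation with rows of \<open>E\<close>.\<close>

lemma omega_W:
 assumes l: "\<And>i. l i = vec (%s. int (lam i s))"
 shows "omega_W a h A l = w"
proof -
 interpret L: comm_group "L_group A" by (rule L_comm_group)
 have pl: "w [^][L_group A] a i = L_class A (l i)" for i
 proof -
  have "comb (%j. if j = i then 1 else 0) = (%s. int (lam i s))" by (simp add: comb_delta fun_eq_iff)
  then have "L_class A (l i) = w [^][L_group A] (\<Sum>j\<in>UNIV. (if j = i then 1 else 0) * int (a j))"
   using comb_class[of "%j. if j = i then 1 else 0"] l by simp
  moreover have "(\<Sum>j\<in>UNIV. (if j = i then 1 else 0) * int (a j)) = int (a i)" by (simp add: delta_3)
  ultimately show ?thesis by (simp add: int_pow_int)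
 qed
 have om: "w [^][L_group A] (- eps a h) = omega_A A"
 proof -
  \<comment> \<open>The number \<open>- eps a h\<close> is the weight of the first row of
    \<open>E\<close> minus \<open>(1, 1, 1)\<close>, by \<open>hE\<close>; the corresponding
    exponent is \<open>A 1\<close> times \<open>X\<^sub>1\<close> minus all three variables, by
    \<open>rel\<close>.\<close>
  have "w [^][L_group A] (- eps a h) = L_class A (vec (comb (%j. int (E 1 j) - 1)))"
   unfolding comb_class eps_def using arg_cong[OF hE[of 1], of int] by (simp add: sum_3 algebra_simps)
  also have "vec (comb (%j. int (E 1 j) - 1)) = gX (A 1) 1 - gX 1 1 - gX 1 2 - gX 1 3"
  proof (rule poly_mapping_eqI)
   fix s
   have "comb (%j. int (E 1 j) - 1) s = comb (%j. int (E 1 j)) s - int (\<Sum>j\<in>UNIV. lam j s)"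
    by (simp add: comb_def left_diff_distrib sum_subtractf)
   also have "\<dots> = (if s = 1 then int (A 1) else 0) - 1" unfolding rel_comb Mexp[symmetric] by simp
   also have "\<dots> = lk (gX (A 1) 1 - gX 1 1 - gX 1 2 - gX 1 3) s"
   proof -
    have "\<forall>s. (if s = 1 then int (A 1) else 0) - 1 = lk (gX (A 1) 1 - gX 1 1 - gX 1 2 - gX 1 3) s"
     unfolding all_3 by (simp add: lookup_minus lookup_single when_def)
    then show ?thesis by blast
   qed
   finally show "lk (vec (comb (%j. int (E 1 j) - 1))) s = lk (gX (A 1) 1 - gX 1 1 - gX 1 2 - gX 1 3) s" by simp
  qed
  finally show ?thesis by (simp add: omega_A_def)
 qed
 show ?thesis unfolding omega_W_def
 proof (rule the_equality)
  show "w \<in> carrier (L_group A) \<and> w [^][L_group A] (- eps a h) = omega_A A \<and> (\<forall>i. w [^][L_group A] a i = L_class A (l i))"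
   using w_closed om pl by blast
 next
  fix x assume x: "x \<in> carrier (L_group A) \<and> x [^][L_group A] (- eps a h) = omega_A A \<and> (\<forall>i. x [^][L_group A] a i = L_class A (l i))"
  have "y = (y [^][L_group A] a 1) [^][L_group A] bz 1 \<otimes>[L_group A] (y [^][L_group A] a 2) [^][L_group A] bz 2 \<otimes>[L_group A]
    (y [^][L_group A] a 3) [^][L_group A] bz 3" if y: "y \<in> carrier (L_group A)" for y
  proof -
   have "(y [^][L_group A] a i) [^][L_group A] bz i = y [^][L_group A] (bz i * int (a i))" for i
    using L.int_pow_pow[OF y, of "int (a i)" "bz i"] by (simp add: int_pow_int mult.commute)
   then have "(y [^][L_group A] a 1) [^][L_group A] bz 1 \<otimes>[L_group A] (y [^][L_group A] a 2) [^][L_group A] bz 2 \<otimes>[L_group A]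
    (y [^][L_group A] a 3) [^][L_group A] bz 3 = y [^][L_group A] (\<Sum>j\<in>UNIV. bz j * int (a j))"
    using y by (simp add: sum_3 L.int_pow_mult[symmetric])
   then show ?thesis using bz y by simp
  qed
  from this[of x] this[of w] show "x = w" using x w_closed pl by simp
 qed
qed

end

section \<open>The algebras \<open>R\<^sub>A\<close> and \<open>R\<^sub>W\<close>\<close>

type_synonym 'k ralg = "('k, (3 \<Rightarrow>\<^sub>0 int) set, 'k poly3 set) graded_algebra"

abbreviation sg :: "'a => 'b => 'a \<Rightarrow>\<^sub>0 'b::zero" where "sg \<equiv> Poly_Mapping.single"
abbreviation ks :: "('a \<Rightarrow>\<^sub>0 'b::zero) => 'a set" where "ks \<equiv> Poly_Mapping.keys"

lemma pm_induct [case_names zero add]: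
 assumes "P 0" "\<And>m c f. P f ==> P (sg m c + f)"
 shows "P (f :: 'a \<Rightarrow>\<^sub>0 'b::comm_monoid_add)"
proof (induction f rule: update_induct)
 case (update f m c)
 have "Poly_Mapping.update m c f = sg m c + f"
 proof (rule poly_mapping_eqI)
  fix t show "lk (Poly_Mapping.update m c f) t = lk (sg m c + f) t"
   using update(1) by (auto simp: lookup_update lookup_add lookup_single when_def in_keys_iff)
 qed
 then show ?case using assms(2)[OF update(3)] by simp
qed (rule assms(1))

lemma sum_single_mult: "sg m c * f = (\<Sum>n\<in>ks f. sg (m + n) (c * lk f n))"
proof -
 have "f = (\<Sum>n\<in>ks f. sg n (lk f n))"
  by (rule poly_mapping_eqI) (simp add: lookup_sum lookup_single when_def in_keys_iff)
 then have "sg m c * f = sg m c * (\<Sum>n\<in>ks f. sg n (lk f n))" by (rule arg_cong)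
 then show ?thesis by (simp add: sum_distrib_left mult_single)
qed

section \<open>Parts of a polynomial selected by exponents\<close>

definition prt :: "('a => bool) => ('a \<Rightarrow>\<^sub>0 'b) => 'a \<Rightarrow>\<^sub>0 'b::zero" where
 "prt Q f = Poly_Mapping.mapp (%m c. c when Q m) f"

lemma lookup_prt [simp]: "lk (prt Q f) m = (lk f m when Q m)"
 by (simp add: prt_def lookup_mapp when_def in_keys_iff)

lemma keys_prt: "ks (prt Q f) = {m \<in> ks f. Q m}"
 by (auto simp: in_keys_iff)

lemma prt_add: "prt Q (f + g) = prt Q f + prt Q (g :: 'a \<Rightarrow>\<^sub>0 'b::monoid_add)"
 by (rule poly_mapping_eqI) (simp add: lookup_add when_def)

lemma prt_zero [simp]: "prt Q 0 = 0"
 by (rule poly_mapping_eqI) (simp add: when_def)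

lemma prt_diff: "prt Q (f - g) = prt Q f - prt Q (g :: 'a \<Rightarrow>\<^sub>0 'b::ab_group_add)"
 by (rule poly_mapping_eqI) (simp add: lookup_minus when_def)

lemma prt_sum: "prt Q (sum f I) = (\<Sum>i\<in>I. prt Q (f i :: 'a \<Rightarrow>\<^sub>0 'b::comm_monoid_add))"
 by (induction I rule: infinite_finite_induct) (auto simp: prt_add)

lemma prt_single: "prt Q (sg m c) = (if Q m then sg m c else 0)"
 by (rule poly_mapping_eqI) (auto simp: lookup_single when_def)

lemma prt_id: "(\<And>m. m \<in> ks f ==> Q m) ==> prt Q f = f"
 by (rule poly_mapping_eqI) (auto simp: when_def in_keys_iff)

lemma prt_none: "(\<And>m. m \<in> ks f ==> \<not> Q m) ==> prt Q f = 0"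
 by (rule poly_mapping_eqI) (auto simp: when_def in_keys_iff)

lemma prt_single_mult:
 "prt Q (sg k c * f) = sg k c * prt (%m. Q (k + m)) (f :: 'a::monoid_add \<Rightarrow>\<^sub>0 'b::semiring_0)"
proof (induction f rule: pm_induct)
 case (add m d f)
 then show ?case by (simp add: distrib_left prt_add mult_single prt_single)
qed simp

lemma prt_sum_classes:
 assumes "finite I" "\<And>m. m \<in> ks f ==> \<kappa> m \<in> I"
 shows "f = (\<Sum>g\<in>I. prt (%m. \<kappa> m = g) (f :: 'a \<Rightarrow>\<^sub>0 'b::comm_monoid_add))"
proof (rule poly_mapping_eqI)
 fix m
 show "lk f m = lk (\<Sum>g\<in>I. prt (%m. \<kappa> m = g) f) m"
  using assms by (cases "m \<in> ks f") (auto simp: lookup_sum when_def in_keys_iff)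
qed

section \<open>Residue classes modulo \<open>F\<close> and degrees of monomials\<close>

lemma poly3_ops [simp]:
 "carrier poly3_ring = UNIV" "f \<otimes>[poly3_ring] g = f * g" "f \<oplus>[poly3_ring] g = f + g"
 "\<one>[poly3_ring] = 1" "\<zero>[poly3_ring] = 0"
 by (simp_all add: ring_of_type_algebra_def)

interpretation P3: cring "poly3_ring :: 'k::comm_ring_1 poly3 ring"
 by (rule cring_from_type_algebra)

lemma poly3_minus [simp]: "\<ominus>[poly3_ring] f = - f" "f \<ominus>[poly3_ring] g = f - g"
proof -
 show *: "\<ominus>[poly3_ring] f = - f" for f :: "'a poly3" by (rule P3.minus_equality) auto
 show "f \<ominus>[poly3_ring] g = f - g" by (simp add: a_minus_def *)
qed

lemma PIdl_iff: "g \<in> PIdl\<^bsub>poly3_ring\<^esub> f \<longleftrightarrow> f dvd g"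
 unfolding cgenideal_def dvd_def by (auto simp: mult.commute)

lemma PIdl_coset_eq: "PIdl\<^bsub>poly3_ring\<^esub> f +>[poly3_ring] g = PIdl\<^bsub>poly3_ring\<^esub> f +>[poly3_ring] g' \<longleftrightarrow> f dvd (g - g')"
proof -
 interpret I: ideal "PIdl\<^bsub>poly3_ring\<^esub> f" poly3_ring by (rule P3.cgenideal_ideal) simp
 show ?thesis using P3.quotient_eq_iff_same_a_r_cos[OF I.ideal_axioms, of g g'] PIdl_iff[of "g - g'" f] by auto
qed

definition FA :: "(3 => nat) => 'k::field poly3" where
 "FA A = (\<Sum>i\<in>UNIV. sg (sg i (A i)) 1)"

lemma var3_pow: "(var3 i :: 'k::comm_ring_1 poly3) ^ n = sg (sg i n) 1"
proof (induction n)
 case (Suc n)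
 then show ?case by (simp add: var3_def mult_single single_add[symmetric])
qed simp

lemma RA_ideal_PIdl: "RA_ideal A = PIdl\<^bsub>poly3_ring\<^esub> (FA A)"
 by (simp add: RA_ideal_def FA_def var3_pow)

definition cs :: "(3 => nat) => 'k::field poly3 => 'k poly3 set" where
 "cs A f = RA_ideal A +>[poly3_ring] f"

lemma cs_eq: "cs A f = cs A g \<longleftrightarrow> FA A dvd (f - g)"
 unfolding cs_def RA_ideal_PIdl by (rule PIdl_coset_eq)

definition cl :: "(3 => nat) => (3 \<Rightarrow>\<^sub>0 nat) => (3 \<Rightarrow>\<^sub>0 int) set" where
 "cl A m = L_class A (Poly_Mapping.map int m)"

lemma lookup_map_int [simp]: "lk (Poly_Mapping.map int m) s = int (lk m s)"
 by (simp add: Poly_Mapping.map.rep_eq when_def)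

lemma cl_add: "cl A (m + n) = cl A m \<otimes>[L_group A] cl A n"
proof -
 have "Poly_Mapping.map int (m + n) = Poly_Mapping.map int m + Poly_Mapping.map int n"
  by (rule poly_mapping_eqI) (simp add: lookup_add)
 then show ?thesis by (simp add: cl_def L_class_mult)
qed

lemma cl_closed [simp]: "cl A m \<in> carrier (L_group A)"
 by (simp add: cl_def)

lemma cl_zero: "cl A 0 = \<one>[L_group A]"
proof -
 have "Poly_Mapping.map int (0 :: 3 \<Rightarrow>\<^sub>0 nat) = 0" by (rule poly_mapping_eqI) simp
 then show ?thesis by (simp add: cl_def L_one)
qed

lemma cl_c: "cl A (sg i (A i)) = cl A (sg j (A j))"
proof -
 have "gX (A i) i - gX (A j) j \<in> L_relations A" unfolding L_relations_def by (rule generate.incl) blast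
 moreover have "Poly_Mapping.map int (sg i n) = sg i (int n)" for i :: 3 and n
  by (rule poly_mapping_eqI) (simp add: lookup_single when_def)
 ultimately show ?thesis by (simp add: cl_def L_class_eq L_relations_iff)
qed

lemma RA_simps [simp]:
 "ga_grp (RA A) = L_group A" "ga_ring (RA A) = poly3_ring Quot RA_ideal A"
 "ga_emb (RA A) = (%c. cs A (const3 c))"
 "ga_comp (RA A) g = cs A ` {f. \<forall>m\<in>ks f. cl A m = g}"
 by (simp_all add: RA_def cs_def[abs_def] cl_def)

lemma RA_ideal_ideal: "ideal (RA_ideal A :: 'k::field poly3 set) poly3_ring"
 unfolding RA_ideal_PIdl by (rule P3.cgenideal_ideal) simp

lemma RA_cring: "cring (ga_ring (RA A :: 'k::field ralg))"
 using ideal.quotient_is_cring[OF RA_ideal_ideal P3.cring_axioms] by simp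

lemma cs_ops:
 fixes f g :: "'k::field poly3"
 shows "cs A f \<otimes>[ga_ring (RA A)] cs A g = cs A (f * g)" "cs A f \<oplus>[ga_ring (RA A)] cs A g = cs A (f + g)"
  "\<one>[ga_ring (RA A)] = cs A (1 :: 'k poly3)" "\<zero>[ga_ring (RA A)] = cs A (0 :: 'k poly3)"
  "carrier (ga_ring (RA A :: 'k ralg)) = range (cs A)"
  "cs A f [^][ga_ring (RA A)] n = cs A (f ^ n)"
  "\<ominus>[ga_ring (RA A)] cs A f = cs A (- f)"
proof -
 interpret I: ideal "RA_ideal A :: 'k poly3 set" poly3_ring by (rule RA_ideal_ideal)
 interpret Q: cring "ga_ring (RA A :: 'k ralg)" by (rule RA_cring)
 note I = I.rcos_ring_hom
 show m: "cs A f \<otimes>[ga_ring (RA A)] cs A g = cs A (f * g)" for f g :: "'k poly3" using ring_hom_mult[OF I, of f g] by (simp add: cs_def)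
 show a: "cs A f \<oplus>[ga_ring (RA A)] cs A g = cs A (f + g)" for f g :: "'k poly3" using ring_hom_add[OF I, of f g] by (simp add: cs_def)
 show o: "\<one>[ga_ring (RA A)] = cs A (1 :: 'k poly3)" using ring_hom_one[OF I] by (simp add: cs_def)
 show c: "carrier (ga_ring (RA A :: 'k ralg)) = range (cs A)"
  by (auto simp: FactRing_def A_RCOSETS_def' cs_def)
 show z: "\<zero>[ga_ring (RA A)] = cs A (0 :: 'k poly3)"
  using ring_hom_zero[OF I P3.ring_axioms] Q.ring_axioms by (simp add: cs_def)
 show "cs A f [^][ga_ring (RA A)] n = cs A (f ^ n)"
  by (induction n) (simp_all only: Q.nat_pow_0 Q.nat_pow_Suc o m power.simps power_Suc2 mult.commute)
 show "\<ominus>[ga_ring (RA A)] cs A f = cs A (- f)"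
  by (rule Q.minus_equality) (simp_all only: a c rangeI z left_minus)
qed

lemma cs_sum: "finite I ==> cs A (\<Sum>i\<in>I. f i) = finsum (ga_ring (RA A)) (%i. cs A (f i :: 'k::field poly3)) I"
proof (induction I rule: finite_induct)
 case empty
 interpret Q: cring "ga_ring (RA A :: 'k ralg)" by (rule RA_cring)
 show ?case by (simp only: sum.empty Q.finsum_empty cs_ops)
next
 case (insert i I)
 interpret Q: cring "ga_ring (RA A :: 'k ralg)" by (rule RA_cring)
 have "finsum (ga_ring (RA A)) (%i. cs A (f i)) (insert i I) = cs A (f i) \<oplus>[ga_ring (RA A)] finsum (ga_ring (RA A)) (%i. cs A (f i)) I"
  using insert by (intro Q.finsum_insert) (auto simp del: RA_simps simp: cs_ops)
 also have "\<dots> = cs A (f i + sum f I)" unfolding insert.IH[symmetric] by (rule cs_ops)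
 finally show ?case using insert by simp
qed

text \<open>A condition on exponents that is affected in the same way by all monomials of
  \<open>F\<close> selects a part compatible with multiplication by \<open>F\<close>. Having a given
  degree in \<open>L(A)\<close>, or a degree in the lattice, are such conditions.\<close>

lemma prt_FA_mult:
 assumes "\<And>i m. Q (sg i (A i) + m) = Q' m"
 shows "prt Q (FA A * f) = FA A * prt Q' f"
proof -
 have "prt Q (FA A * f) = (\<Sum>i\<in>UNIV. prt Q (sg (sg i (A i)) 1 * f))"
  unfolding FA_def sum_distrib_right by (rule prt_sum)
 then show ?thesis unfolding prt_single_mult assms FA_def sum_distrib_right .
qed

lemma prt_dvd:
 assumes "FA A dvd f" shows "FA A dvd prt (%m. cl A m = g) f"
proof -
 obtain f' where f: "f = FA A * f'" using assms by (elim dvdE)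
 have "prt (%m. cl A m = g) f = FA A * prt (%m. cl A (sg 1 (A 1) + m) = g) f'"
  unfolding f
 proof (rule prt_FA_mult)
  fix i m show "(cl A (sg i (A i) + m) = g) = (cl A (sg 1 (A 1) + m) = g)" by (simp only: cl_add cl_c[of A i 1])
 qed
 then show ?thesis by simp
qed

definition pr :: "(3 => nat) => 'k::field poly3 set => (3 \<Rightarrow>\<^sub>0 int) set => 'k poly3 set" where
 "pr A x g = cs A (prt (%m. cl A m = g) (SOME f. x = cs A f))"

text \<open>Representatives differ by a multiple of the homogeneous \<open>F\<close>, and so do
  their parts of degree \<open>g\<close>.\<close>

lemma pr_cs: "pr A (cs A f) g = cs A (prt (%m. cl A m = g) f)"
proof -
 define f' where "f' = (SOME f'. cs A f = cs A f')"
 have "cs A f = cs A f'" unfolding f'_def by (rule someI) simp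
 then have "FA A dvd prt (%m. cl A m = g) (f' - f)" by (intro prt_dvd) (simp add: cs_eq[symmetric])
 then have "cs A (prt (%m. cl A m = g) f') = cs A (prt (%m. cl A m = g) f)" by (simp add: cs_eq prt_diff)
 then show ?thesis by (simp only: pr_def f'_def)
qed

lemma keys_prt_class: "f \<in> {f. \<forall>m\<in>ks f. cl A m = g} \<longleftrightarrow> prt (%m. cl A m = g) f = f"
 using keys_prt[of "%m. cl A m = g" f] prt_id[of f "%m. cl A m = g"] by auto

section \<open>The grading of \<open>RA A\<close>\<close>

lemma RA_module:
 "abelian_group (reg (RA A :: 'k::field ralg))"
 "Module.module (ga_ring (RA A)) (reg (RA A :: 'k::field ralg))"
proof -
 interpret Q: cring "ga_ring (RA A :: 'k ralg)" by (rule RA_cring)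
 let ?S = "RA A :: 'k ralg"
 show ag: "abelian_group (reg ?S)"
 proof (rule abelian_groupI)
  fix x assume "x \<in> carrier (reg ?S)"
  then show "\<exists>y\<in>carrier (reg ?S). y \<oplus>[reg ?S] x = \<zero>[reg ?S]"
   by (intro bexI[of _ "\<ominus>[ga_ring ?S] x"]) (simp_all del: RA_simps add: Q.l_neg)
 qed (simp_all del: RA_simps add: Q.a_ac)
 show "Module.module (ga_ring ?S) (reg ?S)"
  by (intro Module.module.intro module_axioms.intro ag Q.cring_axioms)
   (simp_all del: RA_simps add: Q.l_distr Q.r_distr Q.m_assoc)
qed

lemma RA_dec: "is_dec (RA A) (reg (RA A)) (cs A f) (%g. cs A (prt (%m. cl A m = g) (f :: 'k::field poly3)))"
proof (rule is_decI[OF RA_module(1), where A = "cl A ` ks f"])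
 interpret Q: cring "ga_ring (RA A :: 'k ralg)" by (rule RA_cring)
 let ?S = "RA A :: 'k ralg" and ?p = "%g. cs A (prt (%m. cl A m = g) f)"
 show "?p g \<in> gm_comp (reg ?S) g" for g by (auto simp: keys_prt)
 show z: "?p g = \<zero>[reg ?S]" if "g \<notin> cl A ` ks f" for g
 proof -
  have "prt (%m. cl A m = g) f = 0" using that by (intro prt_none) blast
  then show ?thesis by (simp del: RA_simps add: cs_ops)
 qed
 show "?p g = \<zero>[reg ?S]" if "g \<notin> carrier (ga_grp ?S)" for g using that by (intro z) auto
 show "?p g \<in> carrier (reg ?S)" for g by (simp del: RA_simps add: cs_ops)
 have "cs A f = finsum (ga_ring ?S) ?p (cl A ` ks f)"
  using prt_sum_classes[of "cl A ` ks f" f "cl A"] cs_sum[of "cl A ` ks f" A "%g. prt (%m. cl A m = g) f"] by simp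
 also have "\<dots> = finsum (reg ?S) ?p (cl A ` ks f)"
  by (rule finsum_additive[where \<phi> = "%x. x", OF Q.abelian_group_axioms RA_module(1)]) (auto simp del: RA_simps simp: cs_ops)
 finally show "cs A f = finsum (reg ?S) ?p (cl A ` ks f)" .
qed simp

lemma RA_graded: "graded_module (RA A) (reg (RA A :: 'k::field ralg))"
proof (rule graded_moduleI[where pr = "pr A"])
 let ?S = "RA A :: 'k ralg"
 show "Module.module (ga_ring ?S) (reg ?S)" by (rule RA_module)
 show sub: "subgroup (gm_comp (reg ?S) g) (add_monoid (reg ?S))" if "g \<in> carrier (ga_grp ?S)" for g
 proof -
  interpret R: abelian_group "reg ?S" by (rule RA_module)
  show ?thesis
  proof (rule R.add.subgroupI)
   show "gm_comp (reg ?S) g <= carrier (reg ?S)"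
    unfolding reg_simps RA_simps(4) by (auto simp del: RA_simps simp: cs_ops)
   show "gm_comp (reg ?S) g \<noteq> {}" by (auto intro!: exI[of _ "0 :: 'k poly3"])
  next
   fix x assume "x \<in> gm_comp (reg ?S) g"
   then obtain f where f: "x = cs A f" "\<forall>m\<in>ks f. cl A m = g" by auto
   have "\<ominus>[reg ?S] x = cs A (- f)"
    by (rule R.minus_equality) (simp_all del: RA_simps add: f(1) cs_ops)
   then show "\<ominus>[reg ?S] x \<in> gm_comp (reg ?S) g" using f(2) by auto
  next
   fix x y assume "x \<in> gm_comp (reg ?S) g" "y \<in> gm_comp (reg ?S) g"
   then obtain f f' where f: "x = cs A f" "prt (%m. cl A m = g) f = f" "y = cs A f'" "prt (%m. cl A m = g) f' = f'"
    by (auto simp: keys_prt_class[simplified])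
   then have "f + f' \<in> {f. \<forall>m\<in>ks f. cl A m = g}" unfolding keys_prt_class by (simp add: prt_add)
   then show "x \<oplus>[reg ?S] y \<in> gm_comp (reg ?S) g"
    using cs_ops(2)[of A f f'] f by (simp del: RA_simps(2))
  qed
 qed
 show "is_dec ?S (reg ?S) x (pr A x)" if x: "x \<in> carrier (reg ?S)" for x
 proof -
  obtain f where f: "x = cs A f" using x by (auto simp del: RA_simps simp: cs_ops)
  have "pr A x = (%g. cs A (prt (%m. cl A m = g) f))" by (simp add: f pr_cs fun_eq_iff)
  then show ?thesis using RA_dec[of A f] f by simp
 qed
 show "pr A (x \<oplus>[reg ?S] y) g = pr A x g \<oplus>[reg ?S] pr A y g" if xy: "x \<in> carrier (reg ?S)" "y \<in> carrier (reg ?S)" for x y g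
 proof -
  obtain f f' where "x = cs A f" "y = cs A f'" using xy unfolding reg_simps cs_ops by blast
  then show ?thesis by (simp del: RA_simps add: cs_ops pr_cs prt_add)
 qed
 show "pr A x g' = (if g' = g then x else \<zero>[reg ?S])" if x: "x \<in> gm_comp (reg ?S) g" for x g g'
 proof -
  obtain f where f: "x = cs A f" "\<forall>m\<in>ks f. cl A m = g" using x by auto
  have "prt (%m. cl A m = g') f = (if g' = g then f else 0)"
   using prt_id[of f "%m. cl A m = g"] prt_none[of f "%m. cl A m = g'"] f(2) by simp
  then show ?thesis by (simp del: RA_simps add: cs_ops pr_cs f(1))
 qed
 fix g h r x assume "g \<in> carrier (ga_grp ?S)" "h \<in> carrier (ga_grp ?S)" "r \<in> ga_comp ?S g" "x \<in> gm_comp (reg ?S) h"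
 then obtain f f' where f: "r = cs A f" "\<forall>m\<in>ks f. cl A m = g" "x = cs A f'" "\<forall>m\<in>ks f'. cl A m = h" by auto
 have "\<forall>m\<in>ks (f * f'). cl A m = g \<otimes>[L_group A] h" using keys_mult[of f f'] f(2,4) by (auto simp: cl_add)
 moreover have "r \<odot>[reg ?S] x = cs A (f * f')" by (simp del: RA_simps add: f cs_ops)
 ultimately show "r \<odot>[reg ?S] x \<in> gm_comp (reg ?S) (g \<otimes>[ga_grp ?S] h)" by auto
qed

lemma const3_ops: "const3 (c + d) = const3 c + const3 d" "const3 (c * d) = const3 c * const3 d" "const3 1 = 1"
 by (simp_all add: const3_def single_add mult_single)

lemma RA_galg: "galg (RA A :: 'k::field ralg)"
proof (rule galg.intro)
 show "comm_group (ga_grp (RA A :: 'k ralg))" by (simp add: L_comm_group)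
 show "cring (ga_ring (RA A :: 'k ralg))" by (rule RA_cring)
next
 fix g and r :: "'k poly3 set" assume "r \<in> ga_comp (RA A) g"
 then show "r \<in> carrier (ga_ring (RA A))" unfolding cs_ops RA_simps(4) by blast
qed (simp_all del: RA_simps(2) add: cs_ops const3_ops)

lemma hc_RA: "hc (RA A) (reg (RA A)) (cs A f) g = cs A (prt (%m. cl A m = g) (f :: 'k::field poly3))"
proof -
 interpret gmod "RA A :: 'k ralg" "reg (RA A)"
  using RA_graded RA_galg by (intro gmod.intro gmod_axioms.intro)
 have "cs A f \<in> carrier (reg (RA A))" by (simp del: RA_simps add: cs_ops)
 from hc_unique[OF this RA_dec] show ?thesis by simp
qed

definition gen :: "(3 => nat) => nat => 'k::field poly3 set" where
 "gen A k = cs A (var3 (if k = 0 then 1 else if k = 1 then 2 else 3))"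

lemma vec_tri: "m = vec (tri (lk m 1) (lk m 2) (lk m 3))"
proof (rule poly_mapping_eqI)
 fix s
 have "\<forall>s. tri (lk m 1) (lk m 2) (lk m 3) s = lk m s" unfolding all_3 by simp
 then show "lk m s = lk (vec (tri (lk m 1) (lk m 2) (lk m 3))) s" by simp
qed

lemma mon_gen: "mon (ga_ring (RA A)) (gen A) (a, b, c) = cs A (sg (vec (tri a b c)) (1::'k::field))"
proof -
 have "mon (ga_ring (RA A)) (gen A) (a, b, c) = cs A (var3 1 ^ a * (var3 2 ^ b * (var3 3 ^ c :: 'k poly3)))"
  by (simp del: RA_simps add: mon_def gen_def cs_ops)
 also have "var3 1 ^ a * (var3 2 ^ b * var3 3 ^ c) = sg (vec (tri a b c)) (1::'k)"
  by (simp add: var3_pow mult_single vec_def sum_3 add.assoc)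
 finally show ?thesis .
qed

text \<open>The vanishing of \<open>F\<close> trades a factor \<open>X\<^sub>i\<close> to the power
  \<open>A i\<close> for minus the sum of the other two powers. Every rewriting of monomials below
  is such a trade.\<close>

lemma cs_reduce:
 "cs A (sg (m + sg i (A i)) 1) = cs A (- (\<Sum>j\<in>UNIV - {i}. sg (m + sg j (A j)) (1::'k::field)))"
proof -
 have "FA A = sg (sg i (A i)) 1 + (\<Sum>j\<in>UNIV - {i}. sg (sg j (A j)) (1::'k))"
  unfolding FA_def by (rule sum.remove) auto
 then have "sg m 1 * FA A = sg (m + sg i (A i)) 1 + (\<Sum>j\<in>UNIV - {i}. sg (m + sg j (A j)) (1::'k))"
  by (simp add: distrib_left mult_single sum_distrib_left)
 then have "sg (m + sg i (A i)) 1 - - (\<Sum>j\<in>UNIV - {i}. sg (m + sg j (A j)) 1) = FA A * sg m (1::'k)" by (simp add: mult.commute)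
 then show ?thesis unfolding cs_eq by (rule dvdI)
qed

text \<open>A polynomial is coded by a bound for its support in an enumeration of the exponents,
  followed by the list of its coefficients up to that bound.\<close>

lemma poly3_card:
 assumes inf: "infinite (UNIV :: 'k::field set)"
 shows "\<exists>f :: 'k poly3 => 'k. inj f"
proof -
 obtain p :: "'k \<times> 'k => 'k" where p: "inj p" using infinite_pair_inj[OF inf] by blast
 obtain \<iota> :: "nat => 'k" where \<iota>: "inj \<iota>" using infinite_countable_subset[OF inf] by blast
 define e :: "nat => 3 \<Rightarrow>\<^sub>0 nat" where "e = (%n. case prod_decode n of (a, b) => case prod_decode b of (b, c) => vec (tri a b c))"
 have e: "\<exists>n. e n = m" for m
 proof
  have "m = vec (tri (lk m 1) (lk m 2) (lk m 3))" by (rule vec_tri)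
  then show "e (prod_encode (lk m 1, prod_encode (lk m 2, lk m 3))) = m" by (simp add: e_def)
 qed
 define enc :: "'k list => 'k" where "enc xs = foldr (%x y. p (x, y)) xs 0" for xs
 have enc: "xs = ys" if "length xs = length ys" "enc xs = enc ys" for xs ys
  using that by (induction xs ys rule: list_induct2) (auto simp: enc_def dest: injD[OF p])
 have bd: "\<exists>n. \<forall>m\<in>ks f. \<exists>i<n. e i = m" for f :: "'k poly3"
 proof -
  obtain j where j: "\<And>m. e (j m) = m" using e by metis
  have "\<forall>m\<in>ks f. \<exists>i<Suc (Max (j ` ks f)). e i = m" using j by (metis finite_keys finite_imageI Max_ge imageI le_imp_less_Suc)
  then show ?thesis by blast
 qed
 then obtain n where n: "\<And>f :: 'k poly3. \<forall>m\<in>ks f. \<exists>i<n f. e i = m" by metis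
 \<comment> \<open>The bound \<open>n f\<close> is part of the code because \<open>enc\<close>
   separates only lists of equal length.\<close>
 define co where "co f = p (\<iota> (n f), enc (map (%i. lk f (e i)) [0..<n f]))" for f :: "'k poly3"
 have "inj co"
 proof (rule injI)
  fix f g assume eq: "co f = co g"
  then have nn: "n f = n g" using injD[OF p] injD[OF \<iota>] unfolding co_def by blast
  have "enc (map (%i. lk f (e i)) [0..<n f]) = enc (map (%i. lk g (e i)) [0..<n f])"
   using eq injD[OF p] nn unfolding co_def by (metis prod.inject)
  then have "map (%i. lk f (e i)) [0..<n f] = map (%i. lk g (e i)) [0..<n f]" by (intro enc) auto
  then have same: "lk f (e i) = lk g (e i)" if "i < n f" for i using that by (simp add: map_eq_conv)
  show "f = g"
  proof (rule poly_mapping_eqI)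
   fix m
   show "lk f m = lk g m"
   proof (cases "\<exists>i<n f. e i = m")
    case False
    then have "m \<notin> ks f" "m \<notin> ks g" using n[of f] n[of g] nn by auto
    then show ?thesis by (simp add: in_keys_iff)
   qed (use same in auto)
  qed
 qed
 then show ?thesis by blast
qed

lemma RA_card:
 assumes inf: "infinite (UNIV :: 'k::field set)"
 shows "\<exists>f :: 'k poly3 set => 'k. inj_on f (carrier (ga_ring (RA A)))"
proof -
 obtain f :: "'k poly3 => 'k" where f: "inj f" using poly3_card[OF inf] by blast
 have s: "x = cs A (SOME f. x = cs A f)" if "x \<in> range (cs A)" for x :: "'k poly3 set"
  using that by (intro someI_ex[of "%f. x = cs A f"]) blast
 have "inj_on (%x. f (SOME f. x = cs A f)) (range (cs A))"
 proof (rule inj_onI)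
  fix x y :: "'k poly3 set" assume "x \<in> range (cs A)" "y \<in> range (cs A)" "f (SOME f. x = cs A f) = f (SOME f. y = cs A f)"
  then show "x = y" using s[of x] s[of y] injD[OF f] by metis
 qed
 then show ?thesis unfolding cs_ops by blast
qed

section \<open>The subalgebra \<open>RW A w\<close> inside \<open>RA A\<close>\<close>

context wdata
begin

definition H :: "(3 \<Rightarrow>\<^sub>0 int) set set" where
 "H = range (%d::int. w [^][L_group A] d)"

lemma cl_in_H: "cl A m \<in> H \<longleftrightarrow> (\<exists>n. \<forall>s. int (lk m s) = comb n s)"
 unfolding H_def cl_def class_in_H by simp

lemma cl_H_nat: "cl A m \<in> H ==> \<exists>d::nat. cl A m = w [^][L_group A] d"
proof -
 assume "cl A m \<in> H"
 then obtain d :: int where d: "cl A m = w [^][L_group A] d" unfolding H_def by blast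
 have "0 \<le> d"
 proof (rule class_nat_pow)
  show "0 \<le> lk (Poly_Mapping.map int m) s" for s by simp
  show "L_class A (Poly_Mapping.map int m) = w [^][L_group A] d" using d by (simp only: cl_def)
 qed
 then show ?thesis using d by (intro exI[of _ "nat d"]) (simp add: int_pow_int[symmetric])
qed

lemma nat_pow_H: "w [^][L_group A] (d::nat) \<in> H"
 unfolding H_def by (rule range_eqI[where x = "int d"]) (simp add: int_pow_int)

lemma H_subgroup: "subgroup H (L_group A)"
proof -
 interpret L: comm_group "L_group A" by (rule L_comm_group)
 show ?thesis
 proof (rule L.subgroupI)
  show "H <= carrier (L_group A)" "H \<noteq> {}" using w_closed by (auto simp: H_def)
 next
  fix x assume "x \<in> H"
  then obtain d :: int where "x = w [^][L_group A] d" unfolding H_def by blast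
  then have "inv[L_group A] x = w [^][L_group A] (- d)" using L.int_pow_neg[OF w_closed] by simp
  then show "inv[L_group A] x \<in> H" unfolding H_def by blast
 next
  fix x y assume "x \<in> H" "y \<in> H"
  then obtain d d' :: int where "x = w [^][L_group A] d" "y = w [^][L_group A] d'" unfolding H_def by blast
  then have "x \<otimes>[L_group A] y = w [^][L_group A] (d + d')" using L.int_pow_mult[OF w_closed] by simp
  then show "x \<otimes>[L_group A] y \<in> H" unfolding H_def by blast
 qed
qed

lemma RW_simps [simp]:
 "ga_grp (RW A w) = (L_group A)\<lparr>carrier := H\<rparr>" "ga_emb (RW A w) = ga_emb (RA A)"
 by (simp_all add: RW_def H_def)

text \<open>A monomial with degree in the lattice has degree \<open>d\<close> times \<open>w\<close>
  with a natural \<open>d\<close>, so grouping monomials by \<open>d\<close> gives sums of the shape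
  used in \<open>RW\<close>.\<close>

lemma carrier_RW: "carrier (ga_ring (RW A w)) = cs A ` {f :: 'k::field poly3. \<forall>m\<in>ks f. cl A m \<in> H}"
proof -
 interpret Q: cring "ga_ring (RA A :: 'k ralg)" by (rule RA_cring)
 have "x \<in> cs A ` {f :: 'k poly3. \<forall>m\<in>ks f. cl A m \<in> H}"
  if "finite D" "\<forall>d::nat\<in>D. c d \<in> ga_comp (RA A) (w [^][L_group A] d)" "x = finsum (ga_ring (RA A)) c D" for x c D
 proof -
  have "\<forall>d\<in>D. \<exists>f :: 'k poly3. c d = cs A f \<and> (\<forall>m\<in>ks f. cl A m = w [^][L_group A] d)"
  proof
   fix d assume "d \<in> D"
   then have "c d \<in> cs A ` {f. \<forall>m\<in>ks f. cl A m = w [^][L_group A] d}" using that(2) unfolding RA_simps(4) by (rule bspec[rotated])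
   then show "\<exists>f :: 'k poly3. c d = cs A f \<and> (\<forall>m\<in>ks f. cl A m = w [^][L_group A] d)" by (rule imageE) blast
  qed
  from bchoice[OF this] obtain f :: "nat => 'k poly3"
   where f: "\<forall>d\<in>D. c d = cs A (f d) \<and> (\<forall>m\<in>ks (f d). cl A m = w [^][L_group A] d)" by (elim exE)
  have "finsum (ga_ring (RA A)) c D = finsum (ga_ring (RA A)) (%d. cs A (f d)) D"
   by (rule Q.finsum_cong') (use f in \<open>simp_all del: RA_simps add: cs_ops\<close>)
  then have "x = cs A (\<Sum>d\<in>D. f d)" unfolding that(3) cs_sum[OF that(1)] .
  moreover have "\<forall>m\<in>ks (\<Sum>d\<in>D. f d). cl A m \<in> H"
  proof
   fix m assume "m \<in> ks (\<Sum>d\<in>D. f d)"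
   then obtain d where "d \<in> D" "m \<in> ks (f d)" using keys_sum[of f D] by blast
   then have "cl A m = w [^][L_group A] d" using f by simp
   then show "cl A m \<in> H" using nat_pow_H[of d] by simp
  qed
  ultimately show ?thesis by blast
 qed
 moreover have "\<exists>c D. cs A f = finsum (ga_ring (RA A)) c D \<and> finite D \<and> (\<forall>d::nat\<in>D. c d \<in> ga_comp (RA A) (w [^][L_group A] d))"
  if f: "\<forall>m\<in>ks f. cl A m \<in> H" for f :: "'k poly3"
 proof -
  have "\<forall>m\<in>ks f. \<exists>d::nat. cl A m = w [^][L_group A] d" using f cl_H_nat by blast
  from bchoice[OF this] obtain \<kappa> :: "(3 \<Rightarrow>\<^sub>0 nat) => nat" where \<kappa>: "\<forall>m\<in>ks f. cl A m = w [^][L_group A] \<kappa> m" by (elim exE)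
  have "f = (\<Sum>d\<in>\<kappa> ` ks f. prt (%m. \<kappa> m = d) f)" by (rule prt_sum_classes) auto
  then have "cs A f = finsum (ga_ring (RA A)) (%d. cs A (prt (%m. \<kappa> m = d) f)) (\<kappa> ` ks f)"
   using cs_sum[of "\<kappa> ` ks f" A "%d. prt (%m. \<kappa> m = d) f"] by simp
  moreover have "cs A (prt (%m. \<kappa> m = d) f) \<in> ga_comp (RA A) (w [^][L_group A] d)" for d
  proof -
   have "\<forall>m\<in>ks (prt (%m. \<kappa> m = d) f). cl A m = w [^][L_group A] d" using \<kappa> by (simp add: keys_prt)
   then show ?thesis unfolding RA_simps(4) by (intro imageI) simp
  qed
  ultimately show ?thesis by (intro exI[of _ "%d. cs A (prt (%m. \<kappa> m = d) f)"] exI[of _ "\<kappa> ` ks f"]) simp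
 qed
 moreover have "carrier (ga_ring (RW A w :: 'k ralg)) = {finsum (ga_ring (RA A)) c D |c D. finite D \<and>
   (\<forall>d::nat\<in>D. c d \<in> ga_comp (RA A) (w [^][L_group A] d))}" by (simp add: RW_def)
 ultimately show ?thesis by (auto simp del: RA_simps)
qed

lemma hpart_RA: "hpart (RA A) H (reg (RA A)) = cs A ` {f :: 'k::field poly3. \<forall>m\<in>ks f. cl A m \<in> H}"
proof (intro equalityI subsetI)
 fix x :: "'k poly3 set" assume x: "x \<in> hpart (RA A) H (reg (RA A))"
 then obtain f where f: "x = cs A f" unfolding hpart_def reg_simps cs_ops by blast
 have "FA A dvd prt (%m. cl A m = g) f" if "g \<notin> H" for g
 proof -
  have "hc (RA A) (reg (RA A)) (cs A f) g = \<zero>[ga_ring (RA A :: 'k ralg)]"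
   using x that by (simp del: RA_simps add: hpart_def f)
  then show ?thesis unfolding hc_RA cs_ops cs_eq by simp
 qed
 then have "FA A dvd (\<Sum>g\<in>cl A ` ks f - H. prt (%m. cl A m = g) f)" by (intro dvd_sum) auto
 moreover have "f - prt (%m. cl A m \<in> H) f = (\<Sum>g\<in>cl A ` ks f - H. prt (%m. cl A m = g) f)"
 proof (rule poly_mapping_eqI)
  fix m show "lk (f - prt (%m. cl A m \<in> H) f) m = lk (\<Sum>g\<in>cl A ` ks f - H. prt (%m. cl A m = g) f) m"
   by (cases "m \<in> ks f") (auto simp: lookup_minus lookup_sum when_def in_keys_iff)
 qed
 ultimately have "x = cs A (prt (%m. cl A m \<in> H) f)" unfolding f cs_eq by simp
 then show "x \<in> cs A ` {f. \<forall>m\<in>ks f. cl A m \<in> H}" using keys_prt[of "%m. cl A m \<in> H" f] by blast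
next
 fix x :: "'k poly3 set" assume "x \<in> cs A ` {f. \<forall>m\<in>ks f. cl A m \<in> H}"
 then obtain f where f: "x = cs A f" "\<forall>m\<in>ks f. cl A m \<in> H" by blast
 have "prt (%m. cl A m = g) f = 0" if "g \<notin> H" for g using f(2) that by (intro prt_none) blast
 then have "hc (RA A) (reg (RA A)) x g = \<zero>[ga_ring (RA A :: 'k ralg)]" if "g \<notin> H" for g
  using that unfolding f(1) hc_RA cs_ops by simp
 moreover have "x \<in> carrier (ga_ring (RA A :: 'k ralg))" unfolding cs_ops f(1) by simp
 ultimately show "x \<in> hpart (RA A) H (reg (RA A))" by (simp del: RA_simps add: hpart_def)
qed

text \<open>In lattice degrees that are not natural multiples of \<open>w\<close> there are no
  monomials, so both components are zero.\<close>

lemma RW_comp: "g \<in> H ==> ga_comp (RW A w) g = (ga_comp (RA A) g :: 'k::field poly3 set set)"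
proof (cases "\<exists>d::nat. g = w [^][L_group A] d")
 case False
 assume g: "g \<in> H"
 have "f = 0" if "\<forall>m\<in>ks f. cl A m = g" for f :: "'k poly3" using that cl_H_nat g False by (metis all_not_in_conv keys_eq_empty)
 then have "{f :: 'k poly3. \<forall>m\<in>ks f. cl A m = g} = {0}" by auto
 then have "ga_comp (RA A) g = {\<zero>[ga_ring (RA A :: 'k ralg)]}" unfolding RA_simps(4) cs_ops by simp
 then show ?thesis using False by (simp add: RW_def)
qed (simp add: RW_def)

lemma RW_grestr: "grestr (RA A :: 'k::field ralg) (RW A w) H"
proof (intro grestr.intro grestr_axioms.intro)
 show "galg (RA A :: 'k ralg)" by (rule RA_galg)
 show "graded_module (RA A) (reg (RA A :: 'k ralg))" by (rule RA_graded)
 show "ga_emb (RA A) c \<in> ga_comp (RA A) \<one>[ga_grp (RA A :: 'k ralg)]" for c :: 'k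
  by (auto simp: const3_def cl_zero split: if_splits)
 show "subgroup H (ga_grp (RA A :: 'k ralg))" by (simp add: H_subgroup)
 have "ga_ring (RW A w :: 'k ralg) = (ga_ring (RA A))\<lparr>carrier := carrier (ga_ring (RW A w))\<rparr>"
  by (simp add: RW_def)
 then show "ga_ring (RW A w :: 'k ralg) = (ga_ring (RA A))\<lparr>carrier := hpart (RA A) H (reg (RA A))\<rparr>"
  unfolding hpart_RA carrier_RW .
qed (simp_all add: RW_comp del: RA_simps(2-4))

text \<open>The remainders of division of exponents by \<open>N\<close>: a monomial whose exponents
  are all multiples of \<open>N\<close> belongs to the small ring.\<close>

definition Bs :: "'k::field poly3 set set" where
 "Bs = (%m. cs A (sg m 1)) ` {m. \<forall>s. lk m s < N}"

text \<open>Room for \<open>2 * N\<close> trades of a power of a variable, each using up at most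
  \<open>A 1 + A 2 + A 3\<close> factors, with \<open>N\<close> factors left over.\<close>

definition ex :: nat where "ex = N + 2 * N * (A 1 + A 2 + A 3)"

text \<open>By \<open>pair_monomial\<close>, \<open>J\<close> contains every monomial with exponents
  at least \<open>N\<close> in two variables. A high power of one variable is rewritten by trades
  until all resulting monomials are of this kind.\<close>

lemma gen_prim:
 fixes J :: "'k::field poly3 set set"
 assumes J: "ideal J (ga_ring (RA A))" and g: "g \<in> carrier (L_group A)"
  and Jg: "\<And>m. cl A m \<otimes>[L_group A] g \<in> H ==> cs A (sg m 1) \<in> J"
 shows "cs A (var3 i) [^][ga_ring (RA A)] ex \<in> J"
proof -
 interpret J: ideal J "ga_ring (RA A :: 'k ralg)" by (rule J)
 have mult: "cs A (f * f') \<in> J" if "cs A f' \<in> J" for f f'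
 proof -
  have "cs A f \<otimes>[ga_ring (RA A)] cs A f' \<in> J" by (rule J.I_l_closed[OF that]) (simp only: cs_ops rangeI)
  then show ?thesis by (simp only: cs_ops)
 qed
 have add: "cs A (f + f') \<in> J" if "cs A f \<in> J" "cs A f' \<in> J" for f f'
  using additive_subgroup.a_closed[OF J.is_additive_subgroup that] by (simp only: cs_ops)
 have z: "cs A 0 \<in> J" using additive_subgroup.zero_closed[OF J.is_additive_subgroup] by (simp only: cs_ops)
 have sum: "finite I ==> (\<And>i. i \<in> I ==> cs A (f i) \<in> J) ==> cs A (\<Sum>i\<in>I. f i) \<in> J" for f :: "3 => 'k poly3" and I
  by (induction I rule: finite_induct) (simp_all add: z add)
 obtain v where v: "g = L_class A v" using g unfolding carrier_L by blast
 have pairJ: "cs A (sg m 1) \<in> J" if ij: "i \<noteq> j" and N: "N \<le> lk m i" "N \<le> lk m j" for i j m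
 proof -
  obtain p q :: nat and n where pq: "p < N" "q < N"
   "\<forall>s. lk v s + (if s = i then int p else 0) + (if s = j then int q else 0) = comb n s"
   using pair_monomial[OF ij, of "lk v"] by blast
  let ?m = "sg i p + sg j q"
  have "cl A ?m \<otimes>[L_group A] g = L_class A (Poly_Mapping.map int ?m + v)" by (simp only: cl_def v L_class_mult)
  moreover have "\<forall>s. lk (Poly_Mapping.map int ?m + v) s = comb n s"
   unfolding pq(3)[rule_format, symmetric] by (auto simp: lookup_add lookup_single when_def)
  ultimately have "cl A ?m \<otimes>[L_group A] g \<in> H" using class_in_H[of "Poly_Mapping.map int ?m + v"] unfolding H_def by auto
  then have "cs A (sg ?m 1) \<in> J" by (rule Jg)
  moreover have "sg m 1 = sg (m - ?m) 1 * sg ?m (1::'k)"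
  proof -
   have "m = m - ?m + ?m"
    by (rule poly_mapping_eqI) (use pq(1,2) N ij in \<open>auto simp: lookup_add lookup_minus lookup_single when_def\<close>)
   then show ?thesis by (simp add: mult_single)
  qed
  ultimately show ?thesis using mult by simp
 qed
 \<comment> \<open>\<open>t\<close> bounds the trades still to be made. Each raises the sum of the
   two other exponents by at least one; once that sum is \<open>2 * N\<close>, one of them is at
   least \<open>N\<close>.\<close>
 have key: "cs A (sg m 1) \<in> J" if "N + A i * t \<le> lk m i" "2 * N \<le> (\<Sum>j\<in>UNIV - {i}. lk m j) + t" for m t
  using that
 proof (induction t arbitrary: m)
  case 0
  have "\<exists>j. j \<noteq> i \<and> N \<le> lk m j"
  proof (rule ccontr)
   assume "\<not> (\<exists>j. j \<noteq> i \<and> N \<le> lk m j)"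
   then have "(\<Sum>j\<in>UNIV - {i}. lk m j) \<le> of_nat (card (UNIV - {i})) * (N - 1)"
    by (intro sum_bounded_above) fastforce
   moreover have "card (UNIV - {i}) = 2" by (simp add: card_Diff_singleton)
   ultimately show False using 0(2) N(1) by simp
  qed
  then obtain j where "j \<noteq> i" "N \<le> lk m j" by blast
  then show ?case using 0(1) by (intro pairJ[of i j]) simp_all
 next
  case (Suc t)
  define m' where "m' = m - sg i (A i)"
  have m: "m = m' + sg i (A i)"
   by (rule poly_mapping_eqI) (use Suc.prems(1) in \<open>auto simp: m'_def lookup_add lookup_minus lookup_single when_def\<close>)
  have "cs A (sg (m' + sg j (A j)) 1) \<in> J" if "j \<noteq> i" for j
  proof (rule Suc.IH)
   show "N + A i * t \<le> lk (m' + sg j (A j)) i" using Suc.prems(1) that by (simp add: m lookup_add lookup_single when_def)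
   have "(\<Sum>s\<in>UNIV - {i}. lk (m' + sg j (A j)) s) = (\<Sum>s\<in>UNIV - {i}. lk m' s) + A j"
    using that by (simp add: lookup_add sum.distrib lookup_single when_def)
   moreover have "(\<Sum>s\<in>UNIV - {i}. lk m s) = (\<Sum>s\<in>UNIV - {i}. lk m' s)"
    by (rule sum.cong) (auto simp: m lookup_add lookup_single when_def)
   ultimately show "2 * N \<le> (\<Sum>s\<in>UNIV - {i}. lk (m' + sg j (A j)) s) + t" using Suc.prems(2) Apos[of j] by linarith
  qed
  then have "cs A (\<Sum>j\<in>UNIV - {i}. sg (m' + sg j (A j)) 1) \<in> J" by (intro sum) auto
  then have "cs A (- 1 * (\<Sum>j\<in>UNIV - {i}. sg (m' + sg j (A j)) 1)) \<in> J" by (rule mult)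
  then show ?case using cs_reduce[of A m' i, where ?'k = 'k] m by simp
 qed
 have "cs A (sg (sg i ex) 1) \<in> J"
 proof (rule key[of "2 * N"])
  have "A i \<le> A 1 + A 2 + A 3" using all_3[of "%i. A i \<le> A 1 + A 2 + A 3"] by simp
  then show "N + A i * (2 * N) \<le> lk (sg i ex) i" by (simp add: ex_def mult.commute)
 qed simp
 then show ?thesis by (simp only: cs_ops var3_pow)
qed

text \<open>The variables serve as \<open>\<xi>\<close> and the small monomials as
  \<open>Bs\<close>; the cardinality condition holds because a field of characteristic zero is
  infinite.\<close>

lemma RW_veronese:
 "veronese (RA A :: 'k::{field, ring_char_0} ralg) (RW A w) H (gen A) Bs ex"
proof (intro veronese.intro veronese_axioms.intro RW_grestr)
 let ?S = "RA A :: 'k ralg"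
 interpret Q: cring "ga_ring ?S" by (rule RA_cring)
 show "gen A i \<in> carrier (ga_ring ?S)" for i by (simp del: RA_simps add: gen_def cs_ops)
 show "r \<in> kspan (reg ?S) (esc ?S (reg ?S)) (range (mon (ga_ring ?S) (gen A)))" if "r \<in> carrier (ga_ring ?S)" for r
 proof -
  obtain f where r: "r = cs A f" using \<open>r \<in> carrier (ga_ring ?S)\<close> unfolding cs_ops by blast
  show ?thesis unfolding r
  proof (induction f rule: pm_induct)
   case zero
   show ?case using kspan.kspan_zero[of "reg ?S" "esc ?S (reg ?S)"] by (simp del: RA_simps add: cs_ops)
  next
   case (add m c f)
   have "m = vec (tri (lk m 1) (lk m 2) (lk m 3))" by (rule vec_tri)
   then have "cs A (sg m 1) = mon (ga_ring ?S) (gen A) (lk m 1, lk m 2, lk m 3)" unfolding mon_gen by simp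
   then have "cs A (sg m 1) \<in> range (mon (ga_ring ?S) (gen A))" by simp
   from kspan.kspan_step[OF this add, of c]
   have "esc ?S (reg ?S) c (cs A (sg m 1)) \<oplus>[reg ?S] cs A f \<in> kspan (reg ?S) (esc ?S (reg ?S)) (range (mon (ga_ring ?S) (gen A)))" .
   moreover have "esc ?S (reg ?S) c (cs A (sg m 1)) \<oplus>[reg ?S] cs A f = cs A (sg m c + f)"
    by (simp only: esc_def reg_simps RA_simps(3) cs_ops const3_def mult_single add_0 mult_1_right)
   ultimately show ?case by simp
  qed
 qed
 have "{m :: 3 \<Rightarrow>\<^sub>0 nat. \<forall>s. lk m s < N} <= (%(a, b, c). vec (tri a b c)) ` ({..<N} \<times> {..<N} \<times> {..<N})"
 proof
  fix m :: "3 \<Rightarrow>\<^sub>0 nat" assume m: "m \<in> {m. \<forall>s. lk m s < N}"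
  have "m = vec (tri (lk m 1) (lk m 2) (lk m 3))" by (rule vec_tri)
  then show "m \<in> (%(a, b, c). vec (tri a b c)) ` ({..<N} \<times> {..<N} \<times> {..<N})"
   using m by (intro image_eqI[of _ _ "(lk m 1, lk m 2, lk m 3)"]) auto
 qed
 then show "finite (Bs :: 'k poly3 set set)" unfolding Bs_def by (intro finite_imageI) (erule finite_subset, simp)
 show "\<exists>g\<in>carrier (ga_grp ?S). b \<in> ga_comp ?S g" if b: "b \<in> Bs" for b
 proof -
  obtain m where "b = cs A (sg m 1)" using b unfolding Bs_def by blast
  then show ?thesis by (intro bexI[of _ "cl A m"]) auto
 qed
 show "carrier (ga_ring ?S) <= rspan (ga_ring (RW A w)) (reg ?S) Bs"
 proof
  fix r assume "r \<in> carrier (ga_ring ?S)"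
  then obtain f where r: "r = cs A f" unfolding cs_ops by blast
  show "r \<in> rspan (ga_ring (RW A w)) (reg ?S) Bs" unfolding r
  proof (induction f rule: pm_induct)
   case zero
   show ?case using rspan.rspan_zero[of "reg ?S" "ga_ring (RW A w)" Bs] by (simp del: RA_simps add: cs_ops)
  next
   case (add m c f)
   \<comment> \<open>Division of the exponents with remainder: \<open>m1\<close> is divisible by
     \<open>N\<close>, hence in the lattice, and \<open>m0\<close> is one of the finitely many
     generators.\<close>
   define m0 m1 where "m0 = vec (%s. lk m s mod N)" and "m1 = vec (%s. N * (lk m s div N))"
   have m: "m = m1 + m0" by (rule poly_mapping_eqI) (simp add: m0_def m1_def lookup_add)
   obtain n where "\<forall>s. int N * int (lk m s div N) = comb n s" using N(2)[of "%s. int (lk m s div N)"] by blast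
   then have "cl A m1 \<in> H" unfolding cl_in_H m1_def by auto
   then have 1: "cs A (sg m1 c) \<in> carrier (ga_ring (RW A w))" unfolding carrier_RW by (intro imageI) (auto split: if_splits)
   have 2: "cs A (sg m0 (1::'k)) \<in> Bs" unfolding Bs_def m0_def using N(1) by (intro image_eqI[OF refl]) simp
   have "cs A (sg m1 c) \<otimes>[ga_ring ?S] cs A (sg m0 1) \<oplus>[ga_ring ?S] cs A f \<in> rspan (ga_ring (RW A w)) (reg ?S) Bs"
    using rspan.rspan_step[OF 1 2 add] by (simp only: reg_simps)
   then show ?case by (simp only: cs_ops mult_single m mult_1_right)
  qed
 qed
 show "gen A i [^][ga_ring ?S] ex \<in>
   Idl\<^bsub>ga_ring ?S\<^esub> (\<Union>g'\<in>{g' \<in> carrier (ga_grp ?S). g' \<otimes>[ga_grp ?S] g \<in> H}. ga_comp ?S g')" (is "_ \<in> Idl\<^bsub>_\<^esub> ?G")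
  if g: "g \<in> carrier (ga_grp ?S)" for g i
 proof -
  have sub: "?G <= carrier (ga_ring ?S)" unfolding cs_ops by auto
  show ?thesis unfolding gen_def
  proof (rule gen_prim)
   show "ideal (Idl\<^bsub>ga_ring ?S\<^esub> ?G) (ga_ring ?S)" by (rule Q.genideal_ideal[OF sub])
   fix m assume "cl A m \<otimes>[L_group A] g \<in> H"
   then have "cs A (sg m 1) \<in> ?G" by (intro UN_I[of "cl A m"]) auto
   then show "cs A (sg m 1) \<in> Idl\<^bsub>ga_ring ?S\<^esub> ?G" using Q.genideal_self[OF sub] by blast
  qed (use g in simp)
 qed
 show "infinite (UNIV :: 'k set)" by (rule infinite_UNIV_char_0)
 then show "\<exists>f :: 'k poly3 set => 'k. inj_on f (carrier (ga_ring ?S))" by (rule RA_card)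
qed

end

section \<open>Presentation of \<open>R\<^sub>W\<close>\<close>

text \<open>The linear extension of a map of exponents. For an additive map it is a homomorphism of
  rings, namely a substitution of monomials for variables.\<close>

definition push :: "('a => 'b) => ('a \<Rightarrow>\<^sub>0 'c) => 'b \<Rightarrow>\<^sub>0 'c::comm_monoid_add" where
 "push \<phi> f = (\<Sum>m\<in>ks f. sg (\<phi> m) (lk f m))"

lemma push_add: "push \<phi> (f + g) = push \<phi> f + push \<phi> g"
 unfolding push_def by (rule setsum_keys_plus_distrib) (simp_all add: single_add)

lemma push_single: "push \<phi> (sg m c) = sg (\<phi> m) c"
 by (simp add: push_def)

lemma push_zero [simp]: "push \<phi> 0 = 0"
 by (simp add: push_def)

lemma push_uminus: "push \<phi> (- f) = - push \<phi> (f :: 'a \<Rightarrow>\<^sub>0 'c::ab_group_add)"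
 using push_add[of \<phi> "- f" f] by (simp add: eq_neg_iff_add_eq_0)

lemma push_sum: "push \<phi> (sum f I) = (\<Sum>i\<in>I. push \<phi> (f i))"
 by (induction I rule: infinite_finite_induct) (auto simp: push_add)

lemma push_mult:
 fixes f g :: "'a::monoid_add \<Rightarrow>\<^sub>0 'c::comm_semiring_0" and \<phi> :: "'a => 'b::monoid_add"
 assumes \<phi>: "\<And>m n. \<phi> (m + n) = \<phi> m + \<phi> n"
 shows "push \<phi> (f * g) = push \<phi> f * push \<phi> g"
proof (induction f rule: pm_induct)
 case (add m c f)
 have "push \<phi> (sg m c * g) = sg (\<phi> m) c * push \<phi> g"
  by (induction g rule: pm_induct) (simp_all add: distrib_left push_add mult_single push_single \<phi>)
 then show ?case using add by (simp add: distrib_right push_add push_single)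
qed simp

lemma lookup_push:
 assumes "inj \<phi>" shows "lk (push \<phi> f) (\<phi> m) = lk f m"
 by (induction f rule: pm_induct) (auto simp: push_add push_single lookup_add lookup_single when_def inj_eq[OF assms])

lemma keys_push: "ks (push \<phi> f) <= \<phi> ` ks f"
 unfolding push_def using keys_sum[of "%m. sg (\<phi> m) (lk f m)" "ks f"] by (fastforce split: if_splits)

section \<open>Evaluation and partial derivatives\<close>

lemma eval3_add: "eval3 (f + g) p = eval3 f p + eval3 g p"
 unfolding eval3_def by (rule setsum_keys_plus_distrib) (simp_all add: distrib_right)

lemma eval3_single: "eval3 (sg m c) p = c * (\<Prod>i\<in>UNIV. p i ^ lk m i)"
 by (simp add: eval3_def)

lemma eval3_sum: "eval3 (sum f I) p = (\<Sum>i\<in>I. eval3 (f i) p)"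
 by (induction I rule: infinite_finite_induct) (simp_all add: eval3_add, simp_all add: eval3_def)

lemma pderiv3_add: "pderiv3 i (f + g) = pderiv3 i f + pderiv3 i g"
 unfolding pderiv3_def by (rule setsum_keys_plus_distrib) (simp_all add: distrib_left single_add)

lemma pderiv3_single: "pderiv3 i (sg m c) = sg (m - sg i 1) (of_nat (lk m i) * c)"
 by (simp add: pderiv3_def)

lemma pderiv3_sum: "pderiv3 i (sum f I) = (\<Sum>j\<in>I. pderiv3 i (f j))"
 by (induction I rule: infinite_finite_induct) (auto simp: pderiv3_add, auto simp: pderiv3_def)

context wdata
begin

text \<open>The exponent obtained by substituting for the variable \<open>j\<close> the monomial
  with exponent \<open>lam j\<close>.\<close>

definition mu :: "(3 \<Rightarrow>\<^sub>0 nat) => 3 \<Rightarrow>\<^sub>0 nat" where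
 "mu m = vec (%s. \<Sum>j\<in>UNIV. lk m j * lam j s)"

lemma lookup_mu: "int (lk (mu m) s) = comb (%j. int (lk m j)) s"
 by (simp add: mu_def comb_def)

lemma mu_add: "mu (m + n) = mu m + mu n"
 by (rule poly_mapping_eqI) (simp add: mu_def lookup_add sum.distrib distrib_right)

lemma inj_mu: "inj mu"
proof (rule injI)
 fix m n assume e: "mu m = mu n"
 have "(%j. int (lk m j)) = (%j. int (lk n j))"
  by (rule comb_inj) (simp add: lookup_mu[symmetric] e)
 then show "m = n" by (intro poly_mapping_eqI) (metis of_nat_eq_iff)
qed

definition fW :: "'k::field poly3" where
 "fW = (\<Sum>i\<in>UNIV. sg (vec (E i)) 1)"

lemma mu_E: "mu (vec (E i)) = vec Mexp + sg i (A i)"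
 by (rule poly_mapping_eqI) (simp add: mu_def rel_nat lookup_add lookup_single when_def)

lemma push_fW: "push mu fW = sg (vec Mexp) 1 * FA A"
 by (simp add: fW_def FA_def push_sum push_single mu_E sum_distrib_left mult_single)

lemma mu_H: "cl A (mu m) \<in> H"
 unfolding cl_in_H lookup_mu by blast

definition psi :: "'k::field poly3 => 'k poly3 set" where
 "psi P = cs A (push mu P)"

lemma psi_closed: "psi P \<in> carrier (ga_ring (RW A w))"
 unfolding psi_def carrier_RW using keys_push[of mu P] mu_H by (intro imageI) blast

lemma RW_ops: "monoid.mult (ga_ring (RW A w)) = monoid.mult (ga_ring (RA A))" "ring.add (ga_ring (RW A w)) = ring.add (ga_ring (RA A))"
 "one (ga_ring (RW A w)) = one (ga_ring (RA A))" "ring.zero (ga_ring (RW A w)) = ring.zero (ga_ring (RA A))"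
 by (simp_all add: RW_def)

lemma psi_hom: "ring_hom_ring poly3_ring (ga_ring (RW A w)) (psi :: 'k::field poly3 => _)"
proof (rule ring_hom_ringI)
 show "ring (ga_ring (RW A w :: 'k ralg))"
  using galg.rng[OF grestr.galg'[OF RW_grestr]] by (rule cring.axioms)
 have "mu 0 = 0" by (rule poly_mapping_eqI) (simp add: mu_def)
 then have "push mu (1 :: 'k poly3) = 1" using push_single[of mu 0 "1::'k"] by simp
 then show "psi \<one>[poly3_ring] = \<one>[ga_ring (RW A w :: 'k ralg)]" by (simp only: psi_def RW_ops cs_ops poly3_ops)
 show "psi P \<in> carrier (ga_ring (RW A w))" for P :: "'k poly3" by (rule psi_closed)
qed (simp_all only: psi_def RW_ops cs_ops poly3_ops push_add push_mult[of mu, OF mu_add] P3.ring_axioms)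

text \<open>In lattice coordinates, a trade of the variable \<open>i\<close> for \<open>i'\<close>
  adds row \<open>i'\<close> of \<open>E\<close> and subtracts row \<open>i\<close>. As long as a
  coordinate is negative, \<open>red\<close> provides a trade that is possible and lowers
  \<open>negs\<close> in all resulting monomials.\<close>

lemma psi_monomial:
 "(\<forall>s. int (lk m s) = comb n s) ==> \<exists>P :: 'k::field poly3. cs A (sg m 1) = psi P"
proof (induction "negs n" arbitrary: n m rule: less_induct)
 case less
 show ?case
 proof (cases "\<exists>j. n j < 0")
  case False
  have "mu (vec (%j. nat (n j))) = m"
  proof (rule poly_mapping_eqI)
   fix s
   have "int (lk (mu (vec (%j. nat (n j)))) s) = comb n s" unfolding lookup_mu using False by (simp add: not_less)
   also have "\<dots> = int (lk m s)" using less.prems by simp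
   finally show "lk (mu (vec (%j. nat (n j)))) s = lk m s" by simp
  qed
  then show ?thesis by (intro exI[of _ "sg (vec (%j. nat (n j))) 1"]) (simp add: psi_def push_single)
 next
  case True
  have "\<forall>s. 0 \<le> (\<Sum>j\<in>UNIV. n j * int (lam j s))" using less.prems unfolding comb_def[symmetric] by (metis of_nat_0_le_iff)
  from red[OF this True] obtain i where i: "int (A i) \<le> comb n i"
   "\<forall>i'. i' \<noteq> i --> negs (%j. n j - int (E i j) + int (E i' j)) < negs n" unfolding comb_def by blast
  define m' where "m' = m - sg i (A i)"
  have Ai: "A i \<le> lk m i" using i(1) less.prems by (metis of_nat_le_iff)
  have m: "m = m' + sg i (A i)"
   by (rule poly_mapping_eqI) (use Ai in \<open>auto simp: m'_def lookup_add lookup_minus lookup_single when_def\<close>)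
  \<comment> \<open>The two monomials produced by the trade, with their new coordinates.\<close>
  have "\<exists>P :: 'k poly3. cs A (sg (m' + sg j (A j)) 1) = psi P" if j: "j \<noteq> i" for j
  proof (rule less.hyps)
   show "negs (%t. n t - int (E i t) + int (E j t)) < negs n" using i(2) j by blast
   show "\<forall>s. int (lk (m' + sg j (A j)) s) = comb (%t. n t - int (E i t) + int (E j t)) s"
   proof
    fix s
    have "comb (%t. n t - int (E i t) + int (E j t)) s = comb n s - comb (%t. int (E i t)) s + comb (%t. int (E j t)) s"
     unfolding comb_add[symmetric] comb_diff[symmetric] ..
    then show "int (lk (m' + sg j (A j)) s) = comb (%t. n t - int (E i t) + int (E j t)) s"
     unfolding less.prems[rule_format, symmetric] rel_comb by (simp add: m lookup_add lookup_single when_def)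
   qed
  qed
  then obtain P :: "3 => 'k poly3" where P: "\<And>j. j \<noteq> i ==> cs A (sg (m' + sg j (A j)) 1) = psi (P j)" by metis
  have "cs A (sg m 1) = cs A (- (\<Sum>j\<in>UNIV - {i}. sg (m' + sg j (A j)) (1::'k)))" unfolding m by (rule cs_reduce)
  also have "\<dots> = cs A (- (\<Sum>j\<in>UNIV - {i}. push mu (P j)))"
  proof -
   have "FA A dvd (sg (m' + sg j (A j)) 1 - push mu (P j))" if "j \<in> UNIV - {i}" for j
    using P[of j] that unfolding psi_def cs_eq by simp
   then have "FA A dvd (\<Sum>j\<in>UNIV - {i}. sg (m' + sg j (A j)) 1 - push mu (P j))" by (intro dvd_sum) auto
   then have "FA A dvd - (\<Sum>j\<in>UNIV - {i}. sg (m' + sg j (A j)) 1 - push mu (P j))" by (rule dvd_minus_iff[THEN iffD2])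
   then show ?thesis unfolding cs_eq by (simp add: sum_subtractf)
  qed
  also have "- (\<Sum>j\<in>UNIV - {i}. push mu (P j)) = push mu (- (\<Sum>j\<in>UNIV - {i}. P j))"
   by (simp only: push_uminus push_sum)
  finally show ?thesis unfolding psi_def by blast
 qed
qed

lemma psi_surj: "psi ` UNIV = carrier (ga_ring (RW A w :: 'k::field ralg))"
proof
 show "psi ` UNIV <= carrier (ga_ring (RW A w :: 'k ralg))" using psi_closed by blast
 show "carrier (ga_ring (RW A w :: 'k ralg)) <= psi ` UNIV"
 proof
  fix x assume "x \<in> carrier (ga_ring (RW A w :: 'k ralg))"
  then obtain f where f: "x = cs A f" "\<forall>m\<in>ks f. cl A m \<in> H" unfolding carrier_RW by blast
  have "\<forall>m\<in>ks f. \<exists>P. cs A (sg m (1::'k)) = psi P" using f(2) psi_monomial unfolding cl_in_H by blast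
  from bchoice[OF this] obtain P where P: "\<forall>m\<in>ks f. cs A (sg m (1::'k)) = psi (P m)" by (elim exE)
  have "mu 0 = 0" by (rule poly_mapping_eqI) (simp add: mu_def)
  then have p: "push mu (\<Sum>m\<in>ks f. sg 0 (lk f m) * P m) = (\<Sum>m\<in>ks f. sg 0 (lk f m) * push mu (P m))"
   by (simp add: push_sum push_mult[of mu, OF mu_add] push_single)
  have "f = (\<Sum>m\<in>ks f. sg 0 (lk f m) * sg m 1)"
   using sum_single_mult[of 0 1 f] by (simp add: mult_single)
  then have "f - push mu (\<Sum>m\<in>ks f. sg 0 (lk f m) * P m) = (\<Sum>m\<in>ks f. sg 0 (lk f m) * (sg m 1 - push mu (P m)))"
   unfolding p by (simp add: right_diff_distrib sum_subtractf)
  moreover have "FA A dvd (\<Sum>m\<in>ks f. sg 0 (lk f m) * (sg m 1 - push mu (P m)))"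
   using P unfolding psi_def cs_eq by (intro dvd_sum dvd_mult) simp
  ultimately have "x = psi (\<Sum>m\<in>ks f. sg 0 (lk f m) * P m)" unfolding f(1) psi_def cs_eq by simp
  then show "x \<in> psi ` UNIV" by blast
 qed
qed

text \<open>The coordinate \<open>j\<close> of lattice points is minimised over the support of \<open>G\<close>: since some monomial of
 \<open>f\<^sub>W\<close> does not involve the variable \<open>j\<close>, the minimum is attained in the product as well.\<close>

lemma dvd_push:
 assumes "FA A dvd push mu (P :: 'k::field poly3)"
 shows "fW dvd P"
proof -
 obtain G' where G': "push mu P = FA A * G'" using assms by (elim dvdE)
 \<comment> \<open>Only the terms of the cofactor whose product with \<open>F\<close> has degree in
   the lattice contribute; the others can be discarded, as \<open>F\<close> is homogeneous.\<close>
 define G where "G = prt (%m. cl A (sg 1 (A 1) + m) \<in> H) G'"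
 have kP: "\<exists>p. m = mu p" if "m \<in> ks (push mu P)" for m using that keys_push[of mu P] by blast
 have "prt (%m. cl A m \<in> H) (push mu P) = FA A * G" unfolding G' G_def
 proof (rule prt_FA_mult)
  fix i m show "(cl A (sg i (A i) + m) \<in> H) = (cl A (sg 1 (A 1) + m) \<in> H)" by (simp only: cl_add cl_c[of A i 1])
 qed
 moreover have "prt (%m. cl A m \<in> H) (push mu P) = push mu P" using kP mu_H by (intro prt_id) fastforce
 ultimately have FG: "push mu P = FA A * G" by simp
 \<comment> \<open>The exponents of the cofactor form a translate of the lattice by
   \<open>Mexp\<close>. With coordinates taken relative to \<open>Mexp\<close>, multiplication by
   the \<open>i\<close>-th term of \<open>F\<close> adds row \<open>i\<close> of
   \<open>E\<close>.\<close>
 have "\<exists>n. \<forall>s. int (lk m s) = int (Mexp s) + comb n s" if m: "m \<in> ks G" for m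
 proof -
  have "cl A (sg 1 (A 1) + m) \<in> H" using m by (simp add: G_def keys_prt)
  then obtain n where n: "\<forall>s. int (lk (sg 1 (A 1) + m) s) = comb n s" unfolding cl_in_H by blast
  have "int (lk m s) = int (Mexp s) + comb (%j. n j - int (E 1 j)) s" for s
   unfolding comb_diff[symmetric] n[rule_format, symmetric] rel_comb by (simp add: lookup_add lookup_single when_def)
  then show ?thesis by blast
 qed
 then have "\<forall>m\<in>ks G. \<exists>n. \<forall>s. int (lk m s) = int (Mexp s) + comb n s" by blast
 from bchoice[OF this] obtain \<nu> where \<nu>: "\<forall>m\<in>ks G. \<forall>s. int (lk m s) = int (Mexp s) + comb (\<nu> m) s" by (elim exE)
 have pos: "0 \<le> \<nu> m j" if m: "m \<in> ks G" for m j
 proof (rule ccontr)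
  assume "\<not> 0 \<le> \<nu> m j"
  define t where "t = Min ((%m. \<nu> m j) ` ks G)"
  have "t \<le> \<nu> m j" unfolding t_def using m by (intro Min_le) auto
  then have t: "t < 0" using \<open>\<not> 0 \<le> \<nu> m j\<close> by simp
  have tm: "t \<le> \<nu> m j" if "m \<in> ks G" for m unfolding t_def using that by (intro Min_le) auto
  have "t \<in> (%m. \<nu> m j) ` ks G" unfolding t_def using m by (intro Min_in) auto
  then obtain m0 where m0: "m0 \<in> ks G" "\<nu> m0 j = t" by blast
  define \<kappa> where "\<kappa> m = (SOME n. \<forall>s. int (lk m s) = comb n s)" for m
  have \<kappa>: "\<kappa> m = n" if "\<forall>s. int (lk m s) = comb n s" for m n
  proof (rule comb_inj)
   have "\<forall>s. int (lk m s) = comb (\<kappa> m) s" unfolding \<kappa>_def by (rule someI[where x = n]) (rule that)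
   then show "comb (\<kappa> m) s = comb n s" for s using that by simp
  qed
  define G0 where "G0 = prt (%m. \<nu> m j = t) G"
  \<comment> \<open>Exponents in the image of \<open>mu\<close> have nonnegative coordinates, so
    nothing survives at the negative value \<open>t\<close>.\<close>
  have "prt (%m. \<kappa> m j = t) (push mu P) = 0"
  proof (rule prt_none)
   fix m assume "m \<in> ks (push mu P)"
   then obtain p where p: "m = mu p" using kP by blast
   have "\<kappa> m = (%j. int (lk p j))" by (rule \<kappa>) (simp add: p lookup_mu)
   then show "\<kappa> m j \<noteq> t" using t by simp
  qed
  moreover have "prt (%m. \<kappa> m j = t) (push mu P) = (\<Sum>i\<in>UNIV. if E i j = 0 then sg (sg i (A i)) 1 else 0) * G0"
  proof -
   have "prt (%m. \<kappa> (sg i (A i) + m) j = t) G = (if E i j = 0 then G0 else 0)" for i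
   proof -
    have k: "\<kappa> (sg i (A i) + m) j = \<nu> m j + int (E i j)" if m: "m \<in> ks G" for m
    proof -
     have "\<kappa> (sg i (A i) + m) = (%j. \<nu> m j + int (E i j))"
     proof (rule \<kappa>, rule allI)
      fix s show "int (lk (sg i (A i) + m) s) = comb (%j. \<nu> m j + int (E i j)) s"
       using \<nu>[rule_format, OF m, of s] unfolding comb_add[symmetric] rel_comb
       by (simp add: lookup_add lookup_single when_def)
     qed
     then show ?thesis by simp
    qed
    show ?thesis
    proof (rule poly_mapping_eqI)
     fix m show "lk (prt (%m. \<kappa> (sg i (A i) + m) j = t) G) m = lk (if E i j = 0 then G0 else 0) m"
      using k[of m] tm[of m] by (cases "m \<in> ks G") (auto simp: G0_def when_def in_keys_iff)
    qed
   qed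
   then show ?thesis unfolding FG FA_def sum_distrib_right prt_sum prt_single_mult
    by (intro sum.cong) auto
  qed
  moreover have "G0 \<noteq> 0"
  proof
   assume "G0 = 0"
   then have "lk G0 m0 = 0" by simp
   then show False using m0 by (simp add: G0_def in_keys_iff)
  qed
  \<comment> \<open>By \<open>E_zero\<close> some term of \<open>F\<close> leaves coordinate
    \<open>j\<close> unchanged. The part of the product at value \<open>t\<close> is then a product
    of two nonzero polynomials, a contradiction.\<close>
  moreover have "(\<Sum>i\<in>UNIV. if E i j = 0 then sg (sg i (A i)) (1::'k) else 0) \<noteq> 0"
  proof
   assume z: "(\<Sum>i\<in>UNIV. if E i j = 0 then sg (sg i (A i)) (1::'k) else 0) = 0"
   obtain i where i: "E i j = 0" using E_zero by blast
   have "sg i' (A i') = sg i (A i) \<longleftrightarrow> i' = i" for i'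
    using Apos[of i] Apos[of i'] by (metis lookup_single_eq lookup_single_not_eq less_numeral_extra(3))
   then have "lk (if E i' j = 0 then sg (sg i' (A i')) (1::'k) else 0) (sg i (A i)) = (if i' = i then 1 else 0)" for i'
    using i by (auto simp: lookup_single when_def)
   then have "lk (\<Sum>i\<in>UNIV. if E i j = 0 then sg (sg i (A i)) (1::'k) else 0) (sg i (A i)) = 1"
    unfolding lookup_sum by simp
   then show False unfolding z by simp
  qed
  ultimately show False by simp
 qed
 \<comment> \<open>With all coordinates nonnegative, the cofactor is the monomial
   \<open>Mexp\<close> times the image of a polynomial; injectivity of \<open>mu\<close> then
   cancels \<open>push\<close>.\<close>
 define P' where "P' = (\<Sum>m\<in>ks G. sg (vec (%j. nat (\<nu> m j))) (lk G m))"
 have "sg (vec Mexp) 1 * push mu P' = (\<Sum>m\<in>ks G. sg (vec Mexp + mu (vec (%j. nat (\<nu> m j)))) (lk G m))"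
  by (simp add: P'_def push_sum push_single sum_distrib_left mult_single)
 also have "\<dots> = (\<Sum>m\<in>ks G. sg m (lk G m))"
 proof (rule sum.cong[OF refl])
  fix m assume m: "m \<in> ks G"
  have "vec Mexp + mu (vec (%j. nat (\<nu> m j))) = m"
  proof (rule poly_mapping_eqI)
   fix s
   have "int (lk (mu (vec (%j. nat (\<nu> m j)))) s) = comb (\<nu> m) s" unfolding lookup_mu using pos[OF m] by simp
   then show "lk (vec Mexp + mu (vec (%j. nat (\<nu> m j)))) s = lk m s" using \<nu>[rule_format, OF m, of s] by (simp add: lookup_add)
  qed
  then show "sg (vec Mexp + mu (vec (%j. nat (\<nu> m j)))) (lk G m) = sg m (lk G m)" by simp
 qed
 also have "\<dots> = G" using sum_single_mult[of 0 1 G] by simp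
 finally have "push mu P = push mu (fW * P')"
  unfolding FG push_mult[of mu, OF mu_add] push_fW by (metis mult.assoc mult.commute)
 then have "P = fW * P'" by (intro poly_mapping_eqI) (metis lookup_push[OF inj_mu])
 then show ?thesis by simp
qed

lemma psi_kernel: "a_kernel poly3_ring (ga_ring (RW A w)) psi = PIdl\<^bsub>poly3_ring\<^esub> (fW :: 'k::field poly3)"
proof (rule Set.set_eqI)
 fix P :: "'k poly3"
 have "P \<in> a_kernel poly3_ring (ga_ring (RW A w)) psi \<longleftrightarrow> psi P = cs A 0"
  unfolding a_kernel_def' RW_ops cs_ops by simp
 also have "\<dots> \<longleftrightarrow> FA A dvd push mu P" unfolding psi_def cs_eq by simp
 also have "\<dots> \<longleftrightarrow> fW dvd P"
 proof
  assume "fW dvd P"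
  then obtain Q where "P = fW * Q" by (elim dvdE)
  then have "push mu P = FA A * (sg (vec Mexp) 1 * push mu Q)"
   by (simp only: push_mult[of mu, OF mu_add] push_fW mult_ac)
  then show "FA A dvd push mu P" by (rule dvdI)
 qed (rule dvd_push)
 finally show "P \<in> a_kernel poly3_ring (ga_ring (RW A w)) psi \<longleftrightarrow> P \<in> PIdl\<^bsub>poly3_ring\<^esub> fW" unfolding PIdl_iff .
qed

lemma psi_var: "psi (var3 i :: 'k::field poly3) \<in> ga_comp (RW A w) (w [^][L_group A] a i)"
proof -
 have e: "psi (var3 i :: 'k poly3) = cs A (sg (mu (sg i 1)) 1)" by (simp add: psi_def var3_def push_single)
 have "Poly_Mapping.map int (mu (sg i 1)) = vec (comb (%j. if j = i then 1 else 0))"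
 proof (rule poly_mapping_eqI)
  fix s
  have "(%j. int (lk (sg i 1) j)) = (%j. if j = i then 1 else 0)" by (auto simp: lookup_single when_def)
  then show "lk (Poly_Mapping.map int (mu (sg i 1))) s = lk (vec (comb (%j. if j = i then 1 else 0))) s" by (simp add: lookup_mu)
 qed
 then have "cl A (mu (sg i 1)) = w [^][L_group A] (\<Sum>j\<in>UNIV. (if j = i then 1 else 0) * int (a j))"
  unfolding cl_def by (simp only: comb_class)
 then have "cl A (mu (sg i 1)) = w [^][L_group A] a i" by (simp only: delta_3 int_pow_int)
 then show ?thesis unfolding RW_comp[OF nat_pow_H] RA_simps(4) e by (intro imageI) simp
qed

lemma fW_homogeneous: "weighted_homogeneous a h (fW :: 'k::field poly3)"
 unfolding weighted_homogeneous_def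
proof
 fix m assume "m \<in> ks (fW :: 'k poly3)"
 then obtain i where "m = vec (E i)" unfolding fW_def using keys_sum[of "%i. sg (vec (E i)) (1::'k)" UNIV] by auto
 then show "(\<Sum>j\<in>UNIV. a j * lk m j) = h" using hE[of i] by (simp add: mult.commute)
qed

lemma fW_singular:
 assumes "\<And>p :: 3 => 'k. (\<Sum>i\<in>UNIV. \<Prod>s\<in>UNIV. p s ^ E i s) = 0 ==>
  (\<And>j. (\<Sum>i\<in>UNIV. of_nat (E i j) * (\<Prod>s\<in>UNIV. p s ^ (E i s - (if s = j then 1 else 0)))) = 0) ==> p = (%_. 0)"
 shows "singular_points (fW :: 'k::field poly3) <= {%i. 0}"
proof
 fix p :: "3 => 'k" assume p: "p \<in> singular_points fW"
 have "eval3 fW p = (\<Sum>i\<in>UNIV. \<Prod>s\<in>UNIV. p s ^ E i s)"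
  by (simp add: fW_def eval3_sum eval3_single)
 moreover have "eval3 (pderiv3 j fW) p = (\<Sum>i\<in>UNIV. of_nat (E i j) * (\<Prod>s\<in>UNIV. p s ^ (E i s - (if s = j then 1 else 0))))" for j
 proof -
  have "lk (vec (E i) - sg j 1) s = E i s - (if s = j then 1 else 0)" for i s
   by (simp add: lookup_minus lookup_single when_def)
  then show ?thesis by (simp add: fW_def pderiv3_sum pderiv3_single eval3_sum eval3_single)
 qed
 ultimately have "p = (%_. 0)" using p assms[of p] by (simp add: singular_points_def)
 then show "p \<in> {%i. 0}" by simp
qed

lemma RW_presentation:
 "(%V. the_elem (psi ` V)) \<in> ring_iso (poly3_ring Quot (PIdl\<^bsub>poly3_ring\<^esub> (fW :: 'k::field poly3))) (ga_ring (RW A w))"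
 "the_elem (psi ` (PIdl\<^bsub>poly3_ring\<^esub> (fW :: 'k poly3) +>[poly3_ring] P)) = psi P"
proof -
 interpret \<psi>: ring_hom_ring poly3_ring "ga_ring (RW A w)" "psi :: 'k poly3 => _" by (rule psi_hom)
 show "(%V. the_elem (psi ` V)) \<in> ring_iso (poly3_ring Quot (PIdl\<^bsub>poly3_ring\<^esub> (fW :: 'k poly3))) (ga_ring (RW A w))"
  using \<psi>.FactRing_iso_set_aux unfolding psi_kernel poly3_ops psi_surj by simp
 show "the_elem (psi ` (PIdl\<^bsub>poly3_ring\<^esub> (fW :: 'k poly3) +>[poly3_ring] P)) = psi P"
  using \<psi>.the_elem_simp[of P] unfolding psi_kernel by simp
qed

lemma psi_const: "psi (const3 c) = ga_emb (RW A w) (c :: 'k::field)"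
proof -
 have "mu 0 = 0" by (rule poly_mapping_eqI) (simp add: mu_def)
 then show ?thesis by (simp add: psi_def const3_def push_single)
qed

end

section \<open>The five types\<close>

lemma relsI: "n 1 + n 2 + n 3 = 0 ==> \<forall>s. v s = n s * int (A s) ==> v \<in> rels A"
 unfolding rels_def by (auto simp: sum_3 intro!: exI[of _ n])

text \<open>The hypotheses of \<open>wcore\<close> with all sums written out, so that each type
  becomes integer arithmetic. The vectors \<open>n\<close>, \<open>n'\<close> and \<open>n''\<close>
  exhibit the relations behind \<open>pair\<close> for the index pairs 12, 13 and 23.\<close>

lemma wcoreI:
 assumes "\<forall>i. 0 < A i"
  and "\<forall>i s. (\<Sum>j\<in>UNIV. E i j * lam j s) + 1 = (\<Sum>j\<in>UNIV. lam j s) + (if s = i then A i else 0)"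
  and "\<forall>i. (\<Sum>j\<in>UNIV. E i j * a j) = h" and "\<forall>s. \<exists>j. lam j s = 1" and "\<forall>j. \<exists>i. E i j = 0"
  and indep: "\<And>x y z :: int. \<forall>s. x * int (lam 1 s) + y * int (lam 2 s) + z * int (lam 3 s) = 0 ==> x = 0 \<and> y = 0 \<and> z = 0"
  and red: "\<And>x y z :: int. \<forall>s. 0 \<le> x * int (lam 1 s) + y * int (lam 2 s) + z * int (lam 3 s) ==> x < 0 \<or> y < 0 \<or> z < 0 ==>
   \<exists>i. int (A i) \<le> x * int (lam 1 i) + y * int (lam 2 i) + z * int (lam 3 i) \<and> (\<forall>i'. i' \<noteq> i -->
    nat (- (x - int (E i 1) + int (E i' 1))) + nat (- (y - int (E i 2) + int (E i' 2))) + nat (- (z - int (E i 3) + int (E i' 3)))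
    < nat (- x) + nat (- y) + nat (- z))"
  and pair: "\<forall>s. int (a 1) * int (lam 2 s) - int (a 2) * int (lam 1 s) = n s * int (A s)" "n 1 + n 2 + n 3 = 0"
   "\<forall>s. int (a 1) * int (lam 3 s) - int (a 3) * int (lam 1 s) = n' s * int (A s)" "n' 1 + n' 2 + n' 3 = 0"
   "\<forall>s. int (a 2) * int (lam 3 s) - int (a 3) * int (lam 2 s) = n'' s * int (A s)" "n'' 1 + n'' 2 + n'' 3 = 0"
 shows "wcore a h A lam E"
proof
 fix i j :: 3
 have p: "(%s. int (a 1) * int (lam 2 s) - int (a 2) * int (lam 1 s)) \<in> rels A"
  "(%s. int (a 1) * int (lam 3 s) - int (a 3) * int (lam 1 s)) \<in> rels A"
  "(%s. int (a 2) * int (lam 3 s) - int (a 3) * int (lam 2 s)) \<in> rels A"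
  using relsI[OF pair(2), of "%s. int (a 1) * int (lam 2 s) - int (a 2) * int (lam 1 s)" A]
   relsI[OF pair(4), of "%s. int (a 1) * int (lam 3 s) - int (a 3) * int (lam 1 s)" A]
   relsI[OF pair(6), of "%s. int (a 2) * int (lam 3 s) - int (a 3) * int (lam 2 s)" A] pair by blast+
 have n: "(%s. int (a j) * int (lam i s) - int (a i) * int (lam j s)) \<in> rels A"
  if "(%s. int (a i) * int (lam j s) - int (a j) * int (lam i s)) \<in> rels A" for i j
  using rels_cmul[OF that, of "- 1"] by simp
 have z: "(%s. 0) \<in> rels A" by (rule relsI[of "%_. 0"]) auto
 have "\<forall>i j. (%s. int (a i) * int (lam j s) - int (a j) * int (lam i s)) \<in> rels A"
  unfolding all_3 using p n[OF p(1)] n[OF p(2)] n[OF p(3)] z by (simp add: mult.commute)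
 then show "(%s. int (a i) * int (lam j s) - int (a j) * int (lam i s)) \<in> rels A" by blast
 show "n j = 0" if "\<forall>s. (\<Sum>j\<in>UNIV. n j * int (lam j s)) = 0" for n
 proof -
  have "\<forall>j. n j = 0" using that indep[of "n 1" "n 2" "n 3"] unfolding all_3[of "%j. n j = 0"] by (simp add: sum_3)
  then show ?thesis by blast
 qed
 show "\<exists>i. int (A i) \<le> (\<Sum>j\<in>UNIV. n j * int (lam j i)) \<and> (\<forall>i'. i' \<noteq> i --> negs (%j. n j - int (E i j) + int (E i' j)) < negs n)"
  if "\<forall>s. 0 \<le> (\<Sum>j\<in>UNIV. n j * int (lam j s))" "\<exists>j. n j < 0" for n
 proof -
  have "\<forall>s. 0 \<le> n 1 * int (lam 1 s) + n 2 * int (lam 2 s) + n 3 * int (lam 3 s)" using that(1) unfolding sum_3 .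
  moreover have "n 1 < 0 \<or> n 2 < 0 \<or> n 3 < 0" using that(2) unfolding ex_3 .
  ultimately show ?thesis unfolding negs_def sum_3 by (rule red)
 qed
qed (use assms(1-5) in blast)+

text \<open>The Jacobian criterion for the polynomial whose monomials are the rows of
  \<open>E\<close>. Where the exponent of the differentiated variable truncates at zero, the
  coefficient \<open>of_nat (E i j)\<close> is zero as well.\<close>

definition isolated :: "'k::field itself => (3 => 3 => nat) => bool" where
 "isolated K E \<longleftrightarrow> (\<forall>p :: 3 => 'k. (\<Sum>i\<in>UNIV. \<Prod>s\<in>UNIV. p s ^ E i s) = 0 -->
  (\<forall>j. (\<Sum>i\<in>UNIV. of_nat (E i j) * (\<Prod>s\<in>UNIV. p s ^ (E i s - (if s = j then 1 else 0)))) = 0) --> p = (%_. 0))"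

lemma isolatedI:
 assumes "\<And>x y z :: 'k::field. (\<Sum>i\<in>UNIV. x ^ E i 1 * y ^ E i 2 * z ^ E i 3) = 0 ==>
  (\<Sum>i\<in>UNIV. of_nat (E i 1) * (x ^ (E i 1 - 1) * y ^ E i 2 * z ^ E i 3)) = 0 ==>
  (\<Sum>i\<in>UNIV. of_nat (E i 2) * (x ^ E i 1 * y ^ (E i 2 - 1) * z ^ E i 3)) = 0 ==>
  (\<Sum>i\<in>UNIV. of_nat (E i 3) * (x ^ E i 1 * y ^ E i 2 * z ^ (E i 3 - 1))) = 0 ==> x = 0 \<and> y = 0 \<and> z = 0"
 shows "isolated TYPE('k) E"
 unfolding isolated_def
proof (intro allI impI)
 fix p :: "3 => 'k"
 assume 0: "(\<Sum>i\<in>UNIV. \<Prod>s\<in>UNIV. p s ^ E i s) = 0"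
  and "\<forall>j. (\<Sum>i\<in>UNIV. of_nat (E i j) * (\<Prod>s\<in>UNIV. p s ^ (E i s - (if s = j then 1 else 0)))) = 0"
 then have j: "(\<Sum>i\<in>UNIV. of_nat (E i j) * (\<Prod>s\<in>UNIV. p s ^ (E i s - (if s = j then 1 else 0)))) = 0" for j by blast
 have "p 1 = 0 \<and> p 2 = 0 \<and> p 3 = 0"
  using 0 j[of 1] j[of 2] j[of 3] by (intro assms) (simp_all add: prod_3)
 then show "p = (%_. 0)" by (simp add: fun_eq_iff all_3)
qed

lemma of_nat_Suc_0: "of_nat (Suc 0) = (1::'k::semiring_1)" by simp

lemma pow_deriv_zero: "of_nat n * x ^ (n - 1) = (0::'k::field_char_0) ==> 0 < n ==> x = 0"
 by (cases "n = 1") auto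

text \<open>The polynomial is \<open>x^p1 + y^p2 + z^p3\<close>. The principal generators are the
  variables, so no coordinate is ever negative.\<close>

lemma type_I_core:
 assumes "0 < p1" "0 < p2" "0 < p3"
 shows "wcore (tri (p2 * p3) (p3 * p1) (p1 * p2)) (p1 * p2 * p3) (tri p1 p2 p3)
   (tri (tri 1 0 0) (tri 0 1 0) (tri 0 0 1)) (tri (tri p1 0 0) (tri 0 p2 0) (tri 0 0 p3))"
 by (rule wcoreI[where n = "tri (- int p3) (int p3) 0" and n' = "tri (- int p2) 0 (int p2)" and n'' = "tri 0 (- int p1) (int p1)"])
  (use assms in \<open>simp_all add: all_3 ex_3 sum_3 algebra_simps\<close>)

lemma type_I_isolated:
 assumes "0 < p1" "0 < p2" "0 < p3"
 shows "isolated TYPE('k::field_char_0) (tri (tri p1 0 0) (tri 0 p2 0) (tri 0 0 p3))"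
proof (rule isolatedI)
 fix x y z :: 'k
 let ?E = "tri (tri p1 0 0) (tri 0 p2 0) (tri 0 0 p3)"
 assume "(\<Sum>i\<in>UNIV. of_nat (?E i 1) * (x ^ (?E i 1 - 1) * y ^ ?E i 2 * z ^ ?E i 3)) = 0"
  "(\<Sum>i\<in>UNIV. of_nat (?E i 2) * (x ^ ?E i 1 * y ^ (?E i 2 - 1) * z ^ ?E i 3)) = 0"
  "(\<Sum>i\<in>UNIV. of_nat (?E i 3) * (x ^ ?E i 1 * y ^ ?E i 2 * z ^ (?E i 3 - 1))) = 0"
 then have "of_nat p1 * x ^ (p1 - 1) = 0" "of_nat p2 * y ^ (p2 - 1) = 0" "of_nat p3 * z ^ (p3 - 1) = 0"
  by (simp_all add: sum_3 del: mult_eq_0_iff)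
 then show "x = 0 \<and> y = 0 \<and> z = 0" using pow_deriv_zero assms by blast
qed

lemma lin_bound: "0 \<le> x + int p * y ==> y < 0 ==> int p \<le> x"
proof -
 assume "0 \<le> x + int p * y" "y < 0"
 then have "int p * y \<le> int p * (- 1)" by (intro mult_left_mono) auto
 then show ?thesis using \<open>0 \<le> x + int p * y\<close> by simp
qed

text \<open>The polynomial is \<open>x^p1 + y * z^q + y^(P+1)\<close>. The exponent vector is
  \<open>(x, z, x + p1 * y)\<close>, so only \<open>y\<close> can be negative, and then
  \<open>x \<ge> p1\<close> permits a trade of the first variable.\<close>

lemma type_II_core:
 assumes "0 < p1" "0 < P" "0 < q"
 shows "wcore (tri ((P + 1) * q) (p1 * q) (P * p1)) (p1 * ((P + 1) * q)) (tri p1 q (P * p1))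
   (tri (tri 1 0 1) (tri 0 0 p1) (tri 0 1 0)) (tri (tri p1 0 0) (tri 0 1 q) (tri 0 (P + 1) 0))"
proof (rule wcoreI[where n = "tri (- int q) 0 (int q)" and n' = "tri (- int P) (int P + 1) (- 1)"
   and n'' = "tri 0 (int p1) (- int p1)"], goal_cases)
 case (7 x y z)
 then have b: "0 \<le> x" "0 \<le> z" "0 \<le> x + int p1 * y" "y < 0" by (auto simp: all_3 algebra_simps)
 have "int p1 \<le> x" using lin_bound[OF b(3,4)] .
 then show ?case using b by (intro exI[of _ 1]) (simp add: all_3)
qed (use assms in \<open>auto simp: all_3 ex_3 sum_3 algebra_simps\<close>)

lemma type_II_isolated:
 assumes "0 < p1" "0 < P" "1 < q"
 shows "isolated TYPE('k::field_char_0) (tri (tri p1 0 0) (tri 0 1 q) (tri 0 (P + 1) 0))"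
proof (rule isolatedI)
 fix x y z :: 'k
 let ?E = "tri (tri p1 0 0) (tri 0 1 q) (tri 0 (P + 1) 0)"
 assume "(\<Sum>i\<in>UNIV. of_nat (?E i 1) * (x ^ (?E i 1 - 1) * y ^ ?E i 2 * z ^ ?E i 3)) = 0"
  "(\<Sum>i\<in>UNIV. of_nat (?E i 2) * (x ^ ?E i 1 * y ^ (?E i 2 - 1) * z ^ ?E i 3)) = 0"
  "(\<Sum>i\<in>UNIV. of_nat (?E i 3) * (x ^ ?E i 1 * y ^ ?E i 2 * z ^ (?E i 3 - 1))) = 0"
 then have e: "of_nat p1 * x ^ (p1 - 1) = 0" "z ^ q + of_nat (P + 1) * y ^ P = 0" "of_nat q * (y * z ^ (q - 1)) = 0"
  by (simp_all add: sum_3 del: mult_eq_0_iff of_nat_add)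
 have "y = 0 \<or> z = 0" using e(3) assms by simp
 moreover have "y = 0 ==> z = 0" "z = 0 ==> y = 0" using e(2) assms by (simp_all add: zero_power of_nat_neq_0 del: of_nat_add of_nat_Suc)
 ultimately show "x = 0 \<and> y = 0 \<and> z = 0" using pow_deriv_zero[OF e(1)] assms by blast
qed

text \<open>The polynomial is \<open>x^p1 + y * z^(q2+1) + y^(q3+1) * z\<close>. A negative
  \<open>y\<close> or \<open>z\<close> forces \<open>x \<ge> p1\<close>; both replacements for the
  first term increase \<open>y\<close> and \<open>z\<close>.\<close>

lemma type_III_core:
 assumes "0 < p1" "0 < q2" "0 < q3" and p2: "p2 + 1 = (q2 + 1) * (q3 + 1)"
 shows "wcore (tri p2 (p1 * q2) (p1 * q3)) (p1 * p2) (tri p1 (p1 * q2) (p1 * q3))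
   (tri (tri 1 1 1) (tri 0 0 p1) (tri 0 p1 0)) (tri (tri p1 0 0) (tri 0 1 (q2 + 1)) (tri 0 (q3 + 1) 1))"
proof -
 have p2': "p2 = q2 * q3 + q2 + q3" using p2 by simp
 show ?thesis unfolding p2'
 proof (rule wcoreI[where n = "tri (- int q2) (- 1) (int q2 + 1)" and n' = "tri (- int q3) (int q3 + 1) (- 1)"
   and n'' = "tri 0 (int p1) (- int p1)"], goal_cases)
  case (7 x y z)
  then have b: "0 \<le> x" "0 \<le> x + int p1 * z" "0 \<le> x + int p1 * y" "y < 0 \<or> z < 0" by (auto simp: all_3 algebra_simps)
  have "int p1 \<le> x" using b(4) lin_bound[OF b(3)] lin_bound[OF b(2)] by blast
  then show ?case using b(1,4) by (intro exI[of _ 1]) (auto simp: all_3)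
 qed (use assms(1-3) in \<open>auto simp: all_3 ex_3 sum_3 algebra_simps\<close>)
qed

lemma type_III_isolated:
 assumes "0 < p1" "0 < q2" "0 < q3"
 shows "isolated TYPE('k::field_char_0) (tri (tri p1 0 0) (tri 0 1 (q2 + 1)) (tri 0 (q3 + 1) 1))"
proof (rule isolatedI)
 fix x y z :: 'k
 let ?E = "tri (tri p1 0 0) (tri 0 1 (q2 + 1)) (tri 0 (q3 + 1) 1)"
 assume "(\<Sum>i\<in>UNIV. x ^ ?E i 1 * y ^ ?E i 2 * z ^ ?E i 3) = 0"
  "(\<Sum>i\<in>UNIV. of_nat (?E i 1) * (x ^ (?E i 1 - 1) * y ^ ?E i 2 * z ^ ?E i 3)) = 0"
  "(\<Sum>i\<in>UNIV. of_nat (?E i 2) * (x ^ ?E i 1 * y ^ (?E i 2 - 1) * z ^ ?E i 3)) = 0"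
  "(\<Sum>i\<in>UNIV. of_nat (?E i 3) * (x ^ ?E i 1 * y ^ ?E i 2 * z ^ (?E i 3 - 1))) = 0"
 then have e: "x ^ p1 + y * z ^ (q2 + 1) + y ^ (q3 + 1) * z = 0" "of_nat p1 * x ^ (p1 - 1) = 0"
  "z ^ (q2 + 1) + of_nat (q3 + 1) * (y ^ q3 * z) = 0" "of_nat (q2 + 1) * (y * z ^ q2) + y ^ (q3 + 1) = 0"
  by (simp_all add: sum_3 of_nat_Suc_0 del: mult_eq_0_iff of_nat_add power_Suc of_nat_Suc add_eq_0_iff)
 have x: "x = 0" using pow_deriv_zero[OF e(2)] assms by blast
 have "y * z ^ (q2 + 1) + of_nat (q3 + 1) * (y ^ (q3 + 1) * z) = y * (z ^ (q2 + 1) + of_nat (q3 + 1) * (y ^ q3 * z))"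
  by (simp add: algebra_simps)
 then have "y * z ^ (q2 + 1) + of_nat (q3 + 1) * (y ^ (q3 + 1) * z) = 0" unfolding e(3) by simp
 moreover have "y * z ^ (q2 + 1) + y ^ (q3 + 1) * z = 0" using e(1) x assms by (simp add: zero_power)
 \<comment> \<open>On \<open>x = 0\<close> the two mixed monomials \<open>u\<close> and
   \<open>v\<close> satisfy one equation from the polynomial itself and one from its derivative;
   subtracting leaves a multiple of \<open>v\<close>.\<close>
 moreover have "of_nat n * v = 0" if "u + of_nat (n + 1) * v = 0" "u + v = 0" for n and u v :: 'k
 proof -
  have "of_nat n * v = (u + of_nat (n + 1) * v) - (u + v)" by (simp add: algebra_simps)
  then show ?thesis unfolding that by simp
 qed
 ultimately have "of_nat q3 * (y ^ (q3 + 1) * z) = 0" by blast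
 then have "y = 0 \<or> z = 0" using assms by simp
 moreover have "y = 0 ==> z = 0" using e(3) assms by (simp add: zero_power of_nat_neq_0 del: of_nat_add of_nat_Suc)
 moreover have "z = 0 ==> y = 0" using e(4) assms by (simp add: zero_power of_nat_neq_0 del: of_nat_add of_nat_Suc)
 ultimately show "x = 0 \<and> y = 0 \<and> z = 0" using x by blast
qed

text \<open>The polynomial is \<open>y * z^r + x^(P+1) + x * y^(T+1)\<close>, with exponent vector
  \<open>(z, z + r * x, x + (P+1) * y)\<close>. A negative \<open>x\<close> is removed by trading
  the first variable, a negative \<open>y\<close> by trading the second.\<close>

lemma type_IV_core:
 assumes "0 < P" "0 < T" "0 < r"
 shows "wcore (tri ((T + 1) * r) (P * r) ((P + 1) * T + 1)) ((P + 1) * (T + 1) * r) (tri r (P * r) ((P + 1) * T + 1))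
   (tri (tri 0 r 1) (tri 0 0 (P + 1)) (tri 1 1 0)) (tri (tri 0 1 r) (tri (P + 1) 0 0) (tri 1 (T + 1) 0))"
proof (rule wcoreI[where n = "tri 0 (- int r) (int r)" and n' = "tri (int T + 1) (- int T) (- 1)"
   and n'' = "tri (int P) 1 (- int P - 1)"], goal_cases)
 case (6 x y z)
 then show ?case using assms by (auto simp: all_3)
next
 case (7 x y z)
 then have b: "0 \<le> z" "0 \<le> z + int r * x" "0 \<le> x + int (P + 1) * y" "x < 0 \<or> y < 0" by (auto simp: all_3 algebra_simps)
 show ?case
 proof (cases "x < 0")
  case True
  have "int r \<le> z" using lin_bound[OF b(2) True] .
  \<comment> \<open>The row of \<open>E\<close> to be subtracted has entry one at \<open>y\<close>,
    so \<open>y\<close> stays nonnegative after the trade.\<close>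
  moreover have "0 < y" using b(3) True by (smt (verit) mult_nonneg_nonpos of_nat_0_le_iff)
  ultimately show ?thesis using True by (intro exI[of _ 1]) (simp add: all_3)
 next
  case False
  then have y: "y < 0" using b(4) by blast
  have x: "int (P + 1) \<le> x" using lin_bound[OF b(3) y] .
  have "int r * int P \<le> int r * x" using x by (intro mult_left_mono) auto
  then show ?thesis using x y b(1) by (intro exI[of _ 2]) (simp add: all_3 algebra_simps)
 qed
qed (use assms in \<open>auto simp: all_3 ex_3 sum_3 algebra_simps\<close>)

lemma type_IV_isolated:
 assumes "0 < P" "0 < T" "1 < r"
 shows "isolated TYPE('k::field_char_0) (tri (tri 0 1 r) (tri (P + 1) 0 0) (tri 1 (T + 1) 0))"
proof (rule isolatedI)
 fix x y z :: 'k
 let ?E = "tri (tri 0 1 r) (tri (P + 1) 0 0) (tri 1 (T + 1) 0)"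
 assume "(\<Sum>i\<in>UNIV. of_nat (?E i 1) * (x ^ (?E i 1 - 1) * y ^ ?E i 2 * z ^ ?E i 3)) = 0"
  "(\<Sum>i\<in>UNIV. of_nat (?E i 2) * (x ^ ?E i 1 * y ^ (?E i 2 - 1) * z ^ ?E i 3)) = 0"
  "(\<Sum>i\<in>UNIV. of_nat (?E i 3) * (x ^ ?E i 1 * y ^ ?E i 2 * z ^ (?E i 3 - 1))) = 0"
 then have e: "of_nat (P + 1) * x ^ P + y ^ (T + 1) = 0" "z ^ r + of_nat (T + 1) * (x * y ^ T) = 0"
  "of_nat r * (y * z ^ (r - 1)) = 0"
  by (simp_all add: sum_3 of_nat_Suc_0 del: mult_eq_0_iff of_nat_add power_Suc of_nat_Suc add_eq_0_iff)
 have "y = 0 \<or> z = 0" using e(3) assms by simp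
 moreover have y: "y = 0 ==> x = 0 \<and> z = 0" using e(1,2) assms by (simp add: zero_power of_nat_neq_0 del: of_nat_add of_nat_Suc)
 moreover have "z = 0 ==> y = 0"
 proof -
  assume "z = 0"
  then have "x = 0 \<or> y = 0" using e(2) assms by (simp add: zero_power of_nat_neq_0 del: of_nat_add of_nat_Suc)
  then show "y = 0" using e(1) assms by (auto simp: zero_power of_nat_neq_0 simp del: of_nat_add of_nat_Suc)
 qed
 ultimately show "x = 0 \<and> y = 0 \<and> z = 0" by blast
qed

text \<open>The polynomial is \<open>y * z^(L+1) + x * y^(M+1) + x^(K+1) * z\<close>, a cycle. A
  negative coordinate forces one of its neighbours to be large and the other to be positive.\<close>

lemma type_V_core:
 "wcore (tri (L * (M + 1) + 1) (K * (L + 1) + 1) (M * (K + 1) + 1)) ((K + 1) * (L + 1) * (M + 1) + 1)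
   (tri (L * (M + 1) + 1) (M * (K + 1) + 1) (K * (L + 1) + 1))
   (tri (tri 0 1 (L + 1)) (tri 1 (K + 1) 0) (tri (M + 1) 0 1))
   (tri (tri 0 1 (L + 1)) (tri 1 (M + 1) 0) (tri (K + 1) 0 1))"
proof (rule wcoreI[where n = "tri 1 (int L) (- int L - 1)" and n' = "tri (int M + 1) (- 1) (- int M)"
   and n'' = "tri (int K) (- int K - 1) 1"], goal_cases)
 case (6 x y z)
 then have e: "y = - (int M + 1) * z" "x = - (int K + 1) * y" "z = - (int L + 1) * x" by (auto simp: all_3 algebra_simps)
 \<comment> \<open>Going once around the cycle multiplies \<open>x\<close> by a negative integer and
   returns \<open>x\<close>.\<close>
 have "- (int K + 1) * (- (int M + 1) * (- (int L + 1) * x)) = x" unfolding e(3)[symmetric] e(1)[symmetric] e(2)[symmetric] ..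
 then have "(1 + (int K + 1) * (int M + 1) * (int L + 1)) * x = 0" by (simp add: algebra_simps)
 moreover have "0 < 1 + (int K + 1) * (int M + 1) * (int L + 1)" by (simp add: add_pos_nonneg)
 ultimately have x: "x = 0" by simp
 have z: "z = 0" using e(3) x by simp
 show ?case using e(1) x z by simp
next
 case (7 x y z)
 then have b: "0 \<le> y + int (M + 1) * z" "0 \<le> x + int (K + 1) * y" "0 \<le> z + int (L + 1) * x" "x < 0 \<or> y < 0 \<or> z < 0"
  by (auto simp: all_3 algebra_simps)
 have pos: "0 < v" if "0 \<le> u + int n * v" "u < 0" for u v :: int and n
  using that by (smt (verit) mult_nonneg_nonpos of_nat_0_le_iff)
 \<comment> \<open>In each case the term of the polynomial free of the negative coordinate is traded
   away: its row subtracts only from the two coordinates known to be large enough, and the other two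
   rows increase the negative one.\<close>
 consider "x < 0" | "y < 0" | "z < 0" using b(4) by blast
 then show ?case
 proof cases
  case 1
  have z: "int (L + 1) \<le> z" using lin_bound[OF b(3) 1] .
  have y: "0 < y" using pos[OF b(2) 1] .
  have "int (M + 1) * int L \<le> int (M + 1) * z" using z by (intro mult_left_mono) auto
  then show ?thesis using 1 y z by (intro exI[of _ 1]) (simp add: all_3 algebra_simps)
 next
  case 2
  have x: "int (K + 1) \<le> x" using lin_bound[OF b(2) 2] .
  have z: "0 < z" using pos[OF b(1) 2] .
  have "int (L + 1) * int K \<le> int (L + 1) * x" using x by (intro mult_left_mono) auto
  then show ?thesis using 2 x z by (intro exI[of _ 3]) (simp add: all_3 algebra_simps)
 next
  case 3
  have y: "int (M + 1) \<le> y" using lin_bound[OF b(1) 3] .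
  have x: "0 < x" using pos[OF b(3) 3] .
  have "int (K + 1) * int M \<le> int (K + 1) * y" using y by (intro mult_left_mono) auto
  then show ?thesis using 3 x y by (intro exI[of _ 2]) (simp add: all_3 algebra_simps)
 qed
qed (auto simp: all_3 ex_3 sum_3 algebra_simps)

lemma type_V_isolated:
 "isolated TYPE('k::field_char_0) (tri (tri 0 1 (L + 1)) (tri 1 (M + 1) 0) (tri (K + 1) 0 1))"
proof (rule isolatedI)
 fix x y z :: 'k
 let ?E = "tri (tri 0 1 (L + 1)) (tri 1 (M + 1) 0) (tri (K + 1) 0 1)"
 let ?k = "of_nat (K + 1) :: 'k" and ?l = "of_nat (L + 1) :: 'k" and ?m = "of_nat (M + 1) :: 'k"
 assume "(\<Sum>i\<in>UNIV. of_nat (?E i 1) * (x ^ (?E i 1 - 1) * y ^ ?E i 2 * z ^ ?E i 3)) = 0"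
  "(\<Sum>i\<in>UNIV. of_nat (?E i 2) * (x ^ ?E i 1 * y ^ (?E i 2 - 1) * z ^ ?E i 3)) = 0"
  "(\<Sum>i\<in>UNIV. of_nat (?E i 3) * (x ^ ?E i 1 * y ^ ?E i 2 * z ^ (?E i 3 - 1))) = 0"
 then have e: "y ^ (M + 1) + ?k * (x ^ K * z) = 0" "z ^ (L + 1) + ?m * (x * y ^ M) = 0" "?l * (y * z ^ L) + x ^ (K + 1) = 0"
  by (simp_all add: sum_3 of_nat_Suc_0 del: mult_eq_0_iff of_nat_add power_Suc of_nat_Suc add_eq_0_iff)
 \<comment> \<open>The three monomials of the polynomial. Multiplying each partial derivative by its
   variable relates two of them, and going around the cycle shows that a positive integer
   annihilates \<open>M1\<close>.\<close>
 define M1 M2 M3 where "M1 = y * z ^ (L + 1)" and "M2 = x * y ^ (M + 1)" and "M3 = x ^ (K + 1) * z"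
 have "M2 + ?k * M3 = x * (y ^ (M + 1) + ?k * (x ^ K * z))" "M1 + ?m * M2 = y * (z ^ (L + 1) + ?m * (x * y ^ M))"
  "?l * M1 + M3 = z * (?l * (y * z ^ L) + x ^ (K + 1))"
  by (simp_all add: M1_def M2_def M3_def algebra_simps del: of_nat_add of_nat_Suc)
 then have M: "M2 = - ?k * M3" "M1 = - ?m * M2" "M3 = - ?l * M1" unfolding e by (simp_all add: add_eq_0_iff2 del: of_nat_add of_nat_Suc)
 have "- ?m * (- ?k * (- ?l * M1)) = M1" unfolding M(3)[symmetric] M(1)[symmetric] M(2)[symmetric] ..
 moreover have "(1 + ?m * ?k * ?l) * M1 = M1 - (- ?m * (- ?k * (- ?l * M1)))" by (simp add: algebra_simps del: of_nat_add of_nat_Suc)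
 ultimately have "(1 + ?m * ?k * ?l) * M1 = 0" by simp
 moreover have "1 + ?m * ?k * ?l = of_nat (1 + (M + 1) * (K + 1) * (L + 1))" by (simp only: of_nat_add of_nat_mult of_nat_1)
 ultimately have "of_nat (1 + (M + 1) * (K + 1) * (L + 1)) * M1 = 0" by (simp only:)
 then have "M1 = 0" unfolding mult_eq_0_iff of_nat_eq_0_iff by simp
 then have "y = 0 \<or> z = 0" by (auto simp: M1_def)
 moreover have "x = 0 \<and> z = 0" if "y = 0"
 proof -
  have "x = 0" using e(3) that by auto
  then show ?thesis using e(2) by auto
 qed
 moreover have "y = 0" if "z = 0" using e(1) that by auto
 ultimately show "x = 0 \<and> y = 0 \<and> z = 0" by blast
qed

text \<open>A permutation of the weights renames the principal generators, that is the index
  \<open>j\<close>; the variables of \<open>R\<^sub>A\<close> and the signature stay in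
  place.\<close>

lemma wcore_permute:
 assumes "wcore a h A lam E" and \<sigma>: "bij \<sigma>"
 shows "wcore (a \<circ> \<sigma>) h A (lam \<circ> \<sigma>) (%i j. E i (\<sigma> j))"
proof -
 interpret wcore a h A lam E by fact
 have s: "(\<Sum>j\<in>UNIV. g (\<sigma> j)) = (\<Sum>j\<in>UNIV. g j)" for g :: "3 => 'a::comm_monoid_add"
  using sum.reindex_bij_betw[OF \<sigma>] .
 have inv': "n = (%j. (n \<circ> inv_into UNIV \<sigma>) (\<sigma> j))" for n :: "3 => int" using \<sigma> by (simp add: fun_eq_iff bij_is_inj)
 show ?thesis
 proof
  fix i s j :: 3
  show "0 < A i" by (rule Apos)
  show "(\<Sum>j\<in>UNIV. E i (\<sigma> j) * (lam \<circ> \<sigma>) j s) + 1 = (\<Sum>j\<in>UNIV. (lam \<circ> \<sigma>) j s) + (if s = i then A i else 0)"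
   using rel[of i s] s[of "%j. E i j * lam j s"] s[of "%j. lam j s"] by simp
  show "(\<Sum>j\<in>UNIV. E i (\<sigma> j) * (a \<circ> \<sigma>) j) = h" using hE[of i] s[of "%j. E i j * a j"] by simp
  obtain j' where "lam j' s = 1" using lam_one by blast
  then show "\<exists>j. (lam \<circ> \<sigma>) j s = 1" using \<sigma> by (intro exI[of _ "inv_into UNIV \<sigma> j'"]) (simp add: bij_is_surj surj_f_inv_f)
  show "\<exists>i. E i (\<sigma> j) = 0" by (rule E_zero)
  show "(%s. int ((a \<circ> \<sigma>) i) * int ((lam \<circ> \<sigma>) j s) - int ((a \<circ> \<sigma>) j) * int ((lam \<circ> \<sigma>) i s)) \<in> rels A"
   using pair[of "\<sigma> i" "\<sigma> j"] by simp
 next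
  fix n :: "3 => int" and j
  define n' where "n' = n \<circ> inv_into UNIV \<sigma>"
  have n: "n j = n' (\<sigma> j)" for j unfolding n'_def by (rule fun_cong[OF inv'])
  have e: "(\<Sum>j\<in>UNIV. n j * int ((lam \<circ> \<sigma>) j s)) = (\<Sum>j\<in>UNIV. n' j * int (lam j s))" for s
   using s[of "%j. n' j * int (lam j s)"] by (simp add: n)
  show "n j = 0" if "\<forall>s. (\<Sum>j\<in>UNIV. n j * int ((lam \<circ> \<sigma>) j s)) = 0"
   unfolding n using that unfolding e by (rule indep)
  have g: "negs (%j. g (\<sigma> j)) = negs g" for g unfolding negs_def by (rule s)
  show "\<exists>i. int (A i) \<le> (\<Sum>j\<in>UNIV. n j * int ((lam \<circ> \<sigma>) j i)) \<and>
    (\<forall>i'. i' \<noteq> i --> negs (%j. n j - int (E i (\<sigma> j)) + int (E i' (\<sigma> j))) < negs n)"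
   if "\<forall>s. 0 \<le> (\<Sum>j\<in>UNIV. n j * int ((lam \<circ> \<sigma>) j s))" "\<exists>j. n j < 0"
  proof -
   have "\<exists>j. n' j < 0" using that(2) unfolding n by blast
   moreover have "negs n = negs n'" using g[of n'] n by (simp add: fun_eq_iff[symmetric] n[abs_def])
   moreover have "negs (%j. n j - int (E i (\<sigma> j)) + int (E i' (\<sigma> j))) = negs (%j. n' j - int (E i j) + int (E i' j))" for i i'
    unfolding n using g[of "%j. n' j - int (E i j) + int (E i' j)"] .
   ultimately show ?thesis using red[of n'] that(1) unfolding e by simp
  qed
 qed
qed

lemma isolated_permute:
 assumes "isolated TYPE('k::field) E" and \<sigma>: "bij \<sigma>"
 shows "isolated TYPE('k) (%i j. E i (\<sigma> j))"
 unfolding isolated_def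
proof (intro allI impI)
 fix p :: "3 => 'k"
 define p' where "p' = p \<circ> inv_into UNIV \<sigma>"
 have p: "p s = p' (\<sigma> s)" for s using \<sigma> by (simp add: p'_def bij_is_inj)
 have s: "(\<Prod>s\<in>UNIV. g (\<sigma> s)) = (\<Prod>s\<in>UNIV. g s)" for g :: "3 => 'k"
  using prod.reindex_bij_betw[OF \<sigma>] .
 assume 0: "(\<Sum>i\<in>UNIV. \<Prod>s\<in>UNIV. p s ^ E i (\<sigma> s)) = 0"
  and d: "\<forall>j. (\<Sum>i\<in>UNIV. of_nat (E i (\<sigma> j)) * (\<Prod>s\<in>UNIV. p s ^ (E i (\<sigma> s) - (if s = j then 1 else 0)))) = 0"
 have "(\<Sum>i\<in>UNIV. \<Prod>s\<in>UNIV. p' s ^ E i s) = 0" using 0 unfolding p s[of "%s. p' s ^ E _ s"] .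
 moreover have "(\<Sum>i\<in>UNIV. of_nat (E i j) * (\<Prod>s\<in>UNIV. p' s ^ (E i s - (if s = j then 1 else 0)))) = 0" for j
 proof -
  obtain j' where j: "j = \<sigma> j'" using \<sigma> by (metis bij_pointE)
  have "(\<Prod>s\<in>UNIV. p s ^ (E i (\<sigma> s) - (if s = j' then 1 else 0))) = (\<Prod>s\<in>UNIV. p' s ^ (E i s - (if s = j then 1 else 0)))" for i
   using s[of "%s. p' s ^ (E i s - (if s = j then 1 else 0))"] \<sigma> by (simp add: p j inj_eq bij_is_inj)
  then show ?thesis using d[rule_format, of j'] unfolding j by simp
 qed
 ultimately have "p' = (%_. 0)" using assms(1) unfolding isolated_def by blast
 then show "p = (%_. 0)" by (simp add: p fun_eq_iff)
qed

text \<open>In each type the parameters are replaced by ones in which divisions are carried out and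
  predecessors are named, so that no truncated subtraction remains.\<close>

lemma dual_type_core:
 "dual_type a h A l ==> \<exists>lam E. wcore a h A lam E \<and> isolated TYPE('k::field_char_0) E \<and> (\<forall>i s. lk (l i) s = int (lam i s))"
proof (induction rule: dual_type.induct)
 case (type_I p1 p2 p3)
 show ?case
  by (intro exI conjI, rule type_I_core[OF type_I(1-3)], rule type_I_isolated[OF type_I(1-3)])
   (simp add: all_3 lookup_single when_def)
next
 case (type_II p1 p2 p3)
 obtain q where q: "p3 = p2 * q" using type_II by (elim dvdE)
 obtain P where P: "p2 = P + 1" using type_II by (metis Suc_eq_plus1 Suc_pred)
 have "p1 * p3 = p2 * (p1 * q)" by (simp add: q)
 then have d: "p1 * p3 div p2 = p1 * q" "p3 div p2 = q" using q type_II(2) by simp_all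
 have e: "p3 = (P + 1) * q" "p2 - 1 = P" using q P by simp_all
 \<comment> \<open>The condition \<open>p2 \<noteq> p3\<close> gives \<open>1 < q\<close>, which is
   used for the isolated singularity.\<close>
 have "q \<noteq> 0" "q \<noteq> 1" "0 < p1" "0 < P" using type_II q P by auto
 then have c: "0 < p1" "0 < P" "1 < q" by auto
 then have c': "0 < q" by simp
 show ?case unfolding d unfolding e
  by (intro exI conjI, rule type_II_core[OF c(1,2) c'], rule type_II_isolated[OF c])
   (simp add: all_3 lookup_single lookup_add when_def)
next
 case (type_III p1 p2 q2 q3)
 show ?case
  by (intro exI conjI, rule type_III_core[OF type_III(1,3,4,6)], rule type_III_isolated[OF type_III(1,3,4)])
   (simp add: all_3 lookup_single lookup_add when_def)
next
 case (type_IV p1 p2 p3)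
 obtain t where t: "p2 = p1 * t" using type_IV by (elim dvdE)
 obtain r where r: "p3 = p2 * r" using type_IV by (elim dvdE)
 obtain P where P: "p1 = P + 1" using type_IV by (metis Suc_eq_plus1 Suc_pred)
 \<comment> \<open>The inequalities between consecutive \<open>p1\<close>, \<open>p2\<close>,
   \<open>p3\<close> exclude the quotients \<open>t\<close> and \<open>r\<close> from being
   one.\<close>
 have "t \<noteq> 0" "t \<noteq> 1" "r \<noteq> 0" "r \<noteq> 1" "P \<noteq> 0" using type_IV t r P by auto
 then obtain T where T: "t = T + 1" "0 < T" and c: "0 < P" "1 < r" by (cases t) auto
 then have c': "0 < r" by simp
 have "p3 div p2 = r" using r type_IV(2) by simp
 moreover have "p3 = p1 * ((T + 1) * r)" using t r T by (simp only: mult.assoc)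
 ultimately have d: "p3 div p1 = (T + 1) * r" "p3 div p2 = r" using type_IV(1) by simp_all
 have e: "p3 = (P + 1) * (T + 1) * r" "p1 - 1 = P" "p2 - p1 + 1 = (P + 1) * T + 1" "p1 = P + 1"
  using t r P T(1) by simp_all
 show ?case unfolding d e(2,3) unfolding e
  by (intro exI conjI, rule type_IV_core[OF c(1) T(2) c'], rule type_IV_isolated[OF c(1) T(2) c(2)])
   (simp add: all_3 lookup_single lookup_add when_def)
next
 case (type_V k l m)
 obtain K L M where e: "k = K + 1" "l = L + 1" "m = M + 1" using type_V by (metis Suc_eq_plus1 Suc_pred)
 have e': "l * m - m + 1 = L * (M + 1) + 1" "k * l - l + 1 = K * (L + 1) + 1" "m * k - k + 1 = M * (K + 1) + 1"
  using e by simp_all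
 show ?case unfolding e' unfolding e
  by (intro exI conjI, rule type_V_core, rule type_V_isolated)
   (simp add: all_3 lookup_single lookup_add when_def)
next
 case (permute a h A l \<sigma>)
 then obtain lam E where IH: "wcore a h A lam E" "isolated TYPE('k) E" "\<forall>i s. lk (l i) s = int (lam i s)" by blast
 show ?case
  by (intro exI conjI, rule wcore_permute[OF IH(1) permute(2)], rule isolated_permute[OF IH(2) permute(2)])
   (simp add: IH(3))
qed

theorem theorem5p1:
  fixes a :: "3 \<Rightarrow> nat" and h :: nat and A :: "3 \<Rightarrow> nat" and l :: "3 \<Rightarrow> (3 \<Rightarrow>\<^sub>0 int)"
    and k :: "'k::{alg_closed_field, field_char_0} itself"
  assumes "regular_weights a h"
    and "dual_type a h A l"
    and "\<exists>e :: 'k \<Rightarrow> 'u. inj e"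
    and "\<exists>e :: 'k \<Rightarrow> 'v. inj e"
  shows "let w = omega_W a h A l;
             R\<^sub>A = RA A :: ('k, (3 \<Rightarrow>\<^sub>0 int) set, 'k poly3 set) graded_algebra;
             R\<^sub>W = RW A w :: ('k, (3 \<Rightarrow>\<^sub>0 int) set, 'k poly3 set) graded_algebra
         in (\<exists>(x :: 3 \<Rightarrow> 'k poly3 set) (f :: 'k poly3) \<phi>.
               (\<forall>i. x i \<in> ga_comp R\<^sub>W (w [^]\<^bsub>L_group A\<^esub> a i)) \<and>
               weighted_homogeneous a h f \<and>
               singular_points f \<subseteq> {\<lambda>i. 0} \<and>
               \<phi> \<in> ring_iso (poly3_ring Quot (PIdl\<^bsub>poly3_ring\<^esub> f)) (ga_ring R\<^sub>W) \<and>
               (\<forall>c. \<phi> (PIdl\<^bsub>poly3_ring\<^esub> f +>\<^bsub>poly3_ring\<^esub> const3 c) = ga_emb R\<^sub>W c) \<and>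
               (\<forall>i. \<phi> (PIdl\<^bsub>poly3_ring\<^esub> f +>\<^bsub>poly3_ring\<^esub> var3 i) = x i)) \<and>
            equivalent_cats (serre_quotient TYPE('u) R\<^sub>A) (serre_quotient TYPE('v) R\<^sub>W)"
proof -
 obtain lam E where 1: "wcore a h A lam E" "isolated TYPE('k) E" "\<forall>i s. lk (l i) s = int (lam i s)"
  using dual_type_core[OF assms(2), where ?'k = 'k] by blast
 \<comment> \<open>Regularity of the weights supplies their positivity and the gcd condition;
   everything specific to the type is already contained in \<open>lam\<close> and
   \<open>E\<close>.\<close>
 interpret wdata a h A lam E
  by (rule wdata.intro[OF 1(1)], rule wdata_axioms.intro) (use assms(1) in \<open>auto simp: regular_weights_def\<close>)
 have w: "omega_W a h A l = w" by (rule omega_W) (use 1(3) in \<open>auto intro: poly_mapping_eqI\<close>)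
 have s: "singular_points (fW :: 'k poly3) <= {%i. 0}"
  by (rule fW_singular) (use 1(2) in \<open>unfold isolated_def, blast\<close>)
 show ?thesis unfolding Let_def w
 proof (intro conjI exI allI)
  show "psi (var3 i :: 'k poly3) \<in> ga_comp (RW A w) (w [^][L_group A] a i)" for i by (rule psi_var)
  show "weighted_homogeneous a h (fW :: 'k poly3)" by (rule fW_homogeneous)
  show "singular_points (fW :: 'k poly3) <= {%i. 0}" by (rule s)
  show "(%V. the_elem (psi ` V)) \<in> ring_iso (poly3_ring Quot (PIdl\<^bsub>poly3_ring\<^esub> (fW :: 'k poly3))) (ga_ring (RW A w))"
   by (rule RW_presentation)
  show "the_elem (psi ` (PIdl\<^bsub>poly3_ring\<^esub> (fW :: 'k poly3) +>[poly3_ring] const3 c)) = ga_emb (RW A w) c" for c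
   unfolding RW_presentation(2) by (rule psi_const)
  show "the_elem (psi ` (PIdl\<^bsub>poly3_ring\<^esub> (fW :: 'k poly3) +>[poly3_ring] var3 i)) = psi (var3 i)" for i
   by (rule RW_presentation(2))
  show "equivalent_cats (serre_quotient TYPE('u) (RA A :: 'k ralg)) 
   (serre_quotient TYPE('v) (RW A w :: 'k ralg))"
   by (rule veronese.serre_equivalence[OF RW_veronese assms(3,4)])
 qed
qed

end
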